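(* Let $G$ be a group, $\Bbbk$ a field, and $V$ a Yetter–Drinfeld module over $\Bbbk G$ with a basis $\{x_i\}_{i\in I}$ such that $\delta(x_i)=g_i\otimes x_i$ with $g_i\in G$. Let $M=\Bbbk\{x_i\}_{i\in I}\oplus\Bbbk G$ as a vector space, where $g\in G$ acts on $\Bbbk G$ by conjugation and $$g\cdot x_i=g\cdot_Vx_i+\sum_{t\in G}b_t(g,x_i)\,t$$ for bilinear maps $b_t:\Bbbk G\times V\to\Bbbk$ ($t\in G$), only finitely many $b_t(g,x_i)$ being nonzero for each $g,i$; put $b=b_1$ (the map indexed by $t=1$). Then the following statements are equivalent: (a) $M$ is an extension of $V$ by $\Bbbk G$ with action of the form $$g\cdot x_i=g\cdot_Vx_i+b(g,x_i)(1-gg_ig^{-1})\qquad\text{for all } g\in G,\ i\in I. \qquad( * )$$ (b) The action is of the form $( * )$ and $b(gh,x_i)=b(g,h\cdot_Vx_i)+b(h,x_i)$ for all $g,h\in G$ and $i\in I$. (c) $M$ is an extension of $V$ by $\Bbbk G$ and $T(V)\#_M\Bbbk G$ is a pointed Hopf algebra quotient of $T_{\Bbbk G}(M)$. If these statements hold, let $M'=\Bbbk\{y_i\}_{i\in I}\oplus\Bbbk G$ be the extension of $V$ by $\Bbbk G$ (with $y_i$ identified with $x_i\in V$) given by $g\cdot y_i=g\cdot_Vy_i+b(g,x_i)1$. Then $T(V)\#_{M'}\Bbbk G$ is a $(T(V)\#_M\Bbbk G,\,T(V)\#\Bbbk G)$-bigalois extension, and $T(V)\#_M\Bbbk G$ is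 a cocycle deformation of $T(V)\#\Bbbk G$.
   Context: $\Bbbk G$ is regarded as a module over itself via the adjoint action $g\cdot k=gkg^{-1}$. An extension of $V$ by $\Bbbk G$ is a $\Bbbk G$-module $M$ with a short exact sequence of $\Bbbk G$-modules $0\to\Bbbk G\to M\to V\to0$ (here given by the obvious inclusion and projection). $g\cdot_V x$ denotes the action of $g$ on $V$. For an extension $N=\Bbbk\{n_i\}_{i\in I}\oplus\Bbbk G$ of $V$ (with $n_i$ identified with $x_i\in V$), $T_{\Bbbk G}(N)$ is the unital algebra generated by $\{n_i\}$ and $G$ subject only to the relations of $\Bbbk G$; it is a Hopf algebra with $\Delta(g)=g\otimes g$ and $\Delta(n_i)=n_i\otimes1+g_i\otimes n_i$. $T(V)\#_N\Bbbk G$ is its quotient by the ideal $J_N$ generated by $gn_i-(g\cdot n_i)g$, $g\in G$, $i\in I$ (action computed in $N$). It is a Hopf algebra quotient of $T_{\Bbbk G}(N)$ if $J_N$ is a Hopf ideal. $T(V)\#\Bbbk G$ is the usual bosonization, i.e. the case of the direct sum $N=M''=\Bbbk\{z_i\}\oplus\Bbbk G$ with $g\cdot z_i=g\cdot_Vz_i$. The coactions on $T(V)\#_{M'}\Bbbk G$ are the algebra maps with $\rho_r(g)=g\otimes g=\rho_l(g)$, $\rho_r(y_i)=y_i\otimes1+g_i\otimes z_i$ (right, over $T(V)\#\Bbbk G$), $\rho_l(y_i)=x_i\otimes1+g_i\otimes y_i$ (left, over $T(V)\#_M\Bbbk G$). For Hopf algebras $L$ and $A$, an $(L,A)$-bigalois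 extension is a nonzero $(L,A)$-bicomodule algebra $E$ that is both left $L$-Galois and right $A$-Galois with coinvariants $\Bbbk$; the Galois conditions are bijectivity of $\kappa_r:E\otimes E\to E\otimes A$, $c\otimes d\mapsto (c\otimes1)\rho_r(d)$, and $\kappa_l:E\otimes E\to L\otimes E$, $c\otimes d\mapsto\rho_l(c)(1\otimes d)$. A cocycle deformation of a Hopf algebra $A$ is a Hopf algebra isomorphic to $A$ with multiplication twisted by a convolution-invertible 2-cocycle. *)

theory Defs
  imports "HOL-Algebra.Module" "HOL-Algebra.Chinese_Remainder"
begin

section \<open>Algebras, free algebras, quotients\<close>

text \<open>
  All vector spaces over the field \<open>K\<close> are \<^locale>\<open>module\<close>s over \<open>K\<close>. The record type
  \<open>module\<close> also carries the multiplication and unit of an algebra; for objects used only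
  as vector spaces the contents of these two fields are irrelevant.
  (The library's \<^locale>\<open>algebra\<close> is restricted to commutative algebras.)
\<close>

locale unital_algebra = module K A + ring A for K (structure) and A (structure) +
  assumes smult_mult_left:
      "\<lbrakk>a \<in> carrier K; x \<in> carrier A; y \<in> carrier A\<rbrakk> \<Longrightarrow>
        (a \<odot>\<^bsub>A\<^esub> x) \<otimes>\<^bsub>A\<^esub> y = a \<odot>\<^bsub>A\<^esub> (x \<otimes>\<^bsub>A\<^esub> y)"
    and smult_mult_right:
      "\<lbrakk>a \<in> carrier K; x \<in> carrier A; y \<in> carrier A\<rbrakk> \<Longrightarrow>
        x \<otimes>\<^bsub>A\<^esub> (a \<odot>\<^bsub>A\<^esub> y) = a \<odot>\<^bsub>A\<^esub> (x \<otimes>\<^bsub>A\<^esub> y)"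

definition linear_maps ::
  "('k, 'r) ring_scheme \<Rightarrow> ('k, 'v, 'm) module_scheme \<Rightarrow> ('k, 'w, 'n) module_scheme \<Rightarrow> ('v \<Rightarrow> 'w) set"
  where "linear_maps K V W = {f \<in> carrier V \<rightarrow> carrier W.
    (\<forall>u\<in>carrier V. \<forall>v\<in>carrier V. f (u \<oplus>\<^bsub>V\<^esub> v) = f u \<oplus>\<^bsub>W\<^esub> f v) \<and>
    (\<forall>c\<in>carrier K. \<forall>v\<in>carrier V. f (c \<odot>\<^bsub>V\<^esub> v) = c \<odot>\<^bsub>W\<^esub> f v)}"

definition bilinear_maps ::
  "('k, 'r) ring_scheme \<Rightarrow> ('k, 'u, 'l) module_scheme \<Rightarrow> ('k, 'v, 'm) module_scheme
    \<Rightarrow> ('k, 'w, 'n) module_scheme \<Rightarrow> ('u \<Rightarrow> 'v \<Rightarrow> 'w) set"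
  where "bilinear_maps K U V W = {f.
    (\<forall>u\<in>carrier U. f u \<in> linear_maps K V W) \<and>
    (\<forall>v\<in>carrier V. (\<lambda>u. f u v) \<in> linear_maps K U W)}"

definition algebra_homs ::
  "('k, 'r) ring_scheme \<Rightarrow> ('k, 'a, 'm) module_scheme \<Rightarrow> ('k, 'b, 'n) module_scheme \<Rightarrow> ('a \<Rightarrow> 'b) set"
  where "algebra_homs K A B = ring_hom A B \<inter> linear_maps K A B"

definition base_algebra :: "('k, 'r) ring_scheme \<Rightarrow> ('k, 'k) module"
  where "base_algebra K =
    \<lparr>carrier = carrier K, mult = mult K, one = one K, zero = zero K, add = add K, smult = mult K\<rparr>"

definition fin_funs :: "('k, 'r) ring_scheme \<Rightarrow> 's set \<Rightarrow> ('s \<Rightarrow> 'k) set"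
  where "fin_funs K S = {f. range f \<subseteq> carrier K \<and> finite {s. f s \<noteq> \<zero>\<^bsub>K\<^esub>} \<and> {s. f s \<noteq> \<zero>\<^bsub>K\<^esub>} \<subseteq> S}"

definition point :: "('k, 'r) ring_scheme \<Rightarrow> 's \<Rightarrow> 's \<Rightarrow> 'k"
  where "point K s = (\<lambda>t. if t = s then \<one>\<^bsub>K\<^esub> else \<zero>\<^bsub>K\<^esub>)"

definition lincomb ::
  "('k, 'r) ring_scheme \<Rightarrow> ('k, 'w, 'n) module_scheme \<Rightarrow> ('s \<Rightarrow> 'w) \<Rightarrow> ('s \<Rightarrow> 'k) \<Rightarrow> 'w"
  where "lincomb K W \<beta> f = (\<Oplus>\<^bsub>W\<^esub>s\<in>{s. f s \<noteq> \<zero>\<^bsub>K\<^esub>}. f s \<odot>\<^bsub>W\<^esub> \<beta> s)"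

text \<open>The monoid algebra; \<open>point K m\<close> is the basis element belonging to \<open>m\<close>.\<close>

definition monoid_algebra ::
  "('k, 'r) ring_scheme \<Rightarrow> ('s, 'm) monoid_scheme \<Rightarrow> ('k, 's \<Rightarrow> 'k) module"
  where "monoid_algebra K M =
    \<lparr>carrier = fin_funs K (carrier M),
     mult = (\<lambda>f g m. \<Oplus>\<^bsub>K\<^esub>z\<in>{(p, q). f p \<noteq> \<zero>\<^bsub>K\<^esub> \<and> g q \<noteq> \<zero>\<^bsub>K\<^esub> \<and> p \<otimes>\<^bsub>M\<^esub> q = m}.
               f (fst z) \<otimes>\<^bsub>K\<^esub> g (snd z)),
     one = point K \<one>\<^bsub>M\<^esub>,
     zero = (\<lambda>_. \<zero>\<^bsub>K\<^esub>),
     add = (\<lambda>f g m. f m \<oplus>\<^bsub>K\<^esub> g m),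
     smult = (\<lambda>c f m. c \<otimes>\<^bsub>K\<^esub> f m)\<rparr>"

definition free_monoid :: "'s set \<Rightarrow> 's list monoid"
  where "free_monoid S = \<lparr>carrier = lists S, mult = (@), one = []\<rparr>"

abbreviation free_algebra :: "('k, 'r) ring_scheme \<Rightarrow> 's set \<Rightarrow> ('k, 's list \<Rightarrow> 'k) module"
  where "free_algebra K S \<equiv> monoid_algebra K (free_monoid S)"

text \<open>The algebra map out of a free algebra determined by the images of the generators.\<close>

definition free_lift ::
  "('k, 'r) ring_scheme \<Rightarrow> ('k, 'a, 'm) module_scheme \<Rightarrow> ('s \<Rightarrow> 'a) \<Rightarrow> ('s list \<Rightarrow> 'k) \<Rightarrow> 'a"
  where "free_lift K A f = lincomb K A (\<lambda>w. foldr (\<lambda>s y. f s \<otimes>\<^bsub>A\<^esub> y) w \<one>\<^bsub>A\<^esub>)"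

definition module_span ::
  "('k, 'r) ring_scheme \<Rightarrow> ('k, 'v, 'm) module_scheme \<Rightarrow> 'v set \<Rightarrow> 'v set"
  where "module_span K V S = \<Inter>{U. submodule U K V \<and> S \<subseteq> U}"

text \<open>The quotient by a two-sided ideal, or of the underlying vector space by a subspace.\<close>

definition algebra_quot :: "('k, 'a, 'm) module_scheme \<Rightarrow> 'a set \<Rightarrow> ('k, 'a set) module"
  where "algebra_quot A J = ring.extend (A Quot J)
    (module.fields (\<lambda>c X. \<Union>x\<in>X. J +>\<^bsub>A\<^esub> (c \<odot>\<^bsub>A\<^esub> x)))"

text \<open>The map on a quotient induced by a map that is constant on cosets.\<close>

definition coset_lift :: "('a \<Rightarrow> 'b) \<Rightarrow> 'a set \<Rightarrow> 'b"
  where "coset_lift f X = the_elem (f ` X)"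

definition vs_basis ::
  "('k, 'r) ring_scheme \<Rightarrow> ('k, 'v, 'm) module_scheme \<Rightarrow> 'i set \<Rightarrow> ('i \<Rightarrow> 'v) \<Rightarrow> bool"
  where "vs_basis K V I x \<longleftrightarrow> x \<in> I \<rightarrow> carrier V \<and> bij_betw (lincomb K V x) (fin_funs K I) (carrier V)"

definition coords ::
  "('k, 'r) ring_scheme \<Rightarrow> ('k, 'v, 'm) module_scheme \<Rightarrow> 'i set \<Rightarrow> ('i \<Rightarrow> 'v) \<Rightarrow> 'v \<Rightarrow> 'i \<Rightarrow> 'k"
  where "coords K V I x = inv_into (fin_funs K I) (lincomb K V x)"

definition direct_sum ::
  "('k, 'v, 'm) module_scheme \<Rightarrow> ('k, 'w, 'n) module_scheme \<Rightarrow> ('k, 'v \<times> 'w) module"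
  where "direct_sum V W = ring.extend (RDirProd V W)
    (module.fields (\<lambda>c (v, w). (c \<odot>\<^bsub>V\<^esub> v, c \<odot>\<^bsub>W\<^esub> w)))"


section \<open>Tensor products\<close>

type_synonym ('k, 'v, 'w) tensor = "('v \<times> 'w \<Rightarrow> 'k) set"

definition bilinear_relations ::
  "('k, 'r) ring_scheme \<Rightarrow> ('k, 'v, 'm) module_scheme \<Rightarrow> ('k, 'w, 'n) module_scheme
    \<Rightarrow> ('v \<times> 'w \<Rightarrow> 'k) set"
  where "bilinear_relations K V W = (let F = monoid_algebra K (V \<times>\<times> W); e = point K in
    {e (u \<oplus>\<^bsub>V\<^esub> v, w) \<ominus>\<^bsub>F\<^esub> (e (u, w) \<oplus>\<^bsub>F\<^esub> e (v, w)) | u v w.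
        u \<in> carrier V \<and> v \<in> carrier V \<and> w \<in> carrier W} \<union>
    {e (u, v \<oplus>\<^bsub>W\<^esub> w) \<ominus>\<^bsub>F\<^esub> (e (u, v) \<oplus>\<^bsub>F\<^esub> e (u, w)) | u v w.
        u \<in> carrier V \<and> v \<in> carrier W \<and> w \<in> carrier W} \<union>
    {e (c \<odot>\<^bsub>V\<^esub> v, w) \<ominus>\<^bsub>F\<^esub> c \<odot>\<^bsub>F\<^esub> e (v, w) | c v w.
        c \<in> carrier K \<and> v \<in> carrier V \<and> w \<in> carrier W} \<union>
    {e (v, c \<odot>\<^bsub>W\<^esub> w) \<ominus>\<^bsub>F\<^esub> c \<odot>\<^bsub>F\<^esub> e (v, w) | c v w.
        c \<in> carrier K \<and> v \<in> carrier V \<and> w \<in> carrier W})"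

text \<open>
  The free vector space on \<open>V \<times> W\<close> modulo the bilinearity relations. It is formed inside the
  monoid algebra of the product of the multiplicative monoids because, if \<open>V\<close> and \<open>W\<close> are
  algebras, the relations span an ideal there, so that the quotient multiplication is
  \<open>(a \<otimes> b)(c \<otimes> d) = ac \<otimes> bd\<close>.
\<close>

definition tensor ::
  "('k, 'r) ring_scheme \<Rightarrow> ('k, 'v, 'm) module_scheme \<Rightarrow> ('k, 'w, 'n) module_scheme
    \<Rightarrow> ('k, ('k, 'v, 'w) tensor) module"
  where "tensor K V W = (let F = monoid_algebra K (V \<times>\<times> W) in
    algebra_quot F (module_span K F (bilinear_relations K V W)))"

definition tens ::
  "('k, 'r) ring_scheme \<Rightarrow> ('k, 'v, 'm) module_scheme \<Rightarrow> ('k, 'w, 'n) module_scheme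
    \<Rightarrow> 'v \<Rightarrow> 'w \<Rightarrow> ('k, 'v, 'w) tensor"
  where "tens K V W v w = (let F = monoid_algebra K (V \<times>\<times> W) in
    module_span K F (bilinear_relations K V W) +>\<^bsub>F\<^esub> point K (v, w))"

text \<open>
  The linear map out of a tensor product into \<open>U\<close> induced by a bilinear map \<open>\<beta>\<close>. In Sweedler
  notation, \<open>tens_lift K U (\<lambda>h1 h2. t h1 h2) (\<Delta> h)\<close> is the sum \<open>\<Sum> t(h_(1), h_(2))\<close>.
\<close>

definition tens_lift ::
  "('k, 'r) ring_scheme \<Rightarrow> ('k, 'u, 'l) module_scheme \<Rightarrow> ('v \<Rightarrow> 'w \<Rightarrow> 'u) \<Rightarrow> ('k, 'v, 'w) tensor \<Rightarrow> 'u"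
  where "tens_lift K U \<beta> = coset_lift (lincomb K U (case_prod \<beta>))"

definition tens_map ::
  "('k, 'r) ring_scheme \<Rightarrow> ('k, 'v, 'm) module_scheme \<Rightarrow> ('k, 'w, 'n) module_scheme
    \<Rightarrow> ('u \<Rightarrow> 'v) \<Rightarrow> ('t \<Rightarrow> 'w) \<Rightarrow> ('k, 'u, 't) tensor \<Rightarrow> ('k, 'v, 'w) tensor"
  where "tens_map K V W f g = tens_lift K (tensor K V W) (\<lambda>u t. tens K V W (f u) (g t))"


section \<open>Hopf algebras\<close>

record ('k, 'h) bialg = "('k, 'h) module" +
  comult :: "'h \<Rightarrow> ('k, 'h, 'h) tensor"
  counit :: "'h \<Rightarrow> 'k"

definition coalgebra :: "('k, 'r) ring_scheme \<Rightarrow> ('k, 'h, 'm) bialg_scheme \<Rightarrow> bool"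
  where "coalgebra K H \<longleftrightarrow> module K H \<and>
    comult H \<in> linear_maps K H (tensor K H H) \<and>
    counit H \<in> linear_maps K H (base_algebra K) \<and>
    (let HHH = tensor K H (tensor K H H); tn = (\<lambda>a b c. tens K H (tensor K H H) a (tens K H H b c)) in
      \<forall>h\<in>carrier H.
        tens_lift K HHH (\<lambda>h' h3. tens_lift K HHH (\<lambda>h1 h2. tn h1 h2 h3) (comult H h')) (comult H h) =
        tens_lift K HHH (\<lambda>h1 h'. tens_lift K HHH (\<lambda>h2 h3. tn h1 h2 h3) (comult H h')) (comult H h)) \<and>
    (\<forall>h\<in>carrier H. tens_lift K H (\<lambda>h1 h2. counit H h1 \<odot>\<^bsub>H\<^esub> h2) (comult H h) = h) \<and>
    (\<forall>h\<in>carrier H. tens_lift K H (\<lambda>h1 h2. counit H h2 \<odot>\<^bsub>H\<^esub> h1) (comult H h) = h)"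

definition bialgebra :: "('k, 'r) ring_scheme \<Rightarrow> ('k, 'h, 'm) bialg_scheme \<Rightarrow> bool"
  where "bialgebra K H \<longleftrightarrow> unital_algebra K H \<and> coalgebra K H \<and>
    comult H \<in> algebra_homs K H (tensor K H H) \<and> counit H \<in> algebra_homs K H (base_algebra K)"

definition is_antipode :: "('k, 'r) ring_scheme \<Rightarrow> ('k, 'h, 'm) bialg_scheme \<Rightarrow> ('h \<Rightarrow> 'h) \<Rightarrow> bool"
  where "is_antipode K H S \<longleftrightarrow> S \<in> linear_maps K H H \<and>
    (\<forall>h\<in>carrier H.
      tens_lift K H (\<lambda>h1 h2. S h1 \<otimes>\<^bsub>H\<^esub> h2) (comult H h) = counit H h \<odot>\<^bsub>H\<^esub> \<one>\<^bsub>H\<^esub> \<and>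
      tens_lift K H (\<lambda>h1 h2. h1 \<otimes>\<^bsub>H\<^esub> S h2) (comult H h) = counit H h \<odot>\<^bsub>H\<^esub> \<one>\<^bsub>H\<^esub>)"

text \<open>The antipode of a bialgebra is unique (on the carrier), hence not a record field.\<close>

definition hopf_algebra :: "('k, 'r) ring_scheme \<Rightarrow> ('k, 'h, 'm) bialg_scheme \<Rightarrow> bool"
  where "hopf_algebra K H \<longleftrightarrow> bialgebra K H \<and> (\<exists>S. is_antipode K H S)"

definition hopf_ideal :: "('k, 'r) ring_scheme \<Rightarrow> ('k, 'h, 'm) bialg_scheme \<Rightarrow> 'h set \<Rightarrow> bool"
  where "hopf_ideal K H J \<longleftrightarrow> ideal J H \<and>
    comult H ` J \<subseteq> module_span K (tensor K H H)
      ({tens K H H j h | j h. j \<in> J \<and> h \<in> carrier H} \<union>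
       {tens K H H h j | h j. h \<in> carrier H \<and> j \<in> J}) \<and>
    counit H ` J \<subseteq> {\<zero>\<^bsub>K\<^esub>} \<and>
    (\<exists>S. is_antipode K H S \<and> S ` J \<subseteq> J)"

definition bialg_quot ::
  "('k, 'r) ring_scheme \<Rightarrow> ('k, 'h, 'm) bialg_scheme \<Rightarrow> 'h set \<Rightarrow> ('k, 'h set) bialg"
  where "bialg_quot K H J = module.extend (algebra_quot H J)
    (bialg.fields
      (let Q = algebra_quot H J; \<pi> = (\<lambda>h. J +>\<^bsub>H\<^esub> h) in
        coset_lift (\<lambda>h. tens_map K Q Q \<pi> \<pi> (comult H h)))
      (coset_lift (counit H)))"

definition subcoalgebra :: "('k, 'r) ring_scheme \<Rightarrow> ('k, 'h, 'm) bialg_scheme \<Rightarrow> 'h set \<Rightarrow> bool"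
  where "subcoalgebra K H D \<longleftrightarrow> submodule D K H \<and>
    comult H ` D \<subseteq> module_span K (tensor K H H) {tens K H H c d | c d. c \<in> D \<and> d \<in> D}"

definition simple_subcoalgebra :: "('k, 'r) ring_scheme \<Rightarrow> ('k, 'h, 'm) bialg_scheme \<Rightarrow> 'h set \<Rightarrow> bool"
  where "simple_subcoalgebra K H D \<longleftrightarrow> subcoalgebra K H D \<and> D \<noteq> {\<zero>\<^bsub>H\<^esub>} \<and>
    (\<forall>C. subcoalgebra K H C \<and> C \<subseteq> D \<longrightarrow> C = {\<zero>\<^bsub>H\<^esub>} \<or> C = D)"

definition pointed_hopf_algebra :: "('k, 'r) ring_scheme \<Rightarrow> ('k, 'h, 'm) bialg_scheme \<Rightarrow> bool"
  where "pointed_hopf_algebra K H \<longleftrightarrow> hopf_algebra K H \<and>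
    (\<forall>D. simple_subcoalgebra K H D \<longrightarrow>
      (\<exists>d\<in>carrier H. d \<noteq> \<zero>\<^bsub>H\<^esub> \<and> D = {c \<odot>\<^bsub>H\<^esub> d | c. c \<in> carrier K}))"

definition pointed_hopf_quotient ::
  "('k, 'r) ring_scheme \<Rightarrow> ('k, 'h, 'm) bialg_scheme \<Rightarrow> 'h set \<Rightarrow> bool"
  where "pointed_hopf_quotient K H J \<longleftrightarrow> hopf_ideal K H J \<and> pointed_hopf_algebra K (bialg_quot K H J)"

definition bialg_iso ::
  "('k, 'r) ring_scheme \<Rightarrow> ('k, 'a, 'm) bialg_scheme \<Rightarrow> ('k, 'b, 'n) bialg_scheme \<Rightarrow> ('a \<Rightarrow> 'b) \<Rightarrow> bool"
  where "bialg_iso K A B f \<longleftrightarrow> f \<in> algebra_homs K A B \<and> bij_betw f (carrier A) (carrier B) \<and>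
    (\<forall>a\<in>carrier A. comult B (f a) = tens_map K B B f f (comult A a) \<and> counit B (f a) = counit A a)"


section \<open>Cocycle deformations\<close>

definition convolution2 ::
  "('k, 'r) ring_scheme \<Rightarrow> ('k, 'h, 'm) bialg_scheme \<Rightarrow> ('h \<Rightarrow> 'h \<Rightarrow> 'k) \<Rightarrow> ('h \<Rightarrow> 'h \<Rightarrow> 'k) \<Rightarrow> 'h \<Rightarrow> 'h \<Rightarrow> 'k"
  where "convolution2 K H \<sigma> \<tau> a b =
    tens_lift K (base_algebra K) (\<lambda>a1 a2. tens_lift K (base_algebra K)
      (\<lambda>b1 b2. \<sigma> a1 b1 \<otimes>\<^bsub>K\<^esub> \<tau> a2 b2) (comult H b)) (comult H a)"

text \<open>
  \<open>\<sigma>\<close> is a normalised (left) 2-cocycle with convolution inverse \<open>\<tau>\<close>; forms on \<open>H \<otimes> H\<close> are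
  given as bilinear forms.
\<close>

definition inv_two_cocycle ::
  "('k, 'r) ring_scheme \<Rightarrow> ('k, 'h, 'm) bialg_scheme \<Rightarrow> ('h \<Rightarrow> 'h \<Rightarrow> 'k) \<Rightarrow> ('h \<Rightarrow> 'h \<Rightarrow> 'k) \<Rightarrow> bool"
  where "inv_two_cocycle K H \<sigma> \<tau> \<longleftrightarrow>
    \<sigma> \<in> bilinear_maps K H H (base_algebra K) \<and> \<tau> \<in> bilinear_maps K H H (base_algebra K) \<and>
    (\<forall>a\<in>carrier H. \<forall>b\<in>carrier H.
      convolution2 K H \<sigma> \<tau> a b = counit H a \<otimes>\<^bsub>K\<^esub> counit H b \<and>
      convolution2 K H \<tau> \<sigma> a b = counit H a \<otimes>\<^bsub>K\<^esub> counit H b) \<and>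
    (\<forall>a\<in>carrier H. \<sigma> a \<one>\<^bsub>H\<^esub> = counit H a \<and> \<sigma> \<one>\<^bsub>H\<^esub> a = counit H a) \<and>
    (\<forall>a\<in>carrier H. \<forall>b\<in>carrier H. \<forall>c\<in>carrier H.
      tens_lift K (base_algebra K) (\<lambda>a1 a2. tens_lift K (base_algebra K)
        (\<lambda>b1 b2. \<sigma> a1 b1 \<otimes>\<^bsub>K\<^esub> \<sigma> (a2 \<otimes>\<^bsub>H\<^esub> b2) c) (comult H b)) (comult H a) =
      tens_lift K (base_algebra K) (\<lambda>b1 b2. tens_lift K (base_algebra K)
        (\<lambda>c1 c2. \<sigma> b1 c1 \<otimes>\<^bsub>K\<^esub> \<sigma> a (b2 \<otimes>\<^bsub>H\<^esub> c2)) (comult H c)) (comult H b))"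

text \<open>\<open>a \<cdot> b = \<sigma>(a_(1), b_(1)) a_(2) b_(2) \<tau>(a_(3), b_(3))\<close>\<close>

definition cocycle_twist ::
  "('k, 'r) ring_scheme \<Rightarrow> ('k, 'h) bialg \<Rightarrow> ('h \<Rightarrow> 'h \<Rightarrow> 'k) \<Rightarrow> ('h \<Rightarrow> 'h \<Rightarrow> 'k) \<Rightarrow> ('k, 'h) bialg"
  where "cocycle_twist K H \<sigma> \<tau> = H\<lparr>mult := (\<lambda>a b.
    tens_lift K H (\<lambda>a1 a'. tens_lift K H (\<lambda>a2 a3.
      tens_lift K H (\<lambda>b1 b'. tens_lift K H (\<lambda>b2 b3.
        (\<sigma> a1 b1 \<otimes>\<^bsub>K\<^esub> \<tau> a3 b3) \<odot>\<^bsub>H\<^esub> (a2 \<otimes>\<^bsub>H\<^esub> b2))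
      (comult H b')) (comult H b)) (comult H a')) (comult H a))\<rparr>"

definition cocycle_deformation ::
  "('k, 'r) ring_scheme \<Rightarrow> ('k, 'h) bialg \<Rightarrow> ('k, 'l) bialg \<Rightarrow> bool"
  where "cocycle_deformation K H L \<longleftrightarrow> hopf_algebra K H \<and> hopf_algebra K L \<and>
    (\<exists>\<sigma> \<tau> f. inv_two_cocycle K H \<sigma> \<tau> \<and> bialg_iso K L (cocycle_twist K H \<sigma> \<tau>) f)"


section \<open>Bigalois extensions\<close>

definition right_comodule_algebra ::
  "('k, 'r) ring_scheme \<Rightarrow> ('k, 'a, 'm) bialg_scheme \<Rightarrow> ('k, 'e, 'n) module_scheme
    \<Rightarrow> ('e \<Rightarrow> ('k, 'e, 'a) tensor) \<Rightarrow> bool"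
  where "right_comodule_algebra K A E \<rho> \<longleftrightarrow> unital_algebra K E \<and> \<rho> \<in> algebra_homs K E (tensor K E A) \<and>
    (let EAA = tensor K E (tensor K A A); tn = (\<lambda>e a b. tens K E (tensor K A A) e (tens K A A a b)) in
      \<forall>e\<in>carrier E.
        tens_lift K EAA (\<lambda>e' b. tens_lift K EAA (\<lambda>e0 a. tn e0 a b) (\<rho> e')) (\<rho> e) =
        tens_lift K EAA (\<lambda>e0 a'. tens_lift K EAA (\<lambda>a b. tn e0 a b) (comult A a')) (\<rho> e)) \<and>
    (\<forall>e\<in>carrier E. tens_lift K E (\<lambda>e0 a. counit A a \<odot>\<^bsub>E\<^esub> e0) (\<rho> e) = e)"

definition left_comodule ::
  "('k, 'r) ring_scheme \<Rightarrow> ('k, 'l, 'm) bialg_scheme \<Rightarrow> ('k, 'e, 'n) module_scheme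
    \<Rightarrow> ('e \<Rightarrow> ('k, 'l, 'e) tensor) \<Rightarrow> bool"
  where "left_comodule K L E \<rho> \<longleftrightarrow> module K E \<and> \<rho> \<in> linear_maps K E (tensor K L E) \<and>
    (let LLE = tensor K L (tensor K L E); tn = (\<lambda>l m e. tens K L (tensor K L E) l (tens K L E m e)) in
      \<forall>e\<in>carrier E.
        tens_lift K LLE (\<lambda>l' e0. tens_lift K LLE (\<lambda>l m. tn l m e0) (comult L l')) (\<rho> e) =
        tens_lift K LLE (\<lambda>l e'. tens_lift K LLE (\<lambda>m e0. tn l m e0) (\<rho> e')) (\<rho> e)) \<and>
    (\<forall>e\<in>carrier E. tens_lift K E (\<lambda>l e0. counit L l \<odot>\<^bsub>E\<^esub> e0) (\<rho> e) = e)"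

definition left_comodule_algebra ::
  "('k, 'r) ring_scheme \<Rightarrow> ('k, 'l, 'm) bialg_scheme \<Rightarrow> ('k, 'e, 'n) module_scheme
    \<Rightarrow> ('e \<Rightarrow> ('k, 'l, 'e) tensor) \<Rightarrow> bool"
  where "left_comodule_algebra K L E \<rho> \<longleftrightarrow> unital_algebra K E \<and> left_comodule K L E \<rho> \<and>
    \<rho> \<in> algebra_homs K E (tensor K L E)"

definition bicomodule_algebra ::
  "('k, 'r) ring_scheme \<Rightarrow> ('k, 'l, 'm) bialg_scheme \<Rightarrow> ('k, 'a, 'o) bialg_scheme
    \<Rightarrow> ('k, 'e, 'n) module_scheme \<Rightarrow> ('e \<Rightarrow> ('k, 'l, 'e) tensor) \<Rightarrow> ('e \<Rightarrow> ('k, 'e, 'a) tensor) \<Rightarrow> bool"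
  where "bicomodule_algebra K L A E \<rho>l \<rho>r \<longleftrightarrow>
    left_comodule_algebra K L E \<rho>l \<and> right_comodule_algebra K A E \<rho>r \<and>
    (let LEA = tensor K L (tensor K E A); tn = (\<lambda>l e a. tens K L (tensor K E A) l (tens K E A e a)) in
      \<forall>e\<in>carrier E.
        tens_lift K LEA (\<lambda>e' a. tens_lift K LEA (\<lambda>l e0. tn l e0 a) (\<rho>l e')) (\<rho>r e) =
        tens_lift K LEA (\<lambda>l e'. tens_lift K LEA (\<lambda>e0 a. tn l e0 a) (\<rho>r e')) (\<rho>l e))"

definition right_galois ::
  "('k, 'r) ring_scheme \<Rightarrow> ('k, 'a, 'm) bialg_scheme \<Rightarrow> ('k, 'e, 'n) module_scheme
    \<Rightarrow> ('e \<Rightarrow> ('k, 'e, 'a) tensor) \<Rightarrow> bool"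
  where "right_galois K A E \<rho> \<longleftrightarrow>
    {e \<in> carrier E. \<rho> e = tens K E A e \<one>\<^bsub>A\<^esub>} = {c \<odot>\<^bsub>E\<^esub> \<one>\<^bsub>E\<^esub> | c. c \<in> carrier K} \<and>
    bij_betw
      (tens_lift K (tensor K E A) (\<lambda>c d. tens K E A c \<one>\<^bsub>A\<^esub> \<otimes>\<^bsub>tensor K E A\<^esub> \<rho> d))
      (carrier (tensor K E E)) (carrier (tensor K E A))"

definition left_galois ::
  "('k, 'r) ring_scheme \<Rightarrow> ('k, 'l, 'm) bialg_scheme \<Rightarrow> ('k, 'e, 'n) module_scheme
    \<Rightarrow> ('e \<Rightarrow> ('k, 'l, 'e) tensor) \<Rightarrow> bool"
  where "left_galois K L E \<rho> \<longleftrightarrow>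
    {e \<in> carrier E. \<rho> e = tens K L E \<one>\<^bsub>L\<^esub> e} = {c \<odot>\<^bsub>E\<^esub> \<one>\<^bsub>E\<^esub> | c. c \<in> carrier K} \<and>
    bij_betw
      (tens_lift K (tensor K L E) (\<lambda>c d. \<rho> c \<otimes>\<^bsub>tensor K L E\<^esub> tens K L E \<one>\<^bsub>L\<^esub> d))
      (carrier (tensor K E E)) (carrier (tensor K L E))"

definition bigalois_extension ::
  "('k, 'r) ring_scheme \<Rightarrow> ('k, 'l, 'm) bialg_scheme \<Rightarrow> ('k, 'a, 'o) bialg_scheme
    \<Rightarrow> ('k, 'e, 'n) module_scheme \<Rightarrow> ('e \<Rightarrow> ('k, 'l, 'e) tensor) \<Rightarrow> ('e \<Rightarrow> ('k, 'e, 'a) tensor) \<Rightarrow> bool"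
  where "bigalois_extension K L A E \<rho>l \<rho>r \<longleftrightarrow>
    hopf_algebra K L \<and> hopf_algebra K A \<and> carrier E \<noteq> {\<zero>\<^bsub>E\<^esub>} \<and>
    bicomodule_algebra K L A E \<rho>l \<rho>r \<and> left_galois K L E \<rho>l \<and> right_galois K A E \<rho>r"


section \<open>Modules over an algebra, Yetter--Drinfeld modules, extensions\<close>

text \<open>Left modules over a not necessarily commutative algebra \<open>A\<close>; \<open>act\<close> is the action.\<close>

definition left_module ::
  "('k, 'r) ring_scheme \<Rightarrow> ('k, 'a, 'm) module_scheme \<Rightarrow> ('k, 'v, 'n) module_scheme
    \<Rightarrow> ('a \<Rightarrow> 'v \<Rightarrow> 'v) \<Rightarrow> bool"
  where "left_module K A V act \<longleftrightarrow> unital_algebra K A \<and> module K V \<and> act \<in> bilinear_maps K A V V \<and>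
    (\<forall>v\<in>carrier V. act \<one>\<^bsub>A\<^esub> v = v) \<and>
    (\<forall>a\<in>carrier A. \<forall>b\<in>carrier A. \<forall>v\<in>carrier V. act (a \<otimes>\<^bsub>A\<^esub> b) v = act a (act b v))"

definition left_module_homs ::
  "('k, 'r) ring_scheme \<Rightarrow> ('k, 'a, 'm) module_scheme \<Rightarrow> ('k, 'v, 'n) module_scheme
    \<Rightarrow> ('a \<Rightarrow> 'v \<Rightarrow> 'v) \<Rightarrow> ('k, 'w, 'o) module_scheme \<Rightarrow> ('a \<Rightarrow> 'w \<Rightarrow> 'w) \<Rightarrow> ('v \<Rightarrow> 'w) set"
  where "left_module_homs K A V actV W actW = {f \<in> linear_maps K V W.
    \<forall>a\<in>carrier A. \<forall>v\<in>carrier V. f (actV a v) = actW a (f v)}"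

text \<open>The compatibility is \<open>\<delta>(h v) = h_(1) v_(-1) S(h_(3)) \<otimes> h_(2) v_(0)\<close>.\<close>

definition yetter_drinfeld ::
  "('k, 'r) ring_scheme \<Rightarrow> ('k, 'h, 'm) bialg_scheme \<Rightarrow> ('k, 'v, 'n) module_scheme
    \<Rightarrow> ('h \<Rightarrow> 'v \<Rightarrow> 'v) \<Rightarrow> ('v \<Rightarrow> ('k, 'h, 'v) tensor) \<Rightarrow> bool"
  where "yetter_drinfeld K H V act \<delta> \<longleftrightarrow> left_module K H V act \<and> left_comodule K H V \<delta> \<and>
    (\<exists>S. is_antipode K H S \<and>
      (\<forall>h\<in>carrier H. \<forall>v\<in>carrier V. \<delta> (act h v) =
        tens_lift K (tensor K H V) (\<lambda>h1 h'. tens_lift K (tensor K H V) (\<lambda>h2 h3.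
          tens_lift K (tensor K H V) (\<lambda>u w. tens K H V (h1 \<otimes>\<^bsub>H\<^esub> u \<otimes>\<^bsub>H\<^esub> S h3) (act h2 w)) (\<delta> v))
        (comult H h')) (comult H h)))"

definition group_bialg :: "('k, 'r) ring_scheme \<Rightarrow> ('g, 'm) monoid_scheme \<Rightarrow> ('k, 'g \<Rightarrow> 'k) bialg"
  where "group_bialg K G = (let A = monoid_algebra K G in module.extend A
    (bialg.fields
      (lincomb K (tensor K A A) (\<lambda>g. tens K A A (point K g) (point K g)))
      (lincomb K (base_algebra K) (\<lambda>g. \<one>\<^bsub>K\<^esub>))))"

definition adjoint_action ::
  "('k, 'r) ring_scheme \<Rightarrow> ('g, 'm) monoid_scheme \<Rightarrow> ('g \<Rightarrow> 'k) \<Rightarrow> ('g \<Rightarrow> 'k) \<Rightarrow> 'g \<Rightarrow> 'k"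
  where "adjoint_action K G a c = (let A = monoid_algebra K G in
    lincomb K A (\<lambda>g. point K g \<otimes>\<^bsub>A\<^esub> c \<otimes>\<^bsub>A\<^esub> point K (inv\<^bsub>G\<^esub> g)) a)"

definition short_exact ::
  "('k, 'r) ring_scheme \<Rightarrow> ('k, 'a, 'm) module_scheme \<Rightarrow> ('k, 'u, 'n) module_scheme
    \<Rightarrow> ('a \<Rightarrow> 'u \<Rightarrow> 'u) \<Rightarrow> ('k, 'v, 'o) module_scheme \<Rightarrow> ('a \<Rightarrow> 'v \<Rightarrow> 'v)
    \<Rightarrow> ('k, 'w, 'p) module_scheme \<Rightarrow> ('a \<Rightarrow> 'w \<Rightarrow> 'w) \<Rightarrow> ('u \<Rightarrow> 'v) \<Rightarrow> ('v \<Rightarrow> 'w) \<Rightarrow> bool"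
  where "short_exact K A U actU V actV W actW f p \<longleftrightarrow>
    left_module K A U actU \<and> left_module K A V actV \<and> left_module K A W actW \<and>
    f \<in> left_module_homs K A U actU V actV \<and> p \<in> left_module_homs K A V actV W actW \<and>
    inj_on f (carrier U) \<and> f ` carrier U = {v \<in> carrier V. p v = \<zero>\<^bsub>W\<^esub>} \<and> p ` carrier V = carrier W"

text \<open>
  Extensions of \<open>V\<close> by \<open>KG\<close> live on the vector space \<open>V \<oplus> KG\<close>, where the basis vector \<open>x i\<close> of
  \<open>V\<close> stands for the additional basis vector of the extension; only the action \<open>actN\<close> varies.
\<close>

definition extension_space ::
  "('k, 'r) ring_scheme \<Rightarrow> ('g, 'm) monoid_scheme \<Rightarrow> ('k, 'v, 'n) module_scheme
    \<Rightarrow> ('k, 'v \<times> ('g \<Rightarrow> 'k)) module"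
  where "extension_space K G V = direct_sum V (monoid_algebra K G)"

definition is_extension ::
  "('k, 'r) ring_scheme \<Rightarrow> ('g, 'm) monoid_scheme \<Rightarrow> ('k, 'v, 'n) module_scheme
    \<Rightarrow> (('g \<Rightarrow> 'k) \<Rightarrow> 'v \<Rightarrow> 'v) \<Rightarrow> (('g \<Rightarrow> 'k) \<Rightarrow> 'v \<times> ('g \<Rightarrow> 'k) \<Rightarrow> 'v \<times> ('g \<Rightarrow> 'k)) \<Rightarrow> bool"
  where "is_extension K G V act actN \<longleftrightarrow>
    short_exact K (monoid_algebra K G)
      (monoid_algebra K G) (adjoint_action K G) (extension_space K G V) actN V act
      (\<lambda>c. (\<zero>\<^bsub>V\<^esub>, c)) fst"

text \<open>
  The action on \<open>V \<oplus> KG\<close> that is the adjoint action on \<open>KG\<close> and satisfies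
  \<open>g x_i = g \<cdot>_V x_i + \<Sum>_t b_t(g, x_i) t\<close>. The sum over \<open>t\<close>, as an element of \<open>KG\<close>, is the
  function \<open>t \<mapsto> b_t(g, x_i)\<close>.
\<close>

definition extension_action ::
  "('k, 'r) ring_scheme \<Rightarrow> ('g, 'm) monoid_scheme \<Rightarrow> (('g \<Rightarrow> 'k) \<Rightarrow> 'v \<Rightarrow> 'v)
    \<Rightarrow> ('g \<Rightarrow> ('g \<Rightarrow> 'k) \<Rightarrow> 'v \<Rightarrow> 'k)
    \<Rightarrow> ('g \<Rightarrow> 'k) \<Rightarrow> 'v \<times> ('g \<Rightarrow> 'k) \<Rightarrow> 'v \<times> ('g \<Rightarrow> 'k)"
  where "extension_action K G act b a = (\<lambda>(v, c).
    (act a v,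
     adjoint_action K G a c \<oplus>\<^bsub>monoid_algebra K G\<^esub> (\<lambda>t. if t \<in> carrier G then b t a v else \<zero>\<^bsub>K\<^esub>)))"


section \<open>The algebras \<open>T_KG(N)\<close> and \<open>T(V) #_N KG\<close>\<close>

type_synonym ('k, 'g, 'i) tkg = "(('i + 'g) list \<Rightarrow> 'k) set"

definition group_relations ::
  "('k, 'r) ring_scheme \<Rightarrow> ('g, 'm) monoid_scheme \<Rightarrow> 'i set \<Rightarrow> (('i + 'g) list \<Rightarrow> 'k) set"
  where "group_relations K G I = (let F = free_algebra K (I <+> carrier G); e = (\<lambda>g. point K [Inr g]) in
    {e g \<otimes>\<^bsub>F\<^esub> e h \<ominus>\<^bsub>F\<^esub> e (g \<otimes>\<^bsub>G\<^esub> h) | g h. g \<in> carrier G \<and> h \<in> carrier G} \<union>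
    {e \<one>\<^bsub>G\<^esub> \<ominus>\<^bsub>F\<^esub> \<one>\<^bsub>F\<^esub>})"

text \<open>\<open>T_KG(N)\<close> as an algebra; the generators are \<open>tkg_n\<close> and \<open>tkg_g\<close>.\<close>

definition tkg_algebra ::
  "('k, 'r) ring_scheme \<Rightarrow> ('g, 'm) monoid_scheme \<Rightarrow> 'i set \<Rightarrow> ('k, ('k, 'g, 'i) tkg) module"
  where "tkg_algebra K G I = (let F = free_algebra K (I <+> carrier G) in
    algebra_quot F (Idl\<^bsub>F\<^esub> (group_relations K G I)))"

definition tkg_gen ::
  "('k, 'r) ring_scheme \<Rightarrow> ('g, 'm) monoid_scheme \<Rightarrow> 'i set \<Rightarrow> 'i + 'g \<Rightarrow> ('k, 'g, 'i) tkg"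
  where "tkg_gen K G I s = (let F = free_algebra K (I <+> carrier G) in
    Idl\<^bsub>F\<^esub> (group_relations K G I) +>\<^bsub>F\<^esub> point K [s])"

abbreviation tkg_n ::
  "('k, 'r) ring_scheme \<Rightarrow> ('g, 'm) monoid_scheme \<Rightarrow> 'i set \<Rightarrow> 'i \<Rightarrow> ('k, 'g, 'i) tkg"
  where "tkg_n K G I i \<equiv> tkg_gen K G I (Inl i)"

abbreviation tkg_g ::
  "('k, 'r) ring_scheme \<Rightarrow> ('g, 'm) monoid_scheme \<Rightarrow> 'i set \<Rightarrow> 'g \<Rightarrow> ('k, 'g, 'i) tkg"
  where "tkg_g K G I g \<equiv> tkg_gen K G I (Inr g)"

text \<open>
  \<open>T_KG(N)\<close> with \<open>\<Delta>(g) = g \<otimes> g\<close> and \<open>\<Delta>(n_i) = n_i \<otimes> 1 + g_i \<otimes> n_i\<close>, where \<open>gd i\<close> is \<open>g_i\<close>;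
  the counit axiom then forces \<open>\<epsilon>(g) = 1\<close> and \<open>\<epsilon>(n_i) = 0\<close>.
\<close>

definition tkg ::
  "('k, 'r) ring_scheme \<Rightarrow> ('g, 'm) monoid_scheme \<Rightarrow> 'i set \<Rightarrow> ('i \<Rightarrow> 'g) \<Rightarrow> ('k, ('k, 'g, 'i) tkg) bialg"
  where "tkg K G I gd = (let T = tkg_algebra K G I; TT = tensor K T T; n = tkg_n K G I; e = tkg_g K G I in
    module.extend T (bialg.fields
      (coset_lift (free_lift K TT (case_sum
        (\<lambda>i. tens K T T (n i) \<one>\<^bsub>T\<^esub> \<oplus>\<^bsub>TT\<^esub> tens K T T (e (gd i)) (n i))
        (\<lambda>g. tens K T T (e g) (e g)))))
      (coset_lift (free_lift K (base_algebra K) (case_sum (\<lambda>i. \<zero>\<^bsub>K\<^esub>) (\<lambda>g. \<one>\<^bsub>K\<^esub>))))))"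

text \<open>The linear map \<open>N \<rightarrow> T_KG(N)\<close> with \<open>n_i \<mapsto> n_i\<close> and \<open>g \<mapsto> g\<close>.\<close>

definition tkg_embed ::
  "('k, 'r) ring_scheme \<Rightarrow> ('g, 'm) monoid_scheme \<Rightarrow> ('k, 'v, 'n) module_scheme \<Rightarrow> 'i set
    \<Rightarrow> ('i \<Rightarrow> 'v) \<Rightarrow> 'v \<times> ('g \<Rightarrow> 'k) \<Rightarrow> ('k, 'g, 'i) tkg"
  where "tkg_embed K G V I x = (\<lambda>(v, c). let T = tkg_algebra K G I in
    lincomb K T (tkg_n K G I) (coords K V I x v) \<oplus>\<^bsub>T\<^esub> lincomb K T (tkg_g K G I) c)"

text \<open>The ideal \<open>J_N\<close>, generated by the elements \<open>g n_i - (g \<cdot> n_i) g\<close>.\<close>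

definition smash_ideal ::
  "('k, 'r) ring_scheme \<Rightarrow> ('g, 'm) monoid_scheme \<Rightarrow> ('k, 'v, 'n) module_scheme \<Rightarrow> 'i set
    \<Rightarrow> ('i \<Rightarrow> 'v) \<Rightarrow> (('g \<Rightarrow> 'k) \<Rightarrow> 'v \<times> ('g \<Rightarrow> 'k) \<Rightarrow> 'v \<times> ('g \<Rightarrow> 'k)) \<Rightarrow> ('k, 'g, 'i) tkg set"
  where "smash_ideal K G V I x actN = (let T = tkg_algebra K G I; n = tkg_n K G I; e = tkg_g K G I in
    Idl\<^bsub>T\<^esub> {e g \<otimes>\<^bsub>T\<^esub> n i \<ominus>\<^bsub>T\<^esub>
        tkg_embed K G V I x (actN (point K g) (x i, \<zero>\<^bsub>monoid_algebra K G\<^esub>)) \<otimes>\<^bsub>T\<^esub> e g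
      | g i. g \<in> carrier G \<and> i \<in> I})"

text \<open>
  \<open>T(V) #_N KG\<close>, as an algebra and, in case \<open>J_N\<close> is a Hopf ideal, as a Hopf algebra. Its
  generators are \<open>smash_gen\<close> of \<open>Inl i\<close> (the image of \<open>n_i\<close>) and of \<open>Inr g\<close> (the image of \<open>g\<close>).
\<close>

definition smash_algebra ::
  "('k, 'r) ring_scheme \<Rightarrow> ('g, 'm) monoid_scheme \<Rightarrow> ('k, 'v, 'n) module_scheme \<Rightarrow> 'i set
    \<Rightarrow> ('i \<Rightarrow> 'v) \<Rightarrow> (('g \<Rightarrow> 'k) \<Rightarrow> 'v \<times> ('g \<Rightarrow> 'k) \<Rightarrow> 'v \<times> ('g \<Rightarrow> 'k))
    \<Rightarrow> ('k, ('k, 'g, 'i) tkg set) module"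
  where "smash_algebra K G V I x actN =
    algebra_quot (tkg_algebra K G I) (smash_ideal K G V I x actN)"

definition smash_hopf ::
  "('k, 'r) ring_scheme \<Rightarrow> ('g, 'm) monoid_scheme \<Rightarrow> ('k, 'v, 'n) module_scheme \<Rightarrow> 'i set
    \<Rightarrow> ('i \<Rightarrow> 'v) \<Rightarrow> ('i \<Rightarrow> 'g) \<Rightarrow> (('g \<Rightarrow> 'k) \<Rightarrow> 'v \<times> ('g \<Rightarrow> 'k) \<Rightarrow> 'v \<times> ('g \<Rightarrow> 'k))
    \<Rightarrow> ('k, ('k, 'g, 'i) tkg set) bialg"
  where "smash_hopf K G V I x gd actN =
    bialg_quot K (tkg K G I gd) (smash_ideal K G V I x actN)"

definition smash_gen ::
  "('k, 'r) ring_scheme \<Rightarrow> ('g, 'm) monoid_scheme \<Rightarrow> ('k, 'v, 'n) module_scheme \<Rightarrow> 'i set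
    \<Rightarrow> ('i \<Rightarrow> 'v) \<Rightarrow> (('g \<Rightarrow> 'k) \<Rightarrow> 'v \<times> ('g \<Rightarrow> 'k) \<Rightarrow> 'v \<times> ('g \<Rightarrow> 'k)) \<Rightarrow> 'i + 'g
    \<Rightarrow> ('k, 'g, 'i) tkg set"
  where "smash_gen K G V I x actN s =
    smash_ideal K G V I x actN +>\<^bsub>tkg_algebra K G I\<^esub> tkg_gen K G I s"

end

theory Submission
  imports Defs
begin

text \<open>
  For scalars \<open>l\<close> and \<open>m\<close> let \<open>X(l, m)\<close> be the quotient of \<open>T_KG\<close> by the relations
  \<open>g n_i = (g \<cdot>_V x_i + b(g, x_i) (l 1 - m g g_i g\<inverse>)) g\<close>. If \<open>b\<close> is a cocycle as in (b), then the algebra maps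
  \<open>X(l, m) \<rightarrow> X(l, c) \<otimes> X(c, m)\<close> with \<open>g \<mapsto> g \<otimes> g\<close> and \<open>n_i \<mapsto> n_i \<otimes> 1 + g_i \<otimes> n_i\<close> exist because the
  terms containing \<open>c\<close> cancel. With counits on \<open>X(l, l)\<close> and antipodes \<open>X(l, m) \<rightarrow> X(m, l)\<close> they form a
  cogroupoid in the sense of Bichon, whose diagonal objects \<open>X(1, 1)\<close> and \<open>X(0, 0)\<close> are \<open>T(V) #_M KG\<close> and
  \<open>T(V) # KG\<close>, and \<open>X(1, 0)\<close> is \<open>T(V) #_M' KG\<close>. In a cogroupoid, \<open>X(l, m)\<close> is a bigalois extension as soon
  as it has a functional taking the value 1 at 1, and a convolution invertible such functional exhibits
  \<open>X(l, l)\<close> as a cocycle deformation of \<open>X(m, m)\<close>.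

  The cocycle identity also lets \<open>X(l, m)\<close> act on the space of formal words \<open>n_i n_j ... g\<close>, so that these
  words form a basis of \<open>X(l, m)\<close>. The comultiplication is triangular with respect to the length of words. This
  yields the convolution invertible functionals, by solving a triangular system, and the pointedness of \<open>X(l, l)\<close>.

  Conversely, the associativity of the action on \<open>M\<close> amounts to a cocycle identity in \<open>KG\<close>, whose coefficient at
  1 is the identity in (b). If moreover \<open>J_M\<close> is a Hopf ideal, then \<open>\<Delta>\<close> respects the relation for \<open>g n_i\<close>, and
  comparing the coefficients of group elements in this equation shows that the action is of the form (a).
\<close>

text \<open>The cancellation of the terms with c rests on the Yetter-Drinfeld condition: every x_j
  occurring in g \<cdot>_V x_i has the same degree s = g g_i g\<inverse>, and s g = g g_i. With
  \<beta> = b(g, x_i), the rule of X(l, c) contributes - c \<beta> g g_i \<otimes> g and the rule of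
  X(c, m) contributes c \<beta> g g_i \<otimes> g. Coactions, inverses of the Galois maps and the
  2-cocycle all come from one comultiplication and one antipode. If \<phi> on X(1, 0) and \<psi> on
  X(0, 1) are convolution inverse, then h \<mapsto> \<phi>(h_(1)) h_(2) \<psi>(h_(3)) is a coalgebra
  isomorphism from X(1, 1) to X(0, 0), and the product transported along it is the twist by the
  cocycle \<psi>(x_(1)) \<psi>(y_(1)) \<phi>(x_(2) y_(2)).

  In the converse the shape of the action is what has to be found, so the words must be known to be
  a basis before the action has the form (a). For this reason the basis theorem is proved for an
  arbitrary KG-valued cocycle, and X(l, m) is a special case.\<close>

abbreviation (input) mult_in ("(_ \<otimes>[_]/ _)" [70, 0, 71] 70) where "x \<otimes>[A] y \<equiv> x \<otimes>\<^bsub>A\<^esub> y"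
abbreviation (input) add_in ("(_ \<oplus>[_]/ _)" [65, 0, 66] 65) where "x \<oplus>[A] y \<equiv> x \<oplus>\<^bsub>A\<^esub> y"
abbreviation (input) minus_in ("(_ \<ominus>[_]/ _)" [65, 0, 66] 65) where "x \<ominus>[A] y \<equiv> x \<ominus>\<^bsub>A\<^esub> y"
abbreviation (input) uminus_in ("(\<ominus>[_]/ _)" [0, 81] 80) where "\<ominus>[A] x \<equiv> \<ominus>\<^bsub>A\<^esub> x"
abbreviation (input) smult_in ("(_ \<odot>[_]/ _)" [70, 0, 71] 70) where "c \<odot>[A] x \<equiv> c \<odot>\<^bsub>A\<^esub> x"
abbreviation (input) one_in ("\<one>[_]") where "\<one>[A] \<equiv> \<one>\<^bsub>A\<^esub>"
abbreviation (input) zero_in ("\<zero>[_]") where "\<zero>[A] \<equiv> \<zero>\<^bsub>A\<^esub>"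

section \<open>Vector spaces, algebras and tensor products as records over \<open>K\<close>\<close>

locale scalars = cring K for K :: "('k, 'r) ring_scheme" (structure)
begin

abbreviation lin where "lin \<equiv> linear_maps K"
abbreviation bil where "bil \<equiv> bilinear_maps K"
abbreviation vs where "vs \<equiv> module K"

subsection \<open>Linear and bilinear maps\<close>

lemma vs_closed [simp]:
  assumes "vs V"
  shows "[|u \<in> carrier V; v \<in> carrier V|] ==> u \<oplus>[V] v \<in> carrier V" "\<zero>[V] \<in> carrier V"
    "[|c \<in> carrier K; v \<in> carrier V|] ==> c \<odot>[V] v \<in> carrier V"
    "v \<in> carrier V ==> \<ominus>[V] v \<in> carrier V"
    "[|u \<in> carrier V; v \<in> carrier V|] ==> u \<ominus>[V] v \<in> carrier V"
proof -
  interpret V: module K V by fact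
  show "[|u \<in> carrier V; v \<in> carrier V|] ==> u \<oplus>[V] v \<in> carrier V" "\<zero>[V] \<in> carrier V"
    "[|c \<in> carrier K; v \<in> carrier V|] ==> c \<odot>[V] v \<in> carrier V"
    "v \<in> carrier V ==> \<ominus>[V] v \<in> carrier V"
    "[|u \<in> carrier V; v \<in> carrier V|] ==> u \<ominus>[V] v \<in> carrier V" by auto
qed

lemma vs_simps:
  assumes "vs V"
  shows "v \<in> carrier V ==> \<zero>[V] \<oplus>[V] v = v" "v \<in> carrier V ==> v \<oplus>[V] \<zero>[V] = v"
    "v \<in> carrier V ==> \<zero> \<odot>[V] v = \<zero>[V]" "v \<in> carrier V ==> \<one> \<odot>[V] v = v"
    "c \<in> carrier K ==> c \<odot>[V] \<zero>[V] = \<zero>[V]"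
    "v \<in> carrier V ==> \<ominus>[V] v \<oplus>[V] v = \<zero>[V]" "v \<in> carrier V ==> v \<oplus>[V] \<ominus>[V] v = \<zero>[V]"
    "v \<in> carrier V ==> v \<ominus>[V] v = \<zero>[V]" "v \<in> carrier V ==> \<ominus>[V] (\<ominus>[V] v) = v" "\<ominus>[V] \<zero>[V] = \<zero>[V]"
proof -
  interpret V: module K V by fact
  show "v \<in> carrier V ==> \<zero>[V] \<oplus>[V] v = v" "v \<in> carrier V ==> v \<oplus>[V] \<zero>[V] = v"
    "v \<in> carrier V ==> \<zero> \<odot>[V] v = \<zero>[V]" "v \<in> carrier V ==> \<one> \<odot>[V] v = v"
    "c \<in> carrier K ==> c \<odot>[V] \<zero>[V] = \<zero>[V]"
    "v \<in> carrier V ==> \<ominus>[V] v \<oplus>[V] v = \<zero>[V]" "v \<in> carrier V ==> v \<oplus>[V] \<ominus>[V] v = \<zero>[V]"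
    "v \<in> carrier V ==> v \<ominus>[V] v = \<zero>[V]" "v \<in> carrier V ==> \<ominus>[V] (\<ominus>[V] v) = v" "\<ominus>[V] \<zero>[V] = \<zero>[V]"
    by (auto simp: V.M.l_neg V.M.r_neg a_minus_def)
qed

lemma vs_distr:
  assumes "vs V"
  shows "[|a \<in> carrier K; b \<in> carrier K; v \<in> carrier V|] ==> (a \<oplus> b) \<odot>[V] v = a \<odot>[V] v \<oplus>[V] b \<odot>[V] v"
    "[|a \<in> carrier K; u \<in> carrier V; v \<in> carrier V|] ==> a \<odot>[V] (u \<oplus>[V] v) = a \<odot>[V] u \<oplus>[V] a \<odot>[V] v"
    "[|a \<in> carrier K; b \<in> carrier K; v \<in> carrier V|] ==> (a \<otimes> b) \<odot>[V] v = a \<odot>[V] (b \<odot>[V] v)"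
  using module.smult_l_distr[OF assms] module.smult_r_distr[OF assms] module.smult_assoc1[OF assms]
  by auto

lemma vs_minus:
  assumes "vs V"
  shows "[|a \<in> carrier K; v \<in> carrier V|] ==> (\<ominus> a) \<odot>[V] v = \<ominus>[V] (a \<odot>[V] v)"
    "[|a \<in> carrier K; v \<in> carrier V|] ==> a \<odot>[V] (\<ominus>[V] v) = \<ominus>[V] (a \<odot>[V] v)"
    "v \<in> carrier V ==> (\<ominus> \<one>) \<odot>[V] v = \<ominus>[V] v"
    "[|u \<in> carrier V; v \<in> carrier V|] ==> \<ominus>[V] (u \<oplus>[V] v) = \<ominus>[V] u \<oplus>[V] \<ominus>[V] v"
    "u \<ominus>[V] v = u \<oplus>[V] \<ominus>[V] v"
proof -
  interpret V: module K V by fact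
  show "[|a \<in> carrier K; v \<in> carrier V|] ==> (\<ominus> a) \<odot>[V] v = \<ominus>[V] (a \<odot>[V] v)"
    "[|a \<in> carrier K; v \<in> carrier V|] ==> a \<odot>[V] (\<ominus>[V] v) = \<ominus>[V] (a \<odot>[V] v)"
    "v \<in> carrier V ==> (\<ominus> \<one>) \<odot>[V] v = \<ominus>[V] v"
    "[|u \<in> carrier V; v \<in> carrier V|] ==> \<ominus>[V] (u \<oplus>[V] v) = \<ominus>[V] u \<oplus>[V] \<ominus>[V] v"
    "u \<ominus>[V] v = u \<oplus>[V] \<ominus>[V] v"
    by (auto simp: V.smult_l_minus V.smult_r_minus a_minus_def V.M.minus_add)
qed

lemma vs_ac:
  assumes "vs V"
  shows "[|u \<in> carrier V; v \<in> carrier V; w \<in> carrier V|] ==> u \<oplus>[V] v \<oplus>[V] w = u \<oplus>[V] (v \<oplus>[V] w)"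
    "[|u \<in> carrier V; v \<in> carrier V|] ==> u \<oplus>[V] v = v \<oplus>[V] u"
    "[|u \<in> carrier V; v \<in> carrier V; w \<in> carrier V|] ==> u \<oplus>[V] (v \<oplus>[V] w) = v \<oplus>[V] (u \<oplus>[V] w)"
proof -
  interpret V: module K V by fact
  show "[|u \<in> carrier V; v \<in> carrier V; w \<in> carrier V|] ==> u \<oplus>[V] v \<oplus>[V] w = u \<oplus>[V] (v \<oplus>[V] w)"
    "[|u \<in> carrier V; v \<in> carrier V|] ==> u \<oplus>[V] v = v \<oplus>[V] u"
    "[|u \<in> carrier V; v \<in> carrier V; w \<in> carrier V|] ==> u \<oplus>[V] (v \<oplus>[V] w) = v \<oplus>[V] (u \<oplus>[V] w)"
    by (auto simp: V.M.a_ac)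
qed

lemma vs_diff_zero:
  assumes "vs V" "u \<in> carrier V" "v \<in> carrier V"
  shows "u \<ominus>[V] v = \<zero>[V] \<longleftrightarrow> u = v"
proof -
  interpret V: module K V by fact
  show ?thesis using assms by (metis V.M.minus_equality V.M.minus_minus V.M.r_neg a_minus_def vs_closed(4) vs_minus(5))
qed

lemma vs_cancel:
  assumes "vs V" "u \<in> carrier V" "v \<in> carrier V" "w \<in> carrier V" "u \<oplus>[V] w = v \<oplus>[V] w"
  shows "u = v"
proof -
  interpret V: module K V by fact
  show ?thesis using assms by simp
qed

text \<open>Additive inverses need not be supplied: (-1) v is an inverse of v, because 0 v = 0 and
  scalars distribute. Verifying that a function space or a quotient is a module becomes purely
  equational.\<close>

lemma moduleI':
  assumes "\<And>u v. [|u \<in> carrier V; v \<in> carrier V|] ==> u \<oplus>[V] v \<in> carrier V"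
    and "\<zero>[V] \<in> carrier V"
    and "\<And>c v. [|c \<in> carrier K; v \<in> carrier V|] ==> c \<odot>[V] v \<in> carrier V"
    and "\<And>u v w. [|u \<in> carrier V; v \<in> carrier V; w \<in> carrier V|] ==> u \<oplus>[V] v \<oplus>[V] w = u \<oplus>[V] (v \<oplus>[V] w)"
    and "\<And>u v. [|u \<in> carrier V; v \<in> carrier V|] ==> u \<oplus>[V] v = v \<oplus>[V] u"
    and "\<And>v. v \<in> carrier V ==> \<zero>[V] \<oplus>[V] v = v"
    and "\<And>v. v \<in> carrier V ==> \<zero> \<odot>[V] v = \<zero>[V]"
    and "\<And>a b v. [|a \<in> carrier K; b \<in> carrier K; v \<in> carrier V|] ==> (a \<oplus> b) \<odot>[V] v = a \<odot>[V] v \<oplus>[V] b \<odot>[V] v"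
    and "\<And>a u v. [|a \<in> carrier K; u \<in> carrier V; v \<in> carrier V|] ==> a \<odot>[V] (u \<oplus>[V] v) = a \<odot>[V] u \<oplus>[V] a \<odot>[V] v"
    and "\<And>a b v. [|a \<in> carrier K; b \<in> carrier K; v \<in> carrier V|] ==> (a \<otimes> b) \<odot>[V] v = a \<odot>[V] (b \<odot>[V] v)"
    and "\<And>v. v \<in> carrier V ==> \<one> \<odot>[V] v = v"
  shows "vs V"
proof (rule moduleI)
  show "abelian_group V"
  proof (rule abelian_groupI)
    fix v assume v: "v \<in> carrier V"
    have "(\<ominus> \<one>) \<odot>[V] v \<oplus>[V] v = (\<ominus> \<one> \<oplus> \<one>) \<odot>[V] v" using v by (simp add: assms)
    then show "\<exists>y\<in>carrier V. y \<oplus>[V] v = \<zero>[V]" using v assms by (metis l_neg a_inv_closed one_closed)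
  qed (use assms in auto)
qed (use assms is_cring in auto)

lemma linI:
  assumes "\<And>v. v \<in> carrier V ==> f v \<in> carrier W"
    and "\<And>u v. [|u \<in> carrier V; v \<in> carrier V|] ==> f (u \<oplus>[V] v) = f u \<oplus>[W] f v"
    and "\<And>c v. [|c \<in> carrier K; v \<in> carrier V|] ==> f (c \<odot>[V] v) = c \<odot>[W] f v"
  shows "f \<in> lin V W"
  using assms by (auto simp: linear_maps_def)

lemma lin_closed: "[|f \<in> lin V W; v \<in> carrier V|] ==> f v \<in> carrier W"
  and lin_add: "[|f \<in> lin V W; u \<in> carrier V; v \<in> carrier V|] ==> f (u \<oplus>[V] v) = f u \<oplus>[W] f v"
  and lin_smult: "[|f \<in> lin V W; c \<in> carrier K; v \<in> carrier V|] ==> f (c \<odot>[V] v) = c \<odot>[W] f v"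
  by (auto simp: linear_maps_def)

lemma lin_cong: "(\<And>v. v \<in> carrier V ==> f v = g v) ==> vs V ==> f \<in> lin V W \<longleftrightarrow> g \<in> lin V W"
  by (auto simp: linear_maps_def Pi_iff)

lemma lin_zero:
  assumes "f \<in> lin V W" "vs V" "vs W" shows "f \<zero>[V] = \<zero>[W]"
  using lin_smult[OF assms(1) zero_closed, of "\<zero>[V]"] assms lin_closed[OF assms(1), of "\<zero>[V]"] by (simp add: vs_simps)

lemma lin_minus:
  assumes "f \<in> lin V W" "vs V" "vs W" "v \<in> carrier V" shows "f (\<ominus>[V] v) = \<ominus>[W] f v"
  using lin_smult[OF assms(1), of "\<ominus> \<one>" v] assms lin_closed[OF assms(1), of v] by (simp add: vs_minus vs_simps)

lemma lin_diff:
  assumes "f \<in> lin V W" "vs V" "vs W" "u \<in> carrier V" "v \<in> carrier V" shows "f (u \<ominus>[V] v) = f u \<ominus>[W] f v"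
  using assms by (simp add: vs_minus(5) lin_add lin_minus)

lemma lin_id: "(%x. x) \<in> lin V V"
  by (auto intro: linI)

lemma lin_comp: "[|g \<in> lin V W; f \<in> lin U V|] ==> (%x. g (f x)) \<in> lin U W"
  by (auto intro!: linI simp: lin_closed lin_add lin_smult)

lemma lin_null: "vs W ==> (%x. \<zero>[W]) \<in> lin V W"
  by (auto intro!: linI simp: vs_simps)

lemma lin_plus: "[|vs W; f \<in> lin V W; g \<in> lin V W|] ==> (%x. f x \<oplus>[W] g x) \<in> lin V W"
  by (rule linI) (auto simp: lin_closed lin_add lin_smult vs_ac vs_distr)

lemma lin_scale: "[|vs W; c \<in> carrier K; f \<in> lin V W|] ==> (%x. c \<odot>[W] f x) \<in> lin V W"
proof (rule linI)
  assume W: "vs W" and c: "c \<in> carrier K" and f: "f \<in> lin V W"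
  show "c \<odot>[W] f (a \<odot>[V] v) = a \<odot>[W] (c \<odot>[W] f v)" if "a \<in> carrier K" "v \<in> carrier V" for a v
    using lin_smult[OF f that] lin_closed[OF f that(2)] W c that by (simp add: vs_distr(3)[symmetric] m_comm)
qed (auto simp: lin_closed lin_add vs_distr)

lemma lin_uminus: "[|vs W; f \<in> lin V W|] ==> (%x. \<ominus>[W] f x) \<in> lin V W"
  by (rule linI) (auto simp: lin_closed lin_add lin_smult vs_minus)

lemma bilI:
  assumes "\<And>u. u \<in> carrier U ==> (%v. f u v) \<in> lin V W" "\<And>v. v \<in> carrier V ==> (%u. f u v) \<in> lin U W"
  shows "f \<in> bil U V W"
  using assms by (simp add: bilinear_maps_def)

lemma bil1: "[|f \<in> bil U V W; u \<in> carrier U|] ==> f u \<in> lin V W"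
  and bil2: "[|f \<in> bil U V W; v \<in> carrier V|] ==> (%u. f u v) \<in> lin U W"
  by (simp_all add: bilinear_maps_def)

lemma bil_closed: "[|f \<in> bil U V W; u \<in> carrier U; v \<in> carrier V|] ==> f u v \<in> carrier W"
  by (rule lin_closed[OF bil1])

lemma base_simps [simp]:
  "carrier (base_algebra K) = carrier K" "mult (base_algebra K) = mult K" "one (base_algebra K) = one K"
  "zero (base_algebra K) = zero K" "add (base_algebra K) = add K" "smult (base_algebra K) = mult K"
  by (simp_all add: base_algebra_def)

lemma vs_base [simp]: "vs (base_algebra K)"
  by (rule moduleI') (auto simp: a_ac l_distr r_distr m_assoc)

lemma base_a_inv [simp]: "c \<in> carrier K ==> \<ominus>[base_algebra K] c = \<ominus> c"
  using vs_minus(3)[OF vs_base, of c] by (simp add: l_minus)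

subsection \<open>Finitely supported functions\<close>

lemma ff_zero [simp]: "(%_. \<zero>) \<in> fin_funs K S"
  by (auto simp: fin_funs_def)

lemma ff_point [simp]: "s \<in> S ==> point K s \<in> fin_funs K S"
  by (auto simp: fin_funs_def point_def)

lemma ff_val [simp]: "f \<in> fin_funs K S ==> f s \<in> carrier K"
  by (auto simp: fin_funs_def)

lemma ff_fin: "f \<in> fin_funs K S ==> finite {s. f s \<noteq> \<zero>}"
  by (auto simp: fin_funs_def)

lemma ff_supp: "f \<in> fin_funs K S ==> f s \<noteq> \<zero> ==> s \<in> S"
  by (auto simp: fin_funs_def)

lemma ffI: "(\<And>s. f s \<in> carrier K) ==> finite {s. f s \<noteq> \<zero>} ==> (\<And>s. f s \<noteq> \<zero> ==> s \<in> S) ==> f \<in> fin_funs K S"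
  by (auto simp: fin_funs_def)

lemma ff_add [simp]: "[|f \<in> fin_funs K S; g \<in> fin_funs K S|] ==> (%s. f s \<oplus> g s) \<in> fin_funs K S"
proof (rule ffI)
  assume f: "f \<in> fin_funs K S" and g: "g \<in> fin_funs K S"
  have *: "f s \<noteq> \<zero> \<or> g s \<noteq> \<zero>" if "f s \<oplus> g s \<noteq> \<zero>" for s using that by auto
  show "finite {s. f s \<oplus> g s \<noteq> \<zero>}"
    by (rule finite_subset[of _ "{s. f s \<noteq> \<zero>} \<union> {s. g s \<noteq> \<zero>}"]) (use * ff_fin[OF f] ff_fin[OF g] in auto)
  show "s \<in> S" if "f s \<oplus> g s \<noteq> \<zero>" for s using *[OF that] ff_supp[OF f] ff_supp[OF g] by blast
qed simp

lemma ff_smult [simp]: "[|c \<in> carrier K; f \<in> fin_funs K S|] ==> (%s. c \<otimes> f s) \<in> fin_funs K S"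
proof (rule ffI)
  assume c: "c \<in> carrier K" and f: "f \<in> fin_funs K S"
  have *: "f s \<noteq> \<zero>" if "c \<otimes> f s \<noteq> \<zero>" for s using that c by auto
  show "finite {s. c \<otimes> f s \<noteq> \<zero>}"
    by (rule finite_subset[of _ "{s. f s \<noteq> \<zero>}"]) (use * ff_fin[OF f] in auto)
  show "s \<in> S" if "c \<otimes> f s \<noteq> \<zero>" for s using *[OF that] ff_supp[OF f] by blast
qed simp

lemma ff_minus [simp]: "f \<in> fin_funs K S ==> (%s. \<ominus> f s) \<in> fin_funs K S"
proof (rule ffI)
  assume f: "f \<in> fin_funs K S"
  have *: "f s \<noteq> \<zero>" if "\<ominus> f s \<noteq> \<zero>" for s using that  by auto
  show "finite {s. \<ominus> f s \<noteq> \<zero>}"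
    by (rule finite_subset[of _ "{s. f s \<noteq> \<zero>}"]) (use * ff_fin[OF f] in auto)
  show "s \<in> S" if "\<ominus> f s \<noteq> \<zero>" for s using *[OF that] ff_supp[OF f] by blast
qed simp

lemma point_val [simp]: "point K s t \<in> carrier K"
  by (simp add: point_def)

lemma ff_mono: "f \<in> fin_funs K S ==> S \<subseteq> T ==> f \<in> fin_funs K T"
  by (auto simp: fin_funs_def)

text \<open>Induction on the size of the support: one value is split off as a multiple of
  \<open>point K a\<close>, and the remaining function vanishes at a. Linear statements about free
  vector spaces are reduced to basis points in this way.\<close>

lemma ff_induct [consumes 1, case_names zero point add smult]:
  assumes f: "f \<in> fin_funs K S"
    and "P (%_. \<zero>)" and pt: "\<And>s. s \<in> S ==> P (point K s)"
    and add: "\<And>f g. [|f \<in> fin_funs K S; g \<in> fin_funs K S; P f; P g|] ==> P (%s. f s \<oplus> g s)"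
    and sm: "\<And>c f. [|c \<in> carrier K; f \<in> fin_funs K S; P f|] ==> P (%s. c \<otimes> f s)"
  shows "P f"
proof -
  have "f \<in> fin_funs K S ==> {s. f s \<noteq> \<zero>} = A ==> P f" if "finite A" for A f
    using that
  proof (induction A arbitrary: f)
    case empty
    then have "f = (%_. \<zero>)" by auto
    then show ?case using assms by simp
  next
    case (insert a A)
    let ?g = "%s. if s = a then \<zero> else f s"
    have g: "?g \<in> fin_funs K S"
    proof (rule ffI)
      show "finite {s. ?g s \<noteq> \<zero>}"
        by (rule finite_subset[OF _ ff_fin[OF insert.prems(1)]]) auto
    qed (use insert.prems in \<open>auto dest: ff_supp split: if_splits\<close>)
    have sg: "{s. ?g s \<noteq> \<zero>} = A" using insert.prems insert.hyps by auto
    have a: "a \<in> S" using insert.prems by (auto dest: ff_supp)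
    have "f = (%s. f a \<otimes> point K a s \<oplus> ?g s)" using insert.prems(1) by (auto simp: point_def)
    moreover have "P (%s. f a \<otimes> point K a s \<oplus> ?g s)"
      by (rule add[OF _ g sm[OF _ _ pt[OF a]] insert.IH[OF g sg]]) (use insert.prems a in auto)
    ultimately show ?case by simp
  qed
  from this[OF ff_fin[OF f] f refl] show ?thesis .
qed

text \<open>\<open>lincomb\<close> sums over the support, which changes when coefficients are added
  or scaled. Summing over any finite set that contains the support makes two such sums comparable
  term by term.\<close>

lemma lincomb_eq:
  assumes W: "vs W" and f: "f \<in> fin_funs K S" and A: "finite A" "{s. f s \<noteq> \<zero>} \<subseteq> A" "A \<subseteq> S"
    and \<beta>: "\<And>s. s \<in> S ==> \<beta> s \<in> carrier W"
  shows "lincomb K W \<beta> f = (\<Oplus>\<^bsub>W\<^esub>s\<in>A. f s \<odot>[W] \<beta> s)"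
proof -
  interpret W: module K W by fact
  show ?thesis unfolding lincomb_def
    by (rule W.M.add.finprod_mono_neutral_cong_left)
      (use f A \<beta> in \<open>auto simp: subset_iff vs_simps[OF W]\<close>)
qed

lemma lincomb_closed:
  assumes W: "vs W" and f: "f \<in> fin_funs K S" and \<beta>: "\<And>s. s \<in> S ==> \<beta> s \<in> carrier W"
  shows "lincomb K W \<beta> f \<in> carrier W"
proof -
  interpret W: module K W by fact
  show ?thesis unfolding lincomb_def
    by (rule W.M.finsum_closed) (use f \<beta> ff_supp[OF f] in auto)
qed

lemma lincomb_zero: "vs W ==> lincomb K W \<beta> (%_. \<zero>) = \<zero>[W]"
proof -
  assume "vs W" then interpret W: module K W .
  show ?thesis unfolding lincomb_def by simp
qed

lemma lincomb_point:
  assumes W: "vs W" and \<beta>: "\<beta> s \<in> carrier W"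
  shows "lincomb K W \<beta> (point K s) = \<beta> s"
proof -
  interpret W: module K W by fact
  have "lincomb K W \<beta> (point K s) = (\<Oplus>\<^bsub>W\<^esub>t\<in>{s}. point K s t \<odot>[W] \<beta> t)"
    by (rule lincomb_eq[of _ _ "{s}"]) (use assms ff_point[of s "{s}"] in \<open>auto simp: point_def split: if_splits\<close>)
  then show ?thesis using \<beta> by (simp add: point_def)
qed

lemma lincomb_add:
  assumes W: "vs W" and f: "f \<in> fin_funs K S" and g: "g \<in> fin_funs K S" and \<beta>: "\<And>s. s \<in> S ==> \<beta> s \<in> carrier W"
  shows "lincomb K W \<beta> (%s. f s \<oplus> g s) = lincomb K W \<beta> f \<oplus>[W] lincomb K W \<beta> g"
proof -
  interpret W: module K W by fact
  let ?A = "{s. f s \<noteq> \<zero>} \<union> {s. g s \<noteq> \<zero>}"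
  have A: "finite ?A" "?A \<subseteq> S" using f g by (auto dest: ff_fin ff_supp)
  have "lincomb K W \<beta> (%s. f s \<oplus> g s) = (\<Oplus>\<^bsub>W\<^esub>s\<in>?A. (f s \<oplus> g s) \<odot>[W] \<beta> s)"
    by (rule lincomb_eq[of _ _ S]) (use assms A in auto)
  also have "... = (\<Oplus>\<^bsub>W\<^esub>s\<in>?A. f s \<odot>[W] \<beta> s \<oplus>[W] g s \<odot>[W] \<beta> s)"
    by (rule W.M.finsum_cong') (use assms A in \<open>auto simp: W.smult_l_distr subset_iff\<close>)
  also have "... = (\<Oplus>\<^bsub>W\<^esub>s\<in>?A. f s \<odot>[W] \<beta> s) \<oplus>[W] (\<Oplus>\<^bsub>W\<^esub>s\<in>?A. g s \<odot>[W] \<beta> s)"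
    by (rule W.M.finsum_addf) (use assms A in \<open>auto dest: ff_supp\<close>)
  also have "(\<Oplus>\<^bsub>W\<^esub>s\<in>?A. f s \<odot>[W] \<beta> s) = lincomb K W \<beta> f"
    by (rule lincomb_eq[of _ _ S, symmetric]) (use assms A in auto)
  also have "(\<Oplus>\<^bsub>W\<^esub>s\<in>?A. g s \<odot>[W] \<beta> s) = lincomb K W \<beta> g"
    by (rule lincomb_eq[of _ _ S, symmetric]) (use assms A in auto)
  finally show ?thesis .
qed

lemma lincomb_smult:
  assumes W: "vs W" and f: "f \<in> fin_funs K S" and c: "c \<in> carrier K" and \<beta>: "\<And>s. s \<in> S ==> \<beta> s \<in> carrier W"
  shows "lincomb K W \<beta> (%s. c \<otimes> f s) = c \<odot>[W] lincomb K W \<beta> f"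
proof -
  interpret W: module K W by fact
  let ?A = "{s. f s \<noteq> \<zero>}"
  have A: "finite ?A" "?A \<subseteq> S" using f by (auto dest: ff_fin ff_supp)
  have "lincomb K W \<beta> (%s. c \<otimes> f s) = (\<Oplus>\<^bsub>W\<^esub>s\<in>?A. (c \<otimes> f s) \<odot>[W] \<beta> s)"
    by (rule lincomb_eq[of _ _ S]) (use assms A in auto)
  also have "... = (\<Oplus>\<^bsub>W\<^esub>s\<in>?A. c \<odot>[W] (f s \<odot>[W] \<beta> s))"
    by (rule W.M.finsum_cong') (use assms A in \<open>auto simp: W.smult_assoc1 subset_iff\<close>)
  also have "... = c \<odot>[W] (\<Oplus>\<^bsub>W\<^esub>s\<in>?A. f s \<odot>[W] \<beta> s)"
    by (rule W.finsum_smult_ldistr[symmetric]) (use assms A in \<open>auto dest: ff_supp\<close>)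
  finally show ?thesis by (simp add: lincomb_def)
qed

lemma lincomb_cong:
  assumes "vs W" "f \<in> fin_funs K S" "\<And>s. s \<in> S ==> \<beta> s = \<gamma> s" "\<And>s. s \<in> S ==> \<beta> s \<in> carrier W"
  shows "lincomb K W \<beta> f = lincomb K W \<gamma> f"
proof -
  interpret W: module K W by fact
  show ?thesis unfolding lincomb_def by (rule W.M.finsum_cong') (use assms in \<open>auto dest: ff_supp intro!: W.smult_closed\<close>)
qed

lemma ma_simps [simp]:
  "carrier (monoid_algebra K M) = fin_funs K (carrier M)" "zero (monoid_algebra K M) = (%_. \<zero>)"
  "add (monoid_algebra K M) = (%f g m. f m \<oplus> g m)" "smult (monoid_algebra K M) = (%c f m. c \<otimes> f m)"
  "one (monoid_algebra K M) = point K \<one>[M]"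
  by (simp_all add: monoid_algebra_def)

lemma vs_ma [simp]: "vs (monoid_algebra K M)"
  by (rule moduleI') (auto simp: a_ac l_distr r_distr m_assoc)

lemma ma_a_inv: "f \<in> fin_funs K (carrier M) ==> \<ominus>[monoid_algebra K M] f = (%m. \<ominus> f m)"
  using vs_minus(3)[OF vs_ma, of f M] by (auto simp: l_minus)

lemma lincomb_lin:
  assumes "vs W" "\<And>s. s \<in> carrier M ==> \<beta> s \<in> carrier W"
  shows "lincomb K W \<beta> \<in> lin (monoid_algebra K M) W"
  using assms by (auto intro!: linI lincomb_closed lincomb_add lincomb_smult)

lemma lin_ext:
  assumes "F \<in> lin (monoid_algebra K M) W" "F' \<in> lin (monoid_algebra K M) W" "vs W"
    and "\<And>s. s \<in> carrier M ==> F (point K s) = F' (point K s)" "f \<in> fin_funs K (carrier M)"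
  shows "F f = F' f"
  using assms(5)
proof (induction rule: ff_induct)
  case zero then show ?case using lin_zero[OF assms(1)] lin_zero[OF assms(2)] assms by simp
next
  case (add f g) then show ?case using lin_add[OF assms(1), of f g] lin_add[OF assms(2), of f g] by simp
next
  case (smult c f) then show ?case using lin_smult[OF assms(1), of c f] lin_smult[OF assms(2), of c f] by simp
qed (use assms in auto)

text \<open>Only the vector space structure of \<^term>\<open>fmod S\<close> is meaningful; the multiplication is a placeholder.\<close>

definition fmod :: "'s set => ('k, 's => 'k) module"
  where "fmod S = monoid_algebra K \<lparr>carrier = S, mult = (%x y. x), one = undefined\<rparr>"

lemma fmod_simps [simp]:
  "carrier (fmod S) = fin_funs K S" "zero (fmod S) = (%_. \<zero>)"
  "add (fmod S) = (%f g m. f m \<oplus> g m)" "smult (fmod S) = (%c f m. c \<otimes> f m)"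
  by (simp_all add: fmod_def)

lemma vs_fmod [simp]: "vs (fmod S)"
  by (simp add: fmod_def)

lemma lincomb_lin_fmod:
  assumes "vs W" "\<And>s. s \<in> S ==> \<beta> s \<in> carrier W"
  shows "lincomb K W \<beta> \<in> lin (fmod S) W"
  using assms unfolding fmod_def by (auto intro!: lincomb_lin)

lemma lin_ext_fmod:
  assumes "F \<in> lin (fmod S) W" "F' \<in> lin (fmod S) W" "vs W"
    and "\<And>s. s \<in> S ==> F (point K s) = F' (point K s)" "f \<in> fin_funs K S"
  shows "F f = F' f"
  by (rule lin_ext[OF assms(1,2)[unfolded fmod_def] assms(3)]) (simp_all add: assms(4,5))

lemma lin_lincomb:
  assumes "F \<in> lin W U" "vs W" "vs U" "f \<in> fin_funs K S" "\<And>s. s \<in> S ==> \<beta> s \<in> carrier W"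
  shows "F (lincomb K W \<beta> f) = lincomb K U (%s. F (\<beta> s)) f"
proof (rule lin_ext_fmod[where F="%f. F (lincomb K W \<beta> f)"])
  show "(%f. F (lincomb K W \<beta> f)) \<in> lin (fmod S) U"
    by (rule lin_comp[OF assms(1)]) (rule lincomb_lin_fmod[OF assms(2,5)])
  show "lincomb K U (%s. F (\<beta> s)) \<in> lin (fmod S) U"
    by (rule lincomb_lin_fmod) (use assms lin_closed[OF assms(1)] in auto)
qed (use assms lin_closed[OF assms(1)] in \<open>auto simp: lincomb_point\<close>)

text \<open>Here the coefficients are fixed and the vectors vary linearly with a parameter.
  Induction on the coefficients: a point picks one of the linear families, and linear maps are
  closed under sums and multiples.\<close>

lemma lincomb_fun_lin:
  assumes "vs W" "f \<in> fin_funs K S" "\<And>s. s \<in> S ==> (%x. \<beta> x s) \<in> lin V W" "vs V"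
  shows "(%x. lincomb K W (\<beta> x) f) \<in> lin V W"
proof -
  have cl: "\<And>x s. [|x \<in> carrier V; s \<in> S|] ==> \<beta> x s \<in> carrier W" using lin_closed[OF assms(3)] by blast
  show ?thesis using assms(2)
proof (induction rule: ff_induct)
  case zero then show ?case by (simp add: lincomb_zero assms lin_null)
next
  case (point s)
  have "(%x. lincomb K W (\<beta> x) (point K s)) \<in> lin V W \<longleftrightarrow> (%x. \<beta> x s) \<in> lin V W"
    by (rule lin_cong) (use assms point cl in \<open>auto simp: lincomb_point\<close>)
  then show ?case using point assms by simp
next
  case (add f g)
  have "(%x. lincomb K W (\<beta> x) (%s. f s \<oplus> g s)) \<in> lin V W \<longleftrightarrow>
      (%x. lincomb K W (\<beta> x) f \<oplus>[W] lincomb K W (\<beta> x) g) \<in> lin V W"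
    by (rule lin_cong) (use assms add in \<open>auto intro!: lincomb_add[of _ _ S] simp: cl\<close>)
  then show ?case using add assms by (simp add: lin_plus)
next
  case (smult c f)
  have "(%x. lincomb K W (\<beta> x) (%s. c \<otimes> f s)) \<in> lin V W \<longleftrightarrow>
      (%x. c \<odot>[W] lincomb K W (\<beta> x) f) \<in> lin V W"
    by (rule lin_cong) (use assms smult in \<open>auto intro!: lincomb_smult[of _ _ S] simp: cl\<close>)
  then show ?case using smult assms by (simp add: lin_scale)
qed
qed

abbreviation alg where "alg \<equiv> unital_algebra K"
abbreviation ahom where "ahom \<equiv> algebra_homs K"
abbreviation tensr (infixr "><" 72) where "V >< W \<equiv> tensor K V W"
abbreviation span where "span \<equiv> module_span K"

subsection \<open>Submodules and quotients\<close>

lemma submodI: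
  assumes "vs V" "U \<subseteq> carrier V" "\<zero>[V] \<in> U" "\<And>u v. [|u \<in> U; v \<in> U|] ==> u \<oplus>[V] v \<in> U"
    "\<And>c u. [|c \<in> carrier K; u \<in> U|] ==> c \<odot>[V] u \<in> U"
  shows "submodule U K V"
proof -
  interpret V: module K V by fact
  have "\<ominus>[V] u \<in> U" if "u \<in> U" for u
    using assms(5)[of "\<ominus> \<one>" u] that assms(2) vs_minus(3)[OF assms(1), of u] by auto
  then show ?thesis using assms by (intro V.submoduleI) auto
qed

lemma submodD:
  assumes "vs V" "submodule U K V"
  shows "U \<subseteq> carrier V" "\<zero>[V] \<in> U" "\<And>u v. [|u \<in> U; v \<in> U|] ==> u \<oplus>[V] v \<in> U"
    "\<And>c u. [|c \<in> carrier K; u \<in> U|] ==> c \<odot>[V] u \<in> U" "\<And>u. u \<in> U ==> \<ominus>[V] u \<in> U"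
    "\<And>u v. [|u \<in> U; v \<in> U|] ==> u \<ominus>[V] v \<in> U"
proof -
  interpret V: module K V by fact
  note * = V.submoduleE[OF assms(2)]
  show 1: "U \<subseteq> carrier V" "\<And>u v. [|u \<in> U; v \<in> U|] ==> u \<oplus>[V] v \<in> U"
    "\<And>c u. [|c \<in> carrier K; u \<in> U|] ==> c \<odot>[V] u \<in> U" "\<And>u. u \<in> U ==> \<ominus>[V] u \<in> U"
    using * by auto
  then show "\<And>u v. [|u \<in> U; v \<in> U|] ==> u \<ominus>[V] v \<in> U" by (simp add: a_minus_def)
  obtain u where "u \<in> U" using *(2) by auto
  then show "\<zero>[V] \<in> U" using 1(1) 1(3)[of \<zero> u] by auto
qed

lemma submod_preimage:
  assumes "vs V" "vs W" "f \<in> lin V W" "submodule U K W"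
  shows "submodule {v \<in> carrier V. f v \<in> U} K V"
  by (rule submodI) (use assms submodD[OF assms(2,4)] lin_zero[OF assms(3)] lin_add[OF assms(3)] lin_smult[OF assms(3)] in auto)

lemma submod_null: "vs V ==> submodule {\<zero>[V]} K V"
  by (rule submodI) (auto simp: vs_simps)

lemma submod_full: "vs V ==> submodule (carrier V) K V"
  by (rule submodI) auto

lemma span_submod:
  assumes "vs V" "S \<subseteq> carrier V"
  shows "submodule (span V S) K V"
proof (rule submodI[OF assms(1)])
  show "span V S \<subseteq> carrier V" using submod_full[OF assms(1)] assms(2) unfolding module_span_def by blast
qed (use submodD[OF assms(1)] in \<open>auto simp: module_span_def\<close>)

lemma span_incl: "S \<subseteq> span V S"
  by (auto simp: module_span_def)

lemma span_min: "submodule U K V ==> S \<subseteq> U ==> span V S \<subseteq> U"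
  by (auto simp: module_span_def)

context
  fixes V :: "('k, 'v, 'm) module_scheme" and J
  assumes V: "vs V" and J: "submodule J K V"
begin

lemma quot_asub: "abelian_subgroup J V"
proof -
  interpret V: module K V by (rule V)
  show ?thesis
    using J by (intro abelian_subgroupI3 additive_subgroup.intro) (auto simp: submodule_def V.M.abelian_group_axioms)
qed

lemma coset_iff:
  assumes "u \<in> carrier V"
  shows "w \<in> J +>\<^bsub>V\<^esub> u \<longleftrightarrow> w \<in> carrier V \<and> w \<ominus>[V] u \<in> J"
proof -
  interpret V: module K V by (rule V)
  note D = submodD[OF V J]
  have "w \<in> carrier V \<and> w \<ominus>[V] u \<in> J" if "w \<in> J +>\<^bsub>V\<^esub> u"
  proof -
    from that obtain h where h: "h \<in> J" "w = h \<oplus>[V] u" by (auto simp: a_r_coset_def r_coset_def)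
    then have "h \<in> carrier V" using D by auto
    then have "w \<ominus>[V] u = h" using h assms by (simp add: a_minus_def V.M.a_assoc V.M.r_neg)
    then show ?thesis using h D assms by auto
  qed
  moreover have "w \<in> J +>\<^bsub>V\<^esub> u" if "w \<in> carrier V" "w \<ominus>[V] u \<in> J"
  proof -
    have "w = (w \<ominus>[V] u) \<oplus>[V] u" using that assms by (simp add: a_minus_def V.M.a_assoc V.M.l_neg)
    then show ?thesis using that by (auto simp: a_r_coset_def r_coset_def)
  qed
  ultimately show ?thesis by blast
qed

lemma coset_eq:
  assumes u: "u \<in> carrier V" and v: "v \<in> carrier V"
  shows "J +>\<^bsub>V\<^esub> u = J +>\<^bsub>V\<^esub> v \<longleftrightarrow> u \<ominus>[V] v \<in> J"
proof
  assume "J +>\<^bsub>V\<^esub> u = J +>\<^bsub>V\<^esub> v"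
  moreover have "u \<in> J +>\<^bsub>V\<^esub> u" using coset_iff[OF u] submodD[OF V J] u by (simp add: vs_simps V)
  ultimately show "u \<ominus>[V] v \<in> J" using coset_iff[OF v] by auto
next
  interpret V: module K V by (rule V)
  note D = submodD[OF V J]
  assume uv: "u \<ominus>[V] v \<in> J"
  have 1: "w \<ominus>[V] v = (w \<ominus>[V] u) \<oplus>[V] (u \<ominus>[V] v)" if "w \<in> carrier V" for w
    using that u v by (simp add: a_minus_def V.M.a_assoc V.M.r_neg1)
  have 2: "w \<ominus>[V] u = (w \<ominus>[V] v) \<ominus>[V] (u \<ominus>[V] v)" if "w \<in> carrier V" for w
  proof -
    have "w \<ominus>[V] u \<in> carrier V" "u \<ominus>[V] v \<in> carrier V" using that u v by auto
    then show ?thesis unfolding 1[OF that] a_minus_def[of V "_ \<oplus>[V] _"] by (simp add: V.M.a_assoc V.M.r_neg)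
  qed
  have "w \<ominus>[V] v \<in> J \<longleftrightarrow> w \<ominus>[V] u \<in> J" if "w \<in> carrier V" for w
  proof
    assume "w \<ominus>[V] v \<in> J" then show "w \<ominus>[V] u \<in> J" using D(6)[OF _ uv] 2[OF that] by simp
  next
    assume "w \<ominus>[V] u \<in> J" then show "w \<ominus>[V] v \<in> J" using D(3)[OF _ uv] 1[OF that] by simp
  qed
  then show "J +>\<^bsub>V\<^esub> u = J +>\<^bsub>V\<^esub> v" using coset_iff[OF u] coset_iff[OF v] by blast
qed

lemma quot_carrier: "carrier (algebra_quot V J) = a_r_coset V J ` carrier V"
  by (auto simp: algebra_quot_def FactRing_def ring.defs A_RCOSETS_def')

lemma quot_cases:
  assumes "X \<in> carrier (algebra_quot V J)" obtains v where "v \<in> carrier V" "X = a_r_coset V J v"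
  using assms by (auto simp: quot_carrier)

lemma quot_add: "[|u \<in> carrier V; v \<in> carrier V|] ==> a_r_coset V J u \<oplus>[algebra_quot V J] a_r_coset V J v = a_r_coset V J (u \<oplus>[V] v)"
  using abelian_subgroup.a_rcos_sum[OF quot_asub] by (simp add: algebra_quot_def FactRing_def ring.defs)

lemma quot_zero: "\<zero>[algebra_quot V J] = a_r_coset V J \<zero>[V]"
proof -
  interpret V: module K V by (rule V)
  show ?thesis using submodD[OF V J] by (simp add: algebra_quot_def FactRing_def ring.defs)
qed

lemma quot_smult:
  assumes c: "c \<in> carrier K" and v: "v \<in> carrier V"
  shows "c \<odot>[algebra_quot V J] a_r_coset V J v = a_r_coset V J (c \<odot>[V] v)"
proof -
  have *: "a_r_coset V J (c \<odot>[V] x) = a_r_coset V J (c \<odot>[V] v)" if "x \<in> a_r_coset V J v" for x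
  proof -
    have x: "x \<in> carrier V" "x \<ominus>[V] v \<in> J" using that coset_iff[OF v] by auto
    have "c \<odot>[V] x \<ominus>[V] c \<odot>[V] v = c \<odot>[V] (x \<ominus>[V] v)" using x v c V by (simp add: vs_minus vs_distr)
    then show ?thesis using coset_eq[of "c \<odot>[V] x" "c \<odot>[V] v"] x v c V submodD(4)[OF V J c x(2)] by simp
  qed
  have v': "v \<in> a_r_coset V J v" using coset_iff[OF v] submodD[OF V J] v by (simp add: vs_simps V)
  have "(\<Union>x\<in>a_r_coset V J v. a_r_coset V J (c \<odot>[V] x)) = (\<Union>x\<in>a_r_coset V J v. a_r_coset V J (c \<odot>[V] v))"
    by (rule SUP_cong[OF refl *])
  also have "... = a_r_coset V J (c \<odot>[V] v)" using v' by blast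
  finally show ?thesis by (simp add: algebra_quot_def ring.defs module.defs)
qed

lemma vs_quot: "vs (algebra_quot V J)"
proof (rule moduleI')
  fix X Y Z assume "X \<in> carrier (algebra_quot V J)" "Y \<in> carrier (algebra_quot V J)" "Z \<in> carrier (algebra_quot V J)"
  then obtain x y z where "x \<in> carrier V" "y \<in> carrier V" "z \<in> carrier V" "X = a_r_coset V J x" "Y = a_r_coset V J y" "Z = a_r_coset V J z"
    by (metis quot_cases)
  then show "X \<oplus>[algebra_quot V J] Y \<oplus>[algebra_quot V J] Z = X \<oplus>[algebra_quot V J] (Y \<oplus>[algebra_quot V J] Z)" using V by (simp add: quot_add vs_ac)
qed (auto elim!: quot_cases simp: quot_add quot_smult quot_zero V vs_simps[OF V] vs_distr[OF V] vs_ac[OF V] quot_carrier)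

lemma quot_proj_lin: "a_r_coset V J \<in> lin V (algebra_quot V J)"
  by (rule linI) (auto simp: quot_carrier quot_add quot_smult)

context
  fixes f and W :: "('k, 'w, 'n) module_scheme"
  assumes W: "vs W" and f: "f \<in> lin V W" and fJ: "\<And>j. j \<in> J ==> f j = \<zero>[W]"
begin

text \<open>Two elements of a coset differ by an element of \<open>J\<close>, which \<open>f\<close>
  kills. So \<open>f\<close> maps the coset to a singleton, and \<open>coset_lift\<close> picks its
  only element.\<close>

lemma quot_lift_proj:
  assumes v: "v \<in> carrier V" shows "coset_lift f (a_r_coset V J v) = f v"
proof -
  have *: "f w = f v" if "w \<in> a_r_coset V J v" for w
  proof -
    have w: "w \<in> carrier V" "w \<ominus>[V] v \<in> J" using that coset_iff[OF v] by auto
    have "f w \<ominus>[W] f v = \<zero>[W]" using fJ[OF w(2)] lin_diff[OF f V W w(1) v] by simp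
    then show ?thesis using vs_diff_zero[OF W] lin_closed[OF f] w v by simp
  qed
  have "v \<in> a_r_coset V J v" using coset_iff[OF v] submodD[OF V J] v by (simp add: vs_simps V)
  then have "f ` a_r_coset V J v = {f v}" using * by blast
  then show ?thesis by (simp add: coset_lift_def)
qed

lemma quot_lift_lin: "coset_lift f \<in> lin (algebra_quot V J) W"
  by (rule linI) (auto elim!: quot_cases simp: quot_add quot_smult quot_lift_proj V lin_closed[OF f] lin_add[OF f] lin_smult[OF f])

end

end

subsection \<open>Algebras\<close>

lemma alg_vs: "alg A ==> vs A"
  by (simp add: unital_algebra_def)

lemma alg_ring: "alg A ==> ring A"
  by (simp add: unital_algebra_def)

lemma alg_closed [simp]:
  assumes "alg A"
  shows "[|x \<in> carrier A; y \<in> carrier A|] ==> x \<otimes>[A] y \<in> carrier A" "\<one>[A] \<in> carrier A"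
    "[|u \<in> carrier A; v \<in> carrier A|] ==> u \<oplus>[A] v \<in> carrier A" "\<zero>[A] \<in> carrier A"
    "[|c \<in> carrier K; v \<in> carrier A|] ==> c \<odot>[A] v \<in> carrier A"
    "v \<in> carrier A ==> \<ominus>[A] v \<in> carrier A"
    "[|u \<in> carrier A; v \<in> carrier A|] ==> u \<ominus>[A] v \<in> carrier A"
  using vs_closed[OF alg_vs[OF assms]] ring.ring_simprules[OF alg_ring[OF assms]] by auto

lemma alg_simps:
  assumes "alg A"
  shows "x \<in> carrier A ==> \<one>[A] \<otimes>[A] x = x" "x \<in> carrier A ==> x \<otimes>[A] \<one>[A] = x"
    "x \<in> carrier A ==> \<zero>[A] \<otimes>[A] x = \<zero>[A]" "x \<in> carrier A ==> x \<otimes>[A] \<zero>[A] = \<zero>[A]"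
    "[|x \<in> carrier A; y \<in> carrier A; z \<in> carrier A|] ==> x \<otimes>[A] y \<otimes>[A] z = x \<otimes>[A] (y \<otimes>[A] z)"
    "[|x \<in> carrier A; y \<in> carrier A; z \<in> carrier A|] ==> (x \<oplus>[A] y) \<otimes>[A] z = x \<otimes>[A] z \<oplus>[A] y \<otimes>[A] z"
    "[|x \<in> carrier A; y \<in> carrier A; z \<in> carrier A|] ==> z \<otimes>[A] (x \<oplus>[A] y) = z \<otimes>[A] x \<oplus>[A] z \<otimes>[A] y"
    "[|c \<in> carrier K; x \<in> carrier A; y \<in> carrier A|] ==> (c \<odot>[A] x) \<otimes>[A] y = c \<odot>[A] (x \<otimes>[A] y)"
    "[|c \<in> carrier K; x \<in> carrier A; y \<in> carrier A|] ==> x \<otimes>[A] (c \<odot>[A] y) = c \<odot>[A] (x \<otimes>[A] y)"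
    "[|x \<in> carrier A; y \<in> carrier A|] ==> (\<ominus>[A] x) \<otimes>[A] y = \<ominus>[A] (x \<otimes>[A] y)"
    "[|x \<in> carrier A; y \<in> carrier A|] ==> x \<otimes>[A] (\<ominus>[A] y) = \<ominus>[A] (x \<otimes>[A] y)"
proof -
  interpret R: ring A by (rule alg_ring[OF assms])
  note A = unital_algebra.smult_mult_left[OF assms] unital_algebra.smult_mult_right[OF assms]
  show "x \<in> carrier A ==> \<one>[A] \<otimes>[A] x = x" "x \<in> carrier A ==> x \<otimes>[A] \<one>[A] = x"
    "x \<in> carrier A ==> \<zero>[A] \<otimes>[A] x = \<zero>[A]" "x \<in> carrier A ==> x \<otimes>[A] \<zero>[A] = \<zero>[A]"
    "[|x \<in> carrier A; y \<in> carrier A; z \<in> carrier A|] ==> x \<otimes>[A] y \<otimes>[A] z = x \<otimes>[A] (y \<otimes>[A] z)"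
    "[|x \<in> carrier A; y \<in> carrier A; z \<in> carrier A|] ==> (x \<oplus>[A] y) \<otimes>[A] z = x \<otimes>[A] z \<oplus>[A] y \<otimes>[A] z"
    "[|x \<in> carrier A; y \<in> carrier A; z \<in> carrier A|] ==> z \<otimes>[A] (x \<oplus>[A] y) = z \<otimes>[A] x \<oplus>[A] z \<otimes>[A] y"
    "[|c \<in> carrier K; x \<in> carrier A; y \<in> carrier A|] ==> (c \<odot>[A] x) \<otimes>[A] y = c \<odot>[A] (x \<otimes>[A] y)"
    "[|c \<in> carrier K; x \<in> carrier A; y \<in> carrier A|] ==> x \<otimes>[A] (c \<odot>[A] y) = c \<odot>[A] (x \<otimes>[A] y)"
    "[|x \<in> carrier A; y \<in> carrier A|] ==> (\<ominus>[A] x) \<otimes>[A] y = \<ominus>[A] (x \<otimes>[A] y)"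
    "[|x \<in> carrier A; y \<in> carrier A|] ==> x \<otimes>[A] (\<ominus>[A] y) = \<ominus>[A] (x \<otimes>[A] y)"
    using A
      ring.ring_simprules[OF alg_ring[OF assms]] R.l_minus R.r_minus R.l_null R.r_null
    by auto
qed

lemma algI:
  assumes A: "vs A" and cl: "\<And>x y. [|x \<in> carrier A; y \<in> carrier A|] ==> x \<otimes>[A] y \<in> carrier A" "\<one>[A] \<in> carrier A"
    and lr: "\<And>x. x \<in> carrier A ==> (%y. x \<otimes>[A] y) \<in> lin A A" "\<And>y. y \<in> carrier A ==> (%x. x \<otimes>[A] y) \<in> lin A A"
    and "\<And>x. x \<in> carrier A ==> \<one>[A] \<otimes>[A] x = x" "\<And>x. x \<in> carrier A ==> x \<otimes>[A] \<one>[A] = x"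
    "\<And>x y z. [|x \<in> carrier A; y \<in> carrier A; z \<in> carrier A|] ==> x \<otimes>[A] y \<otimes>[A] z = x \<otimes>[A] (y \<otimes>[A] z)"
  shows "alg A"
proof (rule unital_algebra.intro)
  interpret A: module K A by fact
  show "ring A"
    by (rule ringI) (use assms lin_add[OF lr(1)] lin_add[OF lr(2)] in \<open>auto intro!: Group.monoidI simp: A.M.abelian_group_axioms\<close>)
  show "unital_algebra_axioms K A"
    by unfold_locales (use lin_smult[OF lr(1)] lin_smult[OF lr(2)] in auto)
qed fact

lemma lin_mult_left: "[|alg A; a \<in> carrier A; f \<in> lin V A|] ==> (%x. a \<otimes>[A] f x) \<in> lin V A"
  by (rule linI) (simp_all add: lin_closed[of f] lin_add[of f] lin_smult[of f] alg_simps)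

lemma lin_mult_right: "[|alg A; a \<in> carrier A; f \<in> lin V A|] ==> (%x. f x \<otimes>[A] a) \<in> lin V A"
  by (rule linI) (simp_all add: lin_closed[of f] lin_add[of f] lin_smult[of f] alg_simps)

lemma lin_smult_vec: "[|vs W; w \<in> carrier W; f \<in> lin V (base_algebra K)|] ==> (%x. f x \<odot>[W] w) \<in> lin V W"
  using lin_closed[of f V "base_algebra K"]
  by (intro linI) (simp_all add: lin_add[of f] lin_smult[of f] vs_distr)

lemma lin_Kmult_left: "[|a \<in> carrier K; f \<in> lin V (base_algebra K)|] ==> (%x. a \<otimes> f x) \<in> lin V (base_algebra K)"
  using lin_scale[OF vs_base, of a f V] by simp

lemma lin_Kmult_right: "[|a \<in> carrier K; f \<in> lin V (base_algebra K)|] ==> (%x. f x \<otimes> a) \<in> lin V (base_algebra K)"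
  using lin_smult_vec[OF vs_base, of a f V] by simp

lemma alg_base [simp]: "alg (base_algebra K)"
  by (rule algI) (auto simp: m_assoc intro: lin_Kmult_left lin_Kmult_right lin_id)

lemma ahomI:
  assumes "f \<in> lin A B" "\<And>x y. [|x \<in> carrier A; y \<in> carrier A|] ==> f (x \<otimes>[A] y) = f x \<otimes>[B] f y" "f \<one>[A] = \<one>[B]"
  shows "f \<in> ahom A B"
  using assms lin_closed[OF assms(1)] lin_add[OF assms(1)] by (auto simp: algebra_homs_def intro!: ring_hom_memI)

lemma ahom_lin: "f \<in> ahom A B ==> f \<in> lin A B"
  and ahom_mult: "[|f \<in> ahom A B; x \<in> carrier A; y \<in> carrier A|] ==> f (x \<otimes>[A] y) = f x \<otimes>[B] f y"
  and ahom_one: "f \<in> ahom A B ==> f \<one>[A] = \<one>[B]"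
  by (auto simp: algebra_homs_def ring_hom_mult ring_hom_one)

lemma ahom_closed: "f \<in> ahom A B ==> x \<in> carrier A ==> f x \<in> carrier B"
  by (rule lin_closed[OF ahom_lin])

lemma ahom_comp: "[|g \<in> ahom B C; f \<in> ahom A B|] ==> (%x. g (f x)) \<in> ahom A C"
  by (rule ahomI) (auto simp: ahom_mult ahom_one ahom_closed intro: lin_comp ahom_lin)

lemma idealI':
  assumes "alg A" "submodule J K A" "\<And>a x. [|a \<in> carrier A; x \<in> J|] ==> a \<otimes>[A] x \<in> J" "\<And>a x. [|a \<in> carrier A; x \<in> J|] ==> x \<otimes>[A] a \<in> J"
  shows "ideal J A"
  by (rule idealI) (use assms alg_ring in \<open>auto simp: submodule_def\<close>)

lemma ideal_submod:
  assumes A: "alg A" and J: "ideal J A" shows "submodule J K A"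
proof (rule submodI[OF alg_vs[OF A]])
  interpret J: ideal J A by fact
  show "J \<subseteq> carrier A" "\<zero>[A] \<in> J" using J.a_Hcarr by auto
  fix u v assume u: "u \<in> J" and "v \<in> J" then show "u \<oplus>[A] v \<in> J" by auto
  fix c assume c: "c \<in> carrier K"
  have "c \<odot>[A] u = (c \<odot>[A] \<one>[A]) \<otimes>[A] u" using A c u J.a_Hcarr by (simp add: alg_simps)
  then show "c \<odot>[A] u \<in> J" using J.I_l_closed[OF u] A c by simp
qed

lemma quot_mult:
  assumes J: "ideal J A" and "x \<in> carrier A" "y \<in> carrier A"
  shows "(J +>\<^bsub>A\<^esub> x) \<otimes>[algebra_quot A J] (J +>\<^bsub>A\<^esub> y) = J +>\<^bsub>A\<^esub> (x \<otimes>[A] y)"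
  using ideal.rcoset_mult_add[OF assms] by (simp add: algebra_quot_def FactRing_def ring.defs)

lemma quot_one: "\<one>[algebra_quot A J] = J +>\<^bsub>A\<^esub> \<one>[A]"
  by (simp add: algebra_quot_def FactRing_def ring.defs)

lemma
  assumes A: "alg A" and J: "ideal J A"
  shows alg_quot: "alg (algebra_quot A J)" and quot_proj_hom: "(%x. J +>\<^bsub>A\<^esub> x) \<in> ahom A (algebra_quot A J)"
proof -
  note J' = ideal_submod[OF A J] note V = alg_vs[OF A]
  note [elim!] = quot_cases[OF V J'] and [simp] = quot_mult[OF J] quot_add[OF V J'] quot_smult[OF V J'] quot_carrier[OF V J'] quot_one
  show "alg (algebra_quot A J)"
    by (rule algI) (use A in \<open>auto intro!: vs_quot[OF V J'] linI simp: alg_simps\<close>)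
  show "(%x. J +>\<^bsub>A\<^esub> x) \<in> ahom A (algebra_quot A J)"
    by (rule ahomI) (auto intro!: quot_proj_lin[OF V J'])
qed

lemma quot_lift_hom:
  assumes A: "alg A" and J: "ideal J A" and B: "alg B" and f: "f \<in> ahom A B" and fJ: "\<And>j. j \<in> J ==> f j = \<zero>[B]"
  shows "coset_lift f \<in> ahom (algebra_quot A J) B"
proof -
  note J' = ideal_submod[OF A J] note V = alg_vs[OF A]
  note l = quot_lift_proj[OF V J' alg_vs[OF B] ahom_lin[OF f] fJ]
  show ?thesis
    by (rule ahomI) (use A l ahom_mult[OF f] ahom_one[OF f] quot_mult[OF J] in
      \<open>auto intro!: quot_lift_lin[OF V J' alg_vs[OF B] ahom_lin[OF f] fJ] elim!: quot_cases[OF V J'] simp: quot_one\<close>)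
qed

lemma ideal_preimage:
  assumes A: "alg A" and B: "alg B" and f: "f \<in> ahom A B" and J: "ideal J B"
  shows "ideal {x \<in> carrier A. f x \<in> J} A"
  by (rule idealI'[OF A submod_preimage[OF alg_vs[OF A] alg_vs[OF B] ahom_lin[OF f] ideal_submod[OF B J]]])
    (use A ideal.I_l_closed[OF J] ideal.I_r_closed[OF J] ahom_mult[OF f] ahom_closed[OF f] in auto)

lemma ideal_null: "alg A ==> ideal {\<zero>[A]} A"
  using ring.zeroideal alg_ring by blast

text \<open>The preimage of an ideal under an algebra map is an ideal; since it contains
  \<open>S\<close>, it contains the ideal generated by \<open>S\<close>.\<close>

lemma Idl_preimage:
  assumes A: "alg A" and B: "alg B" and f: "f \<in> ahom A B" and J: "ideal J B" and S: "S \<subseteq> carrier A" "\<And>s. s \<in> S ==> f s \<in> J"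
    and x: "x \<in> Idl\<^bsub>A\<^esub> S"
  shows "f x \<in> J"
  using ring.genideal_minimal[OF alg_ring[OF A] ideal_preimage[OF A B f J], of S] S x by auto

lemma Idl_kernel:
  assumes A: "alg A" and B: "alg B" and f: "f \<in> ahom A B" and S: "S \<subseteq> carrier A" "\<And>s. s \<in> S ==> f s = \<zero>[B]"
    and x: "x \<in> Idl\<^bsub>A\<^esub> S"
  shows "f x = \<zero>[B]"
  using Idl_preimage[OF A B f ideal_null[OF B] S(1) _ x] S(2) by auto

subsection \<open>Monoid algebras\<close>

text \<open>A fixed rectangle \<open>P \<times> Q\<close> replaces the product of the supports.
  Distributivity involves factors with different supports, and their products can be added only as
  sums over one index set.\<close>

lemma ma_mult_eq:
  assumes f: "f \<in> fin_funs K (carrier M)" and g: "g \<in> fin_funs K (carrier M)"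
    and P: "finite P" "{p. f p \<noteq> \<zero>} \<subseteq> P" and Q: "finite Q" "{q. g q \<noteq> \<zero>} \<subseteq> Q"
  shows "(f \<otimes>[monoid_algebra K M] g) m = (\<Oplus>z\<in>P\<times>Q. (if fst z \<otimes>[M] snd z = m then f (fst z) \<otimes> g (snd z) else \<zero>))"
proof -
  have "(f \<otimes>[monoid_algebra K M] g) m = (\<Oplus>z\<in>{(p, q). f p \<noteq> \<zero> \<and> g q \<noteq> \<zero> \<and> p \<otimes>[M] q = m}. f (fst z) \<otimes> g (snd z))"
    by (simp add: monoid_algebra_def)
  also have "... = (\<Oplus>z\<in>P\<times>Q. (if fst z \<otimes>[M] snd z = m then f (fst z) \<otimes> g (snd z) else \<zero>))"
  proof (rule add.finprod_mono_neutral_cong_left)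
    show "finite (P \<times> Q)" using P Q by simp
    show "{(p, q). f p \<noteq> \<zero> \<and> g q \<noteq> \<zero> \<and> p \<otimes>[M] q = m} \<subseteq> P \<times> Q" using P Q by auto
    show "(if fst z \<otimes>[M] snd z = m then f (fst z) \<otimes> g (snd z) else \<zero>) = \<zero>"
      if "z \<in> P \<times> Q - {(p, q). f p \<noteq> \<zero> \<and> g q \<noteq> \<zero> \<and> p \<otimes>[M] q = m}" for z
      using that ff_val[OF f] ff_val[OF g] by (cases "f (fst z) = \<zero>") auto
  qed (use ff_val[OF f] ff_val[OF g] in auto)
  finally show ?thesis .
qed

lemma ma_mult_point:
  assumes "p \<in> carrier M" "q \<in> carrier M"
  shows "point K p \<otimes>[monoid_algebra K M] point K q = point K (p \<otimes>[M] q)"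
proof
  fix m
  have "(point K p \<otimes>[monoid_algebra K M] point K q) m
    = (\<Oplus>z\<in>{p}\<times>{q}. (if fst z \<otimes>[M] snd z = m then point K p (fst z) \<otimes> point K q (snd z) else \<zero>))"
    by (rule ma_mult_eq[OF ff_point ff_point]) (use assms in \<open>auto simp: point_def split: if_splits\<close>)
  also have "... = (\<Oplus>z\<in>{(p,q)}. (if fst z \<otimes>[M] snd z = m then point K p (fst z) \<otimes> point K q (snd z) else \<zero>))"
    by simp
  also have "... = point K (p \<otimes>[M] q) m"
    by (subst finsum_insert) (auto simp: point_def)
  finally show "(point K p \<otimes>[monoid_algebra K M] point K q) m = point K (p \<otimes>[M] q) m" .
qed

lemma ma_mult_closed:
  assumes M: "monoid M" and f: "f \<in> fin_funs K (carrier M)" and g: "g \<in> fin_funs K (carrier M)"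
  shows "f \<otimes>[monoid_algebra K M] g \<in> fin_funs K (carrier M)"
proof -
  let ?P = "{p. f p \<noteq> \<zero>}" and ?Q = "{q. g q \<noteq> \<zero>}"
  note e = ma_mult_eq[OF f g ff_fin[OF f] subset_refl ff_fin[OF g] subset_refl]
  have *: "m \<in> (%z. fst z \<otimes>[M] snd z) ` (?P \<times> ?Q)" if "(f \<otimes>[monoid_algebra K M] g) m \<noteq> \<zero>" for m
  proof (rule ccontr)
    assume "\<not> ?thesis"
    then have "(f \<otimes>[monoid_algebra K M] g) m = (\<Oplus>z\<in>?P\<times>?Q. \<zero>)" unfolding e by (intro finsum_cong') auto
    then show False using that by simp
  qed
  show ?thesis
  proof (rule ffI)
    show "(f \<otimes>[monoid_algebra K M] g) s \<in> carrier K" for s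
      unfolding e by (rule finsum_closed) (use ff_val[OF f] ff_val[OF g] in auto)
    show "finite {s. (f \<otimes>[monoid_algebra K M] g) s \<noteq> \<zero>}"
      by (rule finite_subset[of _ "(%z. fst z \<otimes>[M] snd z) ` (?P \<times> ?Q)"]) (use * ff_fin[OF f] ff_fin[OF g] in auto)
    show "s \<in> carrier M" if "(f \<otimes>[monoid_algebra K M] g) s \<noteq> \<zero>" for s
      using *[OF that] ff_supp[OF f] ff_supp[OF g] monoid.m_closed[OF M] by auto
  qed
qed

lemma ma_mult_lin_left:
  assumes M: "monoid M" and g: "g \<in> fin_funs K (carrier M)"
  shows "(%f. f \<otimes>[monoid_algebra K M] g) \<in> lin (monoid_algebra K M) (monoid_algebra K M)"
proof (rule linI)
  let ?Q = "{q. g q \<noteq> \<zero>}"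
  fix f f' assume "f \<in> carrier (monoid_algebra K M)" "f' \<in> carrier (monoid_algebra K M)"
  then have f: "f \<in> fin_funs K (carrier M)" "f' \<in> fin_funs K (carrier M)" by auto
  show "f \<otimes>[monoid_algebra K M] g \<in> carrier (monoid_algebra K M)" using ma_mult_closed[OF M f(1) g] by simp
  let ?P = "{p. f p \<noteq> \<zero>} \<union> {p. f' p \<noteq> \<zero>}"
  have P: "finite ?P" using f ff_fin by auto
  have s: "{p. f p \<oplus> f' p \<noteq> \<zero>} \<subseteq> ?P" using f by auto
  have "((%p. f p \<oplus> f' p) \<otimes>[monoid_algebra K M] g) m = (f \<otimes>[monoid_algebra K M] g) m \<oplus> (f' \<otimes>[monoid_algebra K M] g) m" for m
  proof -
    have "((%p. f p \<oplus> f' p) \<otimes>[monoid_algebra K M] g) m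
      = (\<Oplus>z\<in>?P\<times>?Q. (if fst z \<otimes>[M] snd z = m then (f (fst z) \<oplus> f' (fst z)) \<otimes> g (snd z) else \<zero>))"
      by (rule ma_mult_eq[OF ff_add[OF f] g P s ff_fin[OF g] subset_refl])
    also have "... = (\<Oplus>z\<in>?P\<times>?Q. (if fst z \<otimes>[M] snd z = m then f (fst z) \<otimes> g (snd z) else \<zero>)
        \<oplus> (if fst z \<otimes>[M] snd z = m then f' (fst z) \<otimes> g (snd z) else \<zero>))"
      by (rule finsum_cong') (use ff_val[OF f(1)] ff_val[OF f(2)] ff_val[OF g] in \<open>auto simp: l_distr\<close>)
    also have "... = (\<Oplus>z\<in>?P\<times>?Q. (if fst z \<otimes>[M] snd z = m then f (fst z) \<otimes> g (snd z) else \<zero>))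
        \<oplus> (\<Oplus>z\<in>?P\<times>?Q. (if fst z \<otimes>[M] snd z = m then f' (fst z) \<otimes> g (snd z) else \<zero>))"
      by (rule finsum_addf) (use ff_val[OF f(1)] ff_val[OF f(2)] ff_val[OF g] in auto)
    also have "(\<Oplus>z\<in>?P\<times>?Q. (if fst z \<otimes>[M] snd z = m then f (fst z) \<otimes> g (snd z) else \<zero>)) = (f \<otimes>[monoid_algebra K M] g) m"
      by (rule ma_mult_eq[OF f(1) g P _ ff_fin[OF g] subset_refl, symmetric]) auto
    also have "(\<Oplus>z\<in>?P\<times>?Q. (if fst z \<otimes>[M] snd z = m then f' (fst z) \<otimes> g (snd z) else \<zero>)) = (f' \<otimes>[monoid_algebra K M] g) m"
      by (rule ma_mult_eq[OF f(2) g P _ ff_fin[OF g] subset_refl, symmetric]) auto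
    finally show ?thesis .
  qed
  then show "(f \<oplus>[monoid_algebra K M] f') \<otimes>[monoid_algebra K M] g
      = f \<otimes>[monoid_algebra K M] g \<oplus>[monoid_algebra K M] f' \<otimes>[monoid_algebra K M] g" by auto
  fix c assume c: "c \<in> carrier K"
  have s: "{p. c \<otimes> f p \<noteq> \<zero>} \<subseteq> {p. f p \<noteq> \<zero>}" using c by auto
  have "((%p. c \<otimes> f p) \<otimes>[monoid_algebra K M] g) m = c \<otimes> (f \<otimes>[monoid_algebra K M] g) m" for m
  proof -
    have "((%p. c \<otimes> f p) \<otimes>[monoid_algebra K M] g) m
      = (\<Oplus>z\<in>{p. f p \<noteq> \<zero>}\<times>?Q. (if fst z \<otimes>[M] snd z = m then (c \<otimes> f (fst z)) \<otimes> g (snd z) else \<zero>))"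
      by (rule ma_mult_eq[OF ff_smult[OF c f(1)] g ff_fin[OF f(1)] s ff_fin[OF g] subset_refl])
    also have "... = (\<Oplus>z\<in>{p. f p \<noteq> \<zero>}\<times>?Q. c \<otimes> (if fst z \<otimes>[M] snd z = m then f (fst z) \<otimes> g (snd z) else \<zero>))"
      by (rule finsum_cong') (use c ff_val[OF f(1)] ff_val[OF g] in \<open>auto simp: m_assoc\<close>)
    also have "... = c \<otimes> (\<Oplus>z\<in>{p. f p \<noteq> \<zero>}\<times>?Q. (if fst z \<otimes>[M] snd z = m then f (fst z) \<otimes> g (snd z) else \<zero>))"
      by (rule finsum_rdistr[symmetric]) (use c ff_val[OF f(1)] ff_val[OF g] ff_fin[OF f(1)] ff_fin[OF g] in auto)
    finally show ?thesis
      unfolding ma_mult_eq[OF f(1) g ff_fin[OF f(1)] subset_refl ff_fin[OF g] subset_refl] .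
  qed
  then show "(c \<odot>[monoid_algebra K M] f) \<otimes>[monoid_algebra K M] g
      = c \<odot>[monoid_algebra K M] (f \<otimes>[monoid_algebra K M] g)" by auto
qed

text \<open>Right linearity is left linearity over the opposite monoid.\<close>

lemma ma_mult_swap:
  assumes "f \<in> fin_funs K (carrier M)" "g \<in> fin_funs K (carrier M)"
  shows "f \<otimes>[monoid_algebra K M] g = g \<otimes>\<^bsub>monoid_algebra K \<lparr>carrier = carrier M, mult = (%x y. y \<otimes>[M] x), one = \<one>[M]\<rparr>\<^esub> f"
proof
  fix m
  let ?O = "\<lparr>carrier = carrier M, mult = (%x y. y \<otimes>[M] x), one = \<one>[M]\<rparr>"
  let ?A = "{(p, q). f p \<noteq> \<zero> \<and> g q \<noteq> \<zero> \<and> p \<otimes>[M] q = m}"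
  have im: "{(p, q). g p \<noteq> \<zero> \<and> f q \<noteq> \<zero> \<and> q \<otimes>[M] p = m} = prod.swap ` ?A" by force
  have "(g \<otimes>[monoid_algebra K ?O] f) m = (\<Oplus>z\<in>prod.swap ` ?A. g (fst z) \<otimes> f (snd z))"
    by (simp add: monoid_algebra_def im[symmetric])
  also have "... = (\<Oplus>z\<in>?A. g (fst (prod.swap z)) \<otimes> f (snd (prod.swap z)))"
    by (rule finsum_reindex) (use ff_val[OF assms(1)] ff_val[OF assms(2)] in \<open>auto intro: inj_onI\<close>)
  also have "... = (\<Oplus>z\<in>?A. f (fst z) \<otimes> g (snd z))"
    by (rule finsum_cong') (use ff_val[OF assms(1)] ff_val[OF assms(2)] in \<open>auto simp: m_comm\<close>)
  also have "... = (f \<otimes>[monoid_algebra K M] g) m" by (simp add: monoid_algebra_def)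
  finally show "(f \<otimes>[monoid_algebra K M] g) m = (g \<otimes>[monoid_algebra K ?O] f) m" by simp
qed

lemma ma_mult_lin_right:
  assumes M: "monoid M" and f: "f \<in> fin_funs K (carrier M)"
  shows "(%g. f \<otimes>[monoid_algebra K M] g) \<in> lin (monoid_algebra K M) (monoid_algebra K M)"
proof -
  let ?O = "\<lparr>carrier = carrier M, mult = (%x y. y \<otimes>[M] x), one = \<one>[M]\<rparr>"
  have O: "monoid ?O"
    using monoid.m_closed[OF M] monoid.one_closed[OF M] monoid.m_assoc[OF M] monoid.l_one[OF M] monoid.r_one[OF M]
    by (intro monoidI) auto
  have "(%g. g \<otimes>[monoid_algebra K ?O] f) \<in> lin (monoid_algebra K ?O) (monoid_algebra K ?O)"
    by (rule ma_mult_lin_left[OF O]) (use f in simp)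
  then have "(%g. g \<otimes>[monoid_algebra K ?O] f) \<in> lin (monoid_algebra K M) (monoid_algebra K M)"
    by (simp add: linear_maps_def)
  moreover have "(%g. f \<otimes>[monoid_algebra K M] g) \<in> lin (monoid_algebra K M) (monoid_algebra K M) \<longleftrightarrow>
      (%g. g \<otimes>[monoid_algebra K ?O] f) \<in> lin (monoid_algebra K M) (monoid_algebra K M)"
    by (rule lin_cong) (use ma_mult_swap[OF f] in auto)
  ultimately show ?thesis by simp
qed

lemma alg_ma:
  assumes M: "monoid M" shows "alg (monoid_algebra K M)"
proof (rule algI)
  let ?A = "monoid_algebra K M"
  note l = ma_mult_lin_left[OF M] and r = ma_mult_lin_right[OF M]
  fix f assume "f \<in> carrier ?A"
  then have f: "f \<in> fin_funs K (carrier M)" by simp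
  show "(%g. f \<otimes>[?A] g) \<in> lin ?A ?A" "(%g. g \<otimes>[?A] f) \<in> lin ?A ?A" using l r f by auto
  show "\<one>[?A] \<otimes>[?A] f = f"
    by (rule lin_ext[OF r lin_id vs_ma]) (use f monoid.one_closed[OF M] monoid.l_one[OF M] in \<open>auto simp: ma_mult_point\<close>)
  show "f \<otimes>[?A] \<one>[?A] = f"
    by (rule lin_ext[OF l lin_id vs_ma]) (use f monoid.one_closed[OF M] monoid.r_one[OF M] in \<open>auto simp: ma_mult_point\<close>)
  fix g assume "g \<in> carrier ?A"
  then have g: "g \<in> fin_funs K (carrier M)" by simp
  show "f \<otimes>[?A] g \<in> carrier ?A" using ma_mult_closed[OF M f g] by simp
  fix h assume "h \<in> carrier ?A"
  then have h: "h \<in> fin_funs K (carrier M)" by simp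
  note cl = ma_mult_closed[OF M]
  \<comment> \<open>Associativity is trilinear, so it is enough to know it for three basis elements,
    where it is the associativity of the monoid. The arguments are generalised one at a time, from
    the last to the first.\<close>
  have 1: "(point K p \<otimes>[?A] point K q) \<otimes>[?A] h = point K p \<otimes>[?A] (point K q \<otimes>[?A] h)" if pq: "p \<in> carrier M" "q \<in> carrier M" for p q
    by (rule lin_ext[OF r lin_comp[OF r r] vs_ma])
      (use h pq monoid.m_assoc[OF M] monoid.m_closed[OF M] cl in \<open>auto simp: ma_mult_point\<close>)
  have 2: "(point K p \<otimes>[?A] g) \<otimes>[?A] h = point K p \<otimes>[?A] (g \<otimes>[?A] h)" if pq: "p \<in> carrier M" for p
    by (rule lin_ext[OF lin_comp[OF l r] lin_comp[OF r l] vs_ma]) (use h g pq 1 in auto)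
  show "f \<otimes>[?A] g \<otimes>[?A] h = f \<otimes>[?A] (g \<otimes>[?A] h)"
    by (rule lin_ext[OF lin_comp[OF l l] l vs_ma]) (use h g f 2 cl in auto)
qed (use monoid.one_closed[OF M] in auto)

lemma ma_hom:
  assumes M: "monoid M" and A: "alg A" and \<beta>: "\<And>m. m \<in> carrier M ==> \<beta> m \<in> carrier A" "\<beta> \<one>[M] = \<one>[A]"
    "\<And>m n. [|m \<in> carrier M; n \<in> carrier M|] ==> \<beta> (m \<otimes>[M] n) = \<beta> m \<otimes>[A] \<beta> n"
  shows "lincomb K A \<beta> \<in> ahom (monoid_algebra K M) A"
proof (rule ahomI)
  let ?A = "monoid_algebra K M"
  show L: "lincomb K A \<beta> \<in> lin ?A A" by (rule lincomb_lin[OF alg_vs[OF A]]) (use \<beta> in auto)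
  note p = lincomb_point[OF alg_vs[OF A]]
  show "lincomb K A \<beta> \<one>[?A] = \<one>[A]" using \<beta> monoid.one_closed[OF M] A by (simp add: p)
  note l = ma_mult_lin_left[OF M] and r = ma_mult_lin_right[OF M]
  fix f g assume "f \<in> carrier ?A" "g \<in> carrier ?A"
  then have f: "f \<in> fin_funs K (carrier M)" and g: "g \<in> fin_funs K (carrier M)" by simp_all
  have 1: "lincomb K A \<beta> (point K m \<otimes>[?A] g) = lincomb K A \<beta> (point K m) \<otimes>[A] lincomb K A \<beta> g" if m: "m \<in> carrier M" for m
    by (rule lin_ext[OF lin_comp[OF L r] lin_mult_left[OF A _ L] alg_vs[OF A]])
      (use m g \<beta> monoid.m_closed[OF M] A in \<open>auto simp: ma_mult_point p\<close>)
  show "lincomb K A \<beta> (f \<otimes>[?A] g) = lincomb K A \<beta> f \<otimes>[A] lincomb K A \<beta> g"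
    by (rule lin_ext[OF lin_comp[OF L l] lin_mult_right[OF A _ L] alg_vs[OF A]])
      (use 1 f g lin_closed[OF L] in auto)
qed

lemma free_monoid_simps [simp]:
  "carrier (free_monoid S) = lists S" "mult (free_monoid S) = (@)" "one (free_monoid S) = []"
  by (simp_all add: free_monoid_def)

lemma monoid_free [simp]: "monoid (free_monoid S)"
  by (rule monoidI) auto

lemma alg_free [simp]: "alg (free_algebra K S)"
  by (rule alg_ma) simp

lemma
  assumes A: "alg A" and f: "\<And>s. s \<in> S ==> f s \<in> carrier A"
  shows free_lift_hom: "free_lift K A f \<in> ahom (free_algebra K S) A"
    and free_lift_gen: "\<And>s. s \<in> S ==> free_lift K A f (point K [s]) = f s"
proof -
  have cl: "foldr (%s y. f s \<otimes>[A] y) w \<one>[A] \<in> carrier A" if "w \<in> lists S" for w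
    using that by induction (use A f in auto)
  have m: "foldr (%s y. f s \<otimes>[A] y) (v @ w) \<one>[A] = foldr (%s y. f s \<otimes>[A] y) v \<one>[A] \<otimes>[A] foldr (%s y. f s \<otimes>[A] y) w \<one>[A]"
    if "v \<in> lists S" "w \<in> lists S" for v w
    using that
  proof induction
    case Nil then show ?case using A cl by (simp add: alg_simps)
  next
    case (Cons a l)
    then show ?case using cl[OF Cons.hyps(2)] cl[OF Cons.prems] f[OF Cons.hyps(1)] A by (simp add: alg_simps(5))
  qed
  show "free_lift K A f \<in> ahom (free_algebra K S) A"
    unfolding free_lift_def by (rule ma_hom[OF monoid_free A]) (use cl m in auto)
  show "free_lift K A f (point K [s]) = f s" if "s \<in> S" for s
    unfolding free_lift_def using that A f by (subst lincomb_point) (auto simp: alg_vs alg_simps)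
qed

lemma free_algebra_induct:
  assumes P: "submodule P K (free_algebra K S)" and one: "point K [] \<in> P"
    and st: "\<And>s x. [|s \<in> S; x \<in> P|] ==> point K [s] \<otimes>[free_algebra K S] x \<in> P"
    and x: "x \<in> carrier (free_algebra K S)"
  shows "x \<in> P"
proof -
  note D = submodD[OF vs_ma P]
  have w: "point K w \<in> P" if "w \<in> lists S" for w
    using that
  proof induction
    case Nil show ?case by (rule one)
  next
    case (Cons a l)
    have "point K [a] \<otimes>[free_algebra K S] point K l = point K (a # l)"
      using ma_mult_point[of "[a]" "free_monoid S" l] Cons by auto
    then show ?case using st[OF Cons.hyps(1) Cons.IH] by simp
  qed
  have "x \<in> fin_funs K (lists S)" using x by simp
  then show ?thesis
    by (induction rule: ff_induct) (use D w in auto)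
qed

subsection \<open>Tensor products\<close>

abbreviation (input) tfree where "tfree V W \<equiv> monoid_algebra K (V \<times>\<times> W)"
abbreviation (input) tker where "tker V W \<equiv> span (tfree V W) (bilinear_relations K V W)"

lemma tensor_quot: "V >< W = algebra_quot (tfree V W) (tker V W)"
  by (simp add: tensor_def Let_def)

lemma tens_coset: "tens K V W v w = tker V W +>\<^bsub>tfree V W\<^esub> point K (v, w)"
  by (simp add: tens_def Let_def)

lemma bilinear_relations_sub:
  assumes "vs V" "vs W" shows "bilinear_relations K V W \<subseteq> carrier (tfree V W)"
proof -
  have "point K (v, w) \<in> carrier (tfree V W)" if "v \<in> carrier V" "w \<in> carrier W" for v w using that by simp
  then show ?thesis using assms unfolding bilinear_relations_def Let_def
    by (auto simp del: ma_simps intro!: vs_closed(5)[OF vs_ma] vs_closed(1)[OF vs_ma] vs_closed(3)[OF vs_ma])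
qed

lemma tker_submod: "[|vs V; vs W|] ==> submodule (tker V W) K (tfree V W)"
  by (rule span_submod[OF vs_ma bilinear_relations_sub])

lemma vs_tensor [simp]: "[|vs V; vs W|] ==> vs (V >< W)"
  unfolding tensor_quot by (rule vs_quot[OF vs_ma tker_submod])

lemma tens_closed [simp]: "[|vs V; vs W; v \<in> carrier V; w \<in> carrier W|] ==> tens K V W v w \<in> carrier (V >< W)"
  unfolding tensor_quot tens_coset by (subst quot_carrier[OF vs_ma tker_submod]) auto

lemma tens_bil: assumes V: "vs V" and W: "vs W" shows "tens K V W \<in> bil V W (V >< W)"
proof -
  let ?F = "tfree V W" and ?J = "tker V W"
  note S = tker_submod[OF V W]
  have pt: "point K (v, w) \<in> carrier ?F" if "v \<in> carrier V" "w \<in> carrier W" for v w using that by simp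
  have eq: "a_r_coset ?F ?J x = a_r_coset ?F ?J y" if "x \<ominus>[?F] y \<in> bilinear_relations K V W" "x \<in> carrier ?F" "y \<in> carrier ?F" for x y
    using iffD2[OF coset_eq[OF vs_ma S that(2,3)] subsetD[OF span_incl that(1)]] .
  note q = quot_add[OF vs_ma S] quot_smult[OF vs_ma S]
  note cl = vs_closed[OF vs_ma]
  have 1: "tens K V W (u \<oplus>[V] v) w = tens K V W u w \<oplus>[V >< W] tens K V W v w"
    if "u \<in> carrier V" "v \<in> carrier V" "w \<in> carrier W" for u v w
  proof -
    have "point K (u \<oplus>[V] v, w) \<ominus>[?F] (point K (u, w) \<oplus>[?F] point K (v, w)) \<in> bilinear_relations K V W"
      using that unfolding bilinear_relations_def Let_def by blast
    from eq[OF this pt cl(1)[OF pt pt]] show ?thesis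
      using that V unfolding tens_coset tensor_quot by (simp del: ma_simps add: q pt)
  qed
  have 2: "tens K V W u (v \<oplus>[W] w) = tens K V W u v \<oplus>[V >< W] tens K V W u w"
    if "u \<in> carrier V" "v \<in> carrier W" "w \<in> carrier W" for u v w
  proof -
    have "point K (u, v \<oplus>[W] w) \<ominus>[?F] (point K (u, v) \<oplus>[?F] point K (u, w)) \<in> bilinear_relations K V W"
      using that unfolding bilinear_relations_def Let_def by blast
    from eq[OF this pt cl(1)[OF pt pt]] show ?thesis
      using that W unfolding tens_coset tensor_quot by (simp del: ma_simps add: q pt)
  qed
  have 3: "tens K V W (c \<odot>[V] v) w = c \<odot>[V >< W] tens K V W v w"
    if "c \<in> carrier K" "v \<in> carrier V" "w \<in> carrier W" for c v w
  proof -
    have "point K (c \<odot>[V] v, w) \<ominus>[?F] c \<odot>[?F] point K (v, w) \<in> bilinear_relations K V W"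
      using that unfolding bilinear_relations_def Let_def by blast
    from eq[OF this pt cl(3)[OF _ pt]] show ?thesis
      using that V unfolding tens_coset tensor_quot by (simp del: ma_simps add: q pt)
  qed
  have 4: "tens K V W v (c \<odot>[W] w) = c \<odot>[V >< W] tens K V W v w"
    if "c \<in> carrier K" "v \<in> carrier V" "w \<in> carrier W" for c v w
  proof -
    have "point K (v, c \<odot>[W] w) \<ominus>[?F] c \<odot>[?F] point K (v, w) \<in> bilinear_relations K V W"
      using that unfolding bilinear_relations_def Let_def by blast
    from eq[OF this pt cl(3)[OF _ pt]] show ?thesis
      using that W unfolding tens_coset tensor_quot by (simp del: ma_simps add: q pt)
  qed
  show ?thesis using V W by (intro bilI linI) (simp_all add: 1 2 3 4)
qed

lemma tens_simps:
  assumes "vs V" "vs W"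
  shows "[|u \<in> carrier V; v \<in> carrier V; w \<in> carrier W|] ==> tens K V W (u \<oplus>[V] v) w = tens K V W u w \<oplus>[V >< W] tens K V W v w"
    "[|v \<in> carrier V; w \<in> carrier W; w' \<in> carrier W|] ==> tens K V W v (w \<oplus>[W] w') = tens K V W v w \<oplus>[V >< W] tens K V W v w'"
    "[|c \<in> carrier K; v \<in> carrier V; w \<in> carrier W|] ==> tens K V W (c \<odot>[V] v) w = c \<odot>[V >< W] tens K V W v w"
    "[|c \<in> carrier K; v \<in> carrier V; w \<in> carrier W|] ==> tens K V W v (c \<odot>[W] w) = c \<odot>[V >< W] tens K V W v w"
    "w \<in> carrier W ==> tens K V W \<zero>[V] w = \<zero>[V >< W]"
    "v \<in> carrier V ==> tens K V W v \<zero>[W] = \<zero>[V >< W]"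
    "[|v \<in> carrier V; w \<in> carrier W|] ==> tens K V W (\<ominus>[V] v) w = \<ominus>[V >< W] tens K V W v w"
    "[|v \<in> carrier V; w \<in> carrier W|] ==> tens K V W v (\<ominus>[W] w) = \<ominus>[V >< W] tens K V W v w"
proof -
  note b = tens_bil[OF assms] note l = bil1[OF b] and r = bil2[OF b]
  show "[|u \<in> carrier V; v \<in> carrier V; w \<in> carrier W|] ==> tens K V W (u \<oplus>[V] v) w = tens K V W u w \<oplus>[V >< W] tens K V W v w"
    using lin_add[OF r, of w u v] by simp
  show "[|v \<in> carrier V; w \<in> carrier W; w' \<in> carrier W|] ==> tens K V W v (w \<oplus>[W] w') = tens K V W v w \<oplus>[V >< W] tens K V W v w'"
    using lin_add[OF l, of v w w'] by simp
  show "[|c \<in> carrier K; v \<in> carrier V; w \<in> carrier W|] ==> tens K V W (c \<odot>[V] v) w = c \<odot>[V >< W] tens K V W v w"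
    using lin_smult[OF r, of w c v] by simp
  show "[|c \<in> carrier K; v \<in> carrier V; w \<in> carrier W|] ==> tens K V W v (c \<odot>[W] w) = c \<odot>[V >< W] tens K V W v w"
    using lin_smult[OF l, of v c w] by simp
  show "w \<in> carrier W ==> tens K V W \<zero>[V] w = \<zero>[V >< W]" "v \<in> carrier V ==> tens K V W v \<zero>[W] = \<zero>[V >< W]"
    using lin_zero[OF r, of w] lin_zero[OF l, of v] assms by auto
  show "[|v \<in> carrier V; w \<in> carrier W|] ==> tens K V W (\<ominus>[V] v) w = \<ominus>[V >< W] tens K V W v w"
    using lin_minus[OF r, of w v] assms by simp
  show "[|v \<in> carrier V; w \<in> carrier W|] ==> tens K V W v (\<ominus>[W] w) = \<ominus>[V >< W] tens K V W v w"
    using lin_minus[OF l, of v w] assms by simp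
qed

text \<open>The preimage of \<open>P\<close> in the free vector space on pairs is a subspace that
  contains all basis points, hence it is everything.\<close>

lemma tensor_induct:
  assumes V: "vs V" and W: "vs W" and z: "z \<in> carrier (V >< W)" and P: "submodule P K (V >< W)"
    and t: "\<And>v w. [|v \<in> carrier V; w \<in> carrier W|] ==> tens K V W v w \<in> P"
  shows "z \<in> P"
proof -
  note S = tker_submod[OF V W]
  obtain f where f: "f \<in> carrier (tfree V W)" "z = a_r_coset (tfree V W) (tker V W) f"
    using z quot_cases[OF vs_ma S] unfolding tensor_quot by metis
  have "submodule {f \<in> carrier (tfree V W). a_r_coset (tfree V W) (tker V W) f \<in> P} K (tfree V W)" (is "submodule ?P K _")
    using submod_preimage[OF vs_ma vs_quot[OF vs_ma S] quot_proj_lin[OF vs_ma S]] P unfolding tensor_quot by blast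
  note D = submodD[OF vs_ma this]
  have "f \<in> fin_funs K (carrier V \<times> carrier W)" using f by simp
  then have "f \<in> ?P"
  proof (induction rule: ff_induct)
    case zero then show ?case using D(2) by (simp only: ma_simps)
  next
    case (point s) then show ?case using t by (auto simp: tens_coset)
  next
    case (add f g) then show ?case using D(3) by (simp only: ma_simps)
  next
    case (smult c f) then show ?case using D(4) by (simp only: ma_simps)
  qed
  then show ?thesis using f by simp
qed

lemma tensor_ext:
  assumes V: "vs V" and W: "vs W" and U: "vs U" and F: "F \<in> lin (V >< W) U" "G \<in> lin (V >< W) U"
    and t: "\<And>v w. [|v \<in> carrier V; w \<in> carrier W|] ==> F (tens K V W v w) = G (tens K V W v w)"
    and z: "z \<in> carrier (V >< W)"
  shows "F z = G z"
proof -
  have T: "vs (V >< W)" using V W by simp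
  have "submodule {z \<in> carrier (V >< W). F z = G z} K (V >< W)"
    by (rule submodI[OF T]) (use T U lin_zero[OF F(1)] lin_zero[OF F(2)] lin_add[OF F(1)] lin_add[OF F(2)] lin_smult[OF F(1)] lin_smult[OF F(2)] in auto)
  from tensor_induct[OF V W z this] t V W show ?thesis by auto
qed

context
  fixes V :: "('k, 'v, 'm) module_scheme" and W :: "('k, 'w, 'n) module_scheme" and U :: "('k, 'u, 'l) module_scheme" and \<beta>
  assumes V: "vs V" and W: "vs W" and U: "vs U" and \<beta>: "\<beta> \<in> bil V W U"
begin

private lemma lc: "lincomb K U (case_prod \<beta>) \<in> lin (tfree V W) U"
  by (rule lincomb_lin[OF U]) (auto intro: bil_closed[OF \<beta>])

private lemma lc_ker:
  assumes "j \<in> tker V W" shows "lincomb K U (case_prod \<beta>) j = \<zero>[U]"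
proof -
  let ?F = "tfree V W"
  note d = lin_diff[OF lc vs_ma U] lin_add[OF lc] lin_smult[OF lc]
  have p: "lincomb K U (case_prod \<beta>) (point K (v, w)) = \<beta> v w" if "v \<in> carrier V" "w \<in> carrier W" for v w
    using bil_closed[OF \<beta>] that by (simp add: lincomb_point[OF U])
  have pc: "point K (v, w) \<in> carrier ?F" if "v \<in> carrier V" "w \<in> carrier W" for v w using that by simp
  have cl: "x \<oplus>[?F] y \<in> carrier ?F" "c \<odot>[?F] x \<in> carrier ?F" if "x \<in> carrier ?F" "y \<in> carrier ?F" "c \<in> carrier K" for x y c
    using vs_closed[OF vs_ma] that by auto
  note b = lin_add[OF bil1[OF \<beta>]] lin_add[OF bil2[OF \<beta>]] lin_smult[OF bil1[OF \<beta>]] lin_smult[OF bil2[OF \<beta>]] bil_closed[OF \<beta>]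
  have "submodule {f \<in> carrier ?F. lincomb K U (case_prod \<beta>) f \<in> {\<zero>[U]}} K ?F" (is "submodule ?N K _")
    by (rule submod_preimage[OF vs_ma U lc submod_null[OF U]])
  moreover have "lincomb K U (case_prod \<beta>) r = \<zero>[U]" if "r \<in> bilinear_relations K V W" for r
    using that unfolding bilinear_relations_def Let_def
    by (auto simp del: ma_simps simp: d p pc cl[OF _ _ zero_closed] cl(2)[OF _ pc] b V W vs_simps[OF U] vs_closed[OF U])
  ultimately have "tker V W \<subseteq> ?N" using bilinear_relations_sub[OF V W] by (intro span_min) auto
  then show ?thesis using assms by auto
qed

lemma tens_lift_lin: "tens_lift K U \<beta> \<in> lin (V >< W) U"
  unfolding tens_lift_def tensor_quot by (rule quot_lift_lin[OF vs_ma tker_submod[OF V W] U lc lc_ker])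

lemma tens_lift_tens: "[|v \<in> carrier V; w \<in> carrier W|] ==> tens_lift K U \<beta> (tens K V W v w) = \<beta> v w"
  unfolding tens_lift_def tens_coset
  by (subst quot_lift_proj[OF vs_ma tker_submod[OF V W] U lc lc_ker])
    (auto simp: lincomb_point[OF U] bil_closed[OF \<beta>])

end

lemma bil_cong:
  assumes "\<And>v w. [|v \<in> carrier V; w \<in> carrier W|] ==> \<beta> v w = \<gamma> v w" "vs V" "vs W" "\<beta> \<in> bil V W U"
  shows "\<gamma> \<in> bil V W U"
proof (rule bilI)
  show "(%w. \<gamma> v w) \<in> lin W U" if "v \<in> carrier V" for v
    using bil1[OF assms(4) that] lin_cong[of W "\<beta> v" "\<gamma> v" U] assms that by simp
  show "(%v. \<gamma> v w) \<in> lin V U" if "w \<in> carrier W" for w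
    using bil2[OF assms(4) that] lin_cong[of V "%v. \<beta> v w" "%v. \<gamma> v w" U] assms that by simp
qed

lemma tens_lift_eqI:
  assumes "vs V" "vs W" "vs U" "\<beta> \<in> bil V W U" "F \<in> lin (V >< W) U"
    and "\<And>v w. [|v \<in> carrier V; w \<in> carrier W|] ==> \<beta> v w = F (tens K V W v w)" "z \<in> carrier (V >< W)"
  shows "tens_lift K U \<beta> z = F z"
  by (rule tensor_ext[OF assms(1-3) tens_lift_lin[OF assms(1-4)] assms(5) _ assms(7)])
    (simp add: tens_lift_tens[OF assms(1-4)] assms(6))

lemma tens_lift_cong:
  assumes "\<And>v w. [|v \<in> carrier V; w \<in> carrier W|] ==> \<beta> v w = \<gamma> v w" "vs V" "vs W" "vs U" "\<gamma> \<in> bil V W U" "z \<in> carrier (V >< W)"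
  shows "tens_lift K U \<beta> z = tens_lift K U \<gamma> z"
proof -
  have "\<beta> \<in> bil V W U" by (rule bil_cong[OF _ assms(2,3,5)]) (use assms(1) in simp)
  then show ?thesis
    by (rule tens_lift_eqI[OF assms(2-4) _ tens_lift_lin[OF assms(2-5)] _ assms(6)])
      (simp add: assms(1) tens_lift_tens[OF assms(2-5)])
qed

lemma lin_tens_lift:
  assumes "vs V" "vs W" "vs U" "vs U'" "G \<in> lin U U'" "\<beta> \<in> bil V W U" "z \<in> carrier (V >< W)"
  shows "G (tens_lift K U \<beta> z) = tens_lift K U' (%v w. G (\<beta> v w)) z"
  by (rule sym, rule tens_lift_eqI[OF assms(1,2,4) _ lin_comp[OF assms(5) tens_lift_lin[OF assms(1-3,6)]] _ assms(7)])
    (auto intro!: bilI lin_comp[OF assms(5)] bil1[OF assms(6)] bil2[OF assms(6)] simp: tens_lift_tens[OF assms(1-3,6)])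

lemma tens_lift_self:
  assumes "vs V" "vs W" "z \<in> carrier (V >< W)"
  shows "tens_lift K (V >< W) (tens K V W) z = z"
  by (rule tens_lift_eqI[OF assms(1,2) _ tens_bil[OF assms(1,2)] lin_id _ assms(3)]) (use assms in auto)

text \<open>Iterated Sweedler sums are nested applications of \<open>tens_lift\<close>. The outer
  one needs a bilinear integrand, that is, the inner sum must depend linearly on the parameters of
  its own integrand.\<close>

lemma lin_tens_lift_param:
  assumes X: "vs X" and V: "vs V" and W: "vs W" and U: "vs U" and z: "z \<in> carrier (V >< W)"
    and b: "\<And>x. x \<in> carrier X ==> \<beta> x \<in> bil V W U"
    and l: "\<And>v w. [|v \<in> carrier V; w \<in> carrier W|] ==> (%x. \<beta> x v w) \<in> lin X U"
  shows "(%x. tens_lift K U (\<beta> x) z) \<in> lin X U"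
proof -
  let ?P = "{z \<in> carrier (V >< W). (%x. tens_lift K U (\<beta> x) z) \<in> lin X U}"
  have T: "vs (V >< W)" using V W by simp
  note L = tens_lift_lin[OF V W U b]
  have "submodule ?P K (V >< W)"
  proof (rule submodI[OF T])
    have "(%x. tens_lift K U (\<beta> x) \<zero>[V >< W]) \<in> lin X U \<longleftrightarrow> (%x. \<zero>[U]) \<in> lin X U"
      by (rule lin_cong) (use X lin_zero[OF L T U] in auto)
    then show "\<zero>[V >< W] \<in> ?P" using T lin_null[OF U] by simp
    fix u v assume uv: "u \<in> ?P" "v \<in> ?P"
    have "(%x. tens_lift K U (\<beta> x) (u \<oplus>[V >< W] v)) \<in> lin X U \<longleftrightarrow> (%x. tens_lift K U (\<beta> x) u \<oplus>[U] tens_lift K U (\<beta> x) v) \<in> lin X U"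
      by (rule lin_cong) (use X uv lin_add[OF L] in auto)
    moreover have "(%x. tens_lift K U (\<beta> x) u \<oplus>[U] tens_lift K U (\<beta> x) v) \<in> lin X U"
      by (rule lin_plus[OF U]) (use uv in auto)
    ultimately show "u \<oplus>[V >< W] v \<in> ?P" using T uv by simp
  next
    fix c u assume c: "c \<in> carrier K" and u: "u \<in> ?P"
    have "(%x. tens_lift K U (\<beta> x) (c \<odot>[V >< W] u)) \<in> lin X U \<longleftrightarrow> (%x. c \<odot>[U] tens_lift K U (\<beta> x) u) \<in> lin X U"
      by (rule lin_cong) (use X u c lin_smult[OF L] in auto)
    moreover have "(%x. c \<odot>[U] tens_lift K U (\<beta> x) u) \<in> lin X U"
      by (rule lin_scale[OF U c]) (use u in auto)
    ultimately show "c \<odot>[V >< W] u \<in> ?P" using T c u by simp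
  qed auto
  moreover have "tens K V W v w \<in> ?P" if "v \<in> carrier V" "w \<in> carrier W" for v w
  proof -
    have "(%x. tens_lift K U (\<beta> x) (tens K V W v w)) \<in> lin X U \<longleftrightarrow> (%x. \<beta> x v w) \<in> lin X U"
      by (rule lin_cong) (use X that tens_lift_tens[OF V W U b] in auto)
    then show ?thesis using that V W l by simp
  qed
  ultimately show ?thesis using tensor_induct[OF V W z] by blast
qed

lemma lin_tens_left: "[|vs V; vs W; v \<in> carrier V; f \<in> lin X W|] ==> (%x. tens K V W v (f x)) \<in> lin X (V >< W)"
  by (rule lin_comp[OF bil1[OF tens_bil]])

lemma lin_tens_right: "[|vs V; vs W; w \<in> carrier W; f \<in> lin X V|] ==> (%x. tens K V W (f x) w) \<in> lin X (V >< W)"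
  by (rule lin_comp[OF bil2[OF tens_bil]])

lemma ma_all:
  assumes P: "submodule P K (monoid_algebra K M)" and pt: "\<And>s. s \<in> carrier M ==> point K s \<in> P"
    and f: "f \<in> carrier (monoid_algebra K M)"
  shows "f \<in> P"
proof -
  note D = submodD[OF vs_ma P]
  have "f \<in> fin_funs K (carrier M)" using f by simp
  then show ?thesis
    by (induction rule: ff_induct) (use D pt in auto)
qed

lemma monoid_alg: "alg A ==> monoid A"
  using alg_ring ring.is_monoid by blast

context
  fixes A :: "('k, 'a, 'm) module_scheme" and B :: "('k, 'b, 'n) module_scheme"
  assumes A: "alg A" and B: "alg B"
begin

private lemma M: "monoid (A \<times>\<times> B)"
  by (rule DirProd_monoid) (use A B monoid_alg in auto)

private lemma VA: "vs A" and VB: "vs B"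
  using A B alg_vs by auto

private lemma pm:
  "[|a \<in> carrier A; b \<in> carrier B; c \<in> carrier A; d \<in> carrier B|] ==>
    point K (a, b) \<otimes>[tfree A B] point K (c, d) = point K (a \<otimes>[A] c, b \<otimes>[B] d)"
  using ma_mult_point[of "(a, b)" "A \<times>\<times> B" "(c, d)"] by simp

private lemma pc: "[|a \<in> carrier A; b \<in> carrier B|] ==> point K (a, b) \<in> carrier (tfree A B)"
  by simp

text \<open>Multiplication by a basis point (a, b) acts entrywise on basis points, through the
  linear maps given by multiplication with a and with b. A pair of linear maps carries each of the
  four kinds of bilinearity relations to a relation of the same kind, so the span of the relations
  is stable.\<close>

lemma tker_ideal: "ideal (tker A B) (tfree A B)"
proof (rule idealI'[OF alg_ma[OF M] tker_submod[OF VA VB]])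
  let ?F = "tfree A B" and ?J = "tker A B"
  have F: "alg ?F" by (rule alg_ma[OF M])
  note S = tker_submod[OF VA VB]
  note D = submodD[OF vs_ma S]
  have ac: "a \<in> carrier ?F" if "a \<in> ?J" for a using D(1) that by blast
  note cl = vs_closed[OF vs_ma]
  have rel: "L r \<in> ?J" if "r \<in> bilinear_relations K A B" and L: "L \<in> lin ?F ?F"
    and Lp: "\<And>c d. [|c \<in> carrier A; d \<in> carrier B|] ==> L (point K (c, d)) = point K (p c, q d)"
    and p: "p \<in> lin A A" and q: "q \<in> lin B B" for L r p q
  proof -
    note d = lin_diff[OF L vs_ma vs_ma] lin_add[OF L] lin_smult[OF L]
    note pq = lin_closed[OF p] lin_closed[OF q] lin_add[OF p] lin_add[OF q] lin_smult[OF p] lin_smult[OF q]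
    have "L r \<in> bilinear_relations K A B"
      using that(1) unfolding bilinear_relations_def Let_def
    proof (elim UnE CollectE exE conjE, goal_cases)
      case (1 u v w)
      then have "L r = point K (p u \<oplus>[A] p v, q w) \<ominus>[?F] (point K (p u, q w) \<oplus>[?F] point K (p v, q w))"
        using A B by (simp del: ma_simps add: d pc cl Lp pq)
      then show ?case using 1 pq by blast
    next
      case (2 u v w)
      then have "L r = point K (p u, q v \<oplus>[B] q w) \<ominus>[?F] (point K (p u, q v) \<oplus>[?F] point K (p u, q w))"
        using A B by (simp del: ma_simps add: d pc cl Lp pq)
      then show ?case using 2 pq by blast
    next
      case (3 c v w)
      then have "L r = point K (c \<odot>[A] p v, q w) \<ominus>[?F] c \<odot>[?F] point K (p v, q w)"
        using A B by (simp del: ma_simps add: d pc cl Lp pq)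
      then show ?case using 3 pq by blast
    next
      case (4 c v w)
      then have "L r = point K (p v, c \<odot>[B] q w) \<ominus>[?F] c \<odot>[?F] point K (p v, q w)"
        using A B by (simp del: ma_simps add: d pc cl Lp pq)
      then show ?case using 4 pq by blast
    qed
    then show ?thesis using span_incl by (rule subsetD[rotated])
  qed
  have ext: "L x \<in> ?J" if L: "L \<in> lin ?F ?F" and r: "\<And>r. r \<in> bilinear_relations K A B ==> L r \<in> ?J" and x: "x \<in> ?J" for L x
  proof -
    have "?J \<subseteq> {x \<in> carrier ?F. L x \<in> ?J}"
      by (rule span_min[OF submod_preimage[OF vs_ma vs_ma L S]]) (use r bilinear_relations_sub[OF VA VB] in auto)
    then show ?thesis using x by blast
  qed
  have idA: "(%y. a \<otimes>[A] y) \<in> lin A A" "(%y. y \<otimes>[A] a) \<in> lin A A" if "a \<in> carrier A" for a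
    using lin_mult_left[OF A that lin_id] lin_mult_right[OF A that lin_id] by auto
  have idB: "(%y. a \<otimes>[B] y) \<in> lin B B" "(%y. y \<otimes>[B] a) \<in> lin B B" if "a \<in> carrier B" for a
    using lin_mult_left[OF B that lin_id] lin_mult_right[OF B that lin_id] by auto
  fix f x assume f: "f \<in> carrier ?F" and x: "x \<in> ?J"
  have pt: "point K s \<otimes>[?F] x \<in> ?J" "x \<otimes>[?F] point K s \<in> ?J" if s: "s \<in> carrier (A \<times>\<times> B)" for s
  proof -
    obtain a b where ab: "s = (a, b)" "a \<in> carrier A" "b \<in> carrier B" using s by (cases s) auto
    have c: "point K s \<in> carrier ?F" using s by simp
    note L = lin_mult_left[OF F c lin_id] and R = lin_mult_right[OF F c lin_id]
    show "point K s \<otimes>[?F] x \<in> ?J"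
      by (rule ext[OF L rel[OF _ L _ idA(1)[OF ab(2)] idB(1)[OF ab(3)]] x]) (use ab pm in auto)
    show "x \<otimes>[?F] point K s \<in> ?J"
      by (rule ext[OF R rel[OF _ R _ idA(2)[OF ab(2)] idB(2)[OF ab(3)]] x]) (use ab pm in auto)
  qed
  have "f \<in> {f \<in> carrier ?F. f \<otimes>[?F] x \<in> ?J}"
    by (rule ma_all[OF submod_preimage[OF vs_ma vs_ma lin_mult_right[OF F ac[OF x] lin_id] S] _ f]) (use pt in auto)
  then show "f \<otimes>[?F] x \<in> ?J" by simp
  have "f \<in> {f \<in> carrier ?F. x \<otimes>[?F] f \<in> ?J}"
    by (rule ma_all[OF submod_preimage[OF vs_ma vs_ma lin_mult_left[OF F ac[OF x] lin_id] S] _ f]) (use pt in auto)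
  then show "x \<otimes>[?F] f \<in> ?J" by simp
qed

lemma alg_tensor [simp]: "alg (A >< B)"
  unfolding tensor_quot by (rule alg_quot[OF alg_ma[OF M] tker_ideal])

lemma tens_mult:
  "[|a \<in> carrier A; b \<in> carrier B; c \<in> carrier A; d \<in> carrier B|] ==>
    tens K A B a b \<otimes>[A >< B] tens K A B c d = tens K A B (a \<otimes>[A] c) (b \<otimes>[B] d)"
  unfolding tens_coset tensor_quot by (subst quot_mult[OF tker_ideal]) (simp_all add: pm)

lemma tens_one: "\<one>[A >< B] = tens K A B \<one>[A] \<one>[B]"
  unfolding tens_coset tensor_quot quot_one by (simp add: DirProd_def)

lemma tensor_homI:
  fixes C :: "('k, 'c, 'l) module_scheme"
  assumes C: "alg C" and \<beta>: "\<beta> \<in> bil A B C" and one: "\<beta> \<one>[A] \<one>[B] = \<one>[C]"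
    and mul: "\<And>a b c d. [|a \<in> carrier A; b \<in> carrier B; c \<in> carrier A; d \<in> carrier B|] ==>
      \<beta> (a \<otimes>[A] c) (b \<otimes>[B] d) = \<beta> a b \<otimes>[C] \<beta> c d"
  shows "tens_lift K C \<beta> \<in> ahom (A >< B) C"
proof -
  let ?F = "tens_lift K C \<beta>"
  have L: "?F \<in> lin (A >< B) C" by (rule tens_lift_lin[OF VA VB alg_vs[OF C] \<beta>])
  note t = tens_lift_tens[OF VA VB alg_vs[OF C] \<beta>]
  have T: "alg (A >< B)" by simp
  have 1: "?F (tens K A B a b \<otimes>[A >< B] w) = ?F (tens K A B a b) \<otimes>[C] ?F w"
    if ab: "a \<in> carrier A" "b \<in> carrier B" and w: "w \<in> carrier (A >< B)" for a b w
  proof (rule tensor_ext[OF VA VB alg_vs[OF C] _ _ _ w])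
    show "(%w. ?F (tens K A B a b \<otimes>[A >< B] w)) \<in> lin (A >< B) C"
      by (rule lin_comp[OF L lin_mult_left[OF T _ lin_id]]) (use ab VA VB in simp)
    show "(%w. ?F (tens K A B a b) \<otimes>[C] ?F w) \<in> lin (A >< B) C"
      by (rule lin_mult_left[OF C _ L]) (use ab VA VB lin_closed[OF L] in simp)
  qed (use ab A B in \<open>simp add: tens_mult t mul\<close>)
  show ?thesis
  proof (rule ahomI[OF L])
    show "?F \<one>[A >< B] = \<one>[C]" using A B by (simp add: tens_one t one)
    fix z w assume z: "z \<in> carrier (A >< B)" and w: "w \<in> carrier (A >< B)"
    show "?F (z \<otimes>[A >< B] w) = ?F z \<otimes>[C] ?F w"
    proof (rule tensor_ext[OF VA VB alg_vs[OF C] _ _ _ z])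
      show "(%z. ?F (z \<otimes>[A >< B] w)) \<in> lin (A >< B) C"
        by (rule lin_comp[OF L lin_mult_right[OF T w lin_id]])
      show "(%z. ?F z \<otimes>[C] ?F w) \<in> lin (A >< B) C"
        by (rule lin_mult_right[OF C lin_closed[OF L w] L])
    qed (use 1 w in simp)
  qed
qed

end

subsection \<open>Opposite algebras\<close>

text \<open>An antipode reverses products, so it is an algebra map into the opposite algebra. In
  this form it can be obtained from the universal properties of \<open>T\<close> and of its
  quotients.\<close>

definition op_alg :: "('k, 'a, 'm) module_scheme => ('k, 'a) module"
  where "op_alg A = \<lparr>carrier = carrier A, mult = (%x y. y \<otimes>[A] x), one = one A, zero = zero A, add = add A, smult = smult A\<rparr>"

lemma op_simps [simp]:
  "carrier (op_alg A) = carrier A" "x \<otimes>[op_alg A] y = y \<otimes>[A] x" "one (op_alg A) = one A"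
  "zero (op_alg A) = zero A" "add (op_alg A) = add A" "smult (op_alg A) = smult A"
  by (simp_all add: op_alg_def)

lemma lin_op [simp]: "lin V (op_alg A) = lin V A" "lin (op_alg A) V = lin A V"
  by (simp_all add: linear_maps_def)

lemma vs_op [simp]: "vs A ==> vs (op_alg A)"
  by (rule moduleI') (auto simp: vs_simps vs_distr vs_ac)

lemma alg_op [simp]: "alg A ==> alg (op_alg A)"
  by (rule algI) (auto simp: alg_vs alg_simps intro: lin_mult_left lin_mult_right lin_id)

subsection \<open>Generating sets\<close>

text \<open>Generation is expressed through left multiplication by one generator at a time. This
  yields an induction in which a product is taken apart at its first letter.\<close>

definition alg_gen :: "('k, 'a, 'm) module_scheme => 'a set => bool"
  where "alg_gen A S \<longleftrightarrow> S \<subseteq> carrier A \<and>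
    (\<forall>P. submodule P K A \<longrightarrow> \<one>[A] \<in> P \<longrightarrow> (\<forall>s\<in>S. \<forall>x\<in>P. s \<otimes>[A] x \<in> P) \<longrightarrow> carrier A \<subseteq> P)"

lemma alg_gen_induct:
  assumes "alg_gen A S" "submodule P K A" "\<one>[A] \<in> P" "\<And>s x. [|s \<in> S; x \<in> P|] ==> s \<otimes>[A] x \<in> P" "x \<in> carrier A"
  shows "x \<in> P"
  using assms unfolding alg_gen_def by blast

text \<open>The two maps are only linear. The antipode identities are proved in this way, since
  their left-hand sides are not known to be multiplicative. For algebra maps the step is automatic,
  which gives \<open>hom_ext\<close>.\<close>

lemma lin_gen_ext:
  assumes A: "alg A" and B: "vs B" and S: "alg_gen A S" and F: "F \<in> lin A B" "G \<in> lin A B"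
    and one: "F \<one>[A] = G \<one>[A]"
    and st: "\<And>s x. [|s \<in> S; x \<in> carrier A; F x = G x|] ==> F (s \<otimes>[A] x) = G (s \<otimes>[A] x)"
    and x: "x \<in> carrier A"
  shows "F x = G x"
proof -
  have Sc: "s \<in> carrier A" if "s \<in> S" for s using S that by (auto simp: alg_gen_def)
  have "submodule {x \<in> carrier A. F x = G x} K A"
    by (rule submodI) (use A B alg_vs[OF A] lin_zero[OF F(1)] lin_zero[OF F(2)] lin_add[OF F(1)] lin_add[OF F(2)]
      lin_smult[OF F(1)] lin_smult[OF F(2)] in auto)
  from alg_gen_induct[OF S this _ _ x] show ?thesis using A one st Sc by auto
qed

lemma hom_ext:
  assumes A: "alg A" and B: "alg B" and S: "alg_gen A S" and F: "F \<in> ahom A B" "G \<in> ahom A B"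
    and s: "\<And>s. s \<in> S ==> F s = G s" and x: "x \<in> carrier A"
  shows "F x = G x"
proof (rule lin_gen_ext[OF A alg_vs[OF B] S ahom_lin[OF F(1)] ahom_lin[OF F(2)] _ _ x])
  fix t y assume "t \<in> S" "y \<in> carrier A" "F y = G y"
  moreover have "t \<in> carrier A" using S \<open>t \<in> S\<close> by (auto simp: alg_gen_def)
  ultimately show "F (t \<otimes>[A] y) = G (t \<otimes>[A] y)" using ahom_mult[OF F(1)] ahom_mult[OF F(2)] s by simp
qed (use ahom_one[OF F(1)] ahom_one[OF F(2)] in simp)

lemma alg_gen_free: "alg_gen (free_algebra K S) ((%s. point K [s]) ` S)"
proof -
  have "carrier (free_algebra K S) \<subseteq> P" if "submodule P K (free_algebra K S)" "\<one>[free_algebra K S] \<in> P"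
    "\<forall>s\<in>(%s. point K [s]) ` S. \<forall>x\<in>P. s \<otimes>[free_algebra K S] x \<in> P" for P
    using free_algebra_induct[OF that(1)] that(2,3) by auto
  then show ?thesis by (auto simp: alg_gen_def)
qed

lemma alg_gen_quot:
  assumes A: "alg A" and J: "ideal J A" and S: "alg_gen A S"
  shows "alg_gen (algebra_quot A J) (a_r_coset A J ` S)"
proof -
  let ?Q = "algebra_quot A J"
  note h = quot_proj_hom[OF A J]
  have Sc: "s \<in> carrier A" if "s \<in> S" for s using S that by (auto simp: alg_gen_def)
  have "carrier ?Q \<subseteq> P" if P: "submodule P K ?Q" "\<one>[?Q] \<in> P" "\<forall>s\<in>a_r_coset A J ` S. \<forall>x\<in>P. s \<otimes>[?Q] x \<in> P" for P
  proof
    fix X assume "X \<in> carrier ?Q"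
    then obtain x where x: "x \<in> carrier A" "X = a_r_coset A J x" using quot_cases[OF alg_vs[OF A] ideal_submod[OF A J]] by metis
    have "x \<in> {x \<in> carrier A. a_r_coset A J x \<in> P}"
      by (rule alg_gen_induct[OF S submod_preimage[OF alg_vs[OF A] alg_vs[OF alg_quot[OF A J]] ahom_lin[OF h] P(1)] _ _ x(1)])
        (use A P Sc ahom_one[OF h] ahom_mult[OF h] in auto)
    then show "X \<in> P" using x by simp
  qed
  moreover have "a_r_coset A J ` S \<subseteq> carrier ?Q" using Sc ahom_closed[OF h] by auto
  ultimately show ?thesis by (auto simp: alg_gen_def)
qed

subsection \<open>Records with the same operations\<close>

text \<open>A bialgebra such as \<open>tkg\<close> and its underlying algebra
  \<open>tkg_algebra\<close> are records of different types. If all algebra operations coincide,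
  then ideals, homomorphisms, quotients and tensor products carry over.\<close>

definition same :: "('k, 'a, 'm) module_scheme => ('k, 'a, 'n) module_scheme => bool"
  where "same A B \<longleftrightarrow> carrier A = carrier B \<and> mult A = mult B \<and> one A = one B \<and> zero A = zero B \<and> add A = add B \<and> smult A = smult B"

lemma same_sym: "same A B ==> same B A" and same_refl: "same A A"
  by (auto simp: same_def)

lemma same_lin: "same A B ==> lin A V = lin B V" "same A B ==> lin V A = lin V B"
  by (auto simp: same_def linear_maps_def)

lemma same_a_inv: "same A B ==> a_inv A = a_inv B"
  by (rule ext) (simp add: same_def a_inv_def m_inv_def)

lemma same_vs: assumes "same A B" "vs A" shows "vs B"
  using assms(1) unfolding same_def
  by (intro moduleI') (use vs_closed[OF assms(2)] vs_simps[OF assms(2)] vs_distr[OF assms(2)] vs_ac[OF assms(2)] in auto)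

lemma same_alg: assumes "same A B" "alg A" shows "alg B"
  by (rule algI[OF same_vs[OF assms(1) alg_vs[OF assms(2)]]])
    (use assms(1) alg_closed[OF assms(2)] alg_simps[OF assms(2)] in \<open>auto simp: same_def intro!: linI\<close>)

lemma same_ahom: "same A B ==> ahom A C = ahom B C" "same A B ==> ahom C A = ahom C B"
  by (simp_all add: algebra_homs_def linear_maps_def ring_hom_def same_def)

lemma same_submod: assumes "same A B" "vs A" "submodule J K A" shows "submodule J K B"
  by (rule submodI[OF same_vs[OF assms(1,2)]]) (use submodD[OF assms(2,3)] assms(1) in \<open>auto simp: same_def\<close>)

lemma same_ideal: assumes "same A B" "alg A" "ideal J A" shows "ideal J B"
  by (rule idealI'[OF same_alg[OF assms(1,2)] same_submod[OF assms(1) alg_vs[OF assms(2)] ideal_submod[OF assms(2,3)]]])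
    (use ideal.I_l_closed[OF assms(3)] ideal.I_r_closed[OF assms(3)] assms(1) in \<open>auto simp: same_def\<close>)

lemma same_DirProd: "same A A' ==> same B B' ==> A \<times>\<times> B = A' \<times>\<times> B'"
  by (simp add: same_def DirProd_def)

lemma same_tensor: assumes "same A A'" "same B B'" shows "A >< B = A' >< B'" "tens K A B = tens K A' B'"
proof -
  have "bilinear_relations K A B = bilinear_relations K A' B'"
    using assms unfolding bilinear_relations_def Let_def same_DirProd[OF assms] by (simp add: same_def)
  then show "A >< B = A' >< B'" "tens K A B = tens K A' B'"
    by (auto simp: tensor_quot tens_coset same_DirProd[OF assms] fun_eq_iff)
qed

lemma same_quot: "same A B ==> algebra_quot A J = algebra_quot B J" "same A B ==> a_r_coset A J = a_r_coset B J"
proof -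
  assume s: "same A B"
  show c: "a_r_coset A J = a_r_coset B J" using s by (auto simp: fun_eq_iff a_r_coset_def r_coset_def same_def)
  show "algebra_quot A J = algebra_quot B J"
    using s by (simp add: algebra_quot_def FactRing_def ring.defs module.defs A_RCOSETS_def' rcoset_mult_def c set_add_def' same_def fun_eq_iff)
qed

lemma lincomb_submod:
  assumes W: "vs W" and P: "submodule P K W" and \<beta>: "\<And>s. s \<in> S ==> \<beta> s \<in> P" and f: "f \<in> fin_funs K S"
  shows "lincomb K W \<beta> f \<in> P"
proof -
  note D = submodD[OF W P]
  have \<beta>W: "\<beta> s \<in> carrier W" if "s \<in> S" for s using \<beta>[OF that] D(1) by blast
  show ?thesis using f
  proof (induction rule: ff_induct)
    case zero then show ?case using D by (simp add: lincomb_zero W)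
  next
    case (point s) then show ?case using \<beta> \<beta>W by (simp add: lincomb_point W)
  next
    case (add f g) then show ?case using D(3) by (simp add: lincomb_add[OF W _ _ \<beta>W])
  next
    case (smult c f) then show ?case using D(4) by (simp add: lincomb_smult[OF W _ _ \<beta>W])
  qed
qed

lemma lincomb_mult_right:
  assumes A: "alg A" and a: "a \<in> carrier A" and \<beta>: "\<And>s. s \<in> S ==> \<beta> s \<in> carrier A" and f: "f \<in> fin_funs K S"
  shows "lincomb K A \<beta> f \<otimes>[A] a = lincomb K A (%s. \<beta> s \<otimes>[A] a) f"
  by (rule lin_lincomb[OF lin_mult_right[OF A a lin_id] alg_vs[OF A] alg_vs[OF A] f \<beta>])

end

section \<open>The universal property of \<open>T_KG\<close>\<close>

locale tkg_pres = scalars K + G: group G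
  for K :: "('k, 'r) ring_scheme" (structure) and G :: "('g, 'z) monoid_scheme" +
  fixes I :: "'i set"
begin

abbreviation "KG \<equiv> monoid_algebra K G"
abbreviation "FA \<equiv> free_algebra K (I <+> carrier G)"
abbreviation "GR \<equiv> group_relations K G I"
abbreviation "T \<equiv> tkg_algebra K G I"
abbreviation "tn \<equiv> tkg_n K G I"
abbreviation "tg \<equiv> tkg_g K G I"
abbreviation "gens \<equiv> I <+> carrier G"

lemma alg_KG [simp]: "alg KG"
  by (rule alg_ma) (rule G.monoid_axioms)

lemma gens_iff [simp]: "Inl i \<in> gens \<longleftrightarrow> i \<in> I" "Inr g \<in> gens \<longleftrightarrow> g \<in> carrier G"
  by auto

lemma free_gen_closed: "s \<in> gens ==> point K [s] \<in> carrier FA"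
  by (simp add: lists.intros)

lemma GR_sub: "GR \<subseteq> carrier FA"
proof -
  have c: "point K [Inr g] \<in> carrier FA" if "g \<in> carrier G" for g using that by (intro free_gen_closed) auto
  show ?thesis
    unfolding group_relations_def Let_def
    using alg_closed[OF alg_free] by (auto simp del: ma_simps simp: c)
qed

lemma GR_ideal: "ideal (Idl\<^bsub>FA\<^esub> GR) FA"
  by (rule ring.genideal_ideal[OF alg_ring[OF alg_free] GR_sub])

lemma T_quot: "T = algebra_quot FA (Idl\<^bsub>FA\<^esub> GR)"
  by (simp add: tkg_algebra_def Let_def)

lemma tkg_gen_coset: "tkg_gen K G I s = a_r_coset FA (Idl\<^bsub>FA\<^esub> GR) (point K [s])"
  by (simp add: tkg_gen_def Let_def)

lemma alg_T [simp]: "alg T"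
  unfolding T_quot by (rule alg_quot[OF alg_free GR_ideal])

lemma vs_T [simp]: "vs T"
  by (rule alg_vs) simp

lemma T_proj: "a_r_coset FA (Idl\<^bsub>FA\<^esub> GR) \<in> ahom FA T"
  unfolding T_quot by (rule quot_proj_hom[OF alg_free GR_ideal])

lemma tkg_gen_closed [simp]: "s \<in> gens ==> tkg_gen K G I s \<in> carrier T"
  unfolding tkg_gen_coset by (rule ahom_closed[OF T_proj free_gen_closed])

lemma tn_closed [simp]: "i \<in> I ==> tn i \<in> carrier T" and tg_closed [simp]: "g \<in> carrier G ==> tg g \<in> carrier T"
  by auto

lemma T_gen: "alg_gen T (tkg_gen K G I ` gens)"
  using alg_gen_quot[OF alg_free GR_ideal alg_gen_free[of gens]]
  by (simp add: T_quot tkg_gen_coset image_image)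

lemma tg_mult: assumes "g \<in> carrier G" "h \<in> carrier G" shows "tg g \<otimes>[T] tg h = tg (g \<otimes>[G] h)"
proof -
  have c: "point K [Inr g] \<in> carrier FA" if "g \<in> carrier G" for g using that by (intro free_gen_closed) auto
  have "point K [Inr g] \<otimes>[FA] point K [Inr h] \<ominus>[FA] point K [Inr (g \<otimes>[G] h)] \<in> GR"
    using assms unfolding group_relations_def Let_def by blast
  then have "a_r_coset FA (Idl\<^bsub>FA\<^esub> GR) (point K [Inr g] \<otimes>[FA] point K [Inr h]) = tg (g \<otimes>[G] h)"
    unfolding tkg_gen_coset using assms c ring.genideal_self[OF alg_ring[OF alg_free] GR_sub]
    by (subst coset_eq[OF vs_ma ideal_submod[OF alg_free GR_ideal]]) (auto simp del: ma_simps)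
  then show ?thesis unfolding tkg_gen_coset using ahom_mult[OF T_proj c c] assms by simp
qed

lemma tg_one: "tg \<one>[G] = \<one>[T]"
proof -
  have c: "point K [Inr \<one>[G]] \<in> carrier FA" by (intro free_gen_closed) auto
  have "point K [Inr \<one>[G]] \<ominus>[FA] \<one>[FA] \<in> GR"
    unfolding group_relations_def Let_def by blast
  then have "tg \<one>[G] = a_r_coset FA (Idl\<^bsub>FA\<^esub> GR) \<one>[FA]"
    unfolding tkg_gen_coset using c ring.genideal_self[OF alg_ring[OF alg_free] GR_sub]
    by (subst coset_eq[OF vs_ma ideal_submod[OF alg_free GR_ideal]]) (auto simp del: ma_simps)
  then show ?thesis using ahom_one[OF T_proj] by simp
qed

text \<open>An algebra map out of \<^const>\<open>tkg_algebra\<close> is a family of elements and a group of units.\<close>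

definition T_datum :: "('k, 'c, 'm) module_scheme => ('i + 'g => 'c) => bool"
  where "T_datum C f \<longleftrightarrow> alg C \<and> (\<forall>s\<in>gens. f s \<in> carrier C) \<and> f (Inr \<one>[G]) = \<one>[C] \<and>
    (\<forall>g\<in>carrier G. \<forall>h\<in>carrier G. f (Inr (g \<otimes>[G] h)) = f (Inr g) \<otimes>[C] f (Inr h))"

lemma
  assumes f: "T_datum C f"
  shows T_lift_hom: "coset_lift (free_lift K C f) \<in> ahom T C"
    and T_lift_gen: "s \<in> gens ==> coset_lift (free_lift K C f) (tkg_gen K G I s) = f s"
proof -
  have C: "alg C" and fc: "\<And>s. s \<in> gens ==> f s \<in> carrier C" using f by (auto simp: T_datum_def)
  have h: "free_lift K C f \<in> ahom FA C" by (rule free_lift_hom[OF C fc])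
  have g: "free_lift K C f (point K [s]) = f s" if "s \<in> gens" for s by (rule free_lift_gen[OF C fc that])
  have c: "point K [s] \<in> carrier FA" if "s \<in> gens" for s using that by (intro free_gen_closed) auto
  have k: "free_lift K C f j = \<zero>[C]" if "j \<in> Idl\<^bsub>FA\<^esub> GR" for j
  proof (rule Idl_kernel[OF alg_free C h GR_sub _ that])
    fix r assume "r \<in> GR"
    then show "free_lift K C f r = \<zero>[C]"
      unfolding group_relations_def Let_def
    proof (elim UnE CollectE exE conjE)
      fix a b assume ab: "r = point K [Inr a] \<otimes>[FA] point K [Inr b] \<ominus>[FA] point K [Inr (a \<otimes>[G] b)]"
        and G: "a \<in> carrier G" "b \<in> carrier G"
      have s: "Inr a \<in> gens" "Inr b \<in> gens" "Inr (a \<otimes>[G] b) \<in> gens" using G by auto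
      show ?thesis unfolding ab
        using f G s c fc g alg_closed[OF alg_free] ahom_mult[OF h c c]
        by (simp add: lin_diff[OF ahom_lin[OF h] vs_ma alg_vs[OF C]] T_datum_def vs_simps[OF alg_vs[OF C]] C del: ma_simps)
    next
      assume "r \<in> {point K [Inr \<one>[G]] \<ominus>[FA] \<one>[FA]}"
      then have r: "r = point K [Inr \<one>[G]] \<ominus>[FA] \<one>[FA]" by simp
      have s: "Inr \<one>[G] \<in> gens" by auto
      show ?thesis unfolding r
        using f s c[OF s] fc[OF s] g[OF s] alg_closed[OF alg_free] ahom_one[OF h]
        by (simp add: lin_diff[OF ahom_lin[OF h] vs_ma alg_vs[OF C]] T_datum_def vs_simps[OF alg_vs[OF C]] C del: ma_simps)
    qed
  qed
  show "coset_lift (free_lift K C f) \<in> ahom T C"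
    unfolding T_quot by (rule quot_lift_hom[OF alg_free GR_ideal C h k])
  show "coset_lift (free_lift K C f) (tkg_gen K G I s) = f s" if "s \<in> gens"
    unfolding tkg_gen_coset
    by (subst quot_lift_proj[OF vs_ma ideal_submod[OF alg_free GR_ideal] alg_vs[OF C] ahom_lin[OF h] k])
      (use c[OF that] g[OF that] in auto)
qed

end

section \<open>Coordinates in \<open>V\<close> and quotients of \<open>T\<close>\<close>

locale smash_pres = tkg_pres K G I
  for K :: "('k, 'r) ring_scheme" (structure) and G :: "('g, 'z) monoid_scheme" and I :: "'i set" +
  fixes V :: "('k, 'v, 'm) module_scheme" and x :: "'i => 'v" and ga :: "'g => 'v => 'v"
  assumes V [simp]: "vs V" and basis: "vs_basis K V I x"
    and ga_lin: "g \<in> carrier G ==> ga g \<in> lin V V"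
    and ga_one: "v \<in> carrier V ==> ga \<one>[G] v = v"
    and ga_mult: "[|g \<in> carrier G; h \<in> carrier G; v \<in> carrier V|] ==> ga (g \<otimes>[G] h) v = ga g (ga h v)"
begin

abbreviation "cd \<equiv> coords K V I x"

lemma x_closed [simp]: "i \<in> I ==> x i \<in> carrier V"
  using basis by (auto simp: vs_basis_def)

lemma ga_closed [simp]: "[|g \<in> carrier G; v \<in> carrier V|] ==> ga g v \<in> carrier V"
  by (rule lin_closed[OF ga_lin])

lemma basis_bij: "bij_betw (lincomb K V x) (fin_funs K I) (carrier V)"
  using basis by (simp add: vs_basis_def)

lemma cd_closed [simp]: "v \<in> carrier V ==> cd v \<in> fin_funs K I"
  and lincomb_cd: "v \<in> carrier V ==> lincomb K V x (cd v) = v"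
  and cd_lincomb: "c \<in> fin_funs K I ==> cd (lincomb K V x c) = c"
  using bij_betw_inv_into_left[OF basis_bij] bij_betw_inv_into_right[OF basis_bij]
    bij_betw_apply[OF bij_betw_inv_into[OF basis_bij]]
  by (auto simp: coords_def)

lemma cd_x: "i \<in> I ==> cd (x i) = point K i"
  using cd_lincomb[of "point K i"] lincomb_point[OF V, of x i] by simp

lemma cd_lin: "cd \<in> lin V (fmod I)"
proof (rule linI)
  have L: "lincomb K V x \<in> lin (fmod I) V" by (rule lincomb_lin_fmod[OF V x_closed])
  have inj: "v = w" if "v \<in> fin_funs K I" "w \<in> fin_funs K I" "lincomb K V x v = lincomb K V x w" for v w
    using that cd_lincomb by metis
  fix u v assume u: "u \<in> carrier V" and v: "v \<in> carrier V"
  show "cd (u \<oplus>[V] v) = cd u \<oplus>[fmod I] cd v"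
    by (rule inj) (use u v lin_add[OF L, where u="cd u" and v="cd v"] in \<open>auto simp: lincomb_cd\<close>)
next
  note L = lincomb_lin_fmod[OF V, of I x]
  have inj: "v = w" if "v \<in> fin_funs K I" "w \<in> fin_funs K I" "lincomb K V x v = lincomb K V x w" for v w
    using that cd_lincomb by metis
  fix c v assume c: "c \<in> carrier K" and v: "v \<in> carrier V"
  show "cd (c \<odot>[V] v) = c \<odot>[fmod I] cd v"
    by (rule inj) (use c v lin_smult[OF L, where c=c and v="cd v"] in \<open>auto simp: lincomb_cd\<close>)
qed auto

text \<open>The linear extension of x_i \<mapsto> n_i. It is written with coordinates because
  \<open>tkg_embed\<close> is; for \<open>n = tn\<close> it is the part of \<open>tkg_embed\<close>
  that belongs to \<open>V\<close>.\<close>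

definition vext :: "('k, 'w, 'n) module_scheme => ('i => 'w) => 'v => 'w"
  where "vext W n v = lincomb K W n (cd v)"

lemma vext_lin: "[|vs W; \<And>i. i \<in> I ==> n i \<in> carrier W|] ==> vext W n \<in> lin V W"
  unfolding vext_def by (rule lin_comp[OF lincomb_lin_fmod cd_lin])

lemma vext_closed: "[|vs W; \<And>i. i \<in> I ==> n i \<in> carrier W; v \<in> carrier V|] ==> vext W n v \<in> carrier W"
  by (rule lin_closed[OF vext_lin])

lemma vext_x: "[|vs W; i \<in> I; n i \<in> carrier W|] ==> vext W n (x i) = n i"
  by (simp add: vext_def cd_x lincomb_point)

lemma vext_unique:
  assumes "vs W" "F \<in> lin V W" "v \<in> carrier V"
  shows "vext W (%i. F (x i)) v = F v"
proof -
  have "F (lincomb K V x (cd v)) = lincomb K W (%i. F (x i)) (cd v)"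
    by (rule lin_lincomb[OF assms(2) V assms(1) cd_closed[OF assms(3)] x_closed])
  then show ?thesis by (simp add: vext_def lincomb_cd assms(3))
qed

lemma lin_ext_V:
  assumes "vs W" "F \<in> lin V W" "F' \<in> lin V W" "\<And>i. i \<in> I ==> F (x i) = F' (x i)" "v \<in> carrier V"
  shows "F v = F' v"
proof -
  have "vext W (%i. F (x i)) v = vext W (%i. F' (x i)) v"
    unfolding vext_def by (rule lincomb_cong[OF assms(1) cd_closed[OF assms(5)]]) (use assms lin_closed[OF assms(2)] lin_closed[OF assms(3)] in auto)
  then show ?thesis using vext_unique assms by metis
qed

lemma lin_vext:
  assumes "F \<in> lin W U" "vs W" "vs U" "\<And>i. i \<in> I ==> n i \<in> carrier W" "v \<in> carrier V"
  shows "F (vext W n v) = vext U (%i. F (n i)) v"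
  unfolding vext_def by (rule lin_lincomb[OF assms(1-3) cd_closed[OF assms(5)] assms(4)])

lemma vext_cong:
  assumes "vs W" "\<And>i. i \<in> I ==> n i = n' i" "\<And>i. i \<in> I ==> n i \<in> carrier W" "v \<in> carrier V"
  shows "vext W n v = vext W n' v"
  unfolding vext_def by (rule lincomb_cong[OF assms(1) cd_closed[OF assms(4)] assms(2,3)])

subsection \<open>The algebras with prescribed commutation rule\<close>

text \<open>The correction \<open>B g i\<close> may be any element of KG. One construction then
  covers M, M' and M'', and also an extension M whose action is not yet known to have the form (a),
  as the converse requires.\<close>

definition Brel :: "('g => 'i => 'g => 'k) => ('k, 'g, 'i) tkg set"
  where "Brel B = {tg g \<otimes>[T] tn i \<ominus>[T] (vext T tn (ga g (x i)) \<oplus>[T] lincomb K T tg (B g i)) \<otimes>[T] tg g | g i. g \<in> carrier G \<and> i \<in> I}"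

abbreviation JB where "JB B \<equiv> Idl\<^bsub>T\<^esub> (Brel B)"
abbreviation XB where "XB B \<equiv> algebra_quot T (JB B)"
abbreviation xgen where "xgen B s \<equiv> a_r_coset T (JB B) (tkg_gen K G I s)"
abbreviation xn where "xn B i \<equiv> xgen B (Inl i)"
abbreviation xg where "xg B g \<equiv> xgen B (Inr g)"

text \<open>The ideal depends on the action only through its values at group elements and the
  vectors x_i. So M, M' and M'' enter only through their corrections \<open>B\<close>.\<close>

lemma smash_ideal_eq:
  assumes "\<And>g i. [|g \<in> carrier G; i \<in> I|] ==> actN (point K g) (x i, \<zero>[KG]) = (ga g (x i), B g i)"
  shows "smash_ideal K G V I x actN = JB B"
proof -
  have e: "tkg_embed K G V I x (actN (point K g) (x i, \<zero>[KG])) = vext T tn (ga g (x i)) \<oplus>[T] lincomb K T tg (B g i)"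
    if "g \<in> carrier G" "i \<in> I" for g i
    unfolding assms[OF that] by (simp add: tkg_embed_def vext_def Let_def)
  have "{tg g \<otimes>[T] tn i \<ominus>[T] tkg_embed K G V I x (actN (point K g) (x i, \<zero>[KG])) \<otimes>[T] tg g | g i. g \<in> carrier G \<and> i \<in> I} = Brel B"
    unfolding Brel_def using e by (intro Collect_cong) (metis (no_types, lifting))
  then show ?thesis unfolding smash_ideal_def Let_def by (rule arg_cong)
qed

lemma nuT_closed [simp]: "v \<in> carrier V ==> vext T tn v \<in> carrier T"
  by (rule vext_closed) auto

lemma glT_closed [simp]: "c \<in> fin_funs K (carrier G) ==> lincomb K T tg c \<in> carrier T"
  by (rule lincomb_closed) auto

definition B_datum :: "('g => 'i => 'g => 'k) => bool"
  where "B_datum B \<longleftrightarrow> (\<forall>g\<in>carrier G. \<forall>i\<in>I. B g i \<in> fin_funs K (carrier G))"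

context
  fixes B assumes B: "B_datum B"
begin

lemma B_closed: "[|g \<in> carrier G; i \<in> I|] ==> B g i \<in> fin_funs K (carrier G)"
  using B by (simp add: B_datum_def)

lemma Brel_sub: "Brel B \<subseteq> carrier T"
  by (auto simp: Brel_def B_closed)

lemma JB_ideal: "ideal (JB B) T"
  by (rule ring.genideal_ideal[OF alg_ring[OF alg_T] Brel_sub])

lemma alg_XB [simp]: "alg (XB B)"
  by (rule alg_quot[OF alg_T JB_ideal])

lemma vs_XB [simp]: "vs (XB B)"
  by (rule alg_vs) simp

lemma XB_proj: "a_r_coset T (JB B) \<in> ahom T (XB B)"
  by (rule quot_proj_hom[OF alg_T JB_ideal])

lemma xgen_closed [simp]: "s \<in> gens ==> xgen B s \<in> carrier (XB B)"
  by (rule ahom_closed[OF XB_proj tkg_gen_closed])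

lemma xn_closed [simp]: "i \<in> I ==> xn B i \<in> carrier (XB B)" and xg_closed [simp]: "g \<in> carrier G ==> xg B g \<in> carrier (XB B)"
  by auto

lemma XB_gen: "alg_gen (XB B) (xgen B ` gens)"
  using alg_gen_quot[OF alg_T JB_ideal T_gen] by (simp add: image_image)

lemma xg_mult: "[|g \<in> carrier G; h \<in> carrier G|] ==> xg B g \<otimes>[XB B] xg B h = xg B (g \<otimes>[G] h)"
  using ahom_mult[OF XB_proj, of "tg g" "tg h"] by (simp add: tg_mult)

lemma xg_one: "xg B \<one>[G] = \<one>[XB B]"
  using ahom_one[OF XB_proj] by (simp add: tg_one)

lemma nuX_closed [simp]: "v \<in> carrier V ==> vext (XB B) (xn B) v \<in> carrier (XB B)"
  by (rule vext_closed) auto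

lemma glX_closed [simp]: "c \<in> fin_funs K (carrier G) ==> lincomb K (XB B) (xg B) c \<in> carrier (XB B)"
  by (rule lincomb_closed) auto

lemma XB_proj_nu: "v \<in> carrier V ==> a_r_coset T (JB B) (vext T tn v) = vext (XB B) (xn B) v"
  by (rule lin_vext[OF ahom_lin[OF XB_proj]]) auto

lemma XB_proj_gl: "c \<in> fin_funs K (carrier G) ==> a_r_coset T (JB B) (lincomb K T tg c) = lincomb K (XB B) (xg B) c"
  by (rule lin_lincomb[OF ahom_lin[OF XB_proj]]) auto

lemma XB_rel:
  assumes g: "g \<in> carrier G" and i: "i \<in> I"
  shows "xg B g \<otimes>[XB B] xn B i = (vext (XB B) (xn B) (ga g (x i)) \<oplus>[XB B] lincomb K (XB B) (xg B) (B g i)) \<otimes>[XB B] xg B g"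
proof -
  note L = ahom_lin[OF XB_proj]
  let ?r = "vext T tn (ga g (x i)) \<oplus>[T] lincomb K T tg (B g i)"
  have c: "vext T tn (ga g (x i)) \<in> carrier T" "lincomb K T tg (B g i) \<in> carrier T"
    using g i by (auto simp: B_closed)
  have r: "?r \<in> carrier T" using c by simp
  have "tg g \<otimes>[T] tn i \<ominus>[T] ?r \<otimes>[T] tg g \<in> Brel B" using g i by (auto simp: Brel_def)
  then have "a_r_coset T (JB B) (tg g \<otimes>[T] tn i) = a_r_coset T (JB B) (?r \<otimes>[T] tg g)"
    using ring.genideal_self[OF alg_ring[OF alg_T] Brel_sub] g i r
    by (subst coset_eq[OF vs_T ideal_submod[OF alg_T JB_ideal]]) auto
  moreover have "a_r_coset T (JB B) (?r \<otimes>[T] tg g) = a_r_coset T (JB B) ?r \<otimes>[XB B] xg B g"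
    by (rule ahom_mult[OF XB_proj r tg_closed[OF g]])
  moreover have "a_r_coset T (JB B) ?r = vext (XB B) (xn B) (ga g (x i)) \<oplus>[XB B] lincomb K (XB B) (xg B) (B g i)"
    using g i by (simp add: lin_add[OF L c] XB_proj_nu XB_proj_gl B_closed)
  moreover have "a_r_coset T (JB B) (tg g \<otimes>[T] tn i) = xg B g \<otimes>[XB B] xn B i"
    by (rule ahom_mult[OF XB_proj tg_closed[OF g] tn_closed[OF i]])
  ultimately show ?thesis by simp
qed

definition XB_datum :: "('k, 'c, 'n) module_scheme => ('i + 'g => 'c) => bool"
  where "XB_datum C f \<longleftrightarrow> T_datum C f \<and> (\<forall>g\<in>carrier G. \<forall>i\<in>I. f (Inr g) \<otimes>[C] f (Inl i) =
    (vext C (%i. f (Inl i)) (ga g (x i)) \<oplus>[C] lincomb K C (%t. f (Inr t)) (B g i)) \<otimes>[C] f (Inr g))"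

text \<open>Two nested coset lifts, because the algebra is a quotient of \<open>T\<close>, which is
  itself a quotient of a free algebra.\<close>

definition XB_lift :: "('k, 'c, 'n) module_scheme => ('i + 'g => 'c) => ('k, 'g, 'i) tkg set => 'c"
  where "XB_lift C f = coset_lift (coset_lift (free_lift K C f))"

lemma
  assumes f: "XB_datum C f"
  shows XB_lift_hom: "XB_lift C f \<in> ahom (XB B) C"
    and XB_lift_gen: "\<And>s. s \<in> gens ==> XB_lift C f (xgen B s) = f s"
proof -
  have f': "T_datum C f" and C: "alg C" and fc: "\<And>s. s \<in> gens ==> f s \<in> carrier C" using f by (auto simp: T_datum_def XB_datum_def)
  note h = T_lift_hom[OF f'] and e = T_lift_gen[OF f'] note L = ahom_lin[OF h] and C' = alg_vs[OF C]
  let ?h = "coset_lift (free_lift K C f)"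
  have k: "?h j = \<zero>[C]" if "j \<in> JB B" for j
  proof (rule Idl_kernel[OF alg_T C h Brel_sub _ that])
    fix r assume "r \<in> Brel B"
    then obtain g i where g: "g \<in> carrier G" and i: "i \<in> I"
      and r: "r = tg g \<otimes>[T] tn i \<ominus>[T] (vext T tn (ga g (x i)) \<oplus>[T] lincomb K T tg (B g i)) \<otimes>[T] tg g"
      by (auto simp: Brel_def)
    have c: "vext T tn (ga g (x i)) \<in> carrier T" "lincomb K T tg (B g i) \<in> carrier T"
      using g i by (auto simp: B_closed)
    have "?h (vext T tn (ga g (x i))) = vext C (%i. ?h (tn i)) (ga g (x i))"
      by (rule lin_vext[OF L vs_T C']) (use g i in auto)
    also have "... = vext C (%i. f (Inl i)) (ga g (x i))" by (rule vext_cong[OF C']) (use g i e fc in auto)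
    finally have 1: "?h (vext T tn (ga g (x i))) = vext C (%i. f (Inl i)) (ga g (x i))" .
    have "?h (lincomb K T tg (B g i)) = lincomb K C (%t. ?h (tg t)) (B g i)"
      by (rule lin_lincomb[OF L vs_T C' B_closed[OF g i]]) auto
    also have "... = lincomb K C (%t. f (Inr t)) (B g i)" by (rule lincomb_cong[OF C' B_closed[OF g i]]) (use e fc in auto)
    finally have 2: "?h (lincomb K T tg (B g i)) = lincomb K C (%t. f (Inr t)) (B g i)" .
    have "?h r = ?h (tg g \<otimes>[T] tn i) \<ominus>[C] ?h ((vext T tn (ga g (x i)) \<oplus>[T] lincomb K T tg (B g i)) \<otimes>[T] tg g)"
      unfolding r by (rule lin_diff[OF L vs_T C']) (use c g i in auto)
    also have "?h (tg g \<otimes>[T] tn i) = f (Inr g) \<otimes>[C] f (Inl i)"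
      using ahom_mult[OF h tg_closed[OF g] tn_closed[OF i]] e g i by simp
    also have "?h ((vext T tn (ga g (x i)) \<oplus>[T] lincomb K T tg (B g i)) \<otimes>[T] tg g)
      = (vext C (%i. f (Inl i)) (ga g (x i)) \<oplus>[C] lincomb K C (%t. f (Inr t)) (B g i)) \<otimes>[C] f (Inr g)"
      using ahom_mult[OF h _ tg_closed[OF g]] lin_add[OF L c] c e g by (simp add: 1 2)
    also have "... = f (Inr g) \<otimes>[C] f (Inl i)" using f g i by (simp add: XB_datum_def)
    finally show "?h r = \<zero>[C]" using fc g i C by (simp add: vs_simps[OF C'] InlI InrI)
  qed
  show "XB_lift C f \<in> ahom (XB B) C"
    unfolding XB_lift_def by (rule quot_lift_hom[OF alg_T JB_ideal C h k])
  show "XB_lift C f (xgen B s) = f s" if "s \<in> gens" for s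
    unfolding XB_lift_def
    by (subst quot_lift_proj[OF vs_T ideal_submod[OF alg_T JB_ideal] C' L k]) (use that e in auto)
qed

end

end

context scalars
begin

subsection \<open>The algebra of endomorphisms\<close>

text \<open>Maps are cut off outside the carrier. Otherwise two endomorphisms that agree on the
  carrier could be different functions, and the algebra axioms, which are equations between
  functions, would fail.\<close>

definition End :: "('k, 'a, 'm) module_scheme => ('k, 'a => 'a) module"
  where "End P = \<lparr>carrier = lin P P \<inter> extensional (carrier P),
    mult = (%f g. restrict (%x. f (g x)) (carrier P)), one = restrict (%x. x) (carrier P),
    zero = restrict (%x. \<zero>[P]) (carrier P), add = (%f g. restrict (%x. f x \<oplus>[P] g x) (carrier P)),
    smult = (%c f. restrict (%x. c \<odot>[P] f x) (carrier P))\<rparr>"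

lemma End_simps:
  "carrier (End P) = lin P P \<inter> extensional (carrier P)"
  "p \<in> carrier P ==> (f \<otimes>[End P] g) p = f (g p)" "p \<in> carrier P ==> \<one>[End P] p = p"
  "p \<in> carrier P ==> \<zero>[End P] p = \<zero>[P]" "p \<in> carrier P ==> (f \<oplus>[End P] g) p = f p \<oplus>[P] g p"
  "p \<in> carrier P ==> (c \<odot>[End P] f) p = c \<odot>[P] f p"
  by (auto simp: End_def)

lemma lin_restrict: "vs P ==> restrict f (carrier P) \<in> lin P W \<longleftrightarrow> f \<in> lin P W"
  by (rule lin_cong) auto

lemma End_closed:
  assumes P: "vs P"
  shows "[|f \<in> carrier (End P); g \<in> carrier (End P)|] ==> f \<otimes>[End P] g \<in> carrier (End P)"
    "\<one>[End P] \<in> carrier (End P)" "\<zero>[End P] \<in> carrier (End P)"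
    "[|f \<in> carrier (End P); g \<in> carrier (End P)|] ==> f \<oplus>[End P] g \<in> carrier (End P)"
    "[|c \<in> carrier K; f \<in> carrier (End P)|] ==> c \<odot>[End P] f \<in> carrier (End P)"
  unfolding End_def
  by (simp_all add: lin_restrict[OF P] lin_id lin_null[OF P] lin_plus[OF P] lin_scale[OF P]) (rule lin_comp[of f P P g P]; simp)

lemma End_eqI: "[|f \<in> carrier (End P); g \<in> carrier (End P); \<And>p. p \<in> carrier P ==> f p = g p|] ==> f = g"
  unfolding End_def by (auto intro: extensionalityI)

lemma End_app: "[|f \<in> carrier (End P); p \<in> carrier P|] ==> f p \<in> carrier P"
  unfolding End_simps using lin_closed[of f P P p] by simp

lemma vs_End: assumes P: "vs P" shows "vs (End P)"
proof (rule moduleI')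
qed (rule End_closed[OF P] End_eqI[of _ P]; (simp add: End_closed[OF P] End_simps(2-) End_app vs_simps[OF P] vs_distr[OF P] vs_ac[OF P])+)+

lemma alg_End: assumes P: "vs P" shows "alg (End P)"
proof (rule algI[OF vs_End[OF P] End_closed(1)[OF P] End_closed(2)[OF P]])
  fix f assume f: "f \<in> carrier (End P)"
  then have L: "f \<in> lin P P" by (simp add: End_simps)
  show "(%g. f \<otimes>[End P] g) \<in> lin (End P) (End P)"
    by (rule linI; (rule End_closed[OF P] End_eqI[of _ P])?; simp add: f End_closed[OF P] End_simps(2-) End_app lin_add[OF L] lin_smult[OF L])
  show "(%g. g \<otimes>[End P] f) \<in> lin (End P) (End P)"
    by (rule linI; (rule End_closed[OF P] End_eqI[of _ P])?; simp add: f End_closed[OF P] End_simps(2-) End_app)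
qed (assumption | (rule End_eqI[of _ P]; simp add: End_closed[OF P] End_simps(2-) End_app P))+

lemma End_eval_lin: "vs P ==> p \<in> carrier P ==> (%f. f p) \<in> lin (End P) P"
  by (rule linI) (simp_all add: End_app End_simps(2-))

end

subsection \<open>A basis of the algebra with commutation rule\<close>

locale smash_alg = smash_pres K G I V x ga
  for K :: "('k, 'r) ring_scheme" (structure) and G :: "('g, 'z) monoid_scheme" and I :: "'i set"
    and V :: "('k, 'v, 'm) module_scheme" and x ga +
  fixes B assumes Bd: "B_datum B"
begin

declare in_listsD [rule del] in_listsI [rule del]

lemma Bc [simp]: "[|g \<in> carrier G; i \<in> I|] ==> B g i \<in> fin_funs K (carrier G)"
  by (rule B_closed[OF Bd])

lemmas X_alg [simp] = alg_XB[OF Bd] and X_vs [simp] = vs_XB[OF Bd] and xn_cl [simp] = xn_closed[OF Bd]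
  and xg_cl [simp] = xg_closed[OF Bd]

definition mon :: "'i list \<times> 'g => ('k, 'g, 'i) tkg set"
  where "mon z = foldr (%i y. xn B i \<otimes>[XB B] y) (fst z) (xg B (snd z))"

lemma mon_simps: "mon ([], h) = xg B h" "mon (i # w, h) = xn B i \<otimes>[XB B] mon (w, h)"
  by (simp_all add: mon_def)

abbreviation "WG \<equiv> lists I \<times> carrier G"

lemma mon_closed [simp]: "z \<in> WG ==> mon z \<in> carrier (XB B)"
proof -
  have "mon (w, h) \<in> carrier (XB B)" if "w \<in> lists I" "h \<in> carrier G" for w h
    using that(1) by induction (use that(2) in \<open>auto simp: mon_simps\<close>)
  note * = this
  show "z \<in> WG ==> mon z \<in> carrier (XB B)" by (cases z) (use * in auto)
qed

text \<open>The span of the words contains 1 and is stable under left multiplication by all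
  generators. For a letter this is immediate. For g the commutation rule replaces g n_i w by letters
  times g w and by elements t g times the shorter word w. Since the factors t g occur, the induction
  on the word treats all group elements at once.\<close>

lemma mon_span:
  assumes P: "submodule P K (XB B)" and m: "\<And>z. z \<in> WG ==> mon z \<in> P" and u: "u \<in> carrier (XB B)"
  shows "u \<in> P"
proof -
  let ?X = "XB B"
  let ?S = "span ?X (mon ` WG)"
  have sub: "mon ` WG \<subseteq> carrier ?X" by auto
  note S = span_submod[OF X_vs sub] note D = submodD[OF X_vs S]
  have ms: "mon z \<in> ?S" if "z \<in> WG" for z by (rule subsetD[OF span_incl imageI[OF that]])
  have stepI: "a \<otimes>[?X] y \<in> ?S" if a: "a \<in> carrier ?X" and st: "\<And>z. z \<in> WG ==> a \<otimes>[?X] mon z \<in> ?S" and y: "y \<in> ?S" for a y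
  proof -
    have "?S \<subseteq> {y \<in> carrier ?X. a \<otimes>[?X] y \<in> ?S}"
      by (rule span_min[OF submod_preimage[OF X_vs X_vs lin_mult_left[OF X_alg a lin_id] S]]) (use st in auto)
    then show ?thesis using y by blast
  qed
  have nS: "xn B i \<otimes>[?X] y \<in> ?S" if "i \<in> I" "y \<in> ?S" for i y
    by (rule stepI[OF xn_cl[OF that(1)] _ that(2)]) (use that ms in \<open>auto simp: mon_simps(2)[symmetric]\<close>)
  have gm: "\<And>g. g \<in> carrier G ==> xg B g \<otimes>[?X] mon (w, h) \<in> ?S" if w: "w \<in> lists I" and h: "h \<in> carrier G" for w h
    using w
  proof induction
    case Nil then show ?case using h ms[of "([], g \<otimes>[G] h)"] by (simp add: mon_simps xg_mult[OF Bd])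
  next
    case (Cons i w)
    let ?y = "xg B g \<otimes>[?X] mon (w, h)"
    have w: "mon (w, h) \<in> carrier ?X" using Cons h by simp
    have c: "ga g (x i) \<in> carrier V" using Cons by simp
    have yS: "?y \<in> ?S" using Cons by blast
    have y: "?y \<in> carrier ?X" using w Cons by simp
    have "xg B g \<otimes>[?X] mon (i # w, h) = (xg B g \<otimes>[?X] xn B i) \<otimes>[?X] mon (w, h)"
      using Cons w by (simp add: mon_simps alg_simps(5))
    also have "... = vext ?X (xn B) (ga g (x i)) \<otimes>[?X] ?y \<oplus>[?X] lincomb K ?X (xg B) (B g i) \<otimes>[?X] ?y"
      using Cons w nuX_closed[OF Bd c] glX_closed[OF Bd Bc] by (simp add: XB_rel[OF Bd] alg_simps(5,6))
    also have "vext ?X (xn B) (ga g (x i)) \<otimes>[?X] ?y = lincomb K ?X (%j. xn B j \<otimes>[?X] ?y) (cd (ga g (x i)))"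
      unfolding vext_def by (rule lincomb_mult_right[OF X_alg y _ cd_closed[OF c]]) auto
    also have "lincomb K ?X (xg B) (B g i) \<otimes>[?X] ?y = lincomb K ?X (%t. xg B t \<otimes>[?X] ?y) (B g i)"
      by (rule lincomb_mult_right[OF X_alg y, of "carrier G"]) (use Cons in auto)
    finally have e: "xg B g \<otimes>[?X] mon (i # w, h)
      = lincomb K ?X (%j. xn B j \<otimes>[?X] ?y) (cd (ga g (x i))) \<oplus>[?X] lincomb K ?X (%t. xg B t \<otimes>[?X] ?y) (B g i)" .
    have "lincomb K ?X (%j. xn B j \<otimes>[?X] ?y) (cd (ga g (x i))) \<in> ?S"
      by (rule lincomb_submod[OF X_vs S _ cd_closed[OF c]]) (rule nS[OF _ yS])
    moreover have "xg B t \<otimes>[?X] ?y \<in> ?S" if t: "t \<in> carrier G" for t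
    proof -
      have "xg B t \<otimes>[?X] ?y = xg B (t \<otimes>[G] g) \<otimes>[?X] mon (w, h)"
        using t Cons w by (simp add: alg_simps(5)[symmetric] xg_mult[OF Bd])
      then show ?thesis using Cons t by simp
    qed
    then have "lincomb K ?X (%t. xg B t \<otimes>[?X] ?y) (B g i) \<in> ?S"
      by (rule lincomb_submod[OF X_vs S, of "carrier G"]) (use Cons in auto)
    ultimately show ?case unfolding e by (rule D(3))
  qed
  have "u \<in> ?S"
  proof (rule alg_gen_induct[OF XB_gen[OF Bd] S _ _ u])
    show "\<one>[?X] \<in> ?S" using ms[of "([], \<one>[G])"] by (simp add: mon_simps xg_one[OF Bd])
    fix s y assume s: "s \<in> xgen B ` gens" and y: "y \<in> ?S"
    then consider i where "i \<in> I" "s = xn B i" | g where "g \<in> carrier G" "s = xg B g" by auto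
    then show "s \<otimes>[?X] y \<in> ?S"
    proof cases
      case 1 then show ?thesis using nS y by simp
    next
      case 2 then show ?thesis using gm by (auto intro!: stepI[OF xg_cl _ y])
    qed
  qed
  moreover have "?S \<subseteq> P" by (rule span_min[OF P]) (use m in auto)
  ultimately show ?thesis by blast
qed

abbreviation "PM \<equiv> fmod WG"

definition nop :: "'i => ('i list \<times> 'g => 'k) => 'i list \<times> 'g => 'k"
  where "nop i = lincomb K PM (%z. point K (i # fst z, snd z))"

text \<open>\<open>GO w g h\<close> is what the product of g and the word w h has to be in normal
  form. The recursion is the commutation rule read from left to right; in the correction term t
  passes through w together with g, which is why the recursive call contains t g.\<close>

primrec GO :: "'i list => 'g => 'g => 'i list \<times> 'g => 'k"
  where "GO [] g h = point K ([], g \<otimes>[G] h)"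
  | "GO (i # w) g h = vext PM (%j. nop j (GO w g h)) (ga g (x i)) \<oplus>[PM] lincomb K PM (%t. GO w (t \<otimes>[G] g) h) (B g i)"

definition gop :: "'g => ('i list \<times> 'g => 'k) => 'i list \<times> 'g => 'k"
  where "gop g = lincomb K PM (%z. GO (fst z) g (snd z))"

lemma nop_lin: "i \<in> I ==> nop i \<in> lin PM PM"
  unfolding nop_def by (rule lincomb_lin_fmod) auto

lemma nop_closed: "[|i \<in> I; p \<in> carrier PM|] ==> nop i p \<in> carrier PM"
  by (rule lin_closed[OF nop_lin])

lemma nop_point: "[|i \<in> I; w \<in> lists I; h \<in> carrier G|] ==> nop i (point K (w, h)) = point K (i # w, h)"
  unfolding nop_def by (subst lincomb_point) auto

lemma NV_closed: "[|v \<in> carrier V; p \<in> carrier PM|] ==> vext PM (%j. nop j p) v \<in> carrier PM"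
  by (rule vext_closed[OF vs_fmod nop_closed])

lemma GO_closed: "[|w \<in> lists I; g \<in> carrier G; h \<in> carrier G|] ==> GO w g h \<in> carrier PM"
proof (induction w arbitrary: g)
  case Nil then show ?case by simp
next
  case (Cons i w)
  have "vext PM (%j. nop j (GO w g h)) (ga g (x i)) \<in> carrier PM"
    by (rule NV_closed) (use Cons in auto)
  moreover have "lincomb K PM (%t. GO w (t \<otimes>[G] g) h) (B g i) \<in> carrier PM"
    by (rule lincomb_closed[OF vs_fmod, of _ "carrier G"]) (use Cons in auto)
  ultimately show ?case unfolding GO.simps by (rule vs_closed(1)[OF vs_fmod])
qed

lemma gop_lin: "g \<in> carrier G ==> gop g \<in> lin PM PM"
  unfolding gop_def by (rule lincomb_lin_fmod[OF vs_fmod]) (auto intro: GO_closed simp del: fmod_simps)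

lemma gop_closed: "[|g \<in> carrier G; p \<in> carrier PM|] ==> gop g p \<in> carrier PM"
  by (rule lin_closed[OF gop_lin])

lemma gop_point: "[|g \<in> carrier G; w \<in> lists I; h \<in> carrier G|] ==> gop g (point K (w, h)) = GO w g h"
  unfolding gop_def by (subst lincomb_point) (auto simp: GO_closed simp del: fmod_simps)

lemma NV_lin: "v \<in> carrier V ==> f \<in> lin W PM ==> vs W ==> (%p. vext PM (%j. nop j (f p)) v) \<in> lin W PM"
  unfolding vext_def by (rule lincomb_fun_lin[OF vs_fmod cd_closed]) (auto intro: lin_comp[OF nop_lin])

lemma gsum_lin:
  "[|g \<in> carrier G; c \<in> fin_funs K (carrier G)|] ==> (%p. lincomb K PM (%t. gop (t \<otimes>[G] g) p) c) \<in> lin PM PM"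
  by (rule lincomb_fun_lin[OF vs_fmod _ _ vs_fmod]) (auto intro: gop_lin)

text \<open>On words this is the recursion for \<open>GO\<close>. It is the commutation rule as an
  identity of operators, stated before \<open>gop\<close> is known to be multiplicative; hence the
  sum contains \<open>gop (t \<otimes>[G] g)\<close> and not a composite.\<close>

lemma gop_nop:
  assumes g: "g \<in> carrier G" and i: "i \<in> I" and p: "p \<in> carrier PM"
  shows "gop g (nop i p) = vext PM (%j. nop j (gop g p)) (ga g (x i)) \<oplus>[PM] lincomb K PM (%t. gop (t \<otimes>[G] g) p) (B g i)"
proof (rule lin_ext_fmod[where S = WG and W = PM and F = "%p. gop g (nop i p)"])
  show "(%p. gop g (nop i p)) \<in> lin PM PM" by (rule lin_comp[OF gop_lin[OF g] nop_lin[OF i]])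
  show "(%p. vext PM (%j. nop j (gop g p)) (ga g (x i)) \<oplus>[PM] lincomb K PM (%t. gop (t \<otimes>[G] g) p) (B g i)) \<in> lin PM PM"
    by (rule lin_plus[OF vs_fmod NV_lin[OF _ gop_lin[OF g] vs_fmod] gsum_lin]) (use g i in auto)
  fix z assume "z \<in> WG"
  then obtain w h where z: "z = (w, h)" "w \<in> lists I" "h \<in> carrier G" by auto
  have "lincomb K PM (%t. gop (t \<otimes>[G] g) (point K z)) (B g i) = lincomb K PM (%t. GO w (t \<otimes>[G] g) h) (B g i)"
    by (rule lincomb_cong[OF vs_fmod Bc[OF g i]]) (use z g in \<open>auto simp: gop_point GO_closed simp del: fmod_simps\<close>)
  then show "gop g (nop i (point K z)) = vext PM (%j. nop j (gop g (point K z))) (ga g (x i)) \<oplus>[PM] lincomb K PM (%t. gop (t \<otimes>[G] g) (point K z)) (B g i)"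
    using z i g by (simp add: nop_point gop_point del: fmod_simps)
qed (use p in auto)

abbreviation "BV g \<equiv> vext KG (B g)"

lemma gop_NV:
  assumes g: "g \<in> carrier G" and v: "v \<in> carrier V" and p: "p \<in> carrier PM"
  shows "gop g (vext PM (%j. nop j p) v) = vext PM (%j. nop j (gop g p)) (ga g v) \<oplus>[PM] lincomb K PM (%t. gop (t \<otimes>[G] g) p) (BV g v)"
proof (rule lin_ext_V[where W = PM and F = "%v. gop g (vext PM (%j. nop j p) v)", OF vs_fmod _ _ _ v])
  have n: "nop i p \<in> carrier PM" "nop i (gop g p) \<in> carrier PM" if "i \<in> I" for i using that p g nop_closed gop_closed by blast+
  show "(%v. gop g (vext PM (%j. nop j p) v)) \<in> lin V PM"
    by (rule lin_comp[OF gop_lin[OF g] vext_lin[OF vs_fmod n(1)]])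
  have L: "lincomb K PM (%t. gop (t \<otimes>[G] g) p) \<in> lin KG PM"
    by (rule lincomb_lin[OF vs_fmod]) (use g p gop_closed in blast)
  have bl: "BV g \<in> lin V KG" by (rule vext_lin[OF vs_ma]) (use g in simp)
  show "(%v. vext PM (%j. nop j (gop g p)) (ga g v) \<oplus>[PM] lincomb K PM (%t. gop (t \<otimes>[G] g) p) (BV g v)) \<in> lin V PM"
    by (rule lin_plus[OF vs_fmod lin_comp[OF vext_lin[OF vs_fmod n(2)] ga_lin[OF g]] lin_comp[OF L bl]])
  show "gop g (vext PM (%j. nop j p) (x i)) = vext PM (%j. nop j (gop g p)) (ga g (x i)) \<oplus>[PM] lincomb K PM (%t. gop (t \<otimes>[G] g) p) (BV g (x i))"
    if i: "i \<in> I" for i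
    using n(1)[OF i] i g p by (simp add: vext_x gop_nop del: fmod_simps ma_simps) (simp add: vext_x)
qed

end

definition (in tkg_pres) gconj :: "'g => ('g => 'k) => 'g => 'k"
  where "gconj g = lincomb K KG (%t. point K (g \<otimes>[G] t \<otimes>[G] inv\<^bsub>G\<^esub> g))"

lemma (in tkg_pres) gconj_closed: "[|g \<in> carrier G; c \<in> fin_funs K (carrier G)|] ==> gconj g c \<in> fin_funs K (carrier G)"
  unfolding gconj_def using lincomb_closed[OF vs_ma, of c "carrier G" "%t. point K (g \<otimes>[G] t \<otimes>[G] inv\<^bsub>G\<^esub> g)" G] by auto

lemma (in tkg_pres) gconj_one: "c \<in> fin_funs K (carrier G) ==> gconj \<one>[G] c = c"
proof -
  assume c: "c \<in> fin_funs K (carrier G)"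
  have "lincomb K KG (%t. point K (\<one>[G] \<otimes>[G] t \<otimes>[G] inv\<^bsub>G\<^esub> \<one>[G])) c = lincomb K KG (point K) c"
    by (rule lincomb_cong[OF vs_ma c]) auto
  also have "... = c"
    by (rule lin_ext[OF lincomb_lin[OF vs_ma] lin_id vs_ma _ c]) (auto simp: lincomb_point)
  finally show ?thesis by (simp add: gconj_def)
qed

text \<open>\<open>Bcoc\<close> is the equation (g h) x_i = g (h x_i) in V \<oplus> KG, read in the
  component KG; \<open>gconj g\<close> is the action of g on this component. It is what makes the
  operators \<open>gop\<close> multiplicative in the group element.\<close>

locale smash_pbw = smash_alg K G I V x ga B
  for K :: "('k, 'r) ring_scheme" (structure) and G :: "('g, 'z) monoid_scheme" and I :: "'i set"
    and V :: "('k, 'v, 'm) module_scheme" and x ga B +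
  assumes Bcoc: "[|g \<in> carrier G; h \<in> carrier G; i \<in> I|] ==>
    B (g \<otimes>[G] h) i = vext KG (B g) (ga h (x i)) \<oplus>[KG] gconj g (B h i)"
begin

text \<open>The cocycle identity at g = h = 1 reads B = B + B.\<close>

lemma B_one: "i \<in> I ==> B \<one>[G] i = \<zero>[KG]"
proof -
  assume i: "i \<in> I"
  have c: "B \<one>[G] i \<in> carrier KG" using i by simp
  have "B \<one>[G] i = B \<one>[G] i \<oplus>[KG] B \<one>[G] i"
    using Bcoc[of "\<one>[G]" "\<one>[G]" i] i by (simp add: ga_one gconj_one vext_x del: ma_simps(3)) 
  then have "\<zero>[KG] \<oplus>[KG] B \<one>[G] i = B \<one>[G] i \<oplus>[KG] B \<one>[G] i" using c by (simp add: vs_simps[OF vs_ma] del: ma_simps)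
  then show ?thesis using vs_cancel[OF vs_ma _ c c] by (metis vs_closed(2) vs_ma)
qed

lemma GO_one: "[|w \<in> lists I; h \<in> carrier G|] ==> GO w \<one>[G] h = point K (w, h)"
proof (induction w)
  case (Cons i w)
  have n: "nop i (point K (w, h)) \<in> carrier PM" by (rule nop_closed) (use Cons in auto)
  have p: "point K (i # w, h) \<in> carrier PM" using Cons by simp
  have "vext PM (%j. nop j (GO w \<one>[G] h)) (ga \<one>[G] (x i)) = point K (i # w, h)"
    using Cons n by (simp add: ga_one vext_x nop_point del: fmod_simps)
  moreover have "lincomb K PM (%t. GO w (t \<otimes>[G] \<one>[G]) h) (B \<one>[G] i) = \<zero>[PM]"
    using B_one[of i] Cons by (simp add: lincomb_zero)
  ultimately show ?case unfolding GO.simps using vs_simps(2)[OF vs_fmod p] by simp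
qed simp

text \<open>Let g act on the expansion of h n_i w. The letters of h x_i produce the correction B(g,
  h x_i). The terms t h w with t from B(h, x_i) become g t h w = (g t g\<inverse>) (g h) w and so
  carry conjugated coefficients. By \<open>Bcoc\<close> the two add up to B(g h, x_i), the
  correction in the expansion of (g h) n_i w.\<close>

lemma gop_GO:
  assumes w: "w \<in> lists I" and g: "g \<in> carrier G" and h: "h \<in> carrier G" and k: "k \<in> carrier G"
  shows "gop g (GO w h k) = GO w (g \<otimes>[G] h) k"
  using w g h
proof (induction w arbitrary: g h)
  case Nil
  then show ?case using k by (simp add: gop_point G.m_assoc del: fmod_simps)
next
  case (Cons i w)
  note gh = Cons.prems and i = Cons.hyps(1) and w = Cons.hyps(2) and IH = Cons.IH
  have q: "GO w h k \<in> carrier PM" by (rule GO_closed[OF w gh(2) k])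
  have v: "ga h (x i) \<in> carrier V" using gh i by simp
  have c1: "vext PM (%j. nop j (GO w h k)) (ga h (x i)) \<in> carrier PM" by (rule NV_closed[OF v q])
  have Gc: "GO w (t \<otimes>[G] h) k \<in> carrier PM" if "t \<in> carrier G" for t by (rule GO_closed) (use that w gh k in auto)
  have c2: "lincomb K PM (%t. GO w (t \<otimes>[G] h) k) (B h i) \<in> carrier PM"
    by (rule lincomb_closed[OF vs_fmod Bc[OF gh(2) i] Gc])
  let ?\<Theta> = "%t. GO w (t \<otimes>[G] (g \<otimes>[G] h)) k"
  have \<Theta>: "?\<Theta> t \<in> carrier PM" if "t \<in> carrier G" for t by (rule GO_closed) (use that w gh k in auto)
  have BVc: "BV g (ga h (x i)) \<in> fin_funs K (carrier G)"
    using vext_closed[OF vs_ma, of "B g" G "ga h (x i)"] gh i by simp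
  have 1: "gop g (vext PM (%j. nop j (GO w h k)) (ga h (x i)))
    = vext PM (%j. nop j (GO w (g \<otimes>[G] h) k)) (ga (g \<otimes>[G] h) (x i)) \<oplus>[PM] lincomb K PM ?\<Theta> (BV g (ga h (x i)))"
  proof -
    have "lincomb K PM (%t. gop (t \<otimes>[G] g) (GO w h k)) (BV g (ga h (x i))) = lincomb K PM ?\<Theta> (BV g (ga h (x i)))"
      by (rule lincomb_cong[OF vs_fmod BVc]) (use IH gh \<Theta> in \<open>auto simp: G.m_assoc simp del: fmod_simps\<close>)
    then show ?thesis using gop_NV[OF gh(1) v q] IH[OF gh] gh i by (simp add: ga_mult del: fmod_simps)
  qed
  have 2: "gop g (lincomb K PM (%t. GO w (t \<otimes>[G] h) k) (B h i)) = lincomb K PM ?\<Theta> (gconj g (B h i))"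
  proof -
    have cj: "g \<otimes>[G] t \<otimes>[G] inv\<^bsub>G\<^esub> g \<otimes>[G] (g \<otimes>[G] h) = g \<otimes>[G] (t \<otimes>[G] h)" if "t \<in> carrier G" for t
    proof -
      have "inv\<^bsub>G\<^esub> g \<otimes>[G] (g \<otimes>[G] h) = h" using gh by (simp add: G.m_assoc[symmetric])
      then show ?thesis using that gh by (simp add: G.m_assoc)
    qed
    have "gop g (lincomb K PM (%t. GO w (t \<otimes>[G] h) k) (B h i)) = lincomb K PM (%t. gop g (GO w (t \<otimes>[G] h) k)) (B h i)"
      by (rule lin_lincomb[OF gop_lin[OF gh(1)] vs_fmod vs_fmod Bc[OF gh(2) i] Gc])
    also have "... = lincomb K PM (%t. ?\<Theta> (g \<otimes>[G] t \<otimes>[G] inv\<^bsub>G\<^esub> g)) (B h i)"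
      by (rule lincomb_cong[OF vs_fmod Bc[OF gh(2) i]])
        (use IH gh Gc GO_closed[OF w _ k] in \<open>auto simp: cj simp del: fmod_simps\<close>)
    also have "... = lincomb K PM (%t. lincomb K PM ?\<Theta> (point K (g \<otimes>[G] t \<otimes>[G] inv\<^bsub>G\<^esub> g))) (B h i)"
      by (rule lincomb_cong[OF vs_fmod Bc[OF gh(2) i]])
        (use gh \<Theta> in \<open>auto simp: lincomb_point simp del: fmod_simps\<close>)
    also have "... = lincomb K PM ?\<Theta> (gconj g (B h i))"
      unfolding gconj_def
      by (rule lin_lincomb[OF lincomb_lin[OF vs_fmod \<Theta>] vs_ma vs_fmod Bc[OF gh(2) i], symmetric]) (use gh in auto)
    finally show ?thesis .
  qed
  have 3: "lincomb K PM ?\<Theta> (B (g \<otimes>[G] h) i) = lincomb K PM ?\<Theta> (BV g (ga h (x i))) \<oplus>[PM] lincomb K PM ?\<Theta> (gconj g (B h i))"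
    unfolding Bcoc[OF gh i] using lincomb_add[OF vs_fmod BVc gconj_closed[OF gh(1) Bc[OF gh(2) i]] \<Theta>] by simp
  have c: "lincomb K PM ?\<Theta> (BV g (ga h (x i))) \<in> carrier PM" "lincomb K PM ?\<Theta> (gconj g (B h i)) \<in> carrier PM"
    by (rule lincomb_closed[OF vs_fmod BVc \<Theta>], assumption)
      (rule lincomb_closed[OF vs_fmod gconj_closed[OF gh(1) Bc[OF gh(2) i]] \<Theta>])
  have c3: "vext PM (%j. nop j (GO w (g \<otimes>[G] h) k)) (ga (g \<otimes>[G] h) (x i)) \<in> carrier PM"
    by (rule NV_closed[OF _ GO_closed]) (use gh i w k in auto)
  show ?case unfolding GO.simps lin_add[OF gop_lin[OF gh(1)] c1 c2] 1 2 3 by (rule vs_ac(1)[OF vs_fmod c3 c])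
qed

lemma gop_mult:
  assumes g: "g \<in> carrier G" and h: "h \<in> carrier G" and p: "p \<in> carrier PM"
  shows "gop g (gop h p) = gop (g \<otimes>[G] h) p"
  by (rule lin_ext_fmod[OF lin_comp[OF gop_lin[OF g] gop_lin[OF h]] gop_lin vs_fmod])
    (use g h p in \<open>auto simp: gop_point gop_GO\<close>)

lemma gop_one: assumes p: "p \<in> carrier PM" shows "gop \<one>[G] p = p"
  by (rule lin_ext_fmod[OF gop_lin lin_id vs_fmod]) (use p in \<open>auto simp: gop_point GO_one\<close>)

definition opm :: "'i + 'g => ('i list \<times> 'g => 'k) => 'i list \<times> 'g => 'k"
  where "opm s = restrict (case s of Inl i => nop i | Inr g => gop g) (carrier PM)"

lemma opm_app: "p \<in> carrier PM ==> opm (Inl i) p = nop i p" "p \<in> carrier PM ==> opm (Inr g) p = gop g p"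
  by (simp_all add: opm_def)

lemma opm_closed: "s \<in> gens ==> opm s \<in> carrier (End PM)"
  unfolding opm_def End_simps by (auto simp: lin_restrict nop_lin gop_lin simp del: fmod_simps)

text \<open>The group relations are \<open>gop_one\<close> and \<open>gop_mult\<close>; the
  commutation rule is \<open>gop_nop\<close>, where the operators of t g are now split by
  multiplicativity.\<close>

lemma opm_datum: "XB_datum B (End PM) opm"
proof -
  note P = vs_fmod[of WG] note E = alg_End[OF P] note VE = alg_vs[OF E]
  have nc: "opm (Inl i) \<in> carrier (End PM)" if "i \<in> I" for i using opm_closed that by auto
  have gc: "opm (Inr g) \<in> carrier (End PM)" if "g \<in> carrier G" for g using opm_closed that by auto
  have one: "opm (Inr \<one>[G]) = \<one>[End PM]"
    by (rule End_eqI[of _ PM]) (auto simp: gc alg_closed[OF E] opm_app End_simps(3) gop_one simp del: fmod_simps)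
  have mul: "opm (Inr (g \<otimes>[G] h)) = opm (Inr g) \<otimes>[End PM] opm (Inr h)" if "g \<in> carrier G" "h \<in> carrier G" for g h
    by (rule End_eqI[of _ PM]) (use that in \<open>auto simp: gc alg_closed[OF E] opm_app End_simps(2) gop_mult gop_closed simp del: fmod_simps\<close>)
  have rel: "opm (Inr g) \<otimes>[End PM] opm (Inl i) =
    (vext (End PM) (%i. opm (Inl i)) (ga g (x i)) \<oplus>[End PM] lincomb K (End PM) (%t. opm (Inr t)) (B g i)) \<otimes>[End PM] opm (Inr g)"
    if g: "g \<in> carrier G" and i: "i \<in> I" for g i
  proof (rule End_eqI[of _ PM])
    have c: "vext (End PM) (%i. opm (Inl i)) (ga g (x i)) \<in> carrier (End PM)" 
      by (rule vext_closed[OF VE nc]) (use g i in auto)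
    have c': "lincomb K (End PM) (%t. opm (Inr t)) (B g i) \<in> carrier (End PM)"
      by (rule lincomb_closed[OF VE Bc[OF g i] gc])
    show "opm (Inr g) \<otimes>[End PM] opm (Inl i) \<in> carrier (End PM)"
      "(vext (End PM) (%i. opm (Inl i)) (ga g (x i)) \<oplus>[End PM] lincomb K (End PM) (%t. opm (Inr t)) (B g i)) \<otimes>[End PM] opm (Inr g) \<in> carrier (End PM)"
      using c c' g i nc gc E by auto
    fix p assume p: "p \<in> carrier PM"
    have q: "gop g p \<in> carrier PM" by (rule gop_closed[OF g p])
    note ev = End_eval_lin[OF P q]
    have 1: "vext (End PM) (%i. opm (Inl i)) (ga g (x i)) (gop g p) = vext PM (%i. opm (Inl i) (gop g p)) (ga g (x i))"
      by (rule lin_vext[OF ev VE P nc]) (use g i in auto)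
    also have "... = vext PM (%i. nop i (gop g p)) (ga g (x i))" using opm_app(1)[OF q] by simp
    finally have 1: "vext (End PM) (%i. opm (Inl i)) (ga g (x i)) (gop g p) = vext PM (%i. nop i (gop g p)) (ga g (x i))" .
    have "lincomb K (End PM) (%t. opm (Inr t)) (B g i) (gop g p) = lincomb K PM (%t. opm (Inr t) (gop g p)) (B g i)"
      by (rule lin_lincomb[OF ev VE P Bc[OF g i] gc])
    also have "... = lincomb K PM (%t. gop (t \<otimes>[G] g) p) (B g i)"
      by (rule lincomb_cong[OF P Bc[OF g i]]) (use g p q gop_closed in \<open>auto simp: opm_app gop_mult simp del: fmod_simps\<close>)
    finally have 2: "lincomb K (End PM) (%t. opm (Inr t)) (B g i) (gop g p) = lincomb K PM (%t. gop (t \<otimes>[G] g) p) (B g i)" .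
    show "(opm (Inr g) \<otimes>[End PM] opm (Inl i)) p = ((vext (End PM) (%i. opm (Inl i)) (ga g (x i))
        \<oplus>[End PM] lincomb K (End PM) (%t. opm (Inr t)) (B g i)) \<otimes>[End PM] opm (Inr g)) p"
      using p q g i by (simp add: End_simps(2,5) opm_app nop_closed gop_nop 1 2 del: fmod_simps)
  qed
  show ?thesis unfolding XB_datum_def[OF Bd] T_datum_def
    using E opm_closed one mul rel by blast
qed

text \<open>Coordinates with respect to the words \<^term>\<open>mon z\<close>: the algebra acts on the space \<^term>\<open>PM\<close> of formal words,
  and the orbit map of the empty word is inverse to the evaluation of words.\<close>

definition vec :: "('k, 'g, 'i) tkg set => 'i list \<times> 'g => 'k"
  where "vec u = XB_lift (End PM) opm u (point K ([], \<one>[G]))"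

lemma vac: "point K ([], \<one>[G]) \<in> carrier PM"
  by simp

lemma vec_lin: "vec \<in> lin (XB B) PM"
  unfolding vec_def by (rule lin_comp[OF End_eval_lin[OF vs_fmod vac] ahom_lin[OF XB_lift_hom[OF Bd opm_datum]]])

lemma vec_mon: "z \<in> WG ==> vec (mon z) = point K z"
proof -
  have "vec (mon (w, h)) = point K (w, h)" if "w \<in> lists I" and h: "h \<in> carrier G" for w h
    using that(1)
  proof induction
    case Nil
    have "XB_lift (End PM) opm (xg B h) = opm (Inr h)" by (rule XB_lift_gen[OF Bd opm_datum]) (use h in simp)
    then show ?case using h by (simp add: vec_def mon_simps opm_app vac gop_point del: fmod_simps)
  next
    case (Cons i w)
    have g: "XB_lift (End PM) opm (xn B i) = opm (Inl i)" by (rule XB_lift_gen[OF Bd opm_datum]) (use Cons in simp)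
    have m: "mon (w, h) \<in> carrier (XB B)" using Cons h by simp
    have p: "point K (w, h) \<in> carrier PM" using Cons h by simp
    show ?case using Cons h ahom_mult[OF XB_lift_hom[OF Bd opm_datum] xn_cl[OF Cons.hyps(1)] m] p
      by (simp add: vec_def mon_simps g End_simps(2) vac opm_app nop_point del: fmod_simps)
  qed
  note * = this
  show "z \<in> WG ==> vec (mon z) = point K z" by (cases z) (use * in auto)
qed

lemma lc_mon_lin: "lincomb K (XB B) mon \<in> lin PM (XB B)"
  by (rule lincomb_lin_fmod[OF X_vs mon_closed])

text \<open>For words this follows from \<open>vec_mon\<close>, and words span by
  \<open>mon_span\<close>. The two statements together say that the words form a basis.\<close>

lemma lc_vec: assumes u: "u \<in> carrier (XB B)" shows "lincomb K (XB B) mon (vec u) = u"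
proof -
  note L = lin_comp[OF lc_mon_lin vec_lin]
  have "submodule {u \<in> carrier (XB B). lincomb K (XB B) mon (vec u) = u} K (XB B)"
    by (rule submodI) (use lin_zero[OF L] lin_add[OF L] lin_smult[OF L] in auto)
  from mon_span[OF this _ u] show ?thesis by (auto simp: vec_mon lincomb_point[OF X_vs])
qed

end

subsection \<open>Cocategories\<close>

text \<open>A coalgebra with several objects. A single coalgebra is the case of one object.\<close>

locale cocat = scalars K for K :: "('k, 'r) ring_scheme" (structure) +
  fixes C :: "'o => 'o => ('k, 'h) module" and D :: "'o => 'o => 'o => 'h => ('k, 'h, 'h) tensor" and E :: "'o => 'h => 'k"
  assumes vsC [simp]: "module K (C a b)"
    and D_lin: "D c a b \<in> linear_maps K (C a b) (tensor K (C a c) (C c b))"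
    and E_lin: "E a \<in> linear_maps K (C a a) (base_algebra K)"
    and coassoc: "h \<in> carrier (C a b) ==>
      tens_lift K (tensor K (C a c) (tensor K (C c d) (C d b))) (%h' h3.
        tens_lift K (tensor K (C a c) (tensor K (C c d) (C d b)))
          (%h1 h2. tens K (C a c) (tensor K (C c d) (C d b)) h1 (tens K (C c d) (C d b) h2 h3)) (D c a d h')) (D d a b h) =
      tens_lift K (tensor K (C a c) (tensor K (C c d) (C d b))) (%h1 h'.
        tens_lift K (tensor K (C a c) (tensor K (C c d) (C d b)))
          (%h2 h3. tens K (C a c) (tensor K (C c d) (C d b)) h1 (tens K (C c d) (C d b) h2 h3)) (D d c b h')) (D c a b h)"
    and counit_left: "h \<in> carrier (C a b) ==> tens_lift K (C a b) (%h1 h2. E a h1 \<odot>[C a b] h2) (D a a b h) = h"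
    and counit_right: "h \<in> carrier (C a b) ==> tens_lift K (C a b) (%h1 h2. E b h2 \<odot>[C a b] h1) (D b a b h) = h"
begin

text \<open>Sweedler notation with objects: the sum of t(h_(1), h_(2)) for h in
  \<open>C a b\<close>, where h_(1) lies in \<open>C a c\<close> and h_(2) in
  \<open>C c b\<close>.\<close>

definition sw :: "'o => 'o => 'o => ('k, 'u, 'n) module_scheme => ('h => 'h => 'u) => 'h => 'u"
  where "sw c a b U t h = tens_lift K U t (D c a b h)"

lemma D_closed [simp]: "h \<in> carrier (C a b) ==> D c a b h \<in> carrier (C a c >< C c b)"
  by (rule lin_closed[OF D_lin])

lemma E_closed [simp]: "h \<in> carrier (C a a) ==> E a h \<in> carrier K"
  using lin_closed[OF E_lin] by simp

lemma sw_lin: "[|vs U; t \<in> bil (C a c) (C c b) U|] ==> sw c a b U t \<in> lin (C a b) U"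
  unfolding sw_def by (rule lin_comp[OF tens_lift_lin D_lin]) simp_all

lemma sw_lin_arg: "[|vs U; t \<in> bil (C a c) (C c b) U; f \<in> lin W (C a b)|] ==> (%x. sw c a b U t (f x)) \<in> lin W U"
  by (rule lin_comp[OF sw_lin])

lemma sw_lin_param:
  assumes "vs W" "vs U" "h \<in> carrier (C a b)" "\<And>x. x \<in> carrier W ==> t x \<in> bil (C a c) (C c b) U"
    "\<And>h1 h2. [|h1 \<in> carrier (C a c); h2 \<in> carrier (C c b)|] ==> (%x. t x h1 h2) \<in> lin W U"
  shows "(%x. sw c a b U (t x) h) \<in> lin W U"
  unfolding sw_def by (rule lin_tens_lift_param[OF assms(1) vsC vsC assms(2) _ assms(4,5)]) (use assms(3) in auto)

lemma sw_closed: "[|vs U; t \<in> bil (C a c) (C c b) U; h \<in> carrier (C a b)|] ==> sw c a b U t h \<in> carrier U"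
  by (rule lin_closed[OF sw_lin])

lemma sw_cong:
  assumes "\<And>h1 h2. [|h1 \<in> carrier (C a c); h2 \<in> carrier (C c b)|] ==> t h1 h2 = t' h1 h2"
    "vs U" "t' \<in> bil (C a c) (C c b) U" "h \<in> carrier (C a b)"
  shows "sw c a b U t h = sw c a b U t' h"
  unfolding sw_def by (rule tens_lift_cong[OF assms(1) vsC vsC assms(2,3)]) (use assms(4) in auto)

lemma lin_sw:
  assumes "F \<in> lin U U'" "vs U" "vs U'" "t \<in> bil (C a c) (C c b) U" "h \<in> carrier (C a b)"
  shows "F (sw c a b U t h) = sw c a b U' (%h1 h2. F (t h1 h2)) h"
  unfolding sw_def by (rule lin_tens_lift[OF vsC vsC assms(2,3,1,4)]) (use assms(5) in auto)

lemmas lin_rules = lin_id lin_Kmult_left lin_Kmult_right lin_scale lin_smult_vec lin_tens_left lin_tens_right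
  sw_lin_arg sw_lin_param

text \<open>A trilinear \<open>t\<close> factors through the threefold tensor product. Applying the
  resulting linear map to the axiom \<open>coassoc\<close> gives coassociativity inside an arbitrary
  expression.\<close>

lemma sw_assoc:
  assumes U: "vs U" and h: "h \<in> carrier (C a b)"
    and t1: "\<And>h2 h3. [|h2 \<in> carrier (C c d); h3 \<in> carrier (C d b)|] ==> (%h1. t h1 h2 h3) \<in> lin (C a c) U"
    and t2: "\<And>h1 h3. [|h1 \<in> carrier (C a c); h3 \<in> carrier (C d b)|] ==> (%h2. t h1 h2 h3) \<in> lin (C c d) U"
    and t3: "\<And>h1 h2. [|h1 \<in> carrier (C a c); h2 \<in> carrier (C c d)|] ==> (%h3. t h1 h2 h3) \<in> lin (C d b) U"
  shows "sw d a b U (%h' h3. sw c a d U (%h1 h2. t h1 h2 h3) h') h = sw c a b U (%h1 h'. sw d c b U (%h2 h3. t h1 h2 h3) h') h"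
proof -
  let ?P = "C c d >< C d b" and ?T = "C a c >< (C c d >< C d b)"
  let ?tn = "%h1 h2 h3. tens K (C a c) ?P h1 (tens K (C c d) (C d b) h2 h3)"
  let ?G = "%h1. tens_lift K U (t h1)"
  let ?F = "tens_lift K U ?G"
  have T: "vs ?T" and P: "vs ?P" by simp_all
  have b: "t h1 \<in> bil (C c d) (C d b) U" if "h1 \<in> carrier (C a c)" for h1
    by (rule bilI) (use that t2 t3 in auto)
  have G: "?G \<in> bil (C a c) ?P U"
  proof (rule bilI)
    show "?G h1 \<in> lin ?P U" if "h1 \<in> carrier (C a c)" for h1 by (rule tens_lift_lin[OF vsC vsC U b[OF that]])
    show "(%h1. ?G h1 z) \<in> lin (C a c) U" if "z \<in> carrier ?P" for z
      by (rule lin_tens_lift_param[OF vsC vsC vsC U that b t1])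
  qed
  have F: "?F \<in> lin ?T U" by (rule tens_lift_lin[OF vsC P U G])
  have Ft: "?F (?tn h1 h2 h3) = t h1 h2 h3" if "h1 \<in> carrier (C a c)" "h2 \<in> carrier (C c d)" "h3 \<in> carrier (C d b)" for h1 h2 h3
    using that by (simp add: tens_lift_tens[OF vsC P U G] tens_lift_tens[OF vsC vsC U b])
  have l1: "(%h1. ?tn h1 h2 h3) \<in> lin (C a c) ?T" if "h2 \<in> carrier (C c d)" "h3 \<in> carrier (C d b)" for h2 h3
    by (intro lin_rules) (use that in auto)
  have l2: "(%h2. ?tn h1 h2 h3) \<in> lin (C c d) ?T" if "h1 \<in> carrier (C a c)" "h3 \<in> carrier (C d b)" for h1 h3
    by (intro lin_rules) (use that in auto)
  have l3: "(%h3. ?tn h1 h2 h3) \<in> lin (C d b) ?T" if "h1 \<in> carrier (C a c)" "h2 \<in> carrier (C c d)" for h1 h2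
    by (intro lin_rules) (use that in auto)
  have bl: "(%h1 h2. ?tn h1 h2 h3) \<in> bil (C a c) (C c d) ?T" if "h3 \<in> carrier (C d b)" for h3
    by (intro bilI l1 l2) (use that in auto)
  have br: "(%h2 h3. ?tn h1 h2 h3) \<in> bil (C c d) (C d b) ?T" if "h1 \<in> carrier (C a c)" for h1
    by (intro bilI l3 l2) (use that in auto)
  have bl': "(%h' h3. sw c a d ?T (%h1 h2. ?tn h1 h2 h3) h') \<in> bil (C a d) (C d b) ?T"
    by (intro bilI lin_rules T bl l3) auto
  have br': "(%h1 h'. sw d c b ?T (%h2 h3. ?tn h1 h2 h3) h') \<in> bil (C a c) (C c b) ?T"
    by (intro bilI lin_rules T br l1) auto
  have tb: "(%h1 h2. t h1 h2 h3) \<in> bil (C a c) (C c d) U" if "h3 \<in> carrier (C d b)" for h3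
    by (intro bilI t1 t2) (use that in auto)
  have cl: "(%h' h3. sw c a d U (%h1 h2. t h1 h2 h3) h') \<in> bil (C a d) (C d b) U"
    by (intro bilI lin_rules U tb t3) auto
  have cr: "(%h1 h'. sw d c b U (%h2 h3. t h1 h2 h3) h') \<in> bil (C a c) (C c b) U"
    by (intro bilI lin_rules U b t1) auto
  have "?F (sw d a b ?T (%h' h3. sw c a d ?T (%h1 h2. ?tn h1 h2 h3) h') h)
    = sw d a b U (%h' h3. ?F (sw c a d ?T (%h1 h2. ?tn h1 h2 h3) h')) h"
    by (rule lin_sw[OF F T U bl' h])
  also have "... = sw d a b U (%h' h3. sw c a d U (%h1 h2. t h1 h2 h3) h') h"
  proof (rule sw_cong[OF _ U cl h])
    fix h' h3 assume 1: "h' \<in> carrier (C a d)" "h3 \<in> carrier (C d b)"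
    have "?F (sw c a d ?T (%h1 h2. ?tn h1 h2 h3) h') = sw c a d U (%h1 h2. ?F (?tn h1 h2 h3)) h'"
      by (rule lin_sw[OF F T U bl[OF 1(2)] 1(1)])
    also have "... = sw c a d U (%h1 h2. t h1 h2 h3) h'"
      by (rule sw_cong[OF Ft U tb[OF 1(2)] 1(1)]) (use 1 in auto)
    finally show "?F (sw c a d ?T (%h1 h2. ?tn h1 h2 h3) h') = sw c a d U (%h1 h2. t h1 h2 h3) h'" .
  qed
  finally have L: "?F (sw d a b ?T (%h' h3. sw c a d ?T (%h1 h2. ?tn h1 h2 h3) h') h)
    = sw d a b U (%h' h3. sw c a d U (%h1 h2. t h1 h2 h3) h') h" .
  have "?F (sw c a b ?T (%h1 h'. sw d c b ?T (%h2 h3. ?tn h1 h2 h3) h') h)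
    = sw c a b U (%h1 h'. ?F (sw d c b ?T (%h2 h3. ?tn h1 h2 h3) h')) h"
    by (rule lin_sw[OF F T U br' h])
  also have "... = sw c a b U (%h1 h'. sw d c b U (%h2 h3. t h1 h2 h3) h') h"
  proof (rule sw_cong[OF _ U cr h])
    fix h1 h' assume 1: "h1 \<in> carrier (C a c)" "h' \<in> carrier (C c b)"
    have "?F (sw d c b ?T (%h2 h3. ?tn h1 h2 h3) h') = sw d c b U (%h2 h3. ?F (?tn h1 h2 h3)) h'"
      by (rule lin_sw[OF F T U br[OF 1(1)] 1(2)])
    also have "... = sw d c b U (%h2 h3. t h1 h2 h3) h'"
      by (rule sw_cong[OF Ft U b[OF 1(1)] 1(2)]) (use 1 in auto)
    finally show "?F (sw d c b ?T (%h2 h3. ?tn h1 h2 h3) h') = sw d c b U (%h2 h3. t h1 h2 h3) h'" .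
  qed
  finally show ?thesis using L coassoc[OF h, of c d] unfolding sw_def by simp
qed

lemma sw_counit_left:
  assumes U: "vs U" and t: "t \<in> lin (C a b) U" and h: "h \<in> carrier (C a b)"
  shows "sw a a b U (%h1 h2. E a h1 \<odot>[U] t h2) h = t h"
proof -
  have b: "(%h1 h2. E a h1 \<odot>[C a b] h2) \<in> bil (C a a) (C a b) (C a b)" by (intro bilI lin_rules E_lin) auto
  have b': "(%h1 h2. E a h1 \<odot>[U] t h2) \<in> bil (C a a) (C a b) U"
    by (intro bilI lin_rules E_lin t U) (use lin_closed[OF t] in auto)
  have "t h = t (sw a a b (C a b) (%h1 h2. E a h1 \<odot>[C a b] h2) h)" using counit_left[OF h] by (simp add: sw_def)
  also have "... = sw a a b U (%h1 h2. t (E a h1 \<odot>[C a b] h2)) h" by (rule lin_sw[OF t vsC U b h])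
  also have "... = sw a a b U (%h1 h2. E a h1 \<odot>[U] t h2) h"
    by (rule sw_cong[OF _ U b' h]) (simp add: lin_smult[OF t])
  finally show ?thesis by simp
qed

lemma sw_counit_right:
  assumes U: "vs U" and t: "t \<in> lin (C a b) U" and h: "h \<in> carrier (C a b)"
  shows "sw b a b U (%h1 h2. E b h2 \<odot>[U] t h1) h = t h"
proof -
  have b: "(%h1 h2. E b h2 \<odot>[C a b] h1) \<in> bil (C a b) (C b b) (C a b)" by (intro bilI lin_rules E_lin) auto
  have b': "(%h1 h2. E b h2 \<odot>[U] t h1) \<in> bil (C a b) (C b b) U"
    by (intro bilI lin_rules E_lin t U) (use lin_closed[OF t] in auto)
  have "t h = t (sw b a b (C a b) (%h1 h2. E b h2 \<odot>[C a b] h1) h)" using counit_right[OF h] by (simp add: sw_def)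
  also have "... = sw b a b U (%h1 h2. t (E b h2 \<odot>[C a b] h1)) h" by (rule lin_sw[OF t vsC U b h])
  also have "... = sw b a b U (%h1 h2. E b h2 \<odot>[U] t h1) h"
    by (rule sw_cong[OF _ U b' h]) (simp add: lin_smult[OF t])
  finally show ?thesis by simp
qed

subsection \<open>Translations by functionals\<close>

abbreviation dual where "dual a b \<equiv> lin (C a b) (base_algebra K)"

lemma dual_closed: "\<alpha> \<in> dual a b ==> h \<in> carrier (C a b) ==> \<alpha> h \<in> carrier K"
  using lin_closed[of \<alpha> "C a b" "base_algebra K" h] by simp

text \<open>A functional on \<open>C a b\<close> moves the first object from a to b by h \<mapsto>
  \<alpha>(h_(1)) h_(2); \<open>rt\<close> does the same with the second object. The convolution of
  two functionals is one of them evaluated at a translate by the other.\<close>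

definition lt :: "'o => 'o => 'o => ('h => 'k) => 'h => 'h"
  where "lt a b c \<alpha> = sw b a c (C b c) (%h1 h2. \<alpha> h1 \<odot>[C b c] h2)"

definition rt :: "'o => 'o => 'o => ('h => 'k) => 'h => 'h"
  where "rt a b c \<beta> = sw b a c (C a b) (%h1 h2. \<beta> h2 \<odot>[C a b] h1)"

lemma lt_bil: "\<alpha> \<in> dual a b ==> (%h1 h2. \<alpha> h1 \<odot>[C b c] h2) \<in> bil (C a b) (C b c) (C b c)"
  by (intro bilI lin_rules) (auto simp: dual_closed)

lemma rt_bil: "\<beta> \<in> dual b c ==> (%h1 h2. \<beta> h2 \<odot>[C a b] h1) \<in> bil (C a b) (C b c) (C a b)"
  by (intro bilI lin_rules) (auto simp: dual_closed)

lemma lt_lin: "\<alpha> \<in> dual a b ==> lt a b c \<alpha> \<in> lin (C a c) (C b c)"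
  unfolding lt_def by (rule sw_lin[OF vsC lt_bil])

lemma rt_lin: "\<beta> \<in> dual b c ==> rt a b c \<beta> \<in> lin (C a c) (C a b)"
  unfolding rt_def by (rule sw_lin[OF vsC rt_bil])

lemma lt_closed: "\<alpha> \<in> dual a b ==> h \<in> carrier (C a c) ==> lt a b c \<alpha> h \<in> carrier (C b c)"
  by (rule lin_closed[OF lt_lin])

lemma rt_closed: "\<beta> \<in> dual b c ==> h \<in> carrier (C a c) ==> rt a b c \<beta> h \<in> carrier (C a b)"
  by (rule lin_closed[OF rt_lin])

lemma lin_lt:
  assumes F: "F \<in> lin (C b c) U" and U: "vs U" and \<alpha>: "\<alpha> \<in> dual a b" and h: "h \<in> carrier (C a c)"
  shows "F (lt a b c \<alpha> h) = sw b a c U (%h1 h2. \<alpha> h1 \<odot>[U] F h2) h"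
proof -
  have "(%h1 h2. \<alpha> h1 \<odot>[U] F h2) \<in> bil (C a b) (C b c) U"
    by (intro bilI lin_rules \<alpha> F U) (use dual_closed[OF \<alpha>] lin_closed[OF F] in auto)
  then show ?thesis
    unfolding lt_def lin_sw[OF F vsC U lt_bil[OF \<alpha>] h]
    by (intro sw_cong[OF _ U _ h]) (use dual_closed[OF \<alpha>] in \<open>auto simp: lin_smult[OF F]\<close>)
qed

lemma lin_rt:
  assumes F: "F \<in> lin (C a b) U" and U: "vs U" and \<beta>: "\<beta> \<in> dual b c" and h: "h \<in> carrier (C a c)"
  shows "F (rt a b c \<beta> h) = sw b a c U (%h1 h2. \<beta> h2 \<odot>[U] F h1) h"
proof -
  have "(%h1 h2. \<beta> h2 \<odot>[U] F h1) \<in> bil (C a b) (C b c) U"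
    by (intro bilI lin_rules \<beta> F U) (use dual_closed[OF \<beta>] lin_closed[OF F] in auto)
  then show ?thesis
    unfolding rt_def lin_sw[OF F vsC U rt_bil[OF \<beta>] h]
    by (intro sw_cong[OF _ U _ h]) (use dual_closed[OF \<beta>] in \<open>auto simp: lin_smult[OF F]\<close>)
qed

text \<open>Left translation is a map of right comodules: by coassociativity only the first factor
  of the comultiplication is translated.\<close>

lemma sw_lt:
  assumes U: "vs U" and t: "t \<in> bil (C b d) (C d c) U" and \<alpha>: "\<alpha> \<in> dual a b" and h: "h \<in> carrier (C a c)"
  shows "sw d b c U t (lt a b c \<alpha> h) = sw d a c U (%h1 h2. t (lt a b d \<alpha> h1) h2) h"
proof -
  note t1 = bil1[OF t] and t2 = bil2[OF t] and ac = dual_closed[OF \<alpha>]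
  have "sw d b c U t (lt a b c \<alpha> h) = sw b a c U (%h1 h'. \<alpha> h1 \<odot>[U] sw d b c U t h') h"
    by (rule lin_lt[OF sw_lin[OF U t] U \<alpha> h])
  also have "... = sw b a c U (%h1 h'. sw d b c U (%h2 h3. \<alpha> h1 \<odot>[U] t h2 h3) h') h"
  proof (rule sw_cong[OF _ U _ h])
    show "\<alpha> h1 \<odot>[U] sw d b c U t h' = sw d b c U (%h2 h3. \<alpha> h1 \<odot>[U] t h2 h3) h'"
      if "h1 \<in> carrier (C a b)" "h' \<in> carrier (C b c)" for h1 h'
      by (rule lin_sw[OF lin_scale[OF U _ lin_id] U U t that(2)]) (use ac that in auto)
    show "(%h1 h'. sw d b c U (%h2 h3. \<alpha> h1 \<odot>[U] t h2 h3) h') \<in> bil (C a b) (C b c) U"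
      by (intro bilI lin_rules \<alpha> U t1 t2) (use ac bil_closed[OF t] in auto)
  qed
  also have "... = sw d a c U (%h' h3. sw b a d U (%h1 h2. \<alpha> h1 \<odot>[U] t h2 h3) h') h"
    by (rule sw_assoc[OF U h, symmetric]; intro lin_rules U t1 t2 \<alpha>; use ac bil_closed[OF t] in auto)
  also have "... = sw d a c U (%h1 h2. t (lt a b d \<alpha> h1) h2) h"
  proof (rule sw_cong[OF _ U _ h])
    show "sw b a d U (%h1 h2. \<alpha> h1 \<odot>[U] t h2 h3) h' = t (lt a b d \<alpha> h') h3"
      if "h' \<in> carrier (C a d)" "h3 \<in> carrier (C d c)" for h' h3
      by (rule lin_lt[OF t2[OF that(2)] U \<alpha> that(1), symmetric])
    show "(%h1 h2. t (lt a b d \<alpha> h1) h2) \<in> bil (C a d) (C d c) U"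
      by (intro bilI t1 lin_comp[OF t2 lt_lin[OF \<alpha>]] lt_closed[OF \<alpha>])
  qed
  finally show ?thesis .
qed

lemma sw_rt:
  assumes U: "vs U" and t: "t \<in> bil (C a d) (C d b) U" and \<beta>: "\<beta> \<in> dual b c" and h: "h \<in> carrier (C a c)"
  shows "sw d a b U t (rt a b c \<beta> h) = sw d a c U (%h1 h2. t h1 (rt d b c \<beta> h2)) h"
proof -
  note t1 = bil1[OF t] and t2 = bil2[OF t] and bc = dual_closed[OF \<beta>]
  have "sw d a b U t (rt a b c \<beta> h) = sw b a c U (%h' h3. \<beta> h3 \<odot>[U] sw d a b U t h') h"
    by (rule lin_rt[OF sw_lin[OF U t] U \<beta> h])
  also have "... = sw b a c U (%h' h3. sw d a b U (%h1 h2. \<beta> h3 \<odot>[U] t h1 h2) h') h"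
  proof (rule sw_cong[OF _ U _ h])
    show "\<beta> h3 \<odot>[U] sw d a b U t h' = sw d a b U (%h1 h2. \<beta> h3 \<odot>[U] t h1 h2) h'"
      if "h' \<in> carrier (C a b)" "h3 \<in> carrier (C b c)" for h3 h'
      by (rule lin_sw[OF lin_scale[OF U _ lin_id] U U t that(1)]) (use bc that in auto)
    show "(%h' h3. sw d a b U (%h1 h2. \<beta> h3 \<odot>[U] t h1 h2) h') \<in> bil (C a b) (C b c) U"
      by (intro bilI lin_rules \<beta> U t1 t2) (use bc bil_closed[OF t] in auto)
  qed
  also have "... = sw d a c U (%h1 h'. sw b d c U (%h2 h3. \<beta> h3 \<odot>[U] t h1 h2) h') h"
    by (rule sw_assoc[OF U h]; intro lin_rules U t1 t2 \<beta>; use bc bil_closed[OF t] in auto)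
  also have "... = sw d a c U (%h1 h2. t h1 (rt d b c \<beta> h2)) h"
  proof (rule sw_cong[OF _ U _ h])
    show "sw b d c U (%h2 h3. \<beta> h3 \<odot>[U] t h1 h2) h' = t h1 (rt d b c \<beta> h')"
      if "h1 \<in> carrier (C a d)" "h' \<in> carrier (C d c)" for h' h1
      by (rule lin_rt[OF t1[OF that(1)] U \<beta> that(2), symmetric])
    show "(%h1 h2. t h1 (rt d b c \<beta> h2)) \<in> bil (C a d) (C d c) U"
      by (intro bilI t2 lin_comp[OF t1 rt_lin[OF \<beta>]] rt_closed[OF \<beta>])
  qed
  finally show ?thesis .
qed

text \<open>Both sides are the sum of \<beta>(h_(2)) t(h_(1), h_(3)); the middle factor can be
  absorbed to the left or to the right.\<close>

lemma sw_rt_lt: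
  assumes U: "vs U" and t: "t \<in> bil (C a b) (C c e) U" and \<beta>: "\<beta> \<in> dual b c" and h: "h \<in> carrier (C a e)"
  shows "sw c a e U (%h1 h2. t (rt a b c \<beta> h1) h2) h = sw b a e U (%h1 h2. t h1 (lt b c e \<beta> h2)) h"
proof -
  note t1 = bil1[OF t] and t2 = bil2[OF t] and bc = dual_closed[OF \<beta>]
  have "sw c a e U (%h1 h2. t (rt a b c \<beta> h1) h2) h = sw c a e U (%h' h3. sw b a c U (%h1 h2. \<beta> h2 \<odot>[U] t h1 h3) h') h"
  proof (rule sw_cong[OF _ U _ h])
    show "t (rt a b c \<beta> h1) h2 = sw b a c U (%h1 h3. \<beta> h3 \<odot>[U] t h1 h2) h1"
      if "h1 \<in> carrier (C a c)" "h2 \<in> carrier (C c e)" for h1 h2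
      by (rule lin_rt[OF t2[OF that(2)] U \<beta> that(1)])
    show "(%h' h3. sw b a c U (%h1 h2. \<beta> h2 \<odot>[U] t h1 h3) h') \<in> bil (C a c) (C c e) U"
      by (intro bilI lin_rules \<beta> U t1 t2) (use bc bil_closed[OF t] in auto)
  qed
  also have "... = sw b a e U (%h1 h'. sw c b e U (%h2 h3. \<beta> h2 \<odot>[U] t h1 h3) h') h"
    by (rule sw_assoc[OF U h]; intro lin_rules U t1 t2 \<beta>; use bc bil_closed[OF t] in auto)
  also have "... = sw b a e U (%h1 h2. t h1 (lt b c e \<beta> h2)) h"
  proof (rule sw_cong[OF _ U _ h])
    show "sw c b e U (%h2 h3. \<beta> h2 \<odot>[U] t h1 h3) h' = t h1 (lt b c e \<beta> h')"
      if "h1 \<in> carrier (C a b)" "h' \<in> carrier (C b e)" for h' h1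
      by (rule lin_lt[OF t1[OF that(1)] U \<beta> that(2), symmetric])
    show "(%h1 h2. t h1 (lt b c e \<beta> h2)) \<in> bil (C a b) (C b e) U"
      by (intro bilI t2 lin_comp[OF t1 lt_lin[OF \<beta>]] lt_closed[OF \<beta>])
  qed
  finally show ?thesis .
qed

text \<open>One of the two identities of an inverse: the convolution of \<alpha> and \<beta> is the
  counit of \<open>C a a\<close>. The other identity lives on \<open>C b b\<close> and is
  \<open>conv_inv b a \<beta> \<alpha>\<close>.\<close>

definition conv_inv :: "'o => 'o => ('h => 'k) => ('h => 'k) => bool"
  where "conv_inv a b \<alpha> \<beta> \<longleftrightarrow> \<alpha> \<in> dual a b \<and> \<beta> \<in> dual b a \<and> (\<forall>h\<in>carrier (C a a). \<beta> (lt a b a \<alpha> h) = E a h)"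

text \<open>Both \<open>\<alpha> (rt a b a \<beta> h)\<close> and
  \<open>\<beta> (lt a b a \<alpha> h)\<close> are the sum of \<alpha>(h_(1))
  \<beta>(h_(2)).\<close>

lemma conv_inv_rt:
  assumes "conv_inv a b \<alpha> \<beta>" "h \<in> carrier (C a a)" shows "\<alpha> (rt a b a \<beta> h) = E a h"
proof -
  have \<alpha>: "\<alpha> \<in> dual a b" and \<beta>: "\<beta> \<in> dual b a" using assms by (auto simp: conv_inv_def)
  have "\<alpha> (rt a b a \<beta> h) = sw b a a (base_algebra K) (%h1 h2. \<beta> h2 \<otimes> \<alpha> h1) h"
    using lin_rt[OF \<alpha> vs_base \<beta> assms(2)] by simp
  also have "... = sw b a a (base_algebra K) (%h1 h2. \<alpha> h1 \<otimes> \<beta> h2) h"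
    by (rule sw_cong[OF _ vs_base _ assms(2)])
      (use dual_closed[OF \<alpha>] dual_closed[OF \<beta>] \<alpha> \<beta> in \<open>auto simp: m_comm intro!: bilI lin_Kmult_left lin_Kmult_right\<close>)
  also have "... = \<beta> (lt a b a \<alpha> h)" using lin_lt[OF \<beta> vs_base \<alpha> assms(2)] by simp
  finally show ?thesis using assms by (simp add: conv_inv_def)
qed

lemma lt_lt:
  assumes i: "conv_inv a b \<alpha> \<beta>" and h: "h \<in> carrier (C a c)"
  shows "lt b a c \<beta> (lt a b c \<alpha> h) = h"
proof -
  have \<alpha>: "\<alpha> \<in> dual a b" and \<beta>: "\<beta> \<in> dual b a" using assms by (auto simp: conv_inv_def)
  have "lt b a c \<beta> (lt a b c \<alpha> h) = sw a a c (C a c) (%h1 h2. \<beta> (lt a b a \<alpha> h1) \<odot>[C a c] h2) h"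
    unfolding lt_def[of b] by (rule sw_lt[OF vsC lt_bil[OF \<beta>] \<alpha> h])
  also have "... = sw a a c (C a c) (%h1 h2. E a h1 \<odot>[C a c] h2) h"
    by (rule sw_cong[OF _ vsC _ h]) (use i in \<open>auto simp: conv_inv_def intro!: bilI lin_scale lin_smult_vec lin_id E_lin\<close>)
  finally show ?thesis using sw_counit_left[OF vsC lin_id h] by simp
qed

lemma rt_rt:
  assumes i: "conv_inv a b \<alpha> \<beta>" and h: "h \<in> carrier (C c a)"
  shows "rt c a b \<alpha> (rt c b a \<beta> h) = h"
proof -
  have \<alpha>: "\<alpha> \<in> dual a b" and \<beta>: "\<beta> \<in> dual b a" using assms by (auto simp: conv_inv_def)
  have "rt c a b \<alpha> (rt c b a \<beta> h) = sw a c a (C c a) (%h1 h2. \<alpha> (rt a b a \<beta> h2) \<odot>[C c a] h1) h"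
    unfolding rt_def[of c a b] by (rule sw_rt[OF vsC rt_bil[OF \<alpha>] \<beta> h])
  also have "... = sw a c a (C c a) (%h1 h2. E a h2 \<odot>[C c a] h1) h"
    by (rule sw_cong[OF _ vsC _ h]) (auto simp: conv_inv_rt[OF i] intro!: bilI lin_scale lin_smult_vec lin_id E_lin)
  finally show ?thesis using sw_counit_right[OF vsC lin_id h] by simp
qed

lemma lt_rt_commute:
  assumes \<alpha>: "\<alpha> \<in> dual a b" and \<beta>: "\<beta> \<in> dual c d" and h: "h \<in> carrier (C a d)"
  shows "lt a b c \<alpha> (rt a c d \<beta> h) = rt b c d \<beta> (lt a b d \<alpha> h)"
proof -
  have "lt a b c \<alpha> (rt a c d \<beta> h) = sw b a d (C b c) (%h1 h2. \<alpha> h1 \<odot>[C b c] rt b c d \<beta> h2) h"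
    unfolding lt_def by (rule sw_rt[OF vsC lt_bil[OF \<alpha>] \<beta> h])
  also have "... = rt b c d \<beta> (lt a b d \<alpha> h)" by (rule lin_lt[OF rt_lin[OF \<beta>] vsC \<alpha> h, symmetric])
  finally show ?thesis .
qed

lemma E_lt: assumes \<alpha>: "\<alpha> \<in> dual a b" and h: "h \<in> carrier (C a b)" shows "E b (lt a b b \<alpha> h) = \<alpha> h"
proof -
  have "E b (lt a b b \<alpha> h) = sw b a b (base_algebra K) (%h1 h2. \<alpha> h1 \<otimes> E b h2) h"
    using lin_lt[OF E_lin vs_base \<alpha> h] by simp
  also have "... = sw b a b (base_algebra K) (%h1 h2. E b h2 \<otimes> \<alpha> h1) h"
    by (rule sw_cong[OF _ vs_base _ h])
      (use dual_closed[OF \<alpha>] \<alpha> in \<open>auto simp: m_comm intro!: bilI lin_Kmult_left lin_Kmult_right E_lin\<close>)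
  also have "... = \<alpha> h" using sw_counit_right[OF vs_base \<alpha> h] by simp
  finally show ?thesis .
qed

text \<open>A left inverse \<alpha> and a right inverse \<gamma> of \<beta> agree, as in any monoid:
  \<gamma> is evaluated at an element translated by \<alpha> and back by \<beta>.\<close>

lemma conv_inv_sym:
  assumes i: "conv_inv a b \<alpha> \<beta>" and j: "conv_inv b a \<beta> \<gamma>"
  shows "conv_inv b a \<beta> \<alpha>"
proof -
  have \<alpha>: "\<alpha> \<in> dual a b" and \<beta>: "\<beta> \<in> dual b a" and \<gamma>: "\<gamma> \<in> dual a b" using i j by (auto simp: conv_inv_def)
  have "\<gamma> h = \<alpha> h" if h: "h \<in> carrier (C a b)" for h
  proof -
    have l: "lt a b b \<alpha> h \<in> carrier (C b b)" by (rule lt_closed[OF \<alpha> h])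
    have "\<gamma> h = \<gamma> (lt b a b \<beta> (lt a b b \<alpha> h))" by (simp add: lt_lt[OF i h])
    also have "... = E b (lt a b b \<alpha> h)" using j l by (simp add: conv_inv_def)
    also have "... = \<alpha> h" by (rule E_lt[OF \<alpha> h])
    finally show ?thesis .
  qed
  then show ?thesis using j \<alpha> lt_closed[OF \<beta>] by (auto simp: conv_inv_def)
qed

end

section \<open>Sweedler sums of products, and the linear structure underlying an algebra\<close>

context scalars
begin

text \<open>For a comultiplication that is an algebra map this becomes \<open>sw_mult\<close>, the
  rule (x y)_(1) \<otimes> (x y)_(2) = x_(1) y_(1) \<otimes> x_(2) y_(2).\<close>

lemma tens_lift_mult:
  assumes A: "alg A" and B: "alg B" and U: "vs U" and t: "t \<in> bil A B U"
    and z: "z \<in> carrier (A >< B)" and w: "w \<in> carrier (A >< B)"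
  shows "tens_lift K U t (z \<otimes>[A >< B] w)
    = tens_lift K U (%a b. tens_lift K U (%a' b'. t (a \<otimes>[A] a') (b \<otimes>[B] b')) w) z"
proof -
  note VA = alg_vs[OF A] and VB = alg_vs[OF B] and t1 = bil1[OF t] and t2 = bil2[OF t]
  have AB: "alg (A >< B)" by (rule alg_tensor[OF A B])
  note L = tens_lift_lin[OF VA VB U t]
  have b: "(%a' b'. t (a \<otimes>[A] a') (b \<otimes>[B] b')) \<in> bil A B U" if "a \<in> carrier A" "b \<in> carrier B" for a b
    by (intro bilI lin_comp[OF t1] lin_comp[OF t2] lin_mult_left A B lin_id) (use that A B in auto)
  have c: "(%a b. tens_lift K U (%a' b'. t (a \<otimes>[A] a') (b \<otimes>[B] b')) w) \<in> bil A B U"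
    by (intro bilI lin_tens_lift_param[OF _ VA VB U w] b VA VB lin_comp[OF t1] lin_comp[OF t2] lin_mult_right A B lin_id)
      (use A B in auto)
  have 1: "tens_lift K U t (tens K A B a b \<otimes>[A >< B] w) = tens_lift K U (%a' b'. t (a \<otimes>[A] a') (b \<otimes>[B] b')) w"
    if ab: "a \<in> carrier A" "b \<in> carrier B" for a b
    by (rule sym, rule tens_lift_eqI[OF VA VB U b[OF ab] lin_comp[OF L lin_mult_left[OF AB _ lin_id]] _ w])
      (use ab A B VA VB in \<open>auto simp: tens_mult tens_lift_tens[OF VA VB U t]\<close>)
  show ?thesis
    by (rule sym, rule tens_lift_eqI[OF VA VB U c lin_comp[OF L lin_mult_right[OF AB w lin_id]] _ z]) (use 1 in auto)
qed

lemma tens_lift_swap: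
  assumes V: "vs V" "vs W" "vs V'" "vs W'" and U: "vs U" and z: "z \<in> carrier (V >< W)" and w: "w \<in> carrier (V' >< W')"
    and t1: "\<And>v v' w. [|v \<in> carrier W; v' \<in> carrier V'; w \<in> carrier W'|] ==> (%x. t x v v' w) \<in> lin V U"
    and t2: "\<And>v v' w. [|v \<in> carrier V; v' \<in> carrier V'; w \<in> carrier W'|] ==> (%x. t v x v' w) \<in> lin W U"
    and t3: "\<And>v v' w. [|v \<in> carrier V; v' \<in> carrier W; w \<in> carrier W'|] ==> (%x. t v v' x w) \<in> lin V' U"
    and t4: "\<And>v v' w. [|v \<in> carrier V; v' \<in> carrier W; w \<in> carrier V'|] ==> (%x. t v v' w x) \<in> lin W' U"
  shows "tens_lift K U (%v1 v2. tens_lift K U (t v1 v2) w) z = tens_lift K U (%w1 w2. tens_lift K U (%v1 v2. t v1 v2 w1 w2) z) w"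
proof -
  have b1: "t v1 v2 \<in> bil V' W' U" if "v1 \<in> carrier V" "v2 \<in> carrier W" for v1 v2
    by (intro bilI t3 t4 that)
  have b2: "(%v1 v2. t v1 v2 w1 w2) \<in> bil V W U" if "w1 \<in> carrier V'" "w2 \<in> carrier W'" for w1 w2
    by (intro bilI t1 t2 that)
  have c: "(%v1 v2. tens_lift K U (t v1 v2) w) \<in> bil V W U"
    by (intro bilI lin_tens_lift_param[OF _ V(3,4) U w] b1 V t1 t2)
  have d: "(%w1 w2. tens_lift K U (%v1 v2. t v1 v2 w1 w2) z) \<in> bil V' W' U" if "z \<in> carrier (V >< W)" for z
    by (intro bilI lin_tens_lift_param[OF _ V(1,2) U that] b2 V t3 t4)
  have e: "(%z. tens_lift K U (%w1 w2. tens_lift K U (%v1 v2. t v1 v2 w1 w2) z) w) \<in> lin (V >< W) U"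
    by (intro lin_tens_lift_param[OF _ V(3,4) U w] tens_lift_lin[OF V(1,2) U] b2 d) (use V in auto)
  show ?thesis
  proof (rule tens_lift_eqI[OF V(1,2) U c e _ z])
    fix v1 v2 assume v: "v1 \<in> carrier V" "v2 \<in> carrier W"
    show "tens_lift K U (t v1 v2) w = tens_lift K U (%w1 w2. tens_lift K U (%v1 v2. t v1 v2 w1 w2) (tens K V W v1 v2)) w"
      by (rule tens_lift_cong[OF _ V(3,4) U d w]) (use v V in \<open>auto simp: tens_lift_tens[OF V(1,2) U b2]\<close>)
  qed
qed

text \<open>A cocycle twist keeps the coalgebra and replaces the multiplication. By
  \<open>vsame_tens\<close> the pure tensors of two algebras with the same linear structure are the
  same sets, although the products on the two tensor product records may differ; so the
  comultiplication of the twist can be read in either.\<close>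

definition vsame :: "('k, 'a, 'm) module_scheme => ('k, 'a, 'n) module_scheme => bool"
  where "vsame A B \<longleftrightarrow> carrier A = carrier B \<and> zero A = zero B \<and> add A = add B \<and> smult A = smult B"

lemma vsame_lincomb: "vsame A B ==> lincomb K A = lincomb K B"
  by (intro ext) (simp add: vsame_def lincomb_def finsum_def finprod_def)

lemma vsame_tens_lift: "vsame A B ==> tens_lift K A = tens_lift K B"
  by (simp add: tens_lift_def fun_eq_iff vsame_lincomb)

lemma vsame_lin: "vsame A B ==> lin A V = lin B V" "vsame A B ==> lin V A = lin V B"
  by (auto simp: vsame_def linear_maps_def)

lemma vsame_a_inv: "vsame A B ==> a_inv A = a_inv B"
  by (rule ext) (simp add: vsame_def a_inv_def m_inv_def)

lemma vsame_tens:
  assumes V: "vs V" "vs W" and s: "vsame V V'" "vsame W W'"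
  shows "tens K V' W' = tens K V W" and "vsame (V >< W) (V' >< W')"
proof -
  have c: "carrier V' = carrier V" "carrier W' = carrier W" "add V' = add V" "add W' = add W" "smult V' = smult V" "smult W' = smult W"
    using s by (auto simp: vsame_def)
  let ?F = "tfree V W" and ?F' = "tfree V' W'"
  have F: "vsame ?F ?F'" using c by (simp add: vsame_def)
  then have m: "a_minus ?F = a_minus ?F'"
    using vsame_a_inv[OF F] by (simp add: fun_eq_iff a_minus_def)
  have F': "add ?F = add ?F'" "smult ?F = smult ?F'" by (simp_all add: c)
  have R: "bilinear_relations K V W = bilinear_relations K V' W'"
    unfolding bilinear_relations_def Let_def c m F' ..
  have "submodule P K ?F \<longleftrightarrow> submodule P K ?F'" for P
    using submodD[OF vs_ma, of P "V \<times>\<times> W"] submodD[OF vs_ma, of P "V' \<times>\<times> W'"]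
    by (intro iffI submodI) (auto simp: c)
  then have J: "tker V W = tker V' W'" by (simp add: module_span_def R)
  have q: "a_r_coset ?F X = a_r_coset ?F' X" for X by (auto simp: fun_eq_iff a_r_coset_def r_coset_def c)
  show "tens K V' W' = tens K V W" by (simp add: fun_eq_iff tens_coset J q)
  have cc: "carrier ?F = carrier ?F'" by (simp add: c)
  have sa: "set_add ?F = set_add ?F'" by (intro ext) (simp add: set_add_def' c)
  show "vsame (V >< W) (V' >< W')"
    unfolding vsame_def tensor_quot J
    by (simp add: algebra_quot_def FactRing_def ring.defs module.defs A_RCOSETS_def' q sa cc del: ma_simps) (simp add: c)
qed

end

subsection \<open>Cogroupoids\<close>

text \<open>The antipode identities concern a diagonal element h of \<open>X a a\<close> split
  through another object b: h_(1) lies in \<open>X a b\<close> and h_(2) in \<open>X b a\<close>, so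
  the antipode has to exchange the two objects for the products to make sense. For b = a these are
  the usual axioms, and \<open>X a a\<close> is a Hopf algebra.\<close>

locale cogroupoid = cocat K X D E
  for K :: "('k, 'r) ring_scheme" (structure) and X :: "'o => 'o => ('k, 'h) module"
    and D :: "'o => 'o => 'o => 'h => ('k, 'h, 'h) tensor" and E :: "'o => 'h => 'k" +
  fixes S :: "'o => 'o => 'h => 'h"
  assumes algX [simp]: "unital_algebra K (X a b)"
    and D_hom: "D c a b \<in> algebra_homs K (X a b) (tensor K (X a c) (X c b))"
    and E_hom: "E a \<in> algebra_homs K (X a a) (base_algebra K)"
    and S_lin: "S a b \<in> linear_maps K (X a b) (X b a)"
    and antipode_left: "h \<in> carrier (X a a) ==>
      tens_lift K (X b a) (%h1 h2. S a b h1 \<otimes>[X b a] h2) (D b a a h) = E a h \<odot>[X b a] \<one>[X b a]"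
    and antipode_right: "h \<in> carrier (X a a) ==>
      tens_lift K (X a b) (%h1 h2. h1 \<otimes>[X a b] S b a h2) (D b a a h) = E a h \<odot>[X a b] \<one>[X a b]"
begin

lemma S_closed [simp]: "h \<in> carrier (X a b) ==> S a b h \<in> carrier (X b a)"
  by (rule lin_closed[OF S_lin])

lemma D_mult: "[|h \<in> carrier (X a b); k \<in> carrier (X a b)|] ==>
    D c a b (h \<otimes>[X a b] k) = D c a b h \<otimes>[X a c >< X c b] D c a b k"
  by (rule ahom_mult[OF D_hom])

lemma D_one: "D c a b \<one>[X a b] = tens K (X a c) (X c b) \<one>[X a c] \<one>[X c b]"
  using ahom_one[OF D_hom] by (simp add: tens_one)

lemma E_mult: "[|h \<in> carrier (X a a); k \<in> carrier (X a a)|] ==> E a (h \<otimes>[X a a] k) = E a h \<otimes> E a k"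
  using ahom_mult[OF E_hom] by simp

lemma sw_mult:
  assumes U: "vs U" and t: "t \<in> bil (X a c) (X c b) U" and h: "h \<in> carrier (X a b)" and k: "k \<in> carrier (X a b)"
  shows "sw c a b U t (h \<otimes>[X a b] k) = sw c a b U (%h1 h2. sw c a b U (%k1 k2. t (h1 \<otimes>[X a c] k1) (h2 \<otimes>[X c b] k2)) k) h"
  unfolding sw_def D_mult[OF h k] by (rule tens_lift_mult[OF algX algX U t]) (use h k in auto)

lemma sw_one: "[|vs U; t \<in> bil (X a c) (X c b) U|] ==> sw c a b U t \<one>[X a b] = t \<one>[X a c] \<one>[X c b]"
  unfolding sw_def D_one by (rule tens_lift_tens) auto

lemmas lin_rules' = lin_rules lin_mult_left lin_mult_right

subsubsection \<open>The diagonal Hopf algebras and the Galois property\<close>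

definition HA :: "'o => ('k, 'h) bialg"
  where "HA a = module.extend (X a a) (bialg.fields (D a a a) (E a))"

lemma HA_simps [simp]:
  "carrier (HA a) = carrier (X a a)" "mult (HA a) = mult (X a a)" "one (HA a) = one (X a a)" "zero (HA a) = zero (X a a)"
  "add (HA a) = add (X a a)" "smult (HA a) = smult (X a a)" "comult (HA a) = D a a a" "counit (HA a) = E a"
  by (simp_all add: HA_def module.defs bialg.defs)

lemma same_HA: "same (HA a) (X a a)"
  by (simp add: same_def)

lemma HA_same [simp]:
  "HA a >< W = X a a >< W" "W >< HA a = W >< X a a" "tens K (HA a) W = tens K (X a a) W" "tens K W (HA a) = tens K W (X a a)"
  "lin (HA a) W = lin (X a a) W" "lin W (HA a) = lin W (X a a)"
  "ahom (HA a) W = ahom (X a a) W" "ahom W (HA a) = ahom W (X a a)"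
  "tens_lift K (HA a) = tens_lift K (X a a)"
proof -
  show "tens_lift K (HA a) = tens_lift K (X a a)" by (rule vsame_tens_lift) (simp add: vsame_def)
qed (rule same_tensor[OF same_HA same_refl] same_tensor[OF same_refl same_HA] same_lin[OF same_HA] same_ahom[OF same_HA])+

lemma HA_vs [simp]: "vs (HA a)" and HA_alg [simp]: "alg (HA a)"
  using same_vs[OF same_sym[OF same_HA] vsC] same_alg[OF same_sym[OF same_HA] algX] by auto

lemma HA_hopf: "hopf_algebra K (HA a)"
proof -
  have "is_antipode K (HA a) (S a a)"
    unfolding is_antipode_def by (simp add: S_lin antipode_left antipode_right)
  moreover have "bialgebra K (HA a)"
    unfolding bialgebra_def coalgebra_def Let_def
    by (simp add: D_lin E_lin D_hom E_hom coassoc counit_left counit_right)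
  ultimately show ?thesis unfolding hopf_algebra_def by blast
qed

lemma bicomodule: "bicomodule_algebra K (HA a) (HA b) (X a b) (D a a b) (D b a b)"
  unfolding bicomodule_algebra_def left_comodule_algebra_def left_comodule_def right_comodule_algebra_def Let_def
  by (simp add: D_lin D_hom coassoc counit_left counit_right)

definition kr where "kr a b = (%c d. tens K (X a b) (X b b) c \<one>[X b b] \<otimes>[X a b >< X b b] D b a b d)"

lemma kr_sw:
  assumes c: "c \<in> carrier (X a b)" and d: "d \<in> carrier (X a b)"
  shows "kr a b c d = sw b a b (X a b >< X b b) (%d1 d2. tens K (X a b) (X b b) (c \<otimes>[X a b] d1) d2) d"
proof -
  have b: "(%d1 d2. tens K (X a b) (X b b) (c \<otimes>[X a b] d1) d2) \<in> bil (X a b) (X b b) (X a b >< X b b)"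
    by (intro bilI lin_rules') (use c in auto)
  show ?thesis unfolding kr_def sw_def
    by (rule sym, rule tens_lift_eqI[OF vsC vsC vs_tensor[OF vsC vsC] b lin_mult_left[OF alg_tensor[OF algX algX] _ lin_id]])
      (use c d in \<open>auto simp: tens_mult alg_simps\<close>)
qed

lemma kr_bil: "kr a b \<in> bil (X a b) (X a b) (X a b >< X b b)"
  unfolding kr_def by (intro bilI lin_rules' D_lin alg_tensor algX) auto

text \<open>The inverse sends c \<otimes> e to c S(e_(1)) \<otimes> e_(2), where e in
  \<open>X b b\<close> is split through a. In the two composites coassociativity brings together
  d_(1) S(d_(2)) and S(e_(1)) e_(2), which collapse by the antipode identities.\<close>

lemma kr_bij: "bij_betw (tens_lift K (X a b >< X b b) (kr a b)) (carrier (X a b >< X a b)) (carrier (X a b >< X b b))"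
proof -
  let ?P = "X a b >< X b b" and ?Q = "X a b >< X a b"
  let ?l = "%c e1 e2. tens K (X a b) (X a b) (c \<otimes>[X a b] S b a e1) e2"
  let ?k = "%c e. sw a b b ?Q (?l c) e"
  have P: "vs ?P" and Q: "vs ?Q" by simp_all
  have l1: "(%c. ?l c e1 e2) \<in> lin (X a b) ?Q" if "e1 \<in> carrier (X b a)" "e2 \<in> carrier (X a b)" for e1 e2
    by (intro lin_rules' algX) (use that in auto)
  have l2: "(%e1. ?l c e1 e2) \<in> lin (X b a) ?Q" if "c \<in> carrier (X a b)" "e2 \<in> carrier (X a b)" for c e2
    by (intro lin_rules' S_lin algX) (use that in auto)
  have l3: "(%e2. ?l c e1 e2) \<in> lin (X a b) ?Q" if "c \<in> carrier (X a b)" "e1 \<in> carrier (X b a)" for c e1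
    by (intro lin_rules' algX) (use that in auto)
  have lb: "?l c \<in> bil (X b a) (X a b) ?Q" if "c \<in> carrier (X a b)" for c
    by (intro bilI l2 l3 that)
  have kb: "?k \<in> bil (X a b) (X b b) ?Q"
    by (intro bilI sw_lin sw_lin_param lb l1 Q vsC)
  note F = tens_lift_lin[OF vsC vsC P kr_bil] and H = tens_lift_lin[OF vsC vsC Q kb]
  note Ft = tens_lift_tens[OF vsC vsC P kr_bil] and Ht = tens_lift_tens[OF vsC vsC Q kb]
  let ?F = "tens_lift K ?P (kr a b)" and ?H = "tens_lift K ?Q ?k"
  have HF: "?H (?F z) = z" if z: "z \<in> carrier ?Q" for z
  proof (rule tensor_ext[OF vsC vsC Q lin_comp[OF H F] lin_id _ z])
    fix c d assume c: "c \<in> carrier (X a b)" and d: "d \<in> carrier (X a b)"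
    have tb: "(%d1 d2. tens K (X a b) (X b b) (c \<otimes>[X a b] d1) d2) \<in> bil (X a b) (X b b) ?P"
      by (intro bilI lin_rules' algX) (use c in auto)
    have kb': "(%d1 e. ?k (c \<otimes>[X a b] d1) e) \<in> bil (X a b) (X b b) ?Q"
      by (intro bilI bil1[OF kb] lin_comp[OF bil2[OF kb] lin_mult_left[OF algX c lin_id]]) (use c in auto)
    have eb: "(%d' e2. E a d' \<odot>[?Q] tens K (X a b) (X a b) c e2) \<in> bil (X a a) (X a b) ?Q"
      by (intro bilI lin_rules' E_lin) (use c in auto)
    have "?H (?F (tens K (X a b) (X a b) c d)) = ?H (sw b a b ?P (%d1 d2. tens K (X a b) (X b b) (c \<otimes>[X a b] d1) d2) d)"
      using c d by (simp add: Ft kr_sw)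
    also have "... = sw b a b ?Q (%d1 d2. ?H (tens K (X a b) (X b b) (c \<otimes>[X a b] d1) d2)) d"
      by (rule lin_sw[OF H P Q tb d])
    also have "... = sw b a b ?Q (%d1 e. ?k (c \<otimes>[X a b] d1) e) d"
      by (rule sw_cong[OF _ Q kb' d]) (use c in \<open>simp add: Ht\<close>)
    also have "... = sw a a b ?Q (%d' e2. sw b a a ?Q (%d1 e1. ?l (c \<otimes>[X a b] d1) e1 e2) d') d"
      by (rule sw_assoc[OF Q d, symmetric]; intro lin_rules' S_lin algX; use c in auto)
    also have "... = sw a a b ?Q (%d' e2. E a d' \<odot>[?Q] tens K (X a b) (X a b) c e2) d"
    proof (rule sw_cong[OF _ Q eb d])
      fix d' e2 assume 1: "d' \<in> carrier (X a a)" "e2 \<in> carrier (X a b)"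
      have M: "(%u. tens K (X a b) (X a b) (c \<otimes>[X a b] u) e2) \<in> lin (X a b) ?Q"
        by (intro lin_rules' algX) (use c 1 in auto)
      have ab: "(%h1 h2. h1 \<otimes>[X a b] S b a h2) \<in> bil (X a b) (X b a) (X a b)"
        by (intro bilI lin_rules' algX S_lin) auto
      have "sw b a a ?Q (%d1 e1. ?l (c \<otimes>[X a b] d1) e1 e2) d' = sw b a a ?Q (%d1 e1. tens K (X a b) (X a b) (c \<otimes>[X a b] (d1 \<otimes>[X a b] S b a e1)) e2) d'"
        by (rule sw_cong[OF _ Q _ 1(1)]; (intro bilI lin_rules' algX S_lin)?; use c 1 in \<open>auto simp: alg_simps(5)\<close>)
      also have "... = tens K (X a b) (X a b) (c \<otimes>[X a b] (E a d' \<odot>[X a b] \<one>[X a b])) e2"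
        using lin_sw[OF M vsC Q ab 1(1)] antipode_right[OF 1(1), of b] by (simp add: sw_def)
      also have "... = E a d' \<odot>[?Q] tens K (X a b) (X a b) c e2"
        using c 1 by (simp add: alg_simps tens_simps)
      finally show "sw b a a ?Q (%d1 e1. ?l (c \<otimes>[X a b] d1) e1 e2) d' = E a d' \<odot>[?Q] tens K (X a b) (X a b) c e2" .
    qed
    also have "... = tens K (X a b) (X a b) c d"
      by (rule sw_counit_left[OF Q lin_tens_left[OF vsC vsC c lin_id] d])
    finally show "?H (?F (tens K (X a b) (X a b) c d)) = tens K (X a b) (X a b) c d" .
  qed
  have FH: "?F (?H z) = z" if z: "z \<in> carrier ?P" for z
  proof (rule tensor_ext[OF vsC vsC P lin_comp[OF F H] lin_id _ z])
    fix c e assume c: "c \<in> carrier (X a b)" and e: "e \<in> carrier (X b b)"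
    let ?g = "%e1 f1 f2. tens K (X a b) (X b b) (c \<otimes>[X a b] (S b a e1 \<otimes>[X a b] f1)) f2"
    have krb: "(%e1 e2. kr a b (c \<otimes>[X a b] S b a e1) e2) \<in> bil (X b a) (X a b) ?P"
      by (intro bilI bil1[OF kr_bil] lin_comp[OF bil2[OF kr_bil]] lin_rules' algX S_lin) (use c in auto)
    have g1: "(%e1. ?g e1 f1 f2) \<in> lin (X b a) ?P" if "f1 \<in> carrier (X a b)" "f2 \<in> carrier (X b b)" for f1 f2
      by (intro lin_rules' algX S_lin) (use c that in auto)
    have g2: "(%f1. ?g e1 f1 f2) \<in> lin (X a b) ?P" if "e1 \<in> carrier (X b a)" "f2 \<in> carrier (X b b)" for e1 f2
      by (intro lin_rules' algX S_lin) (use c that in auto)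
    have g3: "(%f2. ?g e1 f1 f2) \<in> lin (X b b) ?P" if "e1 \<in> carrier (X b a)" "f1 \<in> carrier (X a b)" for e1 f1
      by (intro lin_rules' algX S_lin) (use c that in auto)
    have sb: "(%e1 e2. sw b a b ?P (%f1 f2. ?g e1 f1 f2) e2) \<in> bil (X b a) (X a b) ?P"
      by (intro bilI sw_lin sw_lin_param P vsC g1 g2 g3)
    have eb: "(%e' f2. E b e' \<odot>[?P] tens K (X a b) (X b b) c f2) \<in> bil (X b b) (X b b) ?P"
      by (intro bilI lin_rules' E_lin) (use c in auto)
    have "?F (?H (tens K (X a b) (X b b) c e)) = sw a b b ?P (%e1 e2. ?F (?l c e1 e2)) e"
      using c e lin_sw[OF F Q P lb[OF c] e] by (simp add: Ht)
    also have "... = sw a b b ?P (%e1 e2. kr a b (c \<otimes>[X a b] S b a e1) e2) e"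
      by (rule sw_cong[OF _ P krb e]) (use c in \<open>simp add: Ft\<close>)
    also have "... = sw a b b ?P (%e1 e2. sw b a b ?P (%f1 f2. ?g e1 f1 f2) e2) e"
    proof (rule sw_cong[OF _ P sb e])
      fix e1 e2 assume 1: "e1 \<in> carrier (X b a)" "e2 \<in> carrier (X a b)"
      show "kr a b (c \<otimes>[X a b] S b a e1) e2 = sw b a b ?P (%f1 f2. ?g e1 f1 f2) e2"
        unfolding kr_sw[OF alg_closed(1)[OF algX c S_closed[OF 1(1)]] 1(2)]
        by (rule sw_cong[OF _ P _ 1(2)]; (intro bilI g2 g3 1)?; use c 1 in \<open>auto simp: alg_simps(5)\<close>)
    qed
    also have "... = sw b b b ?P (%e' f2. sw a b b ?P (%e1 f1. ?g e1 f1 f2) e') e"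
      by (rule sw_assoc[OF P e g1 g2 g3, symmetric])
    also have "... = sw b b b ?P (%e' f2. E b e' \<odot>[?P] tens K (X a b) (X b b) c f2) e"
    proof (rule sw_cong[OF _ P eb e])
      fix e' f2 assume 1: "e' \<in> carrier (X b b)" "f2 \<in> carrier (X b b)"
      have M: "(%u. tens K (X a b) (X b b) (c \<otimes>[X a b] u) f2) \<in> lin (X a b) ?P"
        by (intro lin_rules' algX) (use c 1 in auto)
      have ab: "(%h1 h2. S b a h1 \<otimes>[X a b] h2) \<in> bil (X b a) (X a b) (X a b)"
        by (intro bilI lin_rules' algX S_lin) auto
      have "sw a b b ?P (%e1 f1. ?g e1 f1 f2) e' = tens K (X a b) (X b b) (c \<otimes>[X a b] (E b e' \<odot>[X a b] \<one>[X a b])) f2"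
        using lin_sw[OF M vsC P ab 1(1)] antipode_left[OF 1(1), of a] by (simp add: sw_def)
      also have "... = E b e' \<odot>[?P] tens K (X a b) (X b b) c f2"
        using c 1 by (simp add: alg_simps tens_simps)
      finally show "sw a b b ?P (%e1 f1. ?g e1 f1 f2) e' = E b e' \<odot>[?P] tens K (X a b) (X b b) c f2" .
    qed
    also have "... = tens K (X a b) (X b b) c e"
      by (rule sw_counit_left[OF P lin_tens_left[OF vsC vsC c lin_id] e])
    finally show "?F (?H (tens K (X a b) (X b b) c e)) = tens K (X a b) (X b b) c e" .
  qed
  show ?thesis
    by (rule bij_betw_byWitness[where f' = ?H]) (use HF FH lin_closed[OF F] lin_closed[OF H] in auto)
qed

definition kl where "kl a b = (%c d. D a a b c \<otimes>[X a a >< X a b] tens K (X a a) (X a b) \<one>[X a a] d)"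

lemma kl_sw:
  assumes c: "c \<in> carrier (X a b)" and d: "d \<in> carrier (X a b)"
  shows "kl a b c d = sw a a b (X a a >< X a b) (%c1 c2. tens K (X a a) (X a b) c1 (c2 \<otimes>[X a b] d)) c"
proof -
  have b: "(%c1 c2. tens K (X a a) (X a b) c1 (c2 \<otimes>[X a b] d)) \<in> bil (X a a) (X a b) (X a a >< X a b)"
    by (intro bilI lin_rules') (use d in auto)
  show ?thesis unfolding kl_def sw_def
    by (rule sym, rule tens_lift_eqI[OF vsC vsC vs_tensor[OF vsC vsC] b lin_mult_right[OF alg_tensor[OF algX algX] _ lin_id]])
      (use c d in \<open>auto simp: tens_mult alg_simps\<close>)
qed

lemma kl_bil: "kl a b \<in> bil (X a b) (X a b) (X a a >< X a b)"
  unfolding kl_def by (intro bilI lin_rules' D_lin alg_tensor algX) auto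

text \<open>The mirror image: the inverse sends l \<otimes> d to l_(1) \<otimes> S(l_(2)) d, where l
  in \<open>X a a\<close> is split through b.\<close>

lemma kl_bij: "bij_betw (tens_lift K (X a a >< X a b) (kl a b)) (carrier (X a b >< X a b)) (carrier (X a a >< X a b))"
proof -
  let ?P = "X a a >< X a b" and ?Q = "X a b >< X a b"
  let ?l = "%l1 l2 d. tens K (X a b) (X a b) l1 (S b a l2 \<otimes>[X a b] d)"
  let ?k = "%l d. sw b a a ?Q (%l1 l2. ?l l1 l2 d) l"
  have P: "vs ?P" and Q: "vs ?Q" by simp_all
  have l1: "(%l1. ?l l1 l2 d) \<in> lin (X a b) ?Q" if "l2 \<in> carrier (X b a)" "d \<in> carrier (X a b)" for l2 d
    by (intro lin_rules' algX) (use that in auto)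
  have l2: "(%l2. ?l l1 l2 d) \<in> lin (X b a) ?Q" if "l1 \<in> carrier (X a b)" "d \<in> carrier (X a b)" for l1 d
    by (intro lin_rules' S_lin algX) (use that in auto)
  have l3: "(%d. ?l l1 l2 d) \<in> lin (X a b) ?Q" if "l1 \<in> carrier (X a b)" "l2 \<in> carrier (X b a)" for l1 l2
    by (intro lin_rules' algX) (use that in auto)
  have lb: "(%l1 l2. ?l l1 l2 d) \<in> bil (X a b) (X b a) ?Q" if "d \<in> carrier (X a b)" for d
    by (intro bilI l1 l2 that)
  have kb: "?k \<in> bil (X a a) (X a b) ?Q"
    by (intro bilI sw_lin sw_lin_param lb l3 Q vsC)
  note F = tens_lift_lin[OF vsC vsC P kl_bil] and H = tens_lift_lin[OF vsC vsC Q kb]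
  note Ft = tens_lift_tens[OF vsC vsC P kl_bil] and Ht = tens_lift_tens[OF vsC vsC Q kb]
  let ?F = "tens_lift K ?P (kl a b)" and ?H = "tens_lift K ?Q ?k"
  have HF: "?H (?F z) = z" if z: "z \<in> carrier ?Q" for z
  proof (rule tensor_ext[OF vsC vsC Q lin_comp[OF H F] lin_id _ z])
    fix c d assume c: "c \<in> carrier (X a b)" and d: "d \<in> carrier (X a b)"
    let ?g = "%l1 l2 c2. tens K (X a b) (X a b) l1 ((S b a l2 \<otimes>[X a b] c2) \<otimes>[X a b] d)"
    have g1: "(%l1. ?g l1 l2 c2) \<in> lin (X a b) ?Q" if "l2 \<in> carrier (X b a)" "c2 \<in> carrier (X a b)" for l2 c2
      by (intro lin_rules' algX S_lin) (use d that in auto)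
    have g2: "(%l2. ?g l1 l2 c2) \<in> lin (X b a) ?Q" if "l1 \<in> carrier (X a b)" "c2 \<in> carrier (X a b)" for l1 c2
      by (intro lin_rules' algX S_lin) (use d that in auto)
    have g3: "(%c2. ?g l1 l2 c2) \<in> lin (X a b) ?Q" if "l1 \<in> carrier (X a b)" "l2 \<in> carrier (X b a)" for l1 l2
      by (intro lin_rules' algX S_lin) (use d that in auto)
    have tb: "(%c1 c2. tens K (X a a) (X a b) c1 (c2 \<otimes>[X a b] d)) \<in> bil (X a a) (X a b) ?P"
      by (intro bilI lin_rules' algX) (use d in auto)
    have sb: "(%c1 c2. sw b a a ?Q (%l1 l2. ?g l1 l2 c2) c1) \<in> bil (X a a) (X a b) ?Q"
      by (intro bilI sw_lin sw_lin_param Q vsC g1 g2 g3)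
    have eb: "(%l1 c'. E b c' \<odot>[?Q] tens K (X a b) (X a b) l1 d) \<in> bil (X a b) (X b b) ?Q"
      by (intro bilI lin_rules' E_lin) (use d in auto)
    have "?H (?F (tens K (X a b) (X a b) c d)) = ?H (sw a a b ?P (%c1 c2. tens K (X a a) (X a b) c1 (c2 \<otimes>[X a b] d)) c)"
      using c d by (simp add: Ft kl_sw)
    also have "... = sw a a b ?Q (%c1 c2. ?H (tens K (X a a) (X a b) c1 (c2 \<otimes>[X a b] d))) c"
      by (rule lin_sw[OF H P Q tb c])
    also have "... = sw a a b ?Q (%c1 c2. sw b a a ?Q (%l1 l2. ?g l1 l2 c2) c1) c"
    proof (rule sw_cong[OF _ Q sb c])
      fix c1 c2 assume 1: "c1 \<in> carrier (X a a)" "c2 \<in> carrier (X a b)"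
      have "sw b a a ?Q (%l1 l2. ?l l1 l2 (c2 \<otimes>[X a b] d)) c1 = sw b a a ?Q (%l1 l2. ?g l1 l2 c2) c1"
        by (rule sw_cong[OF _ Q _ 1(1)]; (intro bilI g1 g2 1)?; use d 1 in \<open>auto simp: alg_simps(5)\<close>)
      then show "?H (tens K (X a a) (X a b) c1 (c2 \<otimes>[X a b] d)) = sw b a a ?Q (%l1 l2. ?g l1 l2 c2) c1"
        using d 1 by (simp add: Ht)
    qed
    also have "... = sw b a b ?Q (%l1 c'. sw a b b ?Q (%l2 c2. ?g l1 l2 c2) c') c"
      by (rule sw_assoc[OF Q c g1 g2 g3])
    also have "... = sw b a b ?Q (%l1 c'. E b c' \<odot>[?Q] tens K (X a b) (X a b) l1 d) c"
    proof (rule sw_cong[OF _ Q eb c])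
      fix l1 c' assume 1: "l1 \<in> carrier (X a b)" "c' \<in> carrier (X b b)"
      have M: "(%u. tens K (X a b) (X a b) l1 (u \<otimes>[X a b] d)) \<in> lin (X a b) ?Q"
        by (intro lin_rules' algX) (use d 1 in auto)
      have ab: "(%h1 h2. S b a h1 \<otimes>[X a b] h2) \<in> bil (X b a) (X a b) (X a b)"
        by (intro bilI lin_rules' algX S_lin) auto
      have "sw a b b ?Q (%l2 c2. ?g l1 l2 c2) c' = tens K (X a b) (X a b) l1 ((E b c' \<odot>[X a b] \<one>[X a b]) \<otimes>[X a b] d)"
        using lin_sw[OF M vsC Q ab 1(2)] antipode_left[OF 1(2), of a] by (simp add: sw_def)
      also have "... = E b c' \<odot>[?Q] tens K (X a b) (X a b) l1 d"
        using d 1 by (simp add: alg_simps tens_simps)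
      finally show "sw a b b ?Q (%l2 c2. ?g l1 l2 c2) c' = E b c' \<odot>[?Q] tens K (X a b) (X a b) l1 d" .
    qed
    also have "... = tens K (X a b) (X a b) c d"
      by (rule sw_counit_right[OF Q lin_tens_right[OF vsC vsC d lin_id] c])
    finally show "?H (?F (tens K (X a b) (X a b) c d)) = tens K (X a b) (X a b) c d" .
  qed
  have FH: "?F (?H z) = z" if z: "z \<in> carrier ?P" for z
  proof (rule tensor_ext[OF vsC vsC P lin_comp[OF F H] lin_id _ z])
    fix l d assume l: "l \<in> carrier (X a a)" and d: "d \<in> carrier (X a b)"
    let ?g = "%c1 c2 l2. tens K (X a a) (X a b) c1 ((c2 \<otimes>[X a b] S b a l2) \<otimes>[X a b] d)"
    have klb: "(%l1 l2. kl a b l1 (S b a l2 \<otimes>[X a b] d)) \<in> bil (X a b) (X b a) ?P"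
      by (intro bilI bil2[OF kl_bil] lin_comp[OF bil1[OF kl_bil]] lin_rules' algX S_lin) (use d in auto)
    have g1: "(%c1. ?g c1 c2 l2) \<in> lin (X a a) ?P" if "c2 \<in> carrier (X a b)" "l2 \<in> carrier (X b a)" for c2 l2
      by (intro lin_rules' algX S_lin) (use d that in auto)
    have g2: "(%c2. ?g c1 c2 l2) \<in> lin (X a b) ?P" if "c1 \<in> carrier (X a a)" "l2 \<in> carrier (X b a)" for c1 l2
      by (intro lin_rules' algX S_lin) (use d that in auto)
    have g3: "(%l2. ?g c1 c2 l2) \<in> lin (X b a) ?P" if "c1 \<in> carrier (X a a)" "c2 \<in> carrier (X a b)" for c1 c2
      by (intro lin_rules' algX S_lin) (use d that in auto)
    have sb: "(%l1 l2. sw a a b ?P (%c1 c2. ?g c1 c2 l2) l1) \<in> bil (X a b) (X b a) ?P"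
      by (intro bilI sw_lin sw_lin_param P vsC g1 g2 g3)
    have eb: "(%c1 l'. E a l' \<odot>[?P] tens K (X a a) (X a b) c1 d) \<in> bil (X a a) (X a a) ?P"
      by (intro bilI lin_rules' E_lin) (use d in auto)
    have "?F (?H (tens K (X a a) (X a b) l d)) = sw b a a ?P (%l1 l2. ?F (?l l1 l2 d)) l"
      using l d lin_sw[OF F Q P lb[OF d] l] by (simp add: Ht)
    also have "... = sw b a a ?P (%l1 l2. kl a b l1 (S b a l2 \<otimes>[X a b] d)) l"
      by (rule sw_cong[OF _ P klb l]) (use d in \<open>simp add: Ft\<close>)
    also have "... = sw b a a ?P (%l1 l2. sw a a b ?P (%c1 c2. ?g c1 c2 l2) l1) l"
    proof (rule sw_cong[OF _ P sb l])
      fix l1 l2 assume 1: "l1 \<in> carrier (X a b)" "l2 \<in> carrier (X b a)"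
      show "kl a b l1 (S b a l2 \<otimes>[X a b] d) = sw a a b ?P (%c1 c2. ?g c1 c2 l2) l1"
        unfolding kl_sw[OF 1(1) alg_closed(1)[OF algX S_closed[OF 1(2)] d]]
        by (rule sw_cong[OF _ P _ 1(1)]; (intro bilI g1 g2 1)?; use d 1 in \<open>auto simp: alg_simps(5)\<close>)
    qed
    also have "... = sw a a a ?P (%c1 l'. sw b a a ?P (%c2 l2. ?g c1 c2 l2) l') l"
      by (rule sw_assoc[OF P l g1 g2 g3])
    also have "... = sw a a a ?P (%c1 l'. E a l' \<odot>[?P] tens K (X a a) (X a b) c1 d) l"
    proof (rule sw_cong[OF _ P eb l])
      fix c1 l' assume 1: "c1 \<in> carrier (X a a)" "l' \<in> carrier (X a a)"
      have M: "(%u. tens K (X a a) (X a b) c1 (u \<otimes>[X a b] d)) \<in> lin (X a b) ?P"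
        by (intro lin_rules' algX) (use d 1 in auto)
      have ab: "(%h1 h2. h1 \<otimes>[X a b] S b a h2) \<in> bil (X a b) (X b a) (X a b)"
        by (intro bilI lin_rules' algX S_lin) auto
      have "sw b a a ?P (%c2 l2. ?g c1 c2 l2) l' = tens K (X a a) (X a b) c1 ((E a l' \<odot>[X a b] \<one>[X a b]) \<otimes>[X a b] d)"
        using lin_sw[OF M vsC P ab 1(2)] antipode_right[OF 1(2), of b] by (simp add: sw_def)
      also have "... = E a l' \<odot>[?P] tens K (X a a) (X a b) c1 d"
        using d 1 by (simp add: alg_simps tens_simps)
      finally show "sw b a a ?P (%c2 l2. ?g c1 c2 l2) l' = E a l' \<odot>[?P] tens K (X a a) (X a b) c1 d" .
    qed
    also have "... = tens K (X a a) (X a b) l d"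
      by (rule sw_counit_right[OF P lin_tens_right[OF vsC vsC d lin_id] l])
    finally show "?F (?H (tens K (X a a) (X a b) l d)) = tens K (X a a) (X a b) l d" .
  qed
  show ?thesis
    by (rule bij_betw_byWitness[where f' = ?H]) (use HF FH lin_closed[OF F] lin_closed[OF H] in auto)
qed

text \<open>Applying \<chi> to the left tensor factor turns the equation into e = \<chi>(e)
  1.\<close>

lemma tens_one_swap:
  assumes \<chi>: "\<chi> \<in> dual a b" "\<chi> \<one>[X a b] = \<one>" and e: "e \<in> carrier (X a b)"
    and eq: "tens K (X a b) (X a b) \<one>[X a b] e = tens K (X a b) (X a b) e \<one>[X a b]"
  shows "e \<in> {c \<odot>[X a b] \<one>[X a b] | c. c \<in> carrier K}"
proof -
  have b: "(%u v. \<chi> u \<odot>[X a b] v) \<in> bil (X a b) (X a b) (X a b)"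
    by (intro bilI lin_rules \<chi>) (use dual_closed[OF \<chi>(1)] in auto)
  have "e = tens_lift K (X a b) (%u v. \<chi> u \<odot>[X a b] v) (tens K (X a b) (X a b) \<one>[X a b] e)"
    using e \<chi> by (simp add: tens_lift_tens[OF vsC vsC vsC b] vs_simps[OF vsC])
  also have "... = \<chi> e \<odot>[X a b] \<one>[X a b]"
    unfolding eq using e by (simp add: tens_lift_tens[OF vsC vsC vsC b])
  finally show ?thesis using dual_closed[OF \<chi>(1) e] by blast
qed

text \<open>For a coinvariant e the Galois map sends 1 \<otimes> e and e \<otimes> 1 to the same
  tensor. As it is injective, 1 \<otimes> e = e \<otimes> 1, and \<open>tens_one_swap\<close> makes
  e a scalar. The normalised functional also shows that \<open>X a b\<close> is not zero.\<close>

theorem bigalois: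
  assumes \<chi>: "\<chi> \<in> dual a b" "\<chi> \<one>[X a b] = \<one>" and nt: "\<one> \<noteq> \<zero>"
  shows "bigalois_extension K (HA a) (HA b) (X a b) (D a a b) (D b a b)"
proof -
  have D1: "D b a b (c \<odot>[X a b] \<one>[X a b]) = tens K (X a b) (X b b) (c \<odot>[X a b] \<one>[X a b]) \<one>[X b b]"
    "D a a b (c \<odot>[X a b] \<one>[X a b]) = tens K (X a a) (X a b) \<one>[X a a] (c \<odot>[X a b] \<one>[X a b])" if "c \<in> carrier K" for c
    using that by (simp_all add: lin_smult[OF D_lin] D_one tens_simps)
  have P: "vs (X a b >< X b b)" "vs (X a a >< X a b)" by simp_all
  have r: "e \<in> {c \<odot>[X a b] \<one>[X a b] | c. c \<in> carrier K}" if e: "e \<in> carrier (X a b)" and D: "D b a b e = tens K (X a b) (X b b) e \<one>[X b b]" for e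
  proof (rule tens_one_swap[OF \<chi> e])
    have "kr a b \<one>[X a b] e = kr a b e \<one>[X a b]"
      unfolding kr_def using e by (simp add: D D_one tens_mult alg_simps)
    then have "tens_lift K (X a b >< X b b) (kr a b) (tens K (X a b) (X a b) \<one>[X a b] e)
      = tens_lift K (X a b >< X b b) (kr a b) (tens K (X a b) (X a b) e \<one>[X a b])"
      using e by (simp add: tens_lift_tens[OF vsC vsC P(1) kr_bil])
    then show "tens K (X a b) (X a b) \<one>[X a b] e = tens K (X a b) (X a b) e \<one>[X a b]"
      by (rule inj_onD[OF bij_betw_imp_inj_on[OF kr_bij]]) (use e in simp_all)
  qed
  have l: "e \<in> {c \<odot>[X a b] \<one>[X a b] | c. c \<in> carrier K}" if e: "e \<in> carrier (X a b)" and D: "D a a b e = tens K (X a a) (X a b) \<one>[X a a] e" for e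
  proof (rule tens_one_swap[OF \<chi> e])
    have "kl a b \<one>[X a b] e = kl a b e \<one>[X a b]"
      unfolding kl_def using e by (simp add: D D_one tens_mult alg_simps)
    then have "tens_lift K (X a a >< X a b) (kl a b) (tens K (X a b) (X a b) \<one>[X a b] e)
      = tens_lift K (X a a >< X a b) (kl a b) (tens K (X a b) (X a b) e \<one>[X a b])"
      using e by (simp add: tens_lift_tens[OF vsC vsC P(2) kl_bil])
    then show "tens K (X a b) (X a b) \<one>[X a b] e = tens K (X a b) (X a b) e \<one>[X a b]"
      by (rule inj_onD[OF bij_betw_imp_inj_on[OF kl_bij]]) (use e in simp_all)
  qed
  have "right_galois K (HA b) (X a b) (D b a b)"
    unfolding right_galois_def using r D1 kr_bij[of a b] unfolding kr_def by auto
  moreover have "left_galois K (HA a) (X a b) (D a a b)"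
    unfolding left_galois_def using l D1 kl_bij[of a b] unfolding kl_def by auto
  moreover have "carrier (X a b) \<noteq> {\<zero>[X a b]}"
  proof
    assume "carrier (X a b) = {\<zero>[X a b]}"
    then have "\<one>[X a b] = \<zero>[X a b]" using alg_closed(2)[OF algX[of a b]] by blast
    then show False using \<chi> lin_zero[OF \<chi>(1) vsC vs_base] nt by simp
  qed
  ultimately show ?thesis unfolding bigalois_extension_def by (simp add: HA_hopf bicomodule)
qed

lemma sw_swap:
  assumes U: "vs U" and h: "h \<in> carrier (X a b)" and k: "k \<in> carrier (X a' b')"
    and t1: "\<And>v v' w. [|v \<in> carrier (X c b); v' \<in> carrier (X a' c'); w \<in> carrier (X c' b')|] ==> (%x. t x v v' w) \<in> lin (X a c) U"
    and t2: "\<And>v v' w. [|v \<in> carrier (X a c); v' \<in> carrier (X a' c'); w \<in> carrier (X c' b')|] ==> (%x. t v x v' w) \<in> lin (X c b) U"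
    and t3: "\<And>v v' w. [|v \<in> carrier (X a c); v' \<in> carrier (X c b); w \<in> carrier (X c' b')|] ==> (%x. t v v' x w) \<in> lin (X a' c') U"
    and t4: "\<And>v v' w. [|v \<in> carrier (X a c); v' \<in> carrier (X c b); w \<in> carrier (X a' c')|] ==> (%x. t v v' w x) \<in> lin (X c' b') U"
  shows "sw c a b U (%h1 h2. sw c' a' b' U (%k1 k2. t h1 h2 k1 k2) k) h
    = sw c' a' b' U (%k1 k2. sw c a b U (%h1 h2. t h1 h2 k1 k2) h) k"
  unfolding sw_def by (rule tens_lift_swap[OF vsC vsC vsC vsC U _ _ t1 t2 t3 t4]) (use h k in auto)

text \<open>The factor \<phi>(h_(2)) \<psi>(h_(3)) inserted between the two outer parts is a counit
  applied to the middle of h, so it disappears.\<close>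

lemma sw_flip:
  assumes i: "conv_inv p q \<phi> \<psi>" and U: "vs U" and t: "t \<in> bil (X a p) (X p b) U" and h: "h \<in> carrier (X a b)"
  shows "sw q a b U (%h1 h2. t (rt a p q \<phi> h1) (lt q p b \<psi> h2)) h = sw p a b U t h"
proof -
  have \<phi>: "\<phi> \<in> dual p q" and \<psi>: "\<psi> \<in> dual q p" using i by (auto simp: conv_inv_def)
  have t': "(%u v. t u (lt q p b \<psi> v)) \<in> bil (X a p) (X q b) U"
    by (intro bilI lin_comp[OF bil1[OF t] lt_lin[OF \<psi>]] bil2[OF t] lt_closed[OF \<psi>])
  have "sw q a b U (%h1 h2. t (rt a p q \<phi> h1) (lt q p b \<psi> h2)) h = sw p a b U (%h1 h2. t h1 (lt q p b \<psi> (lt p q b \<phi> h2))) h"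
    by (rule sw_rt_lt[OF U t' \<phi> h])
  also have "... = sw p a b U t h"
    by (rule sw_cong[OF _ U t h]) (simp add: lt_lt[OF i])
  finally show ?thesis .
qed

lemma lt_one:
  assumes "\<alpha> \<in> dual a b" "\<alpha> \<one>[X a b] = \<one>"
  shows "lt a b c \<alpha> \<one>[X a c] = \<one>[X b c]"
  unfolding lt_def by (subst sw_one[OF vsC lt_bil[OF assms(1)]]) (simp add: assms vs_simps[OF vsC])

lemma rt_one:
  assumes "\<beta> \<in> dual b c" "\<beta> \<one>[X b c] = \<one>"
  shows "rt a b c \<beta> \<one>[X a c] = \<one>[X a b]"
  unfolding rt_def by (subst sw_one[OF vsC rt_bil[OF assms(1)]]) (simp add: assms vs_simps[OF vsC])

context
  fixes p q \<phi> \<psi>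
  assumes i: "conv_inv p q \<phi> \<psi>" and j: "conv_inv q p \<psi> \<phi>"
    and \<phi>1: "\<phi> \<one>[X p q] = \<one>" and \<psi>1: "\<psi> \<one>[X q p] = \<one>"
begin

lemma \<phi>d: "\<phi> \<in> dual p q" and \<psi>d: "\<psi> \<in> dual q p"
  using i by (auto simp: conv_inv_def)

abbreviation (input) "L\<psi> \<equiv> lt q p q \<psi>"
abbreviation (input) "R\<phi> \<equiv> rt q p q \<phi>"

text \<open>In Sweedler form \<open>gf h\<close> is \<phi>(h_(1)) h_(2) \<psi>(h_(3)), the
  conjugation by \<phi>, which leads from \<open>X p p\<close> to \<open>X q q\<close>. Its inverse
  \<open>gi\<close> is the conjugation by \<psi>.\<close>

definition gf :: "'h => 'h" where "gf h = lt p q q \<phi> (rt p q p \<psi> h)"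
definition gi :: "'h => 'h" where "gi h = lt q p p \<psi> (rt q p q \<phi> h)"
text \<open>The cocycle of a cleft extension: \<psi>(x_(1)) \<psi>(y_(1)) \<phi>(x_(2) y_(2)), the
  failure of \<phi> to be multiplicative. Its convolution inverse \<open>g\<tau>\<close> is
  \<psi>(x_(1) y_(1)) \<phi>(x_(2)) \<phi>(y_(2)).\<close>

definition g\<sigma> :: "'h => 'h => 'k" where "g\<sigma> x y = \<phi> (lt q p q \<psi> x \<otimes>[X p q] lt q p q \<psi> y)"
definition g\<tau> :: "'h => 'h => 'k" where "g\<tau> x y = \<psi> (rt q p q \<phi> x \<otimes>[X q p] rt q p q \<phi> y)"

lemma gf_lin: "gf \<in> lin (X p p) (X q q)"
  unfolding gf_def by (rule lin_comp[OF lt_lin[OF \<phi>d] rt_lin[OF \<psi>d]])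

lemma gi_lin: "gi \<in> lin (X q q) (X p p)"
  unfolding gi_def by (rule lin_comp[OF lt_lin[OF \<psi>d] rt_lin[OF \<phi>d]])

lemma gf_gi: "h \<in> carrier (X q q) ==> gf (gi h) = h"
  unfolding gf_def gi_def
  by (simp add: lt_rt_commute[OF \<psi>d \<phi>d, symmetric] lt_rt_commute[OF \<phi>d \<psi>d] rt_closed[OF \<phi>d] lt_closed[OF \<psi>d] lt_lt[OF j] rt_rt[OF j])

lemma gi_gf: "h \<in> carrier (X p p) ==> gi (gf h) = h"
  unfolding gf_def gi_def
  by (simp add: lt_rt_commute[OF \<phi>d \<psi>d, symmetric] lt_rt_commute[OF \<psi>d \<phi>d] rt_closed[OF \<psi>d] lt_closed[OF \<phi>d] lt_lt[OF i] rt_rt[OF i])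

lemma L\<psi>_closed: "x \<in> carrier (X q q) ==> lt q p q \<psi> x \<in> carrier (X p q)"
  and R\<phi>_closed: "x \<in> carrier (X q q) ==> rt q p q \<phi> x \<in> carrier (X q p)"
  using lt_closed[OF \<psi>d] rt_closed[OF \<phi>d] by auto

lemma \<phi>_closed: "h \<in> carrier (X p q) ==> \<phi> h \<in> carrier K" and \<psi>_closed: "h \<in> carrier (X q p) ==> \<psi> h \<in> carrier K"
  using dual_closed[OF \<phi>d] dual_closed[OF \<psi>d] by auto

lemma g\<sigma>_bil: "g\<sigma> \<in> bil (X q q) (X q q) (base_algebra K)"
  unfolding g\<sigma>_def by (intro bilI lin_comp[OF \<phi>d] lin_mult_left lin_mult_right algX lt_lin[OF \<psi>d] L\<psi>_closed)

lemma g\<tau>_bil: "g\<tau> \<in> bil (X q q) (X q q) (base_algebra K)"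
  unfolding g\<tau>_def by (intro bilI lin_comp[OF \<psi>d] lin_mult_left lin_mult_right algX rt_lin[OF \<phi>d] R\<phi>_closed)

lemma g\<sigma>_closed [simp]: "[|x \<in> carrier (X q q); y \<in> carrier (X q q)|] ==> g\<sigma> x y \<in> carrier K"
  and g\<tau>_closed [simp]: "[|x \<in> carrier (X q q); y \<in> carrier (X q q)|] ==> g\<tau> x y \<in> carrier K"
  using bil_closed[OF g\<sigma>_bil] bil_closed[OF g\<tau>_bil] by auto

lemmas glin = bil1[OF g\<sigma>_bil] bil2[OF g\<sigma>_bil] bil1[OF g\<tau>_bil] bil2[OF g\<tau>_bil]

text \<open>The comultiplication is multiplicative, so \<phi> is evaluated at the product of the
  first parts of the two translates. This is the left half of the twisted product: x_(2) y_(2)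
  weighted by the cocycle.\<close>

lemma twist_left:
  assumes x: "x \<in> carrier (X q q)" and y: "y \<in> carrier (X q q)"
  shows "lt p q q \<phi> (lt q p q \<psi> x \<otimes>[X p q] lt q p q \<psi> y)
    = sw q q q (X q q) (%x1 x2. sw q q q (X q q) (%y1 y2. g\<sigma> x1 y1 \<odot>[X q q] (x2 \<otimes>[X q q] y2)) y) x"
proof -
  let ?t = "%u1 u2 v1 v2. \<phi> (u1 \<otimes>[X p q] v1) \<odot>[X q q] (u2 \<otimes>[X q q] v2)"
  have t1: "(%u1. ?t u1 u2 v1 v2) \<in> lin (X p q) (X q q)" if "u2 \<in> carrier (X q q)" "v1 \<in> carrier (X p q)" "v2 \<in> carrier (X q q)" for u2 v1 v2
    by (intro lin_rules' lin_comp[OF \<phi>d] algX) (use that in auto)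
  have t2: "(%u2. ?t u1 u2 v1 v2) \<in> lin (X q q) (X q q)" if "u1 \<in> carrier (X p q)" "v1 \<in> carrier (X p q)" "v2 \<in> carrier (X q q)" for u1 v1 v2
    by (intro lin_rules' algX) (use that \<phi>_closed in auto)
  have t3: "(%v1. ?t u1 u2 v1 v2) \<in> lin (X p q) (X q q)" if "u1 \<in> carrier (X p q)" "u2 \<in> carrier (X q q)" "v2 \<in> carrier (X q q)" for u1 u2 v2
    by (intro lin_rules' lin_comp[OF \<phi>d] algX) (use that in auto)
  have t4: "(%v2. ?t u1 u2 v1 v2) \<in> lin (X q q) (X q q)" if "u1 \<in> carrier (X p q)" "u2 \<in> carrier (X q q)" "v1 \<in> carrier (X p q)" for u1 u2 v1
    by (intro lin_rules' algX) (use that \<phi>_closed in auto)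
  have b2: "(%v1 v2. ?t u1 u2 v1 v2) \<in> bil (X p q) (X q q) (X q q)" if "u1 \<in> carrier (X p q)" "u2 \<in> carrier (X q q)" for u1 u2
    by (intro bilI t3 t4 that)
  have b1: "(%u1 u2. sw q p q (X q q) (%v1 v2. ?t u1 u2 v1 v2) v) \<in> bil (X p q) (X q q) (X q q)" if "v \<in> carrier (X p q)" for v
    by (intro bilI sw_lin_param b2 t1 t2 that vsC)
  have s2: "(%y1 y2. ?t u1 u2 (lt q p q \<psi> y1) y2) \<in> bil (X q q) (X q q) (X q q)" if "u1 \<in> carrier (X p q)" "u2 \<in> carrier (X q q)" for u1 u2
    by (intro bilI lin_comp[OF t3 lt_lin[OF \<psi>d]] t4 that L\<psi>_closed)
  have s1: "(%x1 x2. sw q q q (X q q) (%y1 y2. ?t (lt q p q \<psi> x1) x2 (lt q p q \<psi> y1) y2) y) \<in> bil (X q q) (X q q) (X q q)"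
    by (intro bilI sw_lin_param s2 lin_comp[OF t1 lt_lin[OF \<psi>d]] t2 y vsC L\<psi>_closed)
  have "lt p q q \<phi> (lt q p q \<psi> x \<otimes>[X p q] lt q p q \<psi> y)
    = sw q p q (X q q) (%u1 u2. sw q p q (X q q) (%v1 v2. ?t u1 u2 v1 v2) (lt q p q \<psi> y)) (lt q p q \<psi> x)"
    unfolding lt_def[of p q q] by (rule sw_mult[OF vsC lt_bil[OF \<phi>d] L\<psi>_closed[OF x] L\<psi>_closed[OF y]])
  also have "... = sw q q q (X q q) (%x1 x2. sw q p q (X q q) (%v1 v2. ?t (lt q p q \<psi> x1) x2 v1 v2) (lt q p q \<psi> y)) x"
    by (rule sw_lt[OF vsC b1[OF L\<psi>_closed[OF y]] \<psi>d x])
  also have "... = sw q q q (X q q) (%x1 x2. sw q q q (X q q) (%y1 y2. ?t (lt q p q \<psi> x1) x2 (lt q p q \<psi> y1) y2) y) x"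
    by (rule sw_cong[OF _ vsC s1 x], rule sw_lt[OF vsC b2 \<psi>d y]) (auto intro: L\<psi>_closed)
  finally show ?thesis unfolding g\<sigma>_def .
qed

text \<open>The right half, with the inverse cocycle at the last parts. The product of the
  conjugated elements is formed in \<open>X p p\<close>; translating it by \<psi> leaves products in
  \<open>X p q\<close>, to which the left half can still be applied.\<close>

lemma twist_right:
  assumes x: "x \<in> carrier (X q q)" and y: "y \<in> carrier (X q q)"
  shows "rt p q p \<psi> (gi x \<otimes>[X p p] gi y)
    = sw q q q (X p q) (%x1 x2. sw q q q (X p q) (%y1 y2. g\<tau> x2 y2 \<odot>[X p q] (lt q p q \<psi> x1 \<otimes>[X p q] lt q p q \<psi> y1)) y) x"
proof -
  let ?t = "%u1 u2 v1 v2. \<psi> (u2 \<otimes>[X q p] v2) \<odot>[X p q] (u1 \<otimes>[X p q] v1)"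
  have t1: "(%u1. ?t u1 u2 v1 v2) \<in> lin (X p q) (X p q)" if "u2 \<in> carrier (X q p)" "v1 \<in> carrier (X p q)" "v2 \<in> carrier (X q p)" for u2 v1 v2
    by (intro lin_rules' algX) (use that \<psi>_closed in auto)
  have t2: "(%u2. ?t u1 u2 v1 v2) \<in> lin (X q p) (X p q)" if "u1 \<in> carrier (X p q)" "v1 \<in> carrier (X p q)" "v2 \<in> carrier (X q p)" for u1 v1 v2
    by (intro lin_rules' lin_comp[OF \<psi>d] algX) (use that in auto)
  have t3: "(%v1. ?t u1 u2 v1 v2) \<in> lin (X p q) (X p q)" if "u1 \<in> carrier (X p q)" "u2 \<in> carrier (X q p)" "v2 \<in> carrier (X q p)" for u1 u2 v2
    by (intro lin_rules' algX) (use that \<psi>_closed in auto)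
  have t4: "(%v2. ?t u1 u2 v1 v2) \<in> lin (X q p) (X p q)" if "u1 \<in> carrier (X p q)" "u2 \<in> carrier (X q p)" "v1 \<in> carrier (X p q)" for u1 u2 v1
    by (intro lin_rules' lin_comp[OF \<psi>d] algX) (use that in auto)
  have b2: "(%v1 v2. ?t u1 u2 v1 v2) \<in> bil (X p q) (X q p) (X p q)" if "u1 \<in> carrier (X p q)" "u2 \<in> carrier (X q p)" for u1 u2
    by (intro bilI t3 t4 that)
  have b1: "(%u1 u2. sw q p p (X p q) (%v1 v2. ?t u1 u2 v1 v2) v) \<in> bil (X p q) (X q p) (X p q)" if "v \<in> carrier (X p p)" for v
    by (intro bilI sw_lin_param b2 t1 t2 that vsC)
  have gx: "gi x \<in> carrier (X p p)" and gy: "gi y \<in> carrier (X p p)" using lin_closed[OF gi_lin] x y by auto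
  have r: "sw q p p (X p q) t (gi z) = sw q q q (X p q) (%z1 z2. t (lt q p q \<psi> z1) (rt q p q \<phi> z2)) z"
    if t: "t \<in> bil (X p q) (X q p) (X p q)" and z: "z \<in> carrier (X q q)" for t z
  proof -
    have t': "(%u v. t (lt q p q \<psi> u) v) \<in> bil (X q q) (X q p) (X p q)"
      by (intro bilI bil1[OF t] lin_comp[OF bil2[OF t] lt_lin[OF \<psi>d]] L\<psi>_closed)
    show ?thesis unfolding gi_def
      using sw_lt[OF vsC t \<psi>d R\<phi>_closed[OF z]] sw_rt[OF vsC t' \<phi>d z] by simp
  qed
  have s2: "(%y1 y2. ?t u1 u2 (lt q p q \<psi> y1) (rt q p q \<phi> y2)) \<in> bil (X q q) (X q q) (X p q)" if "u1 \<in> carrier (X p q)" "u2 \<in> carrier (X q p)" for u1 u2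
    by (intro bilI lin_comp[OF t3 lt_lin[OF \<psi>d]] lin_comp[OF t4 rt_lin[OF \<phi>d]] that L\<psi>_closed R\<phi>_closed)
  have s1: "(%x1 x2. sw q q q (X p q) (%y1 y2. ?t (lt q p q \<psi> x1) (rt q p q \<phi> x2) (lt q p q \<psi> y1) (rt q p q \<phi> y2)) y) \<in> bil (X q q) (X q q) (X p q)"
    by (intro bilI sw_lin_param s2 lin_comp[OF t1 lt_lin[OF \<psi>d]] lin_comp[OF t2 rt_lin[OF \<phi>d]] y vsC L\<psi>_closed R\<phi>_closed)
  have "rt p q p \<psi> (gi x \<otimes>[X p p] gi y) = sw q p p (X p q) (%u1 u2. sw q p p (X p q) (%v1 v2. ?t u1 u2 v1 v2) (gi y)) (gi x)"
    unfolding rt_def[of p q p] by (rule sw_mult[OF vsC rt_bil[OF \<psi>d] gx gy])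
  also have "... = sw q q q (X p q) (%x1 x2. sw q p p (X p q) (%v1 v2. ?t (lt q p q \<psi> x1) (rt q p q \<phi> x2) v1 v2) (gi y)) x"
    by (rule r[OF b1[OF gy] x])
  also have "... = sw q q q (X p q) (%x1 x2. sw q q q (X p q) (%y1 y2. ?t (lt q p q \<psi> x1) (rt q p q \<phi> x2) (lt q p q \<psi> y1) (rt q p q \<phi> y2)) y) x"
    by (rule sw_cong[OF _ vsC s1 x], rule r[OF b2 y]) (auto intro: L\<psi>_closed R\<phi>_closed)
  finally show ?thesis unfolding g\<tau>_def .
qed

lemma gf_one: "gf \<one>[X p p] = \<one>[X q q]"
  unfolding gf_def by (simp add: rt_one[OF \<psi>d \<psi>1] lt_one[OF \<phi>d \<phi>1])

lemma E_gf: "h \<in> carrier (X p p) ==> E q (gf h) = E p h"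
  unfolding gf_def by (simp add: E_lt[OF \<phi>d] rt_closed[OF \<psi>d] conv_inv_rt[OF i])

lemma E_gi: "h \<in> carrier (X q q) ==> E p (gi h) = E q h"
  unfolding gi_def by (simp add: E_lt[OF \<psi>d] rt_closed[OF \<phi>d] conv_inv_rt[OF j])

lemma lt_twist_right:
  assumes F: "F \<in> lin (X p q) U" and U: "vs U" and x: "x \<in> carrier (X q q)" and y: "y \<in> carrier (X q q)"
  shows "F (rt p q p \<psi> (gi x \<otimes>[X p p] gi y))
    = sw q q q U (%x1 x2. sw q q q U (%y1 y2. g\<tau> x2 y2 \<odot>[U] F (lt q p q \<psi> x1 \<otimes>[X p q] lt q p q \<psi> y1)) y) x"
proof -
  have m: "lt q p q \<psi> x1 \<otimes>[X p q] lt q p q \<psi> y1 \<in> carrier (X p q)" if "x1 \<in> carrier (X q q)" "y1 \<in> carrier (X q q)" for x1 y1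
    using that L\<psi>_closed by simp
  have b: "(%y1 y2. g\<tau> x2 y2 \<odot>[W] H (lt q p q \<psi> x1 \<otimes>[X p q] lt q p q \<psi> y1)) \<in> bil (X q q) (X q q) W"
    if "x1 \<in> carrier (X q q)" "x2 \<in> carrier (X q q)" "H \<in> lin (X p q) W" "vs W" for x1 x2 H and W :: "('k, 'w, 'l) module_scheme"
    by (intro bilI lin_scale lin_smult_vec glin lin_comp[OF that(3)] lin_mult_left algX lt_lin[OF \<psi>d] lin_closed[OF that(3) m] L\<psi>_closed that g\<tau>_closed)
  have c: "(%x1 x2. sw q q q W (%y1 y2. g\<tau> x2 y2 \<odot>[W] H (lt q p q \<psi> x1 \<otimes>[X p q] lt q p q \<psi> y1)) y) \<in> bil (X q q) (X q q) W"
    if "H \<in> lin (X p q) W" "vs W" for H and W :: "('k, 'w, 'l) module_scheme"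
    by (intro bilI sw_lin_param b lin_scale lin_smult_vec glin lin_comp[OF that(1)] lin_mult_right algX lt_lin[OF \<psi>d] lin_closed[OF that(1) m] L\<psi>_closed that g\<tau>_closed vsC y)
  have "F (rt p q p \<psi> (gi x \<otimes>[X p p] gi y))
    = sw q q q U (%x1 x2. F (sw q q q (X p q) (%y1 y2. g\<tau> x2 y2 \<odot>[X p q] (lt q p q \<psi> x1 \<otimes>[X p q] lt q p q \<psi> y1)) y)) x"
    unfolding twist_right[OF x y] by (rule lin_sw[OF F vsC U c[OF lin_id vsC] x])
  also have "... = sw q q q U (%x1 x2. sw q q q U (%y1 y2. g\<tau> x2 y2 \<odot>[U] F (lt q p q \<psi> x1 \<otimes>[X p q] lt q p q \<psi> y1)) y) x"
  proof (rule sw_cong[OF _ U c[OF F U] x])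
    fix x1 x2 assume 1: "x1 \<in> carrier (X q q)" "x2 \<in> carrier (X q q)"
    have "F (sw q q q (X p q) (%y1 y2. g\<tau> x2 y2 \<odot>[X p q] (lt q p q \<psi> x1 \<otimes>[X p q] lt q p q \<psi> y1)) y)
      = sw q q q U (%y1 y2. F (g\<tau> x2 y2 \<odot>[X p q] (lt q p q \<psi> x1 \<otimes>[X p q] lt q p q \<psi> y1))) y"
      by (rule lin_sw[OF F vsC U b[OF 1 lin_id vsC] y])
    also have "... = sw q q q U (%y1 y2. g\<tau> x2 y2 \<odot>[U] F (lt q p q \<psi> x1 \<otimes>[X p q] lt q p q \<psi> y1)) y"
      by (rule sw_cong[OF _ U b[OF 1 F U] y]) (use 1 m in \<open>simp add: lin_smult[OF F]\<close>)
    finally show "F (sw q q q (X p q) (%y1 y2. g\<tau> x2 y2 \<odot>[X p q] (lt q p q \<psi> x1 \<otimes>[X p q] lt q p q \<psi> y1)) y)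
      = sw q q q U (%y1 y2. g\<tau> x2 y2 \<odot>[U] F (lt q p q \<psi> x1 \<otimes>[X p q] lt q p q \<psi> y1)) y" .
  qed
  finally show ?thesis .
qed

text \<open>The twisted product is the product of \<open>X p p\<close> transported along
  \<open>gf\<close>. Hence \<open>gf\<close> is an algebra map into the twist, without a separate
  study of the twisted product.\<close>

lemma twist_mult:
  assumes x: "x \<in> carrier (X q q)" and y: "y \<in> carrier (X q q)"
  shows "sw q q q (X q q) (%a1 a'. sw q q q (X q q) (%a2 a3. sw q q q (X q q) (%b1 b'. sw q q q (X q q) (%b2 b3.
      (g\<sigma> a1 b1 \<otimes> g\<tau> a3 b3) \<odot>[X q q] (a2 \<otimes>[X q q] b2)) b') y) a') x = gf (gi x \<otimes>[X p p] gi y)"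
proof -
  let ?X = "X q q"
  let ?g = "%a1 a2 a3 b1 b2 b3. (g\<sigma> a1 b1 \<otimes> g\<tau> a3 b3) \<odot>[?X] (a2 \<otimes>[?X] b2)"
  note [intro] = lin_scale lin_smult_vec lin_mult_left lin_mult_right lin_Kmult_left lin_Kmult_right glin lin_id
  have a1: "(%a1. ?g a1 a2 a3 b1 b2 b3) \<in> lin ?X ?X" if "a2 \<in> carrier ?X" "a3 \<in> carrier ?X" "b1 \<in> carrier ?X" "b2 \<in> carrier ?X" "b3 \<in> carrier ?X" for a2 a3 b1 b2 b3
    by (intro lin_smult_vec lin_Kmult_right glin) (use that in auto)
  have a2: "(%a2. ?g a1 a2 a3 b1 b2 b3) \<in> lin ?X ?X" if "a1 \<in> carrier ?X" "a3 \<in> carrier ?X" "b1 \<in> carrier ?X" "b2 \<in> carrier ?X" "b3 \<in> carrier ?X" for a1 a3 b1 b2 b3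
    by (intro lin_scale lin_mult_right lin_id algX) (use that in auto)
  have a3: "(%a3. ?g a1 a2 a3 b1 b2 b3) \<in> lin ?X ?X" if "a1 \<in> carrier ?X" "a2 \<in> carrier ?X" "b1 \<in> carrier ?X" "b2 \<in> carrier ?X" "b3 \<in> carrier ?X" for a1 a2 b1 b2 b3
    by (intro lin_smult_vec lin_Kmult_left glin) (use that in auto)
  have b1: "(%b1. ?g a1 a2 a3 b1 b2 b3) \<in> lin ?X ?X" if "a1 \<in> carrier ?X" "a2 \<in> carrier ?X" "a3 \<in> carrier ?X" "b2 \<in> carrier ?X" "b3 \<in> carrier ?X" for a1 a2 a3 b2 b3
    by (intro lin_smult_vec lin_Kmult_right glin) (use that in auto)
  have b2: "(%b2. ?g a1 a2 a3 b1 b2 b3) \<in> lin ?X ?X" if "a1 \<in> carrier ?X" "a2 \<in> carrier ?X" "a3 \<in> carrier ?X" "b1 \<in> carrier ?X" "b3 \<in> carrier ?X" for a1 a2 a3 b1 b3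
    by (intro lin_scale lin_mult_left lin_id algX) (use that in auto)
  have b3: "(%b3. ?g a1 a2 a3 b1 b2 b3) \<in> lin ?X ?X" if "a1 \<in> carrier ?X" "a2 \<in> carrier ?X" "a3 \<in> carrier ?X" "b1 \<in> carrier ?X" "b2 \<in> carrier ?X" for a1 a2 a3 b1 b2
    by (intro lin_smult_vec lin_Kmult_left glin) (use that in auto)
  note ab = a1 a2 a3 b1 b2 b3
  let ?sw = "sw q q q ?X"
  text \<open>Both iterated comultiplications are bracketed to the left.\<close>
  let ?B = "%a1 a2 a3. ?sw (%b' b3. ?sw (%b1 b2. ?g a1 a2 a3 b1 b2 b3) b') y"
  have Bb: "(%b' b3. ?sw (%b1 b2. ?g a1 a2 a3 b1 b2 b3) b') \<in> bil ?X ?X ?X" if "a1 \<in> carrier ?X" "a2 \<in> carrier ?X" "a3 \<in> carrier ?X" for a1 a2 a3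
    by (intro bilI sw_lin sw_lin_param ab vsC that)
  have B1: "(%a1. ?B a1 a2 a3) \<in> lin ?X ?X" if "a2 \<in> carrier ?X" "a3 \<in> carrier ?X" for a2 a3
    by (intro sw_lin_param Bb bilI ab vsC that y)
  have B2: "(%a2. ?B a1 a2 a3) \<in> lin ?X ?X" if "a1 \<in> carrier ?X" "a3 \<in> carrier ?X" for a1 a3
    by (intro sw_lin_param Bb bilI ab vsC that y)
  have B3: "(%a3. ?B a1 a2 a3) \<in> lin ?X ?X" if "a1 \<in> carrier ?X" "a2 \<in> carrier ?X" for a1 a2
    by (intro sw_lin_param Bb bilI ab vsC that y)
  have "?sw (%a1 a'. ?sw (%a2 a3. ?sw (%b1 b'. ?sw (%b2 b3. ?g a1 a2 a3 b1 b2 b3) b') y) a') x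
    = ?sw (%a1 a'. ?sw (%a2 a3. ?B a1 a2 a3) a') x"
  proof (rule sw_cong[OF sw_cong vsC _ x])
    show "?sw (%b1 b'. ?sw (%b2 b3. ?g a1 a2 a3 b1 b2 b3) b') y = ?B a1 a2 a3"
      if "a1 \<in> carrier ?X" "a' \<in> carrier ?X" "a2 \<in> carrier ?X" "a3 \<in> carrier ?X" for a1 a' a2 a3
      by (rule sw_assoc[OF vsC y, symmetric]; intro ab that)
    show "(%a1 a'. ?sw (%a2 a3. ?B a1 a2 a3) a') \<in> bil ?X ?X ?X"
      by (intro bilI sw_lin sw_lin_param B1 B2 B3 vsC)
  qed (auto intro!: bilI B2 B3)
  also have "... = ?sw (%a' a3. ?sw (%a1 a2. ?B a1 a2 a3) a') x"
    by (rule sw_assoc[OF vsC x B1 B2 B3, symmetric])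
  also have "... = ?sw (%a' a3. ?sw (%b' b3. g\<tau> a3 b3 \<odot>[?X] lt p q q \<phi> (lt q p q \<psi> a' \<otimes>[X p q] lt q p q \<psi> b')) y) x"
  proof (rule sw_cong[OF _ vsC _ x])
    have m: "lt p q q \<phi> (lt q p q \<psi> x1 \<otimes>[X p q] lt q p q \<psi> y1) \<in> carrier ?X" if "x1 \<in> carrier ?X" "y1 \<in> carrier ?X" for x1 y1
      using that L\<psi>_closed lt_closed[OF \<phi>d] by simp
    have c: "(%b' b3. g\<tau> a3 b3 \<odot>[?X] lt p q q \<phi> (lt q p q \<psi> a' \<otimes>[X p q] lt q p q \<psi> b')) \<in> bil ?X ?X ?X"
      if "a' \<in> carrier ?X" "a3 \<in> carrier ?X" for a' a3
      by (intro bilI lin_scale lin_smult_vec glin lin_comp[OF lt_lin[OF \<phi>d]] lin_mult_left algX lt_lin[OF \<psi>d] m L\<psi>_closed that g\<tau>_closed vsC)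
    show "(%a' a3. ?sw (%b' b3. g\<tau> a3 b3 \<odot>[?X] lt p q q \<phi> (lt q p q \<psi> a' \<otimes>[X p q] lt q p q \<psi> b')) y) \<in> bil ?X ?X ?X"
      by (intro bilI sw_lin_param c lin_scale lin_smult_vec glin lin_comp[OF lt_lin[OF \<phi>d]] lin_mult_right algX lt_lin[OF \<psi>d] m L\<psi>_closed g\<tau>_closed vsC y)
    fix a' a3 assume a: "a' \<in> carrier ?X" "a3 \<in> carrier ?X"
    \<comment> \<open>Exchanging the two independent sums puts the first and second parts of x and y
      next to each other, where \<open>twist_left\<close> applies; the factor with a3 and b3 is
      constant there.\<close>
    have "?sw (%a1 a2. ?B a1 a2 a3) a' = ?sw (%b' b3. ?sw (%a1 a2. ?sw (%b1 b2. ?g a1 a2 a3 b1 b2 b3) b') a') y"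
      by (rule sw_swap[OF vsC a(1) y]; intro sw_lin_arg sw_lin_param bilI ab vsC lin_id a)
    also have "... = ?sw (%b' b3. g\<tau> a3 b3 \<odot>[?X] lt p q q \<phi> (lt q p q \<psi> a' \<otimes>[X p q] lt q p q \<psi> b')) y"
    proof (rule sw_cong[OF _ vsC c[OF a] y])
      fix b' b3' assume b: "b' \<in> carrier ?X" "b3' \<in> carrier ?X"
      let ?h = "%a1 a2 b1 b2. g\<sigma> a1 b1 \<odot>[?X] (a2 \<otimes>[?X] b2)"
      have h1: "(%a1. ?h a1 a2 b1 b2) \<in> lin ?X ?X" if "a2 \<in> carrier ?X" "b1 \<in> carrier ?X" "b2 \<in> carrier ?X" for a2 b1 b2
        by (intro lin_smult_vec glin vsC alg_closed algX that)
      have h2: "(%a2. ?h a1 a2 b1 b2) \<in> lin ?X ?X" if "a1 \<in> carrier ?X" "b1 \<in> carrier ?X" "b2 \<in> carrier ?X" for a1 b1 b2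
        by (intro lin_scale lin_mult_right lin_id vsC g\<sigma>_closed algX that)
      have h3: "(%b1. ?h a1 a2 b1 b2) \<in> lin ?X ?X" if "a1 \<in> carrier ?X" "a2 \<in> carrier ?X" "b2 \<in> carrier ?X" for a1 a2 b2
        by (intro lin_smult_vec glin vsC alg_closed algX that)
      have h4: "(%b2. ?h a1 a2 b1 b2) \<in> lin ?X ?X" if "a1 \<in> carrier ?X" "a2 \<in> carrier ?X" "b1 \<in> carrier ?X" for a1 a2 b1
        by (intro lin_scale lin_mult_left lin_id vsC g\<sigma>_closed algX that)
      note h = h1 h2 h3 h4
      have t: "g\<tau> a3 b3' \<in> carrier K" using a b by simp
      note sc = lin_scale[OF vsC t lin_id]
      have "g\<tau> a3 b3' \<odot>[?X] lt p q q \<phi> (lt q p q \<psi> a' \<otimes>[X p q] lt q p q \<psi> b')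
        = ?sw (%a1 a2. g\<tau> a3 b3' \<odot>[?X] ?sw (%b1 b2. ?h a1 a2 b1 b2) b') a'"
        unfolding twist_left[OF a(1) b(1)]
        by (rule lin_sw[OF sc vsC vsC _ a(1)]) (intro bilI sw_lin_param h vsC b)
      also have "... = ?sw (%a1 a2. ?sw (%b1 b2. ?g a1 a2 a3 b1 b2 b3') b') a'"
      proof (rule sw_cong[OF _ vsC _ a(1)])
        show "(%a1 a2. ?sw (%b1 b2. ?g a1 a2 a3 b1 b2 b3') b') \<in> bil ?X ?X ?X"
          by (intro bilI sw_lin_param ab vsC a b)
        fix a1 a2 assume 1: "a1 \<in> carrier ?X" "a2 \<in> carrier ?X"
        have "g\<tau> a3 b3' \<odot>[?X] ?sw (%b1 b2. ?h a1 a2 b1 b2) b' = ?sw (%b1 b2. g\<tau> a3 b3' \<odot>[?X] ?h a1 a2 b1 b2) b'"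
          by (rule lin_sw[OF sc vsC vsC _ b(1)]) (intro bilI h 1)
        also have "... = ?sw (%b1 b2. ?g a1 a2 a3 b1 b2 b3') b'"
          by (rule sw_cong[OF _ vsC _ b(1)], use 1 a b in \<open>simp add: vs_distr(3)[OF vsC, symmetric] m_comm\<close>, intro bilI ab 1 a b)
        finally show "g\<tau> a3 b3' \<odot>[?X] ?sw (%b1 b2. ?h a1 a2 b1 b2) b' = ?sw (%b1 b2. ?g a1 a2 a3 b1 b2 b3') b'" .
      qed
      finally show "?sw (%a1 a2. ?sw (%b1 b2. ?g a1 a2 a3 b1 b2 b3') b') a'
        = g\<tau> a3 b3' \<odot>[?X] lt p q q \<phi> (lt q p q \<psi> a' \<otimes>[X p q] lt q p q \<psi> b')" by simp
    qed
    finally show "?sw (%a1 a2. ?B a1 a2 a3) a' = ?sw (%b' b3. g\<tau> a3 b3 \<odot>[?X] lt p q q \<phi> (lt q p q \<psi> a' \<otimes>[X p q] lt q p q \<psi> b')) y" .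
  qed
  also have "... = gf (gi x \<otimes>[X p p] gi y)"
    unfolding gf_def by (rule lt_twist_right[OF lt_lin[OF \<phi>d] vsC x y, symmetric])
  finally show ?thesis .
qed

text \<open>By \<open>lt_twist_right\<close> the sum is \<phi> at the \<psi>-translate of the
  product of \<open>gi x\<close> and \<open>gi y\<close>. This is the convolution of \<phi> and
  \<psi>, that is, the counit, at this product.\<close>

lemma conv_\<sigma>\<tau>:
  assumes x: "x \<in> carrier (X q q)" and y: "y \<in> carrier (X q q)"
  shows "sw q q q (base_algebra K) (%a1 a2. sw q q q (base_algebra K) (%b1 b2. g\<sigma> a1 b1 \<otimes> g\<tau> a2 b2) y) x = E q x \<otimes> E q y"
proof -
  have g: "gi x \<in> carrier (X p p)" "gi y \<in> carrier (X p p)" using lin_closed[OF gi_lin] x y by auto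
  have b': "(%b1 b2. g\<tau> a2 b2 \<otimes> g\<sigma> a1 b1) \<in> bil (X q q) (X q q) (base_algebra K)" if "a1 \<in> carrier (X q q)" "a2 \<in> carrier (X q q)" for a1 a2
    by (intro bilI lin_Kmult_left lin_Kmult_right glin g\<sigma>_closed g\<tau>_closed that)
  have c: "(%a1 a2. sw q q q (base_algebra K) (%b1 b2. g\<tau> a2 b2 \<otimes> g\<sigma> a1 b1) y) \<in> bil (X q q) (X q q) (base_algebra K)"
    by (intro bilI sw_lin_param b' lin_Kmult_left lin_Kmult_right glin g\<sigma>_closed g\<tau>_closed vsC vs_base y)
  have "sw q q q (base_algebra K) (%a1 a2. sw q q q (base_algebra K) (%b1 b2. g\<sigma> a1 b1 \<otimes> g\<tau> a2 b2) y) x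
    = sw q q q (base_algebra K) (%a1 a2. sw q q q (base_algebra K) (%b1 b2. g\<tau> a2 b2 \<otimes> g\<sigma> a1 b1) y) x"
    by (rule sw_cong[OF sw_cong[OF _ vs_base b' y] vs_base c x]) (auto simp: m_comm)
  also have "... = \<phi> (rt p q p \<psi> (gi x \<otimes>[X p p] gi y))"
    using lt_twist_right[OF \<phi>d vs_base x y] unfolding g\<sigma>_def by simp
  also have "... = E p (gi x \<otimes>[X p p] gi y)" by (rule conv_inv_rt[OF i]) (use g in simp)
  also have "... = E q x \<otimes> E q y" using g x y by (simp add: E_mult E_gi)
  finally show ?thesis .
qed

text \<open>In this order the inner factors \<phi>(x_(2)) \<psi>(x_(3)), and likewise those of y,
  cancel by \<open>sw_flip\<close>. What is left is the convolution of \<psi> and \<phi> at the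
  product of x and y.\<close>

lemma conv_\<tau>\<sigma>:
  assumes x: "x \<in> carrier (X q q)" and y: "y \<in> carrier (X q q)"
  shows "sw q q q (base_algebra K) (%a1 a2. sw q q q (base_algebra K) (%b1 b2. g\<tau> a1 b1 \<otimes> g\<sigma> a2 b2) y) x = E q x \<otimes> E q y"
proof -
  let ?K = "base_algebra K"
  let ?t = "%u1 u2 v1 v2. \<psi> (u1 \<otimes>[X q p] v1) \<otimes> \<phi> (u2 \<otimes>[X p q] v2)"
  note c = \<phi>_closed \<psi>_closed alg_closed(1)[OF algX]
  have t1: "(%u1. ?t u1 u2 v1 v2) \<in> lin (X q p) ?K" if "u2 \<in> carrier (X p q)" "v1 \<in> carrier (X q p)" "v2 \<in> carrier (X p q)" for u2 v1 v2
    by (intro lin_Kmult_right lin_comp[OF \<psi>d] lin_mult_right lin_id algX c that)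
  have t2: "(%u2. ?t u1 u2 v1 v2) \<in> lin (X p q) ?K" if "u1 \<in> carrier (X q p)" "v1 \<in> carrier (X q p)" "v2 \<in> carrier (X p q)" for u1 v1 v2
    by (intro lin_Kmult_left lin_comp[OF \<phi>d] lin_mult_right lin_id algX c that)
  have t3: "(%v1. ?t u1 u2 v1 v2) \<in> lin (X q p) ?K" if "u1 \<in> carrier (X q p)" "u2 \<in> carrier (X p q)" "v2 \<in> carrier (X p q)" for u1 u2 v2
    by (intro lin_Kmult_right lin_comp[OF \<psi>d] lin_mult_left lin_id algX c that)
  have t4: "(%v2. ?t u1 u2 v1 v2) \<in> lin (X p q) ?K" if "u1 \<in> carrier (X q p)" "u2 \<in> carrier (X p q)" "v1 \<in> carrier (X q p)" for u1 u2 v1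
    by (intro lin_Kmult_left lin_comp[OF \<phi>d] lin_mult_left lin_id algX c that)
  have b2: "(%v1 v2. ?t u1 u2 v1 v2) \<in> bil (X q p) (X p q) ?K" if "u1 \<in> carrier (X q p)" "u2 \<in> carrier (X p q)" for u1 u2
    by (intro bilI t3 t4 that)
  have b1: "(%u1 u2. sw p q q ?K (%v1 v2. ?t u1 u2 v1 v2) y) \<in> bil (X q p) (X p q) ?K"
    by (intro bilI sw_lin_param b2 t1 t2 vsC vs_base y)
  have b1': "(%a1 a2. sw p q q ?K (%v1 v2. ?t (rt q p q \<phi> a1) (lt q p q \<psi> a2) v1 v2) y) \<in> bil (X q q) (X q q) ?K"
    by (intro bilI lin_comp[OF bil1[OF b1] lt_lin[OF \<psi>d]] lin_comp[OF bil2[OF b1] rt_lin[OF \<phi>d]] L\<psi>_closed R\<phi>_closed)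
  have pb: "(%u v. \<psi> u \<otimes> \<phi> v) \<in> bil (X q p) (X p q) ?K"
    by (intro bilI lin_Kmult_left lin_Kmult_right \<phi>d \<psi>d \<phi>_closed \<psi>_closed)
  have "sw q q q ?K (%a1 a2. sw q q q ?K (%b1 b2. g\<tau> a1 b1 \<otimes> g\<sigma> a2 b2) y) x
    = sw q q q ?K (%a1 a2. sw p q q ?K (%v1 v2. ?t (rt q p q \<phi> a1) (lt q p q \<psi> a2) v1 v2) y) x"
    unfolding g\<sigma>_def g\<tau>_def
    by (rule sw_cong[OF sw_flip[OF i vs_base b2 y] vs_base b1' x]) (auto intro: L\<psi>_closed R\<phi>_closed)
  also have "... = sw p q q ?K (%u1 u2. sw p q q ?K (%v1 v2. ?t u1 u2 v1 v2) y) x"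
    by (rule sw_flip[OF i vs_base b1 x])
  also have "... = sw p q q ?K (%u v. \<psi> u \<otimes> \<phi> v) (x \<otimes>[X q q] y)"
    by (rule sw_mult[OF vs_base pb x y, symmetric])
  also have "... = \<phi> (lt q p q \<psi> (x \<otimes>[X q q] y))"
    using lin_lt[OF \<phi>d vs_base \<psi>d, of "x \<otimes>[X q q] y"] x y by simp
  also have "... = E q (x \<otimes>[X q q] y)" using j x y by (simp add: conv_inv_def)
  finally show ?thesis using x y by (simp add: E_mult)
qed

lemma g\<sigma>_one: "x \<in> carrier (X q q) ==> g\<sigma> x \<one>[X q q] = E q x" "x \<in> carrier (X q q) ==> g\<sigma> \<one>[X q q] x = E q x"
  using j by (simp_all add: g\<sigma>_def lt_one[OF \<psi>d \<psi>1] L\<psi>_closed alg_simps conv_inv_def)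

lemma g\<sigma>_twist:
  assumes x: "x \<in> carrier (X q q)" and y: "y \<in> carrier (X q q)" and F: "F \<in> lin (X q q) (base_algebra K)"
  shows "sw q q q (base_algebra K) (%a1 a2. sw q q q (base_algebra K) (%b1 b2. g\<sigma> a1 b1 \<otimes> F (a2 \<otimes>[X q q] b2)) y) x
    = F (lt p q q \<phi> (lt q p q \<psi> x \<otimes>[X p q] lt q p q \<psi> y))"
proof -
  let ?K = "base_algebra K"
  have Fc: "F h \<in> carrier K" if "h \<in> carrier (X q q)" for h using dual_closed[OF F that] .
  note cl = alg_closed(1)[OF algX] g\<sigma>_closed Fc
  have b: "(%b1 b2. g\<sigma> a1 b1 \<odot>[X q q] (a2 \<otimes>[X q q] b2)) \<in> bil (X q q) (X q q) (X q q)" if "a1 \<in> carrier (X q q)" "a2 \<in> carrier (X q q)" for a1 a2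
    by (intro bilI lin_scale lin_smult_vec glin lin_mult_left lin_id vsC algX cl that)
  have b': "(%b1 b2. g\<sigma> a1 b1 \<otimes> F (a2 \<otimes>[X q q] b2)) \<in> bil (X q q) (X q q) ?K" if "a1 \<in> carrier (X q q)" "a2 \<in> carrier (X q q)" for a1 a2
    by (intro bilI lin_Kmult_left lin_Kmult_right glin lin_comp[OF F] lin_mult_left lin_id algX cl that)
  have c: "(%a1 a2. sw q q q (X q q) (%b1 b2. g\<sigma> a1 b1 \<odot>[X q q] (a2 \<otimes>[X q q] b2)) y) \<in> bil (X q q) (X q q) (X q q)"
    by (intro bilI sw_lin_param b lin_scale lin_smult_vec glin lin_mult_right lin_id vsC algX cl y)
  have c': "(%a1 a2. sw q q q ?K (%b1 b2. g\<sigma> a1 b1 \<otimes> F (a2 \<otimes>[X q q] b2)) y) \<in> bil (X q q) (X q q) ?K"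
    by (intro bilI sw_lin_param b' lin_Kmult_left lin_Kmult_right glin lin_comp[OF F] lin_mult_right lin_id vsC vs_base algX cl y)
  have "F (lt p q q \<phi> (lt q p q \<psi> x \<otimes>[X p q] lt q p q \<psi> y))
    = sw q q q ?K (%a1 a2. F (sw q q q (X q q) (%b1 b2. g\<sigma> a1 b1 \<odot>[X q q] (a2 \<otimes>[X q q] b2)) y)) x"
    unfolding twist_left[OF x y] by (rule lin_sw[OF F vsC vs_base c x])
  also have "... = sw q q q ?K (%a1 a2. sw q q q ?K (%b1 b2. g\<sigma> a1 b1 \<otimes> F (a2 \<otimes>[X q q] b2)) y) x"
  proof (rule sw_cong[OF _ vs_base c' x])
    fix a1 a2 assume 1: "a1 \<in> carrier (X q q)" "a2 \<in> carrier (X q q)"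
    have "F (sw q q q (X q q) (%b1 b2. g\<sigma> a1 b1 \<odot>[X q q] (a2 \<otimes>[X q q] b2)) y)
      = sw q q q ?K (%b1 b2. F (g\<sigma> a1 b1 \<odot>[X q q] (a2 \<otimes>[X q q] b2))) y"
      by (rule lin_sw[OF F vsC vs_base b[OF 1] y])
    also have "... = sw q q q ?K (%b1 b2. g\<sigma> a1 b1 \<otimes> F (a2 \<otimes>[X q q] b2)) y"
      by (rule sw_cong[OF _ vs_base b'[OF 1] y]) (use 1 in \<open>simp add: lin_smult[OF F]\<close>)
    finally show "F (sw q q q (X q q) (%b1 b2. g\<sigma> a1 b1 \<odot>[X q q] (a2 \<otimes>[X q q] b2)) y)
      = sw q q q ?K (%b1 b2. g\<sigma> a1 b1 \<otimes> F (a2 \<otimes>[X q q] b2)) y" .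
  qed
  finally show ?thesis by simp
qed

text \<open>Translation by \<psi> undoes the translation by \<phi> in \<open>twist_left\<close>. So
  both sides are \<phi> at the product of the three translated elements, bracketed in the two
  possible ways.\<close>

lemma g\<sigma>_cocycle:
  assumes x: "x \<in> carrier (X q q)" and y: "y \<in> carrier (X q q)" and z: "z \<in> carrier (X q q)"
  shows "sw q q q (base_algebra K) (%a1 a2. sw q q q (base_algebra K) (%b1 b2. g\<sigma> a1 b1 \<otimes> g\<sigma> (a2 \<otimes>[X q q] b2) z) y) x
    = sw q q q (base_algebra K) (%b1 b2. sw q q q (base_algebra K) (%c1 c2. g\<sigma> b1 c1 \<otimes> g\<sigma> x (b2 \<otimes>[X q q] c2)) z) y"
proof -
  have l: "lt q p q \<psi> (lt p q q \<phi> u) = u" if "u \<in> carrier (X p q)" for u by (rule lt_lt[OF i that])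
  note c = L\<psi>_closed[OF x] L\<psi>_closed[OF y] L\<psi>_closed[OF z]
  show ?thesis
    unfolding g\<sigma>_twist[OF x y bil2[OF g\<sigma>_bil z]] g\<sigma>_twist[OF y z bil1[OF g\<sigma>_bil x]]
    using c by (simp add: g\<sigma>_def l alg_simps(5))
qed

lemma g\<sigma>_two_cocycle: "inv_two_cocycle K (HA q) g\<sigma> g\<tau>"
proof -
  have "bilinear_maps K (HA q) (HA q) (base_algebra K) = bil (X q q) (X q q) (base_algebra K)"
    by (simp add: bilinear_maps_def)
  then show ?thesis
    unfolding inv_two_cocycle_def convolution2_def
    using g\<sigma>_bil g\<tau>_bil conv_\<sigma>\<tau> conv_\<tau>\<sigma> g\<sigma>_one g\<sigma>_cocycle by (simp add: sw_def)
qed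

text \<open>Conjugating both factors inserts \<psi>(h_(3)) \<phi>(h_(4)) between them, which
  \<open>sw_flip\<close> removes.\<close>

lemma D_gf:
  assumes a: "a \<in> carrier (X p p)"
  shows "D q q q (gf a) = sw p p p (X q q >< X q q) (%u v. tens K (X q q) (X q q) (gf u) (gf v)) a"
proof -
  let ?P = "X q q >< X q q" and ?t = "tens K (X q q) (X q q)"
  have P: "vs ?P" by simp
  have ga: "gf a \<in> carrier (X q q)" by (rule lin_closed[OF gf_lin a])
  note tb = tens_bil[OF vsC vsC, of q q q q]
  have t': "(%u v. ?t (lt p q q \<phi> u) v) \<in> bil (X p q) (X q q) ?P"
    by (intro bilI bil1[OF tb] lin_comp[OF bil2[OF tb] lt_lin[OF \<phi>d]] lt_closed[OF \<phi>d])
  have t'': "(%u v. ?t (lt p q q \<phi> u) (rt q q p \<psi> v)) \<in> bil (X p q) (X q p) ?P"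
    by (intro bilI lin_comp[OF bil1[OF tb] rt_lin[OF \<psi>d]] lin_comp[OF bil2[OF tb] lt_lin[OF \<phi>d]] lt_closed[OF \<phi>d] rt_closed[OF \<psi>d])
  have g: "(%u v. ?t (gf u) (gf v)) \<in> bil (X p p) (X p p) ?P"
    by (intro bilI lin_comp[OF bil1[OF tb] gf_lin] lin_comp[OF bil2[OF tb] gf_lin] lin_closed[OF gf_lin])
  have "D q q q (gf a) = sw q q q ?P ?t (gf a)"
    unfolding sw_def by (rule tens_lift_self[OF vsC vsC, symmetric]) (use ga in simp)
  also have "... = sw q p q ?P (%u v. ?t (lt p q q \<phi> u) v) (rt p q p \<psi> a)"
    unfolding gf_def by (rule sw_lt[OF P tb \<phi>d rt_closed[OF \<psi>d a]])
  also have "... = sw q p p ?P (%u v. ?t (lt p q q \<phi> u) (rt q q p \<psi> v)) a"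
    by (rule sw_rt[OF P t' \<psi>d a])
  also have "... = sw p p p ?P (%u v. ?t (lt p q q \<phi> (rt p q p \<psi> u)) (rt q q p \<psi> (lt p q p \<phi> v))) a"
    by (rule sw_flip[OF j P t'' a, symmetric])
  also have "... = sw p p p ?P (%u v. ?t (gf u) (gf v)) a"
    by (rule sw_cong[OF _ P g a]) (simp add: gf_def lt_rt_commute[OF \<phi>d \<psi>d])
  finally show ?thesis .
qed

theorem cocycle_deformation: "cocycle_deformation K (HA q) (HA p)"
proof -
  let ?B = "cocycle_twist K (HA q) g\<sigma> g\<tau>"
  have sel: "carrier ?B = carrier (X q q)" "one ?B = one (X q q)" "zero ?B = zero (X q q)" "add ?B = add (X q q)"
    "smult ?B = smult (X q q)" "comult ?B = D q q q" "counit ?B = E q"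
    by (simp_all add: cocycle_twist_def)
  have mul: "x \<otimes>[?B] y = gf (gi x \<otimes>[X p p] gi y)" if "x \<in> carrier (X q q)" "y \<in> carrier (X q q)" for x y
    using twist_mult[OF that] by (simp add: cocycle_twist_def sw_def)
  have v: "vsame (X q q) ?B" by (simp add: vsame_def sel)
  note vt = vsame_tens[OF vsC vsC v v]
  have l: "lin W ?B = lin W (X q q)" for W :: "('k, 'h) module" by (rule vsame_lin(2)[OF v, symmetric])
  have gc: "gf a \<in> carrier (X q q)" if "a \<in> carrier (X p p)" for a by (rule lin_closed[OF gf_lin that])
  have gc': "gi a \<in> carrier (X p p)" if "a \<in> carrier (X q q)" for a by (rule lin_closed[OF gi_lin that])
  have "gf \<in> ahom (X p p) ?B"
    by (rule ahomI) (use gf_lin in \<open>simp_all add: l mul gc gi_gf gf_one sel\<close>)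
  then have h: "gf \<in> ahom (HA p) ?B" by simp
  have "comult ?B (gf a) = tens_map K ?B ?B gf gf (comult (HA p) a)" if "a \<in> carrier (X p p)" for a
    using D_gf[OF that] by (simp add: sel tens_map_def vt(1) vsame_tens_lift[OF vt(2), symmetric] sw_def)
  moreover have "bij_betw gf (carrier (HA p)) (carrier ?B)"
    by (rule bij_betw_byWitness[where f' = gi]) (auto simp: sel gc gc' gi_gf gf_gi)
  ultimately have "bialg_iso K (HA p) ?B gf"
    unfolding bialg_iso_def using h by (simp add: sel E_gf)
  then show ?thesis
    unfolding cocycle_deformation_def using HA_hopf g\<sigma>_two_cocycle by blast
qed

end

end

section \<open>Checking coassociativity and antipode identities on generators\<close>

context scalars
begin

text \<open>With h' \<otimes> h3 \<mapsto> D(h') \<otimes> h3 an algebra map, coassociativity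
  becomes an equation between algebra maps and can be checked on generators.\<close>

lemma assoc_hom_left:
  assumes A: "alg A" "alg A1" "alg A2" "alg A3" and D: "D \<in> ahom A (A1 >< A2)"
  shows "tens_lift K (A1 >< (A2 >< A3)) (%h' h3. tens_lift K (A1 >< (A2 >< A3))
      (%h1 h2. tens K A1 (A2 >< A3) h1 (tens K A2 A3 h2 h3)) (D h')) \<in> ahom (A >< A3) (A1 >< (A2 >< A3))"
    and "[|h' \<in> carrier A; h3 \<in> carrier A3|] ==>
      tens_lift K (A1 >< (A2 >< A3)) (%h' h3. tens_lift K (A1 >< (A2 >< A3))
        (%h1 h2. tens K A1 (A2 >< A3) h1 (tens K A2 A3 h2 h3)) (D h')) (tens K A A3 h' h3)
      = tens_lift K (A1 >< (A2 >< A3)) (%h1 h2. tens K A1 (A2 >< A3) h1 (tens K A2 A3 h2 h3)) (D h')"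
proof -
  let ?P = "A2 >< A3" and ?T = "A1 >< (A2 >< A3)"
  let ?tn = "%h1 h2 h3. tens K A1 ?P h1 (tens K A2 A3 h2 h3)"
  let ?\<beta> = "%h' h3. tens_lift K ?T (%h1 h2. ?tn h1 h2 h3) (D h')"
  note V = A[THEN alg_vs] note Dl = ahom_lin[OF D] and Dc = ahom_closed[OF D]
  have P: "alg ?P" and T: "alg ?T" using A by auto
  note TV = alg_vs[OF T] and PV = alg_vs[OF P]
  have t1: "(%h1. ?tn h1 h2 h3) \<in> lin A1 ?T" if "h2 \<in> carrier A2" "h3 \<in> carrier A3" for h2 h3
    by (intro lin_tens_right lin_id V PV) (use that V in auto)
  have t2: "(%h2. ?tn h1 h2 h3) \<in> lin A2 ?T" if "h1 \<in> carrier A1" "h3 \<in> carrier A3" for h1 h3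
    by (intro lin_tens_right lin_tens_left lin_id V PV) (use that V in auto)
  have t3: "(%h3. ?tn h1 h2 h3) \<in> lin A3 ?T" if "h1 \<in> carrier A1" "h2 \<in> carrier A2" for h1 h2
    by (intro lin_tens_left lin_id V PV) (use that V in auto)
  have b: "(%h1 h2. ?tn h1 h2 h3) \<in> bil A1 A2 ?T" if "h3 \<in> carrier A3" for h3
    by (intro bilI t1 t2 that)
  have \<beta>: "?\<beta> \<in> bil A A3 ?T"
  proof (rule bilI)
    show "(%h3. ?\<beta> h' h3) \<in> lin A3 ?T" if "h' \<in> carrier A" for h'
      by (rule lin_tens_lift_param[OF V(4,2,3) TV Dc[OF that] b t3])
    show "(%h'. ?\<beta> h' h3) \<in> lin A ?T" if "h3 \<in> carrier A3" for h3
      by (rule lin_comp[OF tens_lift_lin[OF V(2,3) TV b[OF that]] Dl])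
  qed
  let ?\<Phi> = "tens_lift K ?T (%h1 h2. ?tn h1 h2 \<one>[A3])"
  have o: "\<one>[A3] \<in> carrier A3" "\<one>[A2] \<in> carrier A2" "\<one>[A1] \<in> carrier A1" using A by auto
  have \<Phi>: "?\<Phi> \<in> ahom (A1 >< A2) ?T"
    by (rule tensor_homI[OF A(2,3) T b[OF o(1)]]) (use A V PV o in \<open>auto simp: tens_one tens_mult[OF A(2) P] tens_mult[OF A(3,4)] alg_simps\<close>)
  \<comment> \<open>Each value is D(h') \<otimes> 1 times 1 \<otimes> 1 \<otimes> h3, and by
    \<open>com\<close> these factors commute. Multiplicativity follows without expanding
    D(h').\<close>
  have fac: "tens_lift K ?T (%h1 h2. ?tn h1 h2 h3) z = ?\<Phi> z \<otimes>[?T] ?tn \<one>[A1] \<one>[A2] h3" if "h3 \<in> carrier A3" "z \<in> carrier (A1 >< A2)" for h3 z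
    by (rule tens_lift_eqI[OF V(2,3) TV b[OF that(1)] lin_mult_right[OF T _ ahom_lin[OF \<Phi>]] _ that(2)])
      (use that A V PV o in \<open>auto simp: tens_lift_tens[OF V(2,3) TV b[OF o(1)]] tens_mult[OF A(2) P] tens_mult[OF A(3,4)] alg_simps\<close>)
  have com: "?tn \<one>[A1] \<one>[A2] h3 \<otimes>[?T] ?\<Phi> z = ?\<Phi> z \<otimes>[?T] ?tn \<one>[A1] \<one>[A2] h3" if "h3 \<in> carrier A3" "z \<in> carrier (A1 >< A2)" for h3 z
    by (rule tensor_ext[OF V(2,3) TV lin_mult_left[OF T _ ahom_lin[OF \<Phi>]] lin_mult_right[OF T _ ahom_lin[OF \<Phi>]] _ that(2)])
      (use that A V PV o in \<open>auto simp: tens_lift_tens[OF V(2,3) TV b[OF o(1)]] tens_mult[OF A(2) P] tens_mult[OF A(3,4)] alg_simps\<close>)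
  show "tens_lift K ?T ?\<beta> \<in> ahom (A >< A3) ?T"
  proof (rule tensor_homI[OF A(1,4) T \<beta>])
    show "?\<beta> \<one>[A] \<one>[A3] = \<one>[?T]" using ahom_one[OF D] ahom_one[OF \<Phi>] by simp
    fix a c h k assume 1: "a \<in> carrier A" "h \<in> carrier A3" "c \<in> carrier A" "k \<in> carrier A3"
    have m: "?tn \<one>[A1] \<one>[A2] (h \<otimes>[A3] k) = ?tn \<one>[A1] \<one>[A2] h \<otimes>[?T] ?tn \<one>[A1] \<one>[A2] k"
      using 1 A V PV o by (simp add: tens_mult[OF A(2) P] tens_mult[OF A(3,4)] alg_simps)
    have c: "?\<Phi> (D a) \<in> carrier ?T" "?\<Phi> (D c) \<in> carrier ?T" "?tn \<one>[A1] \<one>[A2] h \<in> carrier ?T" "?tn \<one>[A1] \<one>[A2] k \<in> carrier ?T"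
      using 1 ahom_closed[OF \<Phi>] Dc A V PV o by auto
    have "?\<beta> (a \<otimes>[A] c) (h \<otimes>[A3] k) = (?\<Phi> (D a) \<otimes>[?T] ?\<Phi> (D c)) \<otimes>[?T] (?tn \<one>[A1] \<one>[A2] h \<otimes>[?T] ?tn \<one>[A1] \<one>[A2] k)"
      using 1 A fac[of "h \<otimes>[A3] k" "D (a \<otimes>[A] c)"] by (simp add: Dc ahom_mult[OF D] ahom_mult[OF \<Phi>] m)
    also have "... = ?\<Phi> (D a) \<otimes>[?T] ((?\<Phi> (D c) \<otimes>[?T] ?tn \<one>[A1] \<one>[A2] h) \<otimes>[?T] ?tn \<one>[A1] \<one>[A2] k)"
      using c T by (simp add: alg_simps(5))
    also have "?\<Phi> (D c) \<otimes>[?T] ?tn \<one>[A1] \<one>[A2] h = ?tn \<one>[A1] \<one>[A2] h \<otimes>[?T] ?\<Phi> (D c)"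
      by (rule com[symmetric]) (use 1 Dc in auto)
    also have "?\<Phi> (D a) \<otimes>[?T] ((?tn \<one>[A1] \<one>[A2] h \<otimes>[?T] ?\<Phi> (D c)) \<otimes>[?T] ?tn \<one>[A1] \<one>[A2] k)
      = (?\<Phi> (D a) \<otimes>[?T] ?tn \<one>[A1] \<one>[A2] h) \<otimes>[?T] (?\<Phi> (D c) \<otimes>[?T] ?tn \<one>[A1] \<one>[A2] k)"
      using c T by (simp add: alg_simps(5))
    also have "... = ?\<beta> a h \<otimes>[?T] ?\<beta> c k" using fac 1 Dc by simp
    finally show "?\<beta> (a \<otimes>[A] c) (h \<otimes>[A3] k) = ?\<beta> a h \<otimes>[?T] ?\<beta> c k" .
  qed
  show "tens_lift K ?T ?\<beta> (tens K A A3 h' h3) = ?\<beta> h' h3" if "h' \<in> carrier A" "h3 \<in> carrier A3"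
    by (rule tens_lift_tens[OF V(1,4) TV \<beta> that])
qed

lemma assoc_hom_right:
  assumes A: "alg A" "alg A1" "alg A2" "alg A3" and D: "D \<in> ahom A (A2 >< A3)"
  shows "tens_lift K (A1 >< (A2 >< A3)) (%h1 h'. tens_lift K (A1 >< (A2 >< A3))
      (%h2 h3. tens K A1 (A2 >< A3) h1 (tens K A2 A3 h2 h3)) (D h')) \<in> ahom (A1 >< A) (A1 >< (A2 >< A3))"
    and "[|h1 \<in> carrier A1; h' \<in> carrier A|] ==>
      tens_lift K (A1 >< (A2 >< A3)) (%h1 h'. tens_lift K (A1 >< (A2 >< A3))
        (%h2 h3. tens K A1 (A2 >< A3) h1 (tens K A2 A3 h2 h3)) (D h')) (tens K A1 A h1 h')
      = tens K A1 (A2 >< A3) h1 (D h')"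
proof -
  let ?P = "A2 >< A3" and ?T = "A1 >< (A2 >< A3)"
  let ?\<beta> = "%h1 h'. tens_lift K ?T (%h2 h3. tens K A1 ?P h1 (tens K A2 A3 h2 h3)) (D h')"
  note V = A[THEN alg_vs] note Dl = ahom_lin[OF D] and Dc = ahom_closed[OF D]
  have P: "alg ?P" and T: "alg ?T" using A by auto
  note TV = alg_vs[OF T] and PV = alg_vs[OF P]
  have e': "tens_lift K ?T (%h2 h3. tens K A1 ?P h1 (tens K A2 A3 h2 h3)) z = tens K A1 ?P h1 z"
    if "h1 \<in> carrier A1" "z \<in> carrier ?P" for h1 z
    by (rule tens_lift_eqI[OF V(3,4) TV _ lin_tens_left[OF V(2) PV that(1) lin_id] refl that(2)])
      (intro bilI lin_tens_left lin_tens_right lin_id V PV that)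
  have e: "?\<beta> h1 h' = tens K A1 ?P h1 (D h')" if "h1 \<in> carrier A1" "h' \<in> carrier A" for h1 h'
    by (rule e'[OF that(1) Dc[OF that(2)]])
  have b: "(%h1 h'. tens K A1 ?P h1 (D h')) \<in> bil A1 A ?T"
    by (intro bilI lin_tens_left lin_tens_right lin_id V PV Dl Dc)
  have \<beta>: "?\<beta> \<in> bil A1 A ?T" by (rule bil_cong[OF e[symmetric] V(2,1) b])
  show "tens_lift K ?T ?\<beta> \<in> ahom (A1 >< A) ?T"
    by (rule tensor_homI[OF A(2,1) T \<beta>])
      (use A P Dc in \<open>simp_all add: e' ahom_one[OF D] ahom_mult[OF D] tens_one[OF A(2) P] tens_mult[OF A(2) P]\<close>)
  show "tens_lift K ?T ?\<beta> (tens K A1 A h1 h') = tens K A1 ?P h1 (D h')" if "h1 \<in> carrier A1" "h' \<in> carrier A"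
    by (simp add: tens_lift_tens[OF V(2,1) TV \<beta> that] e[OF that])
qed

text \<open>The antipode identities are multiplicative, hence can be checked on generators.\<close>

lemma antipode_left_gen:
  assumes A: "alg A" "alg Y" "alg Z" and D: "D \<in> ahom A (Y >< Z)" and E: "E \<in> ahom A (base_algebra K)"
    and S: "S \<in> ahom Y (op_alg Z)" and Gs: "alg_gen A Gs"
    and gen: "\<And>s. s \<in> Gs ==> tens_lift K Z (%h1 h2. S h1 \<otimes>[Z] h2) (D s) = E s \<odot>[Z] \<one>[Z]"
    and h: "h \<in> carrier A"
  shows "tens_lift K Z (%h1 h2. S h1 \<otimes>[Z] h2) (D h) = E h \<odot>[Z] \<one>[Z]"
proof -
  note V = A[THEN alg_vs] note Dl = ahom_lin[OF D] and Dc = ahom_closed[OF D]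
  have Sl: "S \<in> lin Y Z" using ahom_lin[OF S] by simp
  note Sc = lin_closed[OF Sl]
  have Sm: "S (u \<otimes>[Y] v) = S v \<otimes>[Z] S u" if "u \<in> carrier Y" "v \<in> carrier Y" for u v using ahom_mult[OF S that] by simp
  have El: "E \<in> lin A (base_algebra K)" by (rule ahom_lin[OF E])
  have Ec: "E u \<in> carrier K" if "u \<in> carrier A" for u using lin_closed[OF El that] by simp
  have tb: "(%h1 h2. S h1 \<otimes>[Z] h2) \<in> bil Y Z Z" by (intro bilI lin_mult_left lin_mult_right A Sl Sc lin_id)
  have DA: "s \<in> carrier A" if "s \<in> Gs" for s using Gs that by (auto simp: alg_gen_def)
  show ?thesis
  proof (rule lin_gen_ext[OF A(1) V(3) Gs lin_comp[OF tens_lift_lin[OF V(2,3) V(3) tb] Dl] _ _ _ h])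
    show "(%h. E h \<odot>[Z] \<one>[Z]) \<in> lin A Z" by (rule lin_smult_vec[OF V(3) _ El]) (use A in simp)
    show "tens_lift K Z (%h1 h2. S h1 \<otimes>[Z] h2) (D \<one>[A]) = E \<one>[A] \<odot>[Z] \<one>[Z]"
      using A ahom_one[OF S] by (simp add: ahom_one[OF D] ahom_one[OF E] tens_one tens_lift_tens[OF V(2,3) V(3) tb] vs_simps[OF V(3)] alg_simps)
    fix s y assume s: "s \<in> Gs" and y: "y \<in> carrier A" and IH: "tens_lift K Z (%h1 h2. S h1 \<otimes>[Z] h2) (D y) = E y \<odot>[Z] \<one>[Z]"
    note sA = DA[OF s]
    \<comment> \<open>S(s_(1) y_(1)) s_(2) y_(2) = S(y_(1)) (S(s_(1)) s_(2)) y_(2): the sum over s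
      sits inside the map m \<mapsto> S(y_(1)) m y_(2) and collapses to a scalar, after which the
      induction hypothesis for y applies.\<close>
    let ?M = "%m. tens_lift K Z (%y1 y2. S y1 \<otimes>[Z] (m \<otimes>[Z] y2)) (D y)"
    have mb: "(%y1 y2. S y1 \<otimes>[Z] (m \<otimes>[Z] y2)) \<in> bil Y Z Z" if "m \<in> carrier Z" for m
      by (intro bilI lin_mult_left lin_mult_right A Sl Sc lin_id that alg_closed(1)[OF A(3)])
    have M: "?M \<in> lin Z Z"
      by (rule lin_tens_lift_param[OF V(3) V(2,3) V(3) Dc[OF y]])
        (auto intro!: mb lin_mult_left[OF A(3)] lin_mult_right[OF A(3)] lin_id Sc)
    have mb': "(%s1 s2. ?M (S s1 \<otimes>[Z] s2)) \<in> bil Y Z Z"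
      by (intro bilI lin_comp[OF M] bil1[OF tb] bil2[OF tb])
    have "tens_lift K Z (%h1 h2. S h1 \<otimes>[Z] h2) (D (s \<otimes>[A] y))
      = tens_lift K Z (%s1 s2. tens_lift K Z (%y1 y2. S (s1 \<otimes>[Y] y1) \<otimes>[Z] (s2 \<otimes>[Z] y2)) (D y)) (D s)"
      unfolding ahom_mult[OF D sA y] by (rule tens_lift_mult[OF A(2,3) V(3) tb Dc[OF sA] Dc[OF y]])
    also have "... = tens_lift K Z (%s1 s2. ?M (S s1 \<otimes>[Z] s2)) (D s)"
    proof (rule tens_lift_cong[OF _ V(2,3) V(3) mb' Dc[OF sA]])
      fix s1 s2 assume 1: "s1 \<in> carrier Y" "s2 \<in> carrier Z"
      show "tens_lift K Z (%y1 y2. S (s1 \<otimes>[Y] y1) \<otimes>[Z] (s2 \<otimes>[Z] y2)) (D y) = ?M (S s1 \<otimes>[Z] s2)"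
        by (rule tens_lift_cong[OF _ V(2,3) V(3) mb Dc[OF y]]) (use 1 A Sc in \<open>auto simp: Sm alg_simps(5)\<close>)
    qed
    also have "... = ?M (tens_lift K Z (%h1 h2. S h1 \<otimes>[Z] h2) (D s))"
      by (rule lin_tens_lift[OF V(2,3) V(3) V(3) M tb Dc[OF sA], symmetric])
    also have "... = E s \<odot>[Z] ?M \<one>[Z]" using gen[OF s] lin_smult[OF M Ec[OF sA]] A by simp
    also have "?M \<one>[Z] = tens_lift K Z (%h1 h2. S h1 \<otimes>[Z] h2) (D y)"
      by (rule tens_lift_cong[OF _ V(2,3) V(3) tb Dc[OF y]]) (use A in \<open>simp add: alg_simps\<close>)
    finally show "tens_lift K Z (%h1 h2. S h1 \<otimes>[Z] h2) (D (s \<otimes>[A] y)) = E (s \<otimes>[A] y) \<odot>[Z] \<one>[Z]"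
      using A Ec[OF sA] Ec[OF y] by (simp add: IH ahom_mult[OF E sA y] vs_distr[OF V(3)])
  qed
qed

lemma antipode_right_gen:
  assumes A: "alg A" "alg Y" "alg Z" and D: "D \<in> ahom A (Y >< Z)" and E: "E \<in> ahom A (base_algebra K)"
    and S: "S \<in> ahom Z (op_alg Y)" and Gs: "alg_gen A Gs"
    and gen: "\<And>s. s \<in> Gs ==> tens_lift K Y (%h1 h2. h1 \<otimes>[Y] S h2) (D s) = E s \<odot>[Y] \<one>[Y]"
    and h: "h \<in> carrier A"
  shows "tens_lift K Y (%h1 h2. h1 \<otimes>[Y] S h2) (D h) = E h \<odot>[Y] \<one>[Y]"
proof -
  note V = A[THEN alg_vs] note Dl = ahom_lin[OF D] and Dc = ahom_closed[OF D]
  have Sl: "S \<in> lin Z Y" using ahom_lin[OF S] by simp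
  note Sc = lin_closed[OF Sl]
  have Sm: "S (u \<otimes>[Z] v) = S v \<otimes>[Y] S u" if "u \<in> carrier Z" "v \<in> carrier Z" for u v using ahom_mult[OF S that] by simp
  have El: "E \<in> lin A (base_algebra K)" by (rule ahom_lin[OF E])
  have Ec: "E u \<in> carrier K" if "u \<in> carrier A" for u using lin_closed[OF El that] by simp
  have tb: "(%h1 h2. h1 \<otimes>[Y] S h2) \<in> bil Y Z Y" by (intro bilI lin_mult_left lin_mult_right A Sl Sc lin_id)
  have DA: "s \<in> carrier A" if "s \<in> Gs" for s using Gs that by (auto simp: alg_gen_def)
  show ?thesis
  proof (rule lin_gen_ext[OF A(1) V(2) Gs lin_comp[OF tens_lift_lin[OF V(2,3) V(2) tb] Dl] _ _ _ h])
    show "(%h. E h \<odot>[Y] \<one>[Y]) \<in> lin A Y" by (rule lin_smult_vec[OF V(2) _ El]) (use A in simp)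
    show "tens_lift K Y (%h1 h2. h1 \<otimes>[Y] S h2) (D \<one>[A]) = E \<one>[A] \<odot>[Y] \<one>[Y]"
      using A ahom_one[OF S] by (simp add: ahom_one[OF D] ahom_one[OF E] tens_one tens_lift_tens[OF V(2,3) V(2) tb] vs_simps[OF V(2)] alg_simps)
    fix s y assume s: "s \<in> Gs" and y: "y \<in> carrier A" and IH: "tens_lift K Y (%h1 h2. h1 \<otimes>[Y] S h2) (D y) = E y \<odot>[Y] \<one>[Y]"
    note sA = DA[OF s]
    \<comment> \<open>On this side S(s_(2) y_(2)) = S(y_(2)) S(s_(2)) puts y_(1) S(y_(2)) in the
      middle, so the sum over y collapses before the sum over s.\<close>
    have eb: "(%s1 s2. E y \<odot>[Y] (s1 \<otimes>[Y] S s2)) \<in> bil Y Z Y"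
      by (intro bilI lin_scale V bil1[OF tb] bil2[OF tb] Ec y)
    have "tens_lift K Y (%h1 h2. h1 \<otimes>[Y] S h2) (D (s \<otimes>[A] y))
      = tens_lift K Y (%s1 s2. tens_lift K Y (%y1 y2. (s1 \<otimes>[Y] y1) \<otimes>[Y] S (s2 \<otimes>[Z] y2)) (D y)) (D s)"
      unfolding ahom_mult[OF D sA y] by (rule tens_lift_mult[OF A(2,3) V(2) tb Dc[OF sA] Dc[OF y]])
    also have "... = tens_lift K Y (%s1 s2. E y \<odot>[Y] (s1 \<otimes>[Y] S s2)) (D s)"
    proof (rule tens_lift_cong[OF _ V(2,3) V(2) eb Dc[OF sA]])
      fix s1 s2 assume 1: "s1 \<in> carrier Y" "s2 \<in> carrier Z"
      have M: "(%m. s1 \<otimes>[Y] (m \<otimes>[Y] S s2)) \<in> lin Y Y"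
        by (intro lin_mult_left lin_mult_right A Sc lin_id 1)
      have mb: "(%y1 y2. s1 \<otimes>[Y] ((y1 \<otimes>[Y] S y2) \<otimes>[Y] S s2)) \<in> bil Y Z Y"
        by (intro bilI lin_comp[OF M] bil1[OF tb] bil2[OF tb])
      have "tens_lift K Y (%y1 y2. (s1 \<otimes>[Y] y1) \<otimes>[Y] S (s2 \<otimes>[Z] y2)) (D y)
        = tens_lift K Y (%y1 y2. s1 \<otimes>[Y] ((y1 \<otimes>[Y] S y2) \<otimes>[Y] S s2)) (D y)"
        by (rule tens_lift_cong[OF _ V(2,3) V(2) mb Dc[OF y]]) (use 1 A Sc in \<open>auto simp: Sm alg_simps(5)\<close>)
      also have "... = s1 \<otimes>[Y] ((E y \<odot>[Y] \<one>[Y]) \<otimes>[Y] S s2)"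
        using lin_tens_lift[OF V(2,3) V(2) V(2) M tb Dc[OF y]] IH by simp
      also have "... = E y \<odot>[Y] (s1 \<otimes>[Y] S s2)" using 1 A Sc Ec[OF y] by (simp add: alg_simps)
      finally show "tens_lift K Y (%y1 y2. (s1 \<otimes>[Y] y1) \<otimes>[Y] S (s2 \<otimes>[Z] y2)) (D y) = E y \<odot>[Y] (s1 \<otimes>[Y] S s2)" .
    qed
    also have "... = E y \<odot>[Y] tens_lift K Y (%h1 h2. h1 \<otimes>[Y] S h2) (D s)"
      by (rule lin_tens_lift[OF V(2,3) V(2) V(2) lin_scale[OF V(2) Ec[OF y] lin_id] tb Dc[OF sA], symmetric])
    finally show "tens_lift K Y (%h1 h2. h1 \<otimes>[Y] S h2) (D (s \<otimes>[A] y)) = E (s \<otimes>[A] y) \<odot>[Y] \<one>[Y]"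
      using A Ec[OF sA] Ec[OF y] by (simp add: gen[OF s] ahom_mult[OF E sA y] vs_distr(3)[OF V(2), symmetric] m_comm)
  qed
qed

lemma tens_map_hom:
  assumes A: "alg A" "alg B" "alg A'" "alg B'" and f: "f \<in> ahom A A'" and g: "g \<in> ahom B B'"
  shows "tens_map K A' B' f g \<in> ahom (A >< B) (A' >< B')"
    and "[|a \<in> carrier A; b \<in> carrier B|] ==> tens_map K A' B' f g (tens K A B a b) = tens K A' B' (f a) (g b)"
proof -
  note V = A[THEN alg_vs]
  have b: "(%a b. tens K A' B' (f a) (g b)) \<in> bil A B (A' >< B')"
    by (intro bilI lin_tens_left lin_tens_right V ahom_lin[OF f] ahom_lin[OF g] ahom_closed[OF f] ahom_closed[OF g])
  show "tens_map K A' B' f g \<in> ahom (A >< B) (A' >< B')"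
    unfolding tens_map_def
    by (rule tensor_homI[OF A(1,2) alg_tensor[OF A(3,4)] b])
      (use ahom_one[OF f] ahom_one[OF g] ahom_mult[OF f] ahom_mult[OF g] ahom_closed[OF f] ahom_closed[OF g] A
        in \<open>simp_all add: tens_one tens_mult\<close>)
  show "tens_map K A' B' f g (tens K A B a b) = tens K A' B' (f a) (g b)" if "a \<in> carrier A" "b \<in> carrier B"
    unfolding tens_map_def by (rule tens_lift_tens[OF V(1,2) vs_tensor[OF V(3,4)] b that])
qed

end

subsection \<open>The cogroupoid of a cocycle\<close>

text \<open>\<open>homog\<close> is the Yetter-Drinfeld condition in coordinates: g carries vectors
  of degree g_i to vectors of degree g g_i g\<inverse>. \<open>b\<close> stands for b_1, restricted
  to group elements in its first argument, and \<open>b_coc\<close> is the identity in (b).\<close>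

locale yd_smash = smash_pres K G I V x ga
  for K :: "('k, 'r) ring_scheme" (structure) and G :: "('g, 'z) monoid_scheme" and I :: "'i set"
    and V :: "('k, 'v, 'm) module_scheme" and x ga +
  fixes gd :: "'i => 'g" and b :: "'g => 'v => 'k"
  assumes gd_closed [simp]: "i \<in> I ==> gd i \<in> carrier G"
    and homog: "[|g \<in> carrier G; i \<in> I; coords K V I x (ga g (x i)) j \<noteq> \<zero>|] ==> gd j = g \<otimes>[G] gd i \<otimes>[G] inv\<^bsub>G\<^esub> g"
    and b_lin: "g \<in> carrier G ==> b g \<in> linear_maps K V (base_algebra K)"
    and b_coc: "[|g \<in> carrier G; h \<in> carrier G; i \<in> I|] ==> b (g \<otimes>[G] h) (x i) = b g (ga h (x i)) \<oplus> b h (x i)"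
begin

lemma b_closed [simp]: "[|g \<in> carrier G; v \<in> carrier V|] ==> b g v \<in> carrier K"
  using lin_closed[OF b_lin] by simp

text \<open>Only indices with a nonzero coordinate contribute. Together with \<open>homog\<close>
  this allows g_j to be replaced by the common degree g g_i g\<inverse> in sums over the coordinates
  of g \<cdot>_V x_i.\<close>

lemma vext_homog:
  assumes W: "vs W" and n: "\<And>j. j \<in> I ==> n' j \<in> carrier W" and v: "v \<in> carrier V"
    and e: "\<And>j. [|j \<in> I; cd v j \<noteq> \<zero>|] ==> n j = n' j"
  shows "vext W n v = vext W n' v"
proof -
  interpret W: module K W by (rule W)
  have c: "cd v \<in> fin_funs K I" by (rule cd_closed[OF v])
  show ?thesis unfolding vext_def lincomb_def
    by (rule W.M.finsum_cong') (use n e ff_supp[OF c] ff_val[OF c] in auto)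
qed

lemma conj_mult: "[|g \<in> carrier G; t \<in> carrier G|] ==> g \<otimes>[G] t \<otimes>[G] inv\<^bsub>G\<^esub> g \<otimes>[G] g = g \<otimes>[G] t"
  by (simp add: G.m_assoc)

text \<open>The objects of the cogroupoid are scalars; only \<^term>\<open>\<one>\<close> and \<^term>\<open>\<zero>\<close> are needed.\<close>

definition kk :: "bool => 'k" where "kk l = (if l then \<one> else \<zero>)"

lemma kk_closed [simp]: "kk l \<in> carrier K"
  by (simp add: kk_def)

text \<open>For (l, m) = (1, 1), (1, 0) and (0, 0) these are the corrections of M, if its action has
  the form (a), of M' and of M''.\<close>

definition BB :: "bool => bool => 'g => 'i => 'g => 'k"
  where "BB l m g i = b g (x i) \<odot>[KG] (kk l \<odot>[KG] point K \<one>[G] \<oplus>[KG] (\<ominus> kk m) \<odot>[KG] point K (g \<otimes>[G] gd i \<otimes>[G] inv\<^bsub>G\<^esub> g))"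

lemma BB_closed: "[|g \<in> carrier G; i \<in> I|] ==> BB l m g i \<in> carrier KG"
  unfolding BB_def by (intro vs_closed[OF vs_ma]) auto

lemma BBd: "B_datum (BB l m)"
  using BB_closed by (simp add: B_datum_def)

text \<open>The commutation rule for \<open>BB l m\<close> with the factor g multiplied out: the
  conjugate g g_i g\<inverse> becomes g g_i, and no inverse is left to be handled in tensor
  products.\<close>

definition rel :: "bool => bool => ('k, 'c, 'n) module_scheme => ('i + 'g => 'c) => bool"
  where "rel l m C f \<longleftrightarrow> (\<forall>g\<in>carrier G. \<forall>i\<in>I. f (Inr g) \<otimes>[C] f (Inl i) =
    vext C (%j. f (Inl j)) (ga g (x i)) \<otimes>[C] f (Inr g) \<oplus>[C]
      ((b g (x i) \<otimes> kk l) \<odot>[C] f (Inr g) \<oplus>[C] (\<ominus> (b g (x i) \<otimes> kk m)) \<odot>[C] f (Inr (g \<otimes>[G] gd i))))"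

lemma T_datumD:
  assumes "T_datum C f"
  shows "alg C" "s \<in> gens ==> f s \<in> carrier C" "i \<in> I ==> f (Inl i) \<in> carrier C" "g \<in> carrier G ==> f (Inr g) \<in> carrier C"
    "f (Inr \<one>[G]) = \<one>[C]"
    "[|g \<in> carrier G; h \<in> carrier G|] ==> f (Inr g) \<otimes>[C] f (Inr h) = f (Inr (g \<otimes>[G] h))"
  using assms by (auto simp: T_datum_def)

lemma BB_image:
  assumes f: "T_datum C f" and g: "g \<in> carrier G" and i: "i \<in> I"
  shows "lincomb K C (%t. f (Inr t)) (BB l m g i) \<otimes>[C] f (Inr g)
    = (b g (x i) \<otimes> kk l) \<odot>[C] f (Inr g) \<oplus>[C] (\<ominus> (b g (x i) \<otimes> kk m)) \<odot>[C] f (Inr (g \<otimes>[G] gd i))"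
proof -
  note C = T_datumD(1)[OF f] and d = T_datumD[OF f] note VC = alg_vs[OF C]
  have L: "lincomb K C (%t. f (Inr t)) \<in> lin KG C"
    by (rule lincomb_lin[OF VC]) (use d in auto)
  let ?s = "g \<otimes>[G] gd i \<otimes>[G] inv\<^bsub>G\<^esub> g"
  have s: "?s \<in> carrier G" using g i by simp
  have p: "point K \<one>[G] \<in> carrier KG" "point K ?s \<in> carrier KG" using s by auto
  have Lp: "lincomb K C (%t. f (Inr t)) (point K t) = f (Inr t)" if "t \<in> carrier G" for t
    using d that by (simp add: lincomb_point[OF VC])
  have "lincomb K C (%t. f (Inr t)) (BB l m g i) = b g (x i) \<odot>[C] (kk l \<odot>[C] \<one>[C] \<oplus>[C] (\<ominus> kk m) \<odot>[C] f (Inr ?s))"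
    unfolding BB_def using p g i s
    by (simp add: lin_smult[OF L] lin_add[OF L] Lp d vs_closed[OF vs_ma] del: ma_simps)
  moreover have "f (Inr ?s) \<otimes>[C] f (Inr g) = f (Inr (g \<otimes>[G] gd i))"
    using g i s d(6)[OF s g] by (simp add: conj_mult)
  moreover have "\<ominus> (b g (x i) \<otimes> kk m) = b g (x i) \<otimes> (\<ominus> kk m)" using g i by (simp add: r_minus)
  ultimately show ?thesis
    using g i s C d(4) by (simp add: alg_simps vs_distr[OF VC])
qed

lemma XB_datum_iff:
  assumes f: "T_datum C f"
  shows "XB_datum (BB l m) C f \<longleftrightarrow> rel l m C f"
proof -
  note C = T_datumD(1)[OF f] and d = T_datumD[OF f] note VC = alg_vs[OF C]
  have "(vext C (%i. f (Inl i)) (ga g (x i)) \<oplus>[C] lincomb K C (%t. f (Inr t)) (BB l m g i)) \<otimes>[C] f (Inr g)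
    = vext C (%j. f (Inl j)) (ga g (x i)) \<otimes>[C] f (Inr g) \<oplus>[C]
      ((b g (x i) \<otimes> kk l) \<odot>[C] f (Inr g) \<oplus>[C] (\<ominus> (b g (x i) \<otimes> kk m)) \<odot>[C] f (Inr (g \<otimes>[G] gd i)))"
    if g: "g \<in> carrier G" and i: "i \<in> I" for g i
  proof -
    have "vext C (%i. f (Inl i)) (ga g (x i)) \<in> carrier C" by (rule vext_closed[OF VC]) (use d g i in auto)
    moreover have "lincomb K C (%t. f (Inr t)) (BB l m g i) \<in> carrier C"
      by (rule lincomb_closed[OF VC, of _ "carrier G"]) (use d BB_closed[OF g i] in auto)
    ultimately show ?thesis using C d(4)[OF g] by (simp add: alg_simps(6) BB_image[OF f g i])
  qed
  then show ?thesis using f by (simp add: XB_datum_def[OF BBd] rel_def)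
qed

lemma gens_T_datum: "T_datum T (tkg_gen K G I)"
  by (simp add: T_datum_def tg_mult tg_one)

lemma gens_X_datum: "T_datum (XB (BB l m)) (xgen (BB l m))"
  by (auto simp: T_datum_def alg_XB[OF BBd] xg_mult[OF BBd] xg_one[OF BBd] xgen_closed[OF BBd])

lemma gens_X_rel: "rel l m (XB (BB l m)) (xgen (BB l m))"
proof -
  have "XB_datum (BB l m) (XB (BB l m)) (xgen (BB l m))"
    unfolding XB_datum_def[OF BBd] using gens_X_datum XB_rel[OF BBd] by simp
  then show ?thesis using XB_datum_iff[OF gens_X_datum] by simp
qed

text \<open>One formula for the comultiplication of \<open>T\<close>, for those of the quotients and
  for both coactions; \<open>f\<close> and \<open>f'\<close> are the images of the generators in the
  two tensor factors.\<close>

definition dcop :: "('k, 'c, 'n) module_scheme => ('k, 'd, 'o) module_scheme => ('i + 'g => 'c) => ('i + 'g => 'd) => 'i + 'g => ('k, 'c, 'd) tensor"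
  where "dcop A C f f' = case_sum
    (%i. tens K A C (f (Inl i)) \<one>[C] \<oplus>[A >< C] tens K A C (f (Inr (gd i))) (f' (Inl i)))
    (%g. tens K A C (f (Inr g)) (f' (Inr g)))"

lemma dcop_datum:
  assumes f: "T_datum A f" and f': "T_datum C f'"
  shows "T_datum (A >< C) (dcop A C f f')"
proof -
  note d = T_datumD[OF f] and d' = T_datumD[OF f'] note A = d(1) and C = d'(1)
  show ?thesis
    unfolding T_datum_def using A C d d' alg_vs[OF A] alg_vs[OF C]
    by (auto simp: dcop_def tens_mult[OF A C] tens_one[OF A C])
qed

text \<open>All letters that occur in v have the degree s, so the second summands g_j \<otimes> n_j
  share the left factor s.\<close>

lemma dcop_nu:
  assumes f: "T_datum A f" and f': "T_datum C f'" and v: "v \<in> carrier V" and s: "s \<in> carrier G"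
    and h: "\<And>j. cd v j \<noteq> \<zero> ==> gd j = s"
  shows "vext (A >< C) (%j. dcop A C f f' (Inl j)) v
    = tens K A C (vext A (%j. f (Inl j)) v) \<one>[C] \<oplus>[A >< C] tens K A C (f (Inr s)) (vext C (%j. f' (Inl j)) v)"
proof -
  note d = T_datumD[OF f] and d' = T_datumD[OF f'] note A = d(1) and C = d'(1) note VA = alg_vs[OF A] and VC = alg_vs[OF C]
  have P: "vs (A >< C)" using VA VC by simp
  let ?F = "%v. tens K A C (vext A (%j. f (Inl j)) v) \<one>[C] \<oplus>[A >< C] tens K A C (f (Inr s)) (vext C (%j. f' (Inl j)) v)"
  have F: "?F \<in> lin V (A >< C)"
    by (intro lin_plus lin_tens_left lin_tens_right vext_lin P VA VC) (use d d' s A C in auto)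
  have e: "?F (x j) = tens K A C (f (Inl j)) \<one>[C] \<oplus>[A >< C] tens K A C (f (Inr s)) (f' (Inl j))" if "j \<in> I" for j
    using that d d' by (simp add: vext_x VA VC)
  have "vext (A >< C) (%j. dcop A C f f' (Inl j)) v = vext (A >< C) (%j. ?F (x j)) v"
    by (rule vext_homog[OF P _ v]) (use h d d' s A C VA VC P in \<open>auto simp: e dcop_def\<close>)
  also have "... = ?F v" by (rule vext_unique[OF P F v])
  finally show ?thesis .
qed

text \<open>q1 and q2 will be the terms - c \<beta> g g_i \<otimes> g and c \<beta> g g_i \<otimes>
  g with the intermediate scalar c.\<close>

lemma vs_cancel_middle:
  assumes "vs W" "a \<in> carrier W" "p \<in> carrier W" "q1 \<in> carrier W" "c \<in> carrier W" "q2 \<in> carrier W" "r \<in> carrier W"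
    "q1 \<oplus>[W] q2 = \<zero>[W]"
  shows "(a \<oplus>[W] (p \<oplus>[W] q1)) \<oplus>[W] (c \<oplus>[W] (q2 \<oplus>[W] r)) = (a \<oplus>[W] c) \<oplus>[W] (p \<oplus>[W] r)"
proof -
  have "(a \<oplus>[W] (p \<oplus>[W] q1)) \<oplus>[W] (c \<oplus>[W] (q2 \<oplus>[W] r)) = (q1 \<oplus>[W] q2) \<oplus>[W] ((a \<oplus>[W] c) \<oplus>[W] (p \<oplus>[W] r))"
    using assms(1-7) by (simp add: vs_ac[OF assms(1)] del: assms(8))
  then show ?thesis using assms by (simp add: vs_simps)
qed

text \<open>The images of g and n_i multiply to g n_i \<otimes> g + g g_i \<otimes> g n_i. The rule
  for (l, c) is inserted in the left factor and the rule for (c, m) in the right one. After the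
  cancellation the terms with letters form the image of g \<cdot>_V x_i times g \<otimes> g, because
  (g g_i g\<inverse>) g = g g_i.\<close>

lemma dcop_rel:
  assumes f: "T_datum A f" and f': "T_datum C f'" and r: "rel l c A f" and r': "rel c m C f'"
  shows "rel l m (A >< C) (dcop A C f f')"
  unfolding rel_def
proof (intro ballI)
  note d = T_datumD[OF f] and d' = T_datumD[OF f'] note A = d(1) and C = d'(1) note VA = alg_vs[OF A] and VC = alg_vs[OF C]
  let ?P = "A >< C" and ?t = "tens K A C"
  have P: "alg ?P" using A C by simp
  note VP = alg_vs[OF P]
  fix g i assume g: "g \<in> carrier G" and i: "i \<in> I"
  let ?s = "g \<otimes>[G] gd i \<otimes>[G] inv\<^bsub>G\<^esub> g" and ?v = "ga g (x i)" and ?h = "g \<otimes>[G] gd i"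
  let ?n = "vext A (%j. f (Inl j)) ?v" and ?n' = "vext C (%j. f' (Inl j)) ?v"
  let ?\<beta> = "b g (x i)"
  have s: "?s \<in> carrier G" and h: "?h \<in> carrier G" and v: "?v \<in> carrier V" and \<beta>: "?\<beta> \<in> carrier K" using g i by auto
  have n: "?n \<in> carrier A" by (rule vext_closed[OF VA d(3) v])
  have n': "?n' \<in> carrier C" by (rule vext_closed[OF VC d'(3) v])
  have R: "f (Inr g) \<otimes>[A] f (Inl i) = ?n \<otimes>[A] f (Inr g) \<oplus>[A] ((?\<beta> \<otimes> kk l) \<odot>[A] f (Inr g) \<oplus>[A] (\<ominus> (?\<beta> \<otimes> kk c)) \<odot>[A] f (Inr ?h))"
    using r g i by (simp add: rel_def)
  have R': "f' (Inr g) \<otimes>[C] f' (Inl i) = ?n' \<otimes>[C] f' (Inr g) \<oplus>[C] ((?\<beta> \<otimes> kk c) \<odot>[C] f' (Inr g) \<oplus>[C] (\<ominus> (?\<beta> \<otimes> kk m)) \<odot>[C] f' (Inr ?h))"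
    using r' g i by (simp add: rel_def)
  note cl = d(3)[OF i] d(4)[OF g] d(4)[OF h] d(4)[OF s] d'(3)[OF i] d'(4)[OF g] d'(4)[OF h] d(4)[OF gd_closed[OF i]] d'(4)[OF gd_closed[OF i]]
  have nu: "vext ?P (%j. dcop A C f f' (Inl j)) ?v = ?t ?n \<one>[C] \<oplus>[?P] ?t (f (Inr ?s)) ?n'"
    by (rule dcop_nu[OF f f' v s]) (use homog g i in auto)
  have "dcop A C f f' (Inr g) \<otimes>[?P] dcop A C f f' (Inl i)
    = ?t (f (Inr g) \<otimes>[A] f (Inl i)) (f' (Inr g)) \<oplus>[?P] ?t (f (Inr ?h)) (f' (Inr g) \<otimes>[C] f' (Inl i))"
    using cl A C P VA VC g i by (simp add: dcop_def alg_simps(7)[OF P] tens_mult[OF A C] d d' alg_simps(2)[OF C])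
  also have "... = (?t (?n \<otimes>[A] f (Inr g)) (f' (Inr g)) \<oplus>[?P] ((?\<beta> \<otimes> kk l) \<odot>[?P] ?t (f (Inr g)) (f' (Inr g)) \<oplus>[?P] (\<ominus> (?\<beta> \<otimes> kk c)) \<odot>[?P] ?t (f (Inr ?h)) (f' (Inr g))))
     \<oplus>[?P] (?t (f (Inr ?h)) (?n' \<otimes>[C] f' (Inr g)) \<oplus>[?P] ((?\<beta> \<otimes> kk c) \<odot>[?P] ?t (f (Inr ?h)) (f' (Inr g)) \<oplus>[?P] (\<ominus> (?\<beta> \<otimes> kk m)) \<odot>[?P] ?t (f (Inr ?h)) (f' (Inr ?h))))"
    unfolding R R' using cl A C VA VC n n' \<beta> by (simp add: tens_simps[OF VA VC])
  also have "... = (?t (?n \<otimes>[A] f (Inr g)) (f' (Inr g)) \<oplus>[?P] ?t (f (Inr ?h)) (?n' \<otimes>[C] f' (Inr g)))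
     \<oplus>[?P] ((?\<beta> \<otimes> kk l) \<odot>[?P] ?t (f (Inr g)) (f' (Inr g)) \<oplus>[?P] (\<ominus> (?\<beta> \<otimes> kk m)) \<odot>[?P] ?t (f (Inr ?h)) (f' (Inr ?h)))"
    by (rule vs_cancel_middle[OF VP]) (use cl A C VA VC n n' \<beta> in \<open>simp_all add: vs_distr(1)[OF VP, symmetric] l_neg vs_simps[OF VP]\<close>)
  also have "?t (?n \<otimes>[A] f (Inr g)) (f' (Inr g)) \<oplus>[?P] ?t (f (Inr ?h)) (?n' \<otimes>[C] f' (Inr g))
    = (?t ?n \<one>[C] \<oplus>[?P] ?t (f (Inr ?s)) ?n') \<otimes>[?P] ?t (f (Inr g)) (f' (Inr g))"
    using cl A C VA VC n n' g i s by (simp add: alg_simps(6)[OF P] tens_mult[OF A C] alg_simps(1)[OF C] d(6) conj_mult)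
  finally show "dcop A C f f' (Inr g) \<otimes>[?P] dcop A C f f' (Inl i)
    = vext ?P (%j. dcop A C f f' (Inl j)) ?v \<otimes>[?P] dcop A C f f' (Inr g) \<oplus>[?P]
      ((?\<beta> \<otimes> kk l) \<odot>[?P] dcop A C f f' (Inr g) \<oplus>[?P] (\<ominus> (?\<beta> \<otimes> kk m)) \<odot>[?P] dcop A C f f' (Inr ?h))"
    unfolding nu by (simp add: dcop_def)
qed

definition dcou :: "'i + 'g => 'k" where "dcou = case_sum (%i. \<zero>) (%g. \<one>)"

lemma dcou_datum: "T_datum (base_algebra K) dcou"
  by (auto simp: T_datum_def dcou_def)

lemma vext_null: "vs W ==> v \<in> carrier V ==> vext W (%j. \<zero>[W]) v = \<zero>[W]"
  using vext_unique[OF _ lin_null, of W v] by simp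

text \<open>The counit kills the letters, so the rule asks for b(g, x_i) (l - m) = 0, which holds on
  the diagonal.\<close>

lemma dcou_rel: "rel l l (base_algebra K) dcou"
  unfolding rel_def using vext_null[OF vs_base] by (auto simp: dcou_def l_minus r_neg)

text \<open>The value at n_i is forced by the antipode axiom n_i + g_i S(n_i) = 0.\<close>

definition dant :: "('k, 'c, 'n) module_scheme => ('i + 'g => 'c) => 'i + 'g => 'c"
  where "dant A f = case_sum (%i. \<ominus>[A] (f (Inr (inv\<^bsub>G\<^esub> (gd i))) \<otimes>[A] f (Inl i))) (%g. f (Inr (inv\<^bsub>G\<^esub> g)))"

lemma dant_datum: assumes f: "T_datum A f" shows "T_datum (op_alg A) (dant A f)"
proof -
  note d = T_datumD[OF f]
  show ?thesis unfolding T_datum_def using d by (auto simp: dant_def G.inv_mult_group)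
qed

text \<open>Multiplying the rule for (m, l) by (g g_i)\<inverse> on the left and by g\<inverse> on
  the right interchanges the group elements in the two correction terms, and the sign in S(n_i)
  changes their signs. The result is the rule for (l, m) in the opposite algebra; hence the antipode
  swaps the objects.\<close>

lemma dant_rel:
  assumes f: "T_datum A f" and r: "rel m l A f"
  shows "rel l m (op_alg A) (dant A f)"
  unfolding rel_def
proof (intro ballI)
  note d = T_datumD[OF f] note A = d(1) note VA = alg_vs[OF A]
  fix g i assume g: "g \<in> carrier G" and i: "i \<in> I"
  let ?s = "g \<otimes>[G] gd i \<otimes>[G] inv\<^bsub>G\<^esub> g" and ?v = "ga g (x i)" and ?h = "g \<otimes>[G] gd i"
  let ?n = "vext A (%j. f (Inl j)) ?v" and ?\<beta> = "b g (x i)"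
  let ?u = "f (Inr (inv\<^bsub>G\<^esub> ?h))" and ?w = "f (Inr (inv\<^bsub>G\<^esub> g))"
  have s: "?s \<in> carrier G" and h: "?h \<in> carrier G" and v: "?v \<in> carrier V" and \<beta>: "?\<beta> \<in> carrier K" using g i by auto
  have n: "?n \<in> carrier A" by (rule vext_closed[OF VA d(3) v])
  have R: "f (Inr g) \<otimes>[A] f (Inl i) = ?n \<otimes>[A] f (Inr g) \<oplus>[A] ((?\<beta> \<otimes> kk m) \<odot>[A] f (Inr g) \<oplus>[A] (\<ominus> (?\<beta> \<otimes> kk l)) \<odot>[A] f (Inr ?h))"
    using r g i by (simp add: rel_def)
  have gi: "inv\<^bsub>G\<^esub> g \<in> carrier G" "inv\<^bsub>G\<^esub> ?h \<in> carrier G" "inv\<^bsub>G\<^esub> (gd i) \<in> carrier G" "inv\<^bsub>G\<^esub> ?s \<in> carrier G" using g i by auto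
  note cl = d(3)[OF i] d(4)[OF g] d(4)[OF h] d(4)[OF s] d(4)[OF gi(1)] d(4)[OF gi(2)] d(4)[OF gi(3)] d(4)[OF gi(4)]
  have i1: "inv\<^bsub>G\<^esub> g \<otimes>[G] inv\<^bsub>G\<^esub> ?s = inv\<^bsub>G\<^esub> ?h"
    using g i s by (simp add: G.inv_mult_group[symmetric] conj_mult)
  have i2: "inv\<^bsub>G\<^esub> ?h \<otimes>[G] g = inv\<^bsub>G\<^esub> (gd i)" using g i by (simp add: G.inv_mult_group G.m_assoc)
  have i3: "inv\<^bsub>G\<^esub> ?h \<otimes>[G] ?h = \<one>[G]" "g \<otimes>[G] inv\<^bsub>G\<^esub> g = \<one>[G]" using h g by simp_all
  have nu: "vext (op_alg A) (%j. dant A f (Inl j)) ?v = \<ominus>[A] (f (Inr (inv\<^bsub>G\<^esub> ?s)) \<otimes>[A] ?n)"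
  proof -
    let ?F = "%v. \<ominus>[A] (f (Inr (inv\<^bsub>G\<^esub> ?s)) \<otimes>[A] vext A (%j. f (Inl j)) v)"
    have F: "?F \<in> lin V A" by (intro lin_uminus lin_mult_left vext_lin VA A d(3)) (use cl in auto)
    have "vext (op_alg A) (%j. dant A f (Inl j)) ?v = vext A (%j. dant A f (Inl j)) ?v"
      unfolding vext_def by (simp add: vsame_lincomb[of "op_alg A" A] vsame_def)
    also have "... = vext A (%j. ?F (x j)) ?v"
      by (rule vext_homog[OF VA _ v]) (use cl A homog[OF g i] d(3) in \<open>auto simp: dant_def vext_x VA\<close>)
    also have "... = ?F ?v" by (rule vext_unique[OF VA F v])
    finally show ?thesis .
  qed
  have gg: "f (Inr g) \<otimes>[A] ?w = \<one>[A]" "?u \<otimes>[A] f (Inr ?h) = \<one>[A]" "?u \<otimes>[A] f (Inr g) = f (Inr (inv\<^bsub>G\<^esub> (gd i)))"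
    using d(5) d(6)[OF g gi(1)] d(6)[OF gi(2) h] d(6)[OF gi(2) g] i2 i3 by simp_all
  have "f (Inr (inv\<^bsub>G\<^esub> (gd i))) \<otimes>[A] f (Inl i) \<otimes>[A] ?w = ?u \<otimes>[A] ((f (Inr g) \<otimes>[A] f (Inl i)) \<otimes>[A] ?w)"
    unfolding gg(3)[symmetric] using cl A by (simp add: alg_simps(5))
  also have "... = ?u \<otimes>[A] ?n \<oplus>[A] ((?\<beta> \<otimes> kk m) \<odot>[A] ?u \<oplus>[A] (\<ominus> (?\<beta> \<otimes> kk l)) \<odot>[A] ?w)"
    unfolding R using cl A n \<beta> gg by (simp add: alg_simps alg_simps(5)[symmetric])
  finally have e: "f (Inr (inv\<^bsub>G\<^esub> (gd i))) \<otimes>[A] f (Inl i) \<otimes>[A] ?w = ?u \<otimes>[A] ?n \<oplus>[A] ((?\<beta> \<otimes> kk m) \<odot>[A] ?u \<oplus>[A] (\<ominus> (?\<beta> \<otimes> kk l)) \<odot>[A] ?w)" .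
  have "dant A f (Inr g) \<otimes>[op_alg A] dant A f (Inl i) = \<ominus>[A] (f (Inr (inv\<^bsub>G\<^esub> (gd i))) \<otimes>[A] f (Inl i) \<otimes>[A] ?w)"
    using cl A by (simp add: dant_def alg_simps)
  also have "... = \<ominus>[A] (?u \<otimes>[A] ?n) \<oplus>[A] ((?\<beta> \<otimes> kk l) \<odot>[A] ?w \<oplus>[A] (\<ominus> (?\<beta> \<otimes> kk m)) \<odot>[A] ?u)"
    unfolding e using cl A n \<beta> VA
    by (simp add: vs_minus(4)[OF VA] vs_minus(1)[OF VA] vs_simps[OF VA] vs_ac[OF VA])
  also have "\<ominus>[A] (?u \<otimes>[A] ?n) = ?w \<otimes>[A] vext (op_alg A) (%j. dant A f (Inl j)) ?v"
    unfolding nu using cl A n d(6)[OF gi(1) gi(4)] i1 by (simp add: alg_simps alg_simps(5)[symmetric])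
  finally show "dant A f (Inr g) \<otimes>[op_alg A] dant A f (Inl i)
    = vext (op_alg A) (%j. dant A f (Inl j)) ?v \<otimes>[op_alg A] dant A f (Inr g) \<oplus>[op_alg A]
      ((?\<beta> \<otimes> kk l) \<odot>[op_alg A] dant A f (Inr g) \<oplus>[op_alg A] (\<ominus> (?\<beta> \<otimes> kk m)) \<odot>[op_alg A] dant A f (Inr ?h))"
    by (simp add: dant_def)
qed

end

section \<open>The kernel of the projection on a tensor square\<close>

context scalars
begin

lemma vs_scomm: "[|vs V; a \<in> carrier K; b \<in> carrier K; v \<in> carrier V|] ==> a \<odot>[V] (b \<odot>[V] v) = b \<odot>[V] (a \<odot>[V] v)"
  by (metis vs_distr(3) m_comm)

context
  fixes A :: "('k, 'a, 'm) module_scheme" and J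
  assumes A: "alg A" and J: "ideal J A"
begin

abbreviation (input) "JJ \<equiv> span (A >< A) ({tens K A A j h | j h. j \<in> J \<and> h \<in> carrier A} \<union> {tens K A A h j | h j. h \<in> carrier A \<and> j \<in> J})"

private lemma JA: "j \<in> J ==> j \<in> carrier A"
  using submodD(1)[OF alg_vs[OF A] ideal_submod[OF A J]] by blast

private lemma vsA: "vs A" by (rule alg_vs[OF A])

private lemma AA: "alg (A >< A)" using A by simp

private lemma sub: "{tens K A A j h | j h. j \<in> J \<and> h \<in> carrier A} \<union> {tens K A A h j | h j. h \<in> carrier A \<and> j \<in> J} \<subseteq> carrier (A >< A)"
  using vsA JA by auto

private lemma S: "submodule JJ K (A >< A)"
  by (rule span_submod[OF alg_vs[OF AA] sub])

private lemma JJ_tens: "[|j \<in> J; h \<in> carrier A|] ==> tens K A A j h \<in> JJ" "[|j \<in> J; h \<in> carrier A|] ==> tens K A A h j \<in> JJ"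
  by (rule subsetD[OF span_incl], blast)+

lemma tensor_ideal: "ideal JJ (A >< A)"
proof (rule idealI'[OF AA S])
  note D = submodD[OF alg_vs[OF AA] S]
  note AV = alg_vs[OF AA]
  fix z w assume z: "z \<in> carrier (A >< A)" and w: "w \<in> JJ"
  have wc: "w \<in> carrier (A >< A)" using w D(1) by blast
  have pt: "tens K A A a b \<otimes>[A >< A] w \<in> JJ \<and> w \<otimes>[A >< A] tens K A A a b \<in> JJ" if ab: "a \<in> carrier A" "b \<in> carrier A" for a b
  proof -
    have t: "tens K A A a b \<in> carrier (A >< A)" using ab vsA by simp
    have "JJ \<subseteq> {w \<in> carrier (A >< A). tens K A A a b \<otimes>[A >< A] w \<in> JJ}"
      by (rule span_min[OF submod_preimage[OF AV AV lin_mult_left[OF AA t lin_id] S]])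
        (use ab vsA JA ideal.I_l_closed[OF J] alg_closed(1)[OF A] JJ_tens in \<open>auto simp: tens_mult[OF A A]\<close>)
    moreover have "JJ \<subseteq> {w \<in> carrier (A >< A). w \<otimes>[A >< A] tens K A A a b \<in> JJ}"
      by (rule span_min[OF submod_preimage[OF AV AV lin_mult_right[OF AA t lin_id] S]])
        (use ab vsA JA ideal.I_r_closed[OF J] alg_closed(1)[OF A] JJ_tens in \<open>auto simp: tens_mult[OF A A]\<close>)
    ultimately show ?thesis using w by blast
  qed
  have "z \<in> {z \<in> carrier (A >< A). z \<otimes>[A >< A] w \<in> JJ}"
    by (rule tensor_induct[OF vsA vsA z submod_preimage[OF AV AV lin_mult_right[OF AA wc lin_id] S]]) (use pt vsA in auto)
  then show "z \<otimes>[A >< A] w \<in> JJ" by simp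
  have "z \<in> {z \<in> carrier (A >< A). w \<otimes>[A >< A] z \<in> JJ}"
    by (rule tensor_induct[OF vsA vsA z submod_preimage[OF AV AV lin_mult_left[OF AA wc lin_id] S]]) (use pt vsA in auto)
  then show "w \<otimes>[A >< A] z \<in> JJ" by simp
qed

text \<open>The projection modulo these tensors factors through the tensor square of the quotient.\<close>

lemma tensor_quot_kernel:
  assumes z: "z \<in> carrier (A >< A)"
    and 0: "tens_map K (algebra_quot A J) (algebra_quot A J) (a_r_coset A J) (a_r_coset A J) z = \<zero>[algebra_quot A J >< algebra_quot A J]"
  shows "z \<in> JJ"
proof -
  let ?Q = "algebra_quot A J" and ?\<pi> = "a_r_coset A J"
  let ?R = "algebra_quot (A >< A) JJ" and ?\<rho> = "a_r_coset (A >< A) JJ"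
  note h = quot_proj_hom[OF A J] note Q = alg_quot[OF A J] note VQ = alg_vs[OF Q]
  note hR = quot_proj_hom[OF AA tensor_ideal] note R = alg_quot[OF AA tensor_ideal] note VR = alg_vs[OF R]
  note AV = alg_vs[OF AA]
  \<comment> \<open>Representatives of the cosets are chosen. By \<open>cls\<close> the class of u
    \<otimes> v modulo \<open>JJ\<close> does not depend on the choice, which makes
    \<open>?\<beta>\<close> bilinear on the quotient.\<close>
  define rp where "rp X = (SOME u. u \<in> carrier A \<and> ?\<pi> u = X)" for X
  have rp: "rp (?\<pi> u) \<in> carrier A \<and> ?\<pi> (rp (?\<pi> u)) = ?\<pi> u" if "u \<in> carrier A" for u
    unfolding rp_def by (rule someI[of _ u]) (use that in simp)
  have dJ: "u \<ominus>[A] u' \<in> J" if "u \<in> carrier A" "u' \<in> carrier A" "?\<pi> u = ?\<pi> u'" for u u'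
    using coset_eq[OF vsA ideal_submod[OF A J] that(1,2)] that(3) by simp
  have cls: "?\<rho> (tens K A A u v) = ?\<rho> (tens K A A u' v')"
    if c: "u \<in> carrier A" "u' \<in> carrier A" "v \<in> carrier A" "v' \<in> carrier A" and e: "?\<pi> u = ?\<pi> u'" "?\<pi> v = ?\<pi> v'" for u u' v v'
  proof -
    note l = lin_diff[OF bil2[OF tens_bil[OF vsA vsA]] vsA AV] and r = lin_diff[OF bil1[OF tens_bil[OF vsA vsA]] vsA AV]
    have "tens K A A u v \<ominus>[A >< A] tens K A A u' v \<in> JJ"
      using JJ_tens(1)[OF dJ[OF c(1,2) e(1)] c(3)] l[OF c(3) c(1,2)] by simp
    moreover have "tens K A A u' v \<ominus>[A >< A] tens K A A u' v' \<in> JJ"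
      using JJ_tens(2)[OF dJ[OF c(3,4) e(2)] c(2)] r[OF c(2) c(3,4)] by simp
    ultimately have "?\<rho> (tens K A A u v) = ?\<rho> (tens K A A u' v)" "?\<rho> (tens K A A u' v) = ?\<rho> (tens K A A u' v')"
      using c vsA by (simp_all add: coset_eq[OF AV S])
    then show ?thesis by simp
  qed
  let ?\<beta> = "%X Y. ?\<rho> (tens K A A (rp X) (rp Y))"
  have \<beta>\<pi>: "?\<beta> (?\<pi> u) (?\<pi> v) = ?\<rho> (tens K A A u v)" if "u \<in> carrier A" "v \<in> carrier A" for u v
    by (rule cls) (use that rp in auto)
  note el = quot_cases[OF vsA ideal_submod[OF A J]]
  note \<pi>a = lin_add[OF ahom_lin[OF h], symmetric] and \<pi>s = lin_smult[OF ahom_lin[OF h], symmetric]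
  note \<rho>a = lin_add[OF ahom_lin[OF hR], symmetric] and \<rho>s = lin_smult[OF ahom_lin[OF hR], symmetric]
  have \<rho>c: "?\<rho> (tens K A A u v) \<in> carrier ?R" if "u \<in> carrier A" "v \<in> carrier A" for u v
    using ahom_closed[OF hR] that vsA by simp
  have \<beta>: "?\<beta> \<in> bil ?Q ?Q ?R"
  proof (rule bilI)
    fix X assume "X \<in> carrier ?Q" then obtain u where u: "u \<in> carrier A" "X = ?\<pi> u" by (rule el)
    show "(%Y. ?\<beta> X Y) \<in> lin ?Q ?R"
    proof (rule linI)
      fix Y assume "Y \<in> carrier ?Q" then obtain v where v: "v \<in> carrier A" "Y = ?\<pi> v" by (rule el)
      show "?\<beta> X Y \<in> carrier ?R" using u v \<rho>c by (simp add: \<beta>\<pi>)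
      fix Z assume "Z \<in> carrier ?Q" then obtain w where w: "w \<in> carrier A" "Z = ?\<pi> w" by (rule el)
      show "?\<beta> X (Y \<oplus>[?Q] Z) = ?\<beta> X Y \<oplus>[?R] ?\<beta> X Z"
        unfolding u v w using u v w A vsA by (simp add: \<beta>\<pi> \<pi>a \<rho>a tens_simps[OF vsA vsA])
    next
      fix c Y assume c: "c \<in> carrier K" and "Y \<in> carrier ?Q" then obtain v where v: "v \<in> carrier A" "Y = ?\<pi> v" by (metis el)
      show "?\<beta> X (c \<odot>[?Q] Y) = c \<odot>[?R] ?\<beta> X Y"
        unfolding u v using c u v A vsA by (simp add: \<beta>\<pi> \<pi>s \<rho>s tens_simps[OF vsA vsA])
    qed
  next
    fix X assume "X \<in> carrier ?Q" then obtain u where u: "u \<in> carrier A" "X = ?\<pi> u" by (rule el)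
    show "(%Y. ?\<beta> Y X) \<in> lin ?Q ?R"
    proof (rule linI)
      fix Y assume "Y \<in> carrier ?Q" then obtain v where v: "v \<in> carrier A" "Y = ?\<pi> v" by (rule el)
      show "?\<beta> Y X \<in> carrier ?R" using u v \<rho>c by (simp add: \<beta>\<pi>)
      fix Z assume "Z \<in> carrier ?Q" then obtain w where w: "w \<in> carrier A" "Z = ?\<pi> w" by (rule el)
      show "?\<beta> (Y \<oplus>[?Q] Z) X = ?\<beta> Y X \<oplus>[?R] ?\<beta> Z X"
        unfolding u v w using u v w A vsA by (simp add: \<beta>\<pi> \<pi>a \<rho>a tens_simps[OF vsA vsA])
    next
      fix c Y assume c: "c \<in> carrier K" and "Y \<in> carrier ?Q" then obtain v where v: "v \<in> carrier A" "Y = ?\<pi> v" by (metis el)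
      show "?\<beta> (c \<odot>[?Q] Y) X = c \<odot>[?R] ?\<beta> Y X"
        unfolding u v using c u v A vsA by (simp add: \<beta>\<pi> \<pi>s \<rho>s tens_simps[OF vsA vsA])
    qed
  qed
  note L = tens_lift_lin[OF VQ VQ VR \<beta>]
  \<comment> \<open>Preceded by the projection of both factors, the map induced by
    \<open>?\<beta>\<close> is the projection modulo \<open>JJ\<close>. A tensor with zero image in
    the tensor square of the quotient therefore lies in \<open>JJ\<close>.\<close>
  have "tens_lift K ?R ?\<beta> (tens_map K ?Q ?Q ?\<pi> ?\<pi> z) = ?\<rho> z"
  proof (rule tensor_ext[OF vsA vsA VR lin_comp[OF L ahom_lin[OF tens_map_hom(1)[OF A A Q Q h h]]] ahom_lin[OF hR] _ z])
    fix v w assume "v \<in> carrier A" "w \<in> carrier A"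
    then show "tens_lift K ?R ?\<beta> (tens_map K ?Q ?Q ?\<pi> ?\<pi> (tens K A A v w)) = ?\<rho> (tens K A A v w)"
      using ahom_closed[OF h] by (simp add: tens_map_hom(2)[OF A A Q Q h h] tens_lift_tens[OF VQ VQ VR \<beta>] \<beta>\<pi>)
  qed
  then have "?\<rho> z = \<zero>[?R]" unfolding 0 using lin_zero[OF L vs_tensor[OF VQ VQ] VR] by simp
  then have "z \<ominus>[A >< A] \<zero>[A >< A] \<in> JJ"
    using quot_zero[OF AV S] coset_eq[OF AV S z] AV by simp
  moreover have "z \<ominus>[A >< A] \<zero>[A >< A] = z" using z AV by (simp add: vs_minus(5)[OF AV] vs_simps[OF AV])
  ultimately show ?thesis by simp
qed

end

end

context yd_smash
begin

lemma dcop_image: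
  assumes f: "T_datum A f" and f': "T_datum C f'" and h: "h \<in> ahom A A'" and h': "h' \<in> ahom C C'"
    and A': "alg A'" and C': "alg C'" and s: "s \<in> gens"
  shows "tens_map K A' C' h h' (dcop A C f f' s) = dcop A' C' (%s. h (f s)) (%s. h' (f' s)) s"
proof -
  note d = T_datumD[OF f] and d' = T_datumD[OF f'] note A = d(1) and C = d'(1) note VA = alg_vs[OF A] and VC = alg_vs[OF C]
  note m = tens_map_hom[OF A C A' C' h h'] note l = lin_add[OF ahom_lin[OF m(1)]]
  show ?thesis
    using s d d' A C VA VC by (auto simp: dcop_def l m(2) ahom_one[OF h'])
qed

lemma antipode_gen:
  assumes f: "T_datum Y f" and f': "T_datum Z f'" and s: "s \<in> gens"
  shows "[|S \<in> lin Y Z; \<And>s. s \<in> gens ==> S (f s) = dant Z f' s|] ==>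
      tens_lift K Z (%h1 h2. S h1 \<otimes>[Z] h2) (dcop Y Z f f' s) = dcou s \<odot>[Z] \<one>[Z]"
    and "[|S \<in> lin Z Y; \<And>s. s \<in> gens ==> S (f' s) = dant Y f s|] ==>
      tens_lift K Y (%h1 h2. h1 \<otimes>[Y] S h2) (dcop Y Z f f' s) = dcou s \<odot>[Y] \<one>[Y]"
proof -
  note d = T_datumD[OF f] and d' = T_datumD[OF f'] note Y = d(1) and Z = d'(1) note VY = alg_vs[OF Y] and VZ = alg_vs[OF Z]
  have P: "vs (Y >< Z)" using VY VZ by simp
  {
    assume S: "S \<in> lin Y Z" and Sf: "\<And>s. s \<in> gens ==> S (f s) = dant Z f' s"
    have b: "(%h1 h2. S h1 \<otimes>[Z] h2) \<in> bil Y Z Z" by (intro bilI lin_mult_left lin_mult_right Z S lin_closed[OF S] lin_id)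
    note t = tens_lift_tens[OF VY VZ VZ b] and l = lin_add[OF tens_lift_lin[OF VY VZ VZ b]]
    show "tens_lift K Z (%h1 h2. S h1 \<otimes>[Z] h2) (dcop Y Z f f' s) = dcou s \<odot>[Z] \<one>[Z]"
    proof (cases s)
      case (Inl i)
      then have i: "i \<in> I" using s by simp
      note c = d(3)[OF i] d'(3)[OF i] d(4)[OF gd_closed[OF i]] d'(4)[OF G.inv_closed[OF gd_closed[OF i]]]
      have "S (f (Inl i)) = \<ominus>[Z] (f' (Inr (inv\<^bsub>G\<^esub> (gd i))) \<otimes>[Z] f' (Inl i))" "S (f (Inr (gd i))) = f' (Inr (inv\<^bsub>G\<^esub> (gd i)))"
        using Sf i by (simp_all add: dant_def)
      then show ?thesis using c Y Z VY VZ P Inl by (simp add: dcop_def dcou_def l t alg_simps[OF Z] vs_simps[OF VZ])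
    next
      case (Inr g)
      then have g: "g \<in> carrier G" using s by simp
      have "S (f (Inr g)) = f' (Inr (inv\<^bsub>G\<^esub> g))" using Sf g by (simp add: dant_def)
      then show ?thesis using d(4)[OF g] d'(4)[OF g] d'(5) d'(6)[OF G.inv_closed[OF g] g] g Z VZ Inr
        by (simp add: dcop_def dcou_def t vs_simps[OF VZ])
    qed
  next
    assume S: "S \<in> lin Z Y" and Sf: "\<And>s. s \<in> gens ==> S (f' s) = dant Y f s"
    have b: "(%h1 h2. h1 \<otimes>[Y] S h2) \<in> bil Y Z Y" by (intro bilI lin_mult_left lin_mult_right Y S lin_closed[OF S] lin_id)
    note t = tens_lift_tens[OF VY VZ VY b] and l = lin_add[OF tens_lift_lin[OF VY VZ VY b]]
    have S1: "S \<one>[Z] = \<one>[Y]" using Sf[of "Inr \<one>[G]"] d(5) d'(5) by (simp add: dant_def)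
    show "tens_lift K Y (%h1 h2. h1 \<otimes>[Y] S h2) (dcop Y Z f f' s) = dcou s \<odot>[Y] \<one>[Y]"
    proof (cases s)
      case (Inl i)
      then have i: "i \<in> I" using s by simp
      note c = d(3)[OF i] d'(3)[OF i] d(4)[OF gd_closed[OF i]] d(4)[OF G.inv_closed[OF gd_closed[OF i]]]
      have e: "S (f' (Inl i)) = \<ominus>[Y] (f (Inr (inv\<^bsub>G\<^esub> (gd i))) \<otimes>[Y] f (Inl i))"
        using Sf i by (simp add: dant_def)
      have "f (Inr (gd i)) \<otimes>[Y] (f (Inr (inv\<^bsub>G\<^esub> (gd i))) \<otimes>[Y] f (Inl i)) = f (Inl i)"
        using c Y d(5) d(6)[OF gd_closed[OF i] G.inv_closed[OF gd_closed[OF i]]] i by (simp add: alg_simps(5)[OF Y, symmetric] alg_simps(1)[OF Y])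
      then show ?thesis using e c Y Z VY VZ P Inl S1 by (simp add: dcop_def dcou_def l t alg_simps[OF Y] vs_simps[OF VY])
    next
      case (Inr g)
      then have g: "g \<in> carrier G" using s by simp
      have "S (f' (Inr g)) = f (Inr (inv\<^bsub>G\<^esub> g))" using Sf g by (simp add: dant_def)
      then show ?thesis using d(4)[OF g] d'(4)[OF g] d(5) d(6)[OF g G.inv_closed[OF g]] g Y VY Inr
        by (simp add: dcop_def dcou_def t vs_simps[OF VY])
    qed
  }
qed

subsubsection \<open>The free Hopf algebra\<close>

abbreviation "TK \<equiv> tkg K G I gd"
abbreviation "tgen \<equiv> tkg_gen K G I"

lemma TK_simps [simp]:
  "carrier TK = carrier T" "mult TK = mult T" "one TK = one T" "zero TK = zero T" "add TK = add T" "smult TK = smult T"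
  by (simp_all add: tkg_def Let_def module.defs)

lemma TK_comult: "comult TK = coset_lift (free_lift K (T >< T) (dcop T T tgen tgen))"
  and TK_counit: "counit TK = coset_lift (free_lift K (base_algebra K) dcou)"
  by (simp_all add: tkg_def Let_def module.defs bialg.defs dcop_def dcou_def)

lemma same_TK: "same TK T"
  by (simp add: same_def)

lemma TK_same [simp]:
  "TK >< W = T >< W" "W >< TK = W >< T" "tens K TK W = tens K T W" "tens K W TK = tens K W T"
  "lin TK W = lin T W" "lin W TK = lin W T" "ahom TK W = ahom T W" "ahom W TK = ahom W T"
  "tens_lift K TK = tens_lift K T" "algebra_quot TK = algebra_quot T" "a_r_coset TK = a_r_coset T"
proof -
  show "tens_lift K TK = tens_lift K T" by (rule vsame_tens_lift) (simp add: vsame_def)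
  show "algebra_quot TK = algebra_quot T" "a_r_coset TK = a_r_coset T"
    by (rule ext, rule same_quot[OF same_TK])+
qed (rule same_tensor[OF same_TK same_refl] same_tensor[OF same_refl same_TK] same_lin[OF same_TK] same_ahom[OF same_TK])+

lemma DT_hom: "comult TK \<in> ahom T (T >< T)"
  and DT_gen: "s \<in> gens ==> comult TK (tgen s) = dcop T T tgen tgen s"
  unfolding TK_comult
  by (rule T_lift_hom[OF dcop_datum[OF gens_T_datum gens_T_datum]], rule T_lift_gen[OF dcop_datum[OF gens_T_datum gens_T_datum]])

lemma ET_hom: "counit TK \<in> ahom T (base_algebra K)" and ET_gen: "s \<in> gens ==> counit TK (tgen s) = dcou s"
  unfolding TK_counit by (rule T_lift_hom[OF dcou_datum], rule T_lift_gen[OF dcou_datum])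

definition "ST = coset_lift (free_lift K (op_alg T) (dant T tgen))"

lemma ST_hom: "ST \<in> ahom T (op_alg T)" and ST_gen: "s \<in> gens ==> ST (tgen s) = dant T tgen s"
  unfolding ST_def by (rule T_lift_hom[OF dant_datum[OF gens_T_datum]], rule T_lift_gen[OF dant_datum[OF gens_T_datum]])

lemma ST_lin: "ST \<in> lin T T"
  using ahom_lin[OF ST_hom] by simp

lemma ST_antipode: "is_antipode K TK ST"
proof -
  have "tens_lift K T (%h1 h2. ST h1 \<otimes>[T] h2) (comult TK h) = counit TK h \<odot>[T] \<one>[T]" if "h \<in> carrier T" for h
    by (rule antipode_left_gen[OF alg_T alg_T alg_T DT_hom ET_hom ST_hom T_gen _ that])
      (use antipode_gen(1)[OF gens_T_datum gens_T_datum _ ST_lin ST_gen] in \<open>auto simp: DT_gen ET_gen\<close>)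
  moreover have "tens_lift K T (%h1 h2. h1 \<otimes>[T] ST h2) (comult TK h) = counit TK h \<odot>[T] \<one>[T]" if "h \<in> carrier T" for h
    by (rule antipode_right_gen[OF alg_T alg_T alg_T DT_hom ET_hom ST_hom T_gen _ that])
      (use antipode_gen(2)[OF gens_T_datum gens_T_datum _ ST_lin ST_gen] in \<open>auto simp: DT_gen ET_gen\<close>)
  ultimately show ?thesis unfolding is_antipode_def by (simp add: ST_lin)
qed

subsubsection \<open>The quotients\<close>

abbreviation "Xc \<equiv> (%l m. XB (BB l m))"
abbreviation "Jc \<equiv> (%l m. JB (BB l m))"
abbreviation "xs \<equiv> (%l m. xgen (BB l m))"

lemma X_alg [simp]: "alg (Xc l m)" by (rule alg_XB[OF BBd])
lemma X_vs [simp]: "vs (Xc l m)" by (rule alg_vs[OF X_alg])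
lemmas J_ideal = JB_ideal[OF BBd] and X_proj = XB_proj[OF BBd] and X_gen = XB_gen[OF BBd]

lemma lift_factor:
  assumes F: "F \<in> ahom T C" and f: "T_datum C f" and r: "rel l m C f" and e: "\<And>s. s \<in> gens ==> F (tgen s) = f s" and t: "t \<in> carrier T"
  shows "F t = XB_lift C f (a_r_coset T (Jc l m) t)"
proof -
  have X: "XB_datum (BB l m) C f" using XB_datum_iff[OF f] r by simp
  show ?thesis
    by (rule hom_ext[OF alg_T T_datumD(1)[OF f] T_gen F ahom_comp[OF XB_lift_hom[OF BBd X] X_proj] _ t])
      (use e XB_lift_gen[OF BBd X] in auto)
qed

text \<open>By the universal property the map factors through the quotient. The kernel conditions
  for comultiplication, counit and antipode are all obtained from this.\<close>

lemma lift_kernel: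
  assumes F: "F \<in> ahom T C" and f: "T_datum C f" and r: "rel l m C f" and e: "\<And>s. s \<in> gens ==> F (tgen s) = f s" and j: "j \<in> Jc l m"
  shows "F j = \<zero>[C]"
proof -
  have X: "XB_datum (BB l m) C f" using XB_datum_iff[OF f] r by simp
  note C = T_datumD(1)[OF f] and L = ahom_lin[OF XB_lift_hom[OF BBd X]]
  have jT: "j \<in> carrier T" using submodD(1)[OF vs_T ideal_submod[OF alg_T J_ideal]] j by blast
  have "a_r_coset T (Jc l m) j = a_r_coset T (Jc l m) \<zero>[T]"
    using coset_eq[OF vs_T ideal_submod[OF alg_T J_ideal] jT, of "\<zero>[T]"] j jT by (simp add: vs_minus(5)[OF vs_T] vs_simps[OF vs_T])
  then have "a_r_coset T (Jc l m) j = \<zero>[Xc l m]" using quot_zero[OF vs_T ideal_submod[OF alg_T J_ideal]] by simp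
  then show ?thesis using lift_factor[OF F f r e jT] lin_zero[OF L X_vs alg_vs[OF C]] by simp
qed

lemma proj_ker: "t \<in> carrier T ==> a_r_coset T (Jc l m) t = \<zero>[Xc l m] ==> t \<in> Jc l m"
  using coset_eq[OF vs_T ideal_submod[OF alg_T J_ideal], of t "\<zero>[T]"] quot_zero[OF vs_T ideal_submod[OF alg_T J_ideal]]
  by (simp add: vs_minus(5)[OF vs_T] vs_simps[OF vs_T])

abbreviation "dX l c m \<equiv> dcop (Xc l c) (Xc c m) (xs l c) (xs c m)"

lemma dX_datum: "T_datum (Xc l c >< Xc c m) (dX l c m)" and dX_rel: "rel l m (Xc l c >< Xc c m) (dX l c m)"
  by (rule dcop_datum[OF gens_X_datum gens_X_datum], rule dcop_rel[OF gens_X_datum gens_X_datum gens_X_rel gens_X_rel])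

lemma dX_XB: "XB_datum (BB l m) (Xc l c >< Xc c m) (dX l c m)"
  using XB_datum_iff[OF dX_datum] dX_rel by simp

abbreviation "Hq a \<equiv> bialg_quot K TK (Jc a a)"

definition "cmp a = (%h. tens_map K (Xc a a) (Xc a a) (a_r_coset T (Jc a a)) (a_r_coset T (Jc a a)) (comult TK h))"

lemma cmp_hom: "cmp a \<in> ahom T (Xc a a >< Xc a a)"
  unfolding cmp_def by (rule ahom_comp[OF tens_map_hom(1)[OF alg_T alg_T X_alg X_alg X_proj X_proj] DT_hom])

lemma cmp_gen: "s \<in> gens ==> cmp a (tgen s) = dX a a a s"
  unfolding cmp_def DT_gen by (rule dcop_image[OF gens_T_datum gens_T_datum X_proj X_proj X_alg X_alg])

lemma cmp_kernel: "j \<in> Jc a a ==> cmp a j = \<zero>[Xc a a >< Xc a a]"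
  by (rule lift_kernel[OF cmp_hom dX_datum dX_rel cmp_gen])

lemma Hq_comult: "comult (Hq a) = coset_lift (cmp a)"
  by (simp add: bialg_quot_def Let_def module.defs bialg.defs cmp_def)

lemma Hq_counit: "counit (Hq a) = coset_lift (counit TK)"
  by (simp add: bialg_quot_def Let_def module.defs bialg.defs)

text \<open>For c = m = a the comultiplication of the quotient record itself is taken instead of the
  lift. The two functions agree on the carrier but need not agree outside it, and the diagonal
  bialgebras have to be equal to \<open>Hq a\<close> as records, not merely isomorphic.\<close>

definition Dx where "Dx c a m = (if c = a \<and> m = a then comult (Hq a) else XB_lift (Xc a c >< Xc c m) (dX a c m))"

lemma Dx_hom: "Dx c a m \<in> ahom (Xc a m) (Xc a c >< Xc c m)"
  and Dx_gen: "s \<in> gens ==> Dx c a m (xs a m s) = dX a c m s"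
proof -
  have 1: "comult (Hq a) \<in> ahom (Xc a a) (Xc a a >< Xc a a)"
    unfolding Hq_comult by (rule quot_lift_hom[OF alg_T J_ideal alg_tensor[OF X_alg X_alg] cmp_hom cmp_kernel])
  have 2: "comult (Hq a) (xs a a s) = dX a a a s" if "s \<in> gens"
    unfolding Hq_comult
    using quot_lift_proj[OF vs_T ideal_submod[OF alg_T J_ideal] vs_tensor[OF X_vs X_vs] ahom_lin[OF cmp_hom] cmp_kernel tkg_gen_closed[OF that]]
      cmp_gen[OF that] by simp
  show "Dx c a m \<in> ahom (Xc a m) (Xc a c >< Xc c m)"
    unfolding Dx_def using 1 XB_lift_hom[OF BBd dX_XB] by auto
  show "Dx c a m (xs a m s) = dX a c m s" if "s \<in> gens"
    unfolding Dx_def using 2[OF that] XB_lift_gen[OF BBd dX_XB that] by auto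
qed

definition "Ec a = counit (Hq a)"

lemma ET_kernel: "j \<in> Jc a a ==> counit TK j = \<zero>[base_algebra K]"
  by (rule lift_kernel[OF ET_hom dcou_datum dcou_rel ET_gen])

lemma Ec_hom: "Ec a \<in> ahom (Xc a a) (base_algebra K)"
  unfolding Ec_def Hq_counit by (rule quot_lift_hom[OF alg_T J_ideal alg_base ET_hom ET_kernel])

lemma Ec_gen: "s \<in> gens ==> Ec a (xs a a s) = dcou s"
  unfolding Ec_def Hq_counit
  using quot_lift_proj[OF vs_T ideal_submod[OF alg_T J_ideal] vs_base ahom_lin[OF ET_hom] ET_kernel tkg_gen_closed] ET_gen by simp

lemma ant_XB: "XB_datum (BB l m) (op_alg (Xc m l)) (dant (Xc m l) (xs m l))"
  using XB_datum_iff[OF dant_datum[OF gens_X_datum]] dant_rel[OF gens_X_datum gens_X_rel] by simp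

definition "Sx a m = XB_lift (op_alg (Xc m a)) (dant (Xc m a) (xs m a))"

lemma Sx_hom: "Sx a m \<in> ahom (Xc a m) (op_alg (Xc m a))"
  and Sx_gen: "s \<in> gens ==> Sx a m (xs a m s) = dant (Xc m a) (xs m a) s"
  unfolding Sx_def by (rule XB_lift_hom[OF BBd ant_XB], rule XB_lift_gen[OF BBd ant_XB])

lemma Sx_lin: "Sx a m \<in> lin (Xc a m) (Xc m a)"
  using ahom_lin[OF Sx_hom] by simp

lemma xs_closed [simp]: "s \<in> gens ==> xs l m s \<in> carrier (Xc l m)"
  by (rule xgen_closed[OF BBd])

lemma xs_one: "xs l m (Inr \<one>[G]) = \<one>[Xc l m]"
  by (rule xg_one[OF BBd])

text \<open>Both sides are algebra maps by \<open>assoc_hom_left\<close> and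
  \<open>assoc_hom_right\<close>. On n_i both give n_i \<otimes> 1 \<otimes> 1 + g_i \<otimes> n_i
  \<otimes> 1 + g_i \<otimes> g_i \<otimes> n_i.\<close>

lemma coassoc_x:
  assumes h: "h \<in> carrier (Xc a m)"
  shows "tens_lift K (Xc a c >< (Xc c d >< Xc d m)) (%h' h3.
        tens_lift K (Xc a c >< (Xc c d >< Xc d m))
          (%h1 h2. tens K (Xc a c) (Xc c d >< Xc d m) h1 (tens K (Xc c d) (Xc d m) h2 h3)) (Dx c a d h')) (Dx d a m h) =
      tens_lift K (Xc a c >< (Xc c d >< Xc d m)) (%h1 h'.
        tens_lift K (Xc a c >< (Xc c d >< Xc d m))
          (%h2 h3. tens K (Xc a c) (Xc c d >< Xc d m) h1 (tens K (Xc c d) (Xc d m) h2 h3)) (Dx d c m h')) (Dx c a m h)"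
    (is "?L (Dx d a m h) = ?R (Dx c a m h)")
proof (rule hom_ext[OF X_alg _ X_gen _ _ _ h, where F = "%h. ?L (Dx d a m h)" and G = "%h. ?R (Dx c a m h)"])
  let ?P = "Xc c d >< Xc d m" and ?T = "Xc a c >< (Xc c d >< Xc d m)"
  note L = assoc_hom_left[OF X_alg X_alg X_alg X_alg[of d m] Dx_hom[of c a d]] and R = assoc_hom_right[OF X_alg X_alg[of a c] X_alg X_alg Dx_hom[of d c m]]
  show T: "alg ?T" by simp
  have TV: "vs ?T" by (rule alg_vs[OF T])
  show "(%h. ?L (Dx d a m h)) \<in> ahom (Xc a m) ?T" by (rule ahom_comp[OF L(1) Dx_hom])
  show "(%h. ?R (Dx c a m h)) \<in> ahom (Xc a m) ?T" by (rule ahom_comp[OF R(1) Dx_hom])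
  fix s assume "s \<in> xs a m ` gens"
  then obtain t where t: "t \<in> gens" "s = xs a m t" by auto
  have b: "(%h1 h2. tens K (Xc a c) ?P h1 (tens K (Xc c d) (Xc d m) h2 h3)) \<in> bil (Xc a c) (Xc c d) ?T" if "h3 \<in> carrier (Xc d m)" for h3
    by (intro bilI lin_tens_left lin_tens_right lin_id) (use that in auto)
  note tl = tens_lift_tens[OF X_vs X_vs TV b] and ta = lin_add[OF tens_lift_lin[OF X_vs X_vs TV b]]
  note La = lin_add[OF ahom_lin[OF L(1)]] and Ra = lin_add[OF ahom_lin[OF R(1)]]
  have D1: "Dx c a d \<one>[Xc a d] = tens K (Xc a c) (Xc c d) \<one>[Xc a c] \<one>[Xc c d]" "Dx d c m \<one>[Xc c m] = tens K (Xc c d) (Xc d m) \<one>[Xc c d] \<one>[Xc d m]"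
    using ahom_one[OF Dx_hom] by (simp_all add: tens_one[OF X_alg X_alg])
  show "?L (Dx d a m s) = ?R (Dx c a m s)"
  proof (cases t)
    case (Inl i)
    then have i: "i \<in> I" using t by simp
    have g: "Inl i \<in> gens" "Inr (gd i) \<in> gens" using i by auto
    note D = Dx_gen[OF g(1)] Dx_gen[OF g(2)]
    show ?thesis unfolding t(2) Inl D
      using i g by (simp add: dcop_def La Ra L(2) R(2) D D1 ta tl tens_simps[OF X_vs vs_tensor[OF X_vs X_vs]] vs_ac[OF TV])
  next
    case (Inr g)
    then have g: "Inr g \<in> gens" using t by simp
    note D = Dx_gen[OF g]
    show ?thesis unfolding t(2) Inr D
      using g by (simp add: dcop_def L(2) R(2) D tl)
  qed
qed

text \<open>As the counit is an algebra map, so is h1 \<otimes> h2 \<mapsto> \<epsilon>(h1) h2, and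
  the generators suffice.\<close>

lemma counit_left_x:
  assumes h: "h \<in> carrier (Xc a m)"
  shows "tens_lift K (Xc a m) (%h1 h2. Ec a h1 \<odot>[Xc a m] h2) (Dx a a m h) = h"
proof -
  note El = ahom_lin[OF Ec_hom, of a]
  have Ec: "Ec a u \<in> carrier K" if "u \<in> carrier (Xc a a)" for u using lin_closed[OF El that] by simp
  have b: "(%h1 h2. Ec a h1 \<odot>[Xc a m] h2) \<in> bil (Xc a a) (Xc a m) (Xc a m)"
    by (intro bilI lin_scale lin_smult_vec El lin_id X_vs Ec)
  have H: "tens_lift K (Xc a m) (%h1 h2. Ec a h1 \<odot>[Xc a m] h2) \<in> ahom (Xc a a >< Xc a m) (Xc a m)"
    by (rule tensor_homI[OF X_alg X_alg X_alg b])
      (use ahom_one[OF Ec_hom] ahom_mult[OF Ec_hom] Ec in \<open>auto simp: vs_simps[OF X_vs] alg_simps[OF X_alg] vs_distr[OF X_vs] vs_scomm[OF X_vs]\<close>)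
  note t = tens_lift_tens[OF X_vs X_vs X_vs b] and l = lin_add[OF tens_lift_lin[OF X_vs X_vs X_vs b]]
  show ?thesis
  proof (rule hom_ext[OF X_alg X_alg X_gen ahom_comp[OF H Dx_hom] _ _ h])
    show "(%h. h) \<in> ahom (Xc a m) (Xc a m)" by (rule ahomI) (auto simp: lin_id)
    fix s assume "s \<in> xs a m ` gens"
    then obtain u where u: "u \<in> gens" "s = xs a m u" by auto
    show "tens_lift K (Xc a m) (%h1 h2. Ec a h1 \<odot>[Xc a m] h2) (Dx a a m s) = s"
      unfolding u(2) Dx_gen[OF u(1)]
      by (cases u) (use u in \<open>auto simp: dcop_def l t Ec_gen dcou_def vs_simps[OF X_vs]\<close>)
  qed
qed

lemma counit_right_x:
  assumes h: "h \<in> carrier (Xc a m)"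
  shows "tens_lift K (Xc a m) (%h1 h2. Ec m h2 \<odot>[Xc a m] h1) (Dx m a m h) = h"
proof -
  note El = ahom_lin[OF Ec_hom, of m]
  have Ec: "Ec m u \<in> carrier K" if "u \<in> carrier (Xc m m)" for u using lin_closed[OF El that] by simp
  have b: "(%h1 h2. Ec m h2 \<odot>[Xc a m] h1) \<in> bil (Xc a m) (Xc m m) (Xc a m)"
    by (intro bilI lin_scale lin_smult_vec El lin_id X_vs Ec)
  have H: "tens_lift K (Xc a m) (%h1 h2. Ec m h2 \<odot>[Xc a m] h1) \<in> ahom (Xc a m >< Xc m m) (Xc a m)"
    by (rule tensor_homI[OF X_alg X_alg X_alg b])
      (use ahom_one[OF Ec_hom] ahom_mult[OF Ec_hom] Ec in \<open>auto simp: vs_simps[OF X_vs] alg_simps[OF X_alg] vs_distr[OF X_vs] vs_scomm[OF X_vs]\<close>)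
  note t = tens_lift_tens[OF X_vs X_vs X_vs b] and l = lin_add[OF tens_lift_lin[OF X_vs X_vs X_vs b]]
  have E1: "Ec m \<one>[Xc m m] = \<one>" using ahom_one[OF Ec_hom] by simp
  show ?thesis
  proof (rule hom_ext[OF X_alg X_alg X_gen ahom_comp[OF H Dx_hom] _ _ h])
    show "(%h. h) \<in> ahom (Xc a m) (Xc a m)" by (rule ahomI) (auto simp: lin_id)
    fix s assume "s \<in> xs a m ` gens"
    then obtain u where u: "u \<in> gens" "s = xs a m u" by auto
    show "tens_lift K (Xc a m) (%h1 h2. Ec m h2 \<odot>[Xc a m] h1) (Dx m a m s) = s"
      unfolding u(2) Dx_gen[OF u(1)]
      by (cases u) (use u in \<open>auto simp: dcop_def l t Ec_gen E1 dcou_def vs_simps[OF X_vs]\<close>)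
  qed
qed

theorem cogpd: "cogroupoid K Xc Dx Ec Sx"
proof (intro cogroupoid.intro cocat.intro cocat_axioms.intro cogroupoid_axioms.intro)
  show "scalars K" by (rule scalars_axioms)
  show "tens_lift K (Xc m a) (%h1 h2. Sx a m h1 \<otimes>[Xc m a] h2) (Dx m a a h) = Ec a h \<odot>[Xc m a] \<one>[Xc m a]"
    if "h \<in> carrier (Xc a a)" for h a m
    by (rule antipode_left_gen[OF X_alg X_alg X_alg Dx_hom Ec_hom Sx_hom X_gen _ that])
      (use antipode_gen(1)[OF gens_X_datum gens_X_datum _ Sx_lin Sx_gen] in \<open>auto simp: Dx_gen Ec_gen\<close>)
  show "tens_lift K (Xc a m) (%h1 h2. h1 \<otimes>[Xc a m] Sx m a h2) (Dx m a a h) = Ec a h \<odot>[Xc a m] \<one>[Xc a m]"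
    if "h \<in> carrier (Xc a a)" for h a m
    by (rule antipode_right_gen[OF X_alg X_alg X_alg Dx_hom Ec_hom Sx_hom X_gen _ that])
      (use antipode_gen(2)[OF gens_X_datum gens_X_datum _ Sx_lin Sx_gen] in \<open>auto simp: Dx_gen Ec_gen\<close>)
qed (simp_all add: Dx_hom ahom_lin[OF Dx_hom] Ec_hom ahom_lin[OF Ec_hom] Sx_lin coassoc_x counit_left_x counit_right_x)

sublocale C: cogroupoid K Xc Dx Ec Sx
  by (rule cogpd)

lemma HA_eq: "C.HA a = Hq a"
proof -
  have "Dx a a a = comult (Hq a)" "Ec a = counit (Hq a)" by (simp_all add: Dx_def Ec_def)
  then show ?thesis unfolding C.HA_def Hq_comult Hq_counit
    by (simp add: bialg_quot_def Let_def cmp_def)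
qed

text \<open>Each condition says that some algebra map out of \<open>T\<close> kills the ideal: the
  comultiplication followed by the projection of both factors, the counit, and the antipode followed
  by the projection, into the opposite algebra. For the comultiplication,
  \<open>tensor_quot_kernel\<close> turns vanishing into membership.\<close>

lemma J_hopf_ideal: "hopf_ideal K TK (Jc a a)"
proof -
  have J: "ideal (Jc a a) T" by (rule J_ideal)
  have jT: "j \<in> carrier T" if "j \<in> Jc a a" for j
    using submodD(1)[OF vs_T ideal_submod[OF alg_T J]] that by blast
  have "ideal (Jc a a) TK" by (rule same_ideal[OF same_sym[OF same_TK] alg_T J])
  moreover have "comult TK j \<in> span (T >< T) ({tens K T T j h | j h. j \<in> Jc a a \<and> h \<in> carrier T} \<union> {tens K T T h j | h j. h \<in> carrier T \<and> j \<in> Jc a a})"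
    if "j \<in> Jc a a" for j
    by (rule tensor_quot_kernel[OF alg_T J ahom_closed[OF DT_hom jT[OF that]]])
      (use cmp_kernel[OF that] in \<open>simp add: cmp_def\<close>)
  moreover have "counit TK j = \<zero>" if "j \<in> Jc a a" for j using ET_kernel[OF that] by simp
  moreover have "ST j \<in> Jc a a" if j: "j \<in> Jc a a" for j
  proof (rule proj_ker)
    show "ST j \<in> carrier T" by (rule lin_closed[OF ST_lin jT[OF j]])
    have P: "a_r_coset T (Jc a a) \<in> ahom (op_alg T) (op_alg (Xc a a))"
      by (rule ahomI) (use ahom_lin[OF X_proj] ahom_mult[OF X_proj] ahom_one[OF X_proj] in auto)
    have "a_r_coset T (Jc a a) (ST (tgen s)) = dant (Xc a a) (xs a a) s" if s: "s \<in> gens" for s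
    proof (cases s)
      case (Inl i)
      then have i: "i \<in> I" using s by simp
      have c: "tg (inv\<^bsub>G\<^esub> (gd i)) \<in> carrier T" "tn i \<in> carrier T" using i by auto
      show ?thesis using Inl s c alg_closed(1)[OF alg_T c]
        by (simp add: ST_gen dant_def lin_minus[OF ahom_lin[OF X_proj] vs_T X_vs] ahom_mult[OF X_proj])
    next
      case (Inr g)
      then show ?thesis using s by (simp add: ST_gen dant_def)
    qed
    from lift_kernel[OF ahom_comp[OF P ST_hom] dant_datum[OF gens_X_datum] dant_rel[OF gens_X_datum gens_X_rel] this j]
    show "a_r_coset T (Jc a a) (ST j) = \<zero>[Xc a a]" by simp
  qed
  ultimately show ?thesis unfolding hopf_ideal_def using ST_antipode by auto
qed

end

section \<open>Length of words: convolution inverses and pointedness\<close>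

context scalars
begin

lemma span_lin:
  assumes "vs V" "vs W" "F \<in> lin V W" "submodule P K W" "\<And>s. s \<in> S ==> s \<in> carrier V \<and> F s \<in> P" "z \<in> span V S"
  shows "F z \<in> P"
  using span_min[OF submod_preimage[OF assms(1-4)], of S] assms(5,6) by blast

text \<open>The equation at s determines the value at s from the values at elements of smaller
  length.\<close>

lemma triangular:
  fixes len :: "'s => nat"
  assumes r: "\<And>s. s \<in> S ==> r s \<in> fin_funs K {t \<in> S. len t < len s}" and e: "\<And>s. s \<in> S ==> e s \<in> carrier K"
  obtains \<psi> where "\<And>s. s \<in> S ==> \<psi> s \<in> carrier K" "\<And>s. s \<in> S ==> \<psi> s \<oplus> lincomb K (base_algebra K) \<psi> (r s) = e s"
proof -
  let ?k = "base_algebra K"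
  \<comment> \<open>\<open>F n\<close> is the n-th stage of the recursion. It is final at all
    elements of length below n, where the start value 0 has no influence; by \<open>st\<close> later
    stages do not change it. Hence \<open>Suc (len s)\<close> in the definition of \<psi>.\<close>
  define F where "F = rec_nat (%s. \<zero>) (%n f s. e s \<ominus> lincomb K ?k f (r s))"
  have F: "F 0 s = \<zero>" "F (Suc n) s = e s \<ominus> lincomb K ?k (F n) (r s)" for n s by (simp_all add: F_def)
  have lc: "lincomb K ?k f (r s) \<in> carrier K" if "s \<in> S" "\<And>t. t \<in> S ==> f t \<in> carrier K" for f s
    using lincomb_closed[OF vs_base r[OF that(1)], of f] that(2) by simp
  have c: "s \<in> S ==> F n s \<in> carrier K" for n s by (induction n arbitrary: s) (auto simp: F e lc)
  have st: "s \<in> S ==> len s < n ==> len s < m ==> F n s = F m s" for m n s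
  proof (induction n arbitrary: m s)
    case (Suc n)
    then obtain m' where m: "m = Suc m'" by (cases m) auto
    have "lincomb K ?k (F n) (r s) = lincomb K ?k (F m') (r s)"
      by (rule lincomb_cong[OF vs_base r[OF Suc.prems(1)]]) (use Suc m c in auto)
    then show ?case by (simp add: F m)
  qed simp
  define \<psi> where "\<psi> s = F (Suc (len s)) s" for s
  have "\<psi> s \<oplus> lincomb K ?k \<psi> (r s) = e s" if s: "s \<in> S" for s
  proof -
    have "lincomb K ?k \<psi> (r s) = lincomb K ?k (F (len s)) (r s)"
      unfolding \<psi>_def by (rule lincomb_cong[OF vs_base r[OF s]]) (use st c in auto)
    then show ?thesis using lc[OF s, of "F (len s)"] c e[OF s]
      by (simp add: \<psi>_def F minus_eq a_assoc l_neg)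
  qed
  then show ?thesis using that c by (metis \<psi>_def)
qed

end

lemma (in tkg_pres) gconj_lin: "g \<in> carrier G ==> gconj g \<in> lin KG KG"
  unfolding gconj_def by (rule lincomb_lin[OF vs_ma]) auto

lemma (in tkg_pres) gconj_point: "[|g \<in> carrier G; t \<in> carrier G|] ==> gconj g (point K t) = point K (g \<otimes>[G] t \<otimes>[G] inv\<^bsub>G\<^esub> g)"
  unfolding gconj_def by (rule lincomb_point[OF vs_ma]) auto

context yd_smash
begin

text \<open>Both terms on the right are multiples of the same vector l 1 - m (g h) g_i (g
  h)\<inverse>: the letters of h \<cdot>_V x_i have degree h g_i h\<inverse>, and conjugation by g
  fixes 1. What remains is the scalar identity \<open>b_coc\<close>.\<close>

lemma BB_cocycle:
  assumes g: "g \<in> carrier G" and h: "h \<in> carrier G" and i: "i \<in> I"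
  shows "BB l m (g \<otimes>[G] h) i = vext KG (BB l m g) (ga h (x i)) \<oplus>[KG] gconj g (BB l m h i)"
proof -
  let ?s = "h \<otimes>[G] gd i \<otimes>[G] inv\<^bsub>G\<^esub> h" and ?t = "g \<otimes>[G] h \<otimes>[G] gd i \<otimes>[G] inv\<^bsub>G\<^esub> (g \<otimes>[G] h)"
  let ?P = "%t. kk l \<odot>[KG] point K \<one>[G] \<oplus>[KG] (\<ominus> kk m) \<odot>[KG] point K t"
  have gs: "g \<otimes>[G] ?s \<otimes>[G] inv\<^bsub>G\<^esub> g = ?t" using g h i by (simp add: G.inv_mult_group G.m_assoc)
  have s: "?s \<in> carrier G" and t: "?t \<in> carrier G" and v: "ga h (x i) \<in> carrier V" using g h i by auto
  have P: "?P u \<in> carrier KG" if "u \<in> carrier G" for u by (intro vs_closed[OF vs_ma]) (use that in auto)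
  have p: "point K u \<in> carrier KG" if "u \<in> carrier G" for u using that by simp
  have "vext KG (BB l m g) (ga h (x i)) = vext KG (%j. b g (x j) \<odot>[KG] ?P ?t) (ga h (x i))"
    by (rule vext_homog[OF vs_ma _ v])
      (use homog[OF h i] gs g t P vs_closed(3)[OF vs_ma b_closed P] in \<open>auto simp: BB_def simp del: ma_simps\<close>)
  also have "... = b g (ga h (x i)) \<odot>[KG] ?P ?t"
    by (rule vext_unique[OF vs_ma lin_smult_vec[OF vs_ma P[OF t] b_lin[OF g]] v])
  finally have 1: "vext KG (BB l m g) (ga h (x i)) = b g (ga h (x i)) \<odot>[KG] ?P ?t" .
  have "gconj g (BB l m h i) = b h (x i) \<odot>[KG] ?P ?t"
    unfolding BB_def using h i s g gs p[OF s] p[of "\<one>[G]"]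
    by (simp add: lin_smult[OF gconj_lin[OF g]] lin_add[OF gconj_lin[OF g]] gconj_point vs_closed[OF vs_ma] del: ma_simps)
  then show ?thesis unfolding 1 using g h i v P[OF t] b_coc[OF g h i]
    by (simp add: BB_def vs_distr(1)[OF vs_ma] del: ma_simps)
qed

sublocale P: smash_pbw K G I V x ga "BB l m" for l m
  by unfold_locales (use BBd BB_cocycle in auto)

text \<open>The degree g_i g_j ... g of the word n_i n_j ... g. It is the group element in the
  leading term of the comultiplication of the word.\<close>

definition "\<gamma> z = foldr (%i g. gd i \<otimes>[G] g) (fst z) (snd z)"

lemma \<gamma>_simps [simp]: "\<gamma> ([], g) = g" "\<gamma> (i # w, g) = gd i \<otimes>[G] \<gamma> (w, g)"
  by (simp_all add: \<gamma>_def)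

abbreviation "WG \<equiv> lists I \<times> carrier G"

lemma \<gamma>_closed [simp]: "z \<in> WG ==> \<gamma> z \<in> carrier G"
proof -
  have "w \<in> lists I ==> g \<in> carrier G ==> \<gamma> (w, g) \<in> carrier G" for w g by (induction w) auto
  then show "z \<in> WG ==> \<gamma> z \<in> carrier G" by (cases z) auto
qed

abbreviation "low l m n \<equiv> {P.mon l m z | z. z \<in> WG \<and> length (fst z) < n}"

text \<open>Multiplication by n_i \<otimes> 1 + g_i \<otimes> n_i lengthens the second factor only
  through g_i \<otimes> n_i. So a second factor of full length arises only if this summand is taken
  for every letter, and then the first factor is the degree of the word.\<close>

lemma comult_mon:
  assumes z: "z \<in> WG"
  shows "\<exists>y \<in> span (Xc a c >< Xc c m) {tens K (Xc a c) (Xc c m) u v | u v. u \<in> carrier (Xc a c) \<and> v \<in> low c m (length (fst z))}.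
    Dx c a m (P.mon a m z) = tens K (Xc a c) (Xc c m) (xs a c (Inr (\<gamma> z))) (P.mon c m z) \<oplus>[Xc a c >< Xc c m] y"
proof -
  let ?A = "Xc a c" and ?C = "Xc c m"
  let ?W = "?A >< ?C" and ?t = "tens K ?A ?C"
  let ?R = "%n. {?t u v | u v. u \<in> carrier ?A \<and> v \<in> low c m n}"
  have W: "alg ?W" by simp
  note WV = alg_vs[OF W]
  have Rc: "?R n \<subseteq> carrier ?W" for n by auto
  note S = span_submod[OF WV Rc] note D = submodD[OF WV S]
  have "\<exists>y \<in> span ?W (?R (length w)). Dx c a m (P.mon a m (w, g)) = ?t (xs a c (Inr (\<gamma> (w, g)))) (P.mon c m (w, g)) \<oplus>[?W] y"
    if w: "w \<in> lists I" and g: "g \<in> carrier G" for w g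
    using w
  proof induction
    case Nil
    show ?case
      by (rule bexI[OF _ D(2)]) (use g in \<open>simp add: P.mon_simps Dx_gen dcop_def vs_simps[OF WV]\<close>)
  next
    case (Cons i w)
    then obtain y where y: "y \<in> span ?W (?R (length w))"
      and e: "Dx c a m (P.mon a m (w, g)) = ?t (xs a c (Inr (\<gamma> (w, g)))) (P.mon c m (w, g)) \<oplus>[?W] y" by blast
    let ?n = "Suc (length w)" and ?k = "\<gamma> (w, g)"
    have i: "i \<in> I" and z: "(w, g) \<in> WG" and k: "?k \<in> carrier G" using Cons g \<gamma>_closed[of "(w, g)"] by auto
    have yc: "y \<in> carrier ?W" using y D(1) by blast
    have mc: "P.mon c m (w, g) \<in> carrier ?C" using z by simp
    let ?p = "?t (xs a c (Inl i)) \<one>[?C]" and ?q = "?t (xs a c (Inr (gd i))) (xs c m (Inl i))"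
    have c: "?p \<in> carrier ?W" "?q \<in> carrier ?W" using i by auto
    have RS: "?t u (P.mon c m z) \<in> span ?W (?R n)" if "u \<in> carrier ?A" "z \<in> WG" "length (fst z) < n" for u z n
    proof (rule subsetD[OF span_incl])
      have "P.mon c m z \<in> low c m n" using that by blast
      then show "?t u (P.mon c m z) \<in> ?R n" using that(1) by blast
    qed
    have p: "?p \<otimes>[?W] y \<in> span ?W (?R ?n)"
    proof (rule span_lin[OF WV WV lin_mult_left[OF W c(1) lin_id] S _ y])
      fix s assume "s \<in> ?R (length w)"
      then obtain u z where s: "s = ?t u (P.mon c m z)" "u \<in> carrier ?A" "z \<in> WG" "length (fst z) < length w" by blast
      then show "s \<in> carrier ?W \<and> ?p \<otimes>[?W] s \<in> span ?W (?R ?n)"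
        using i RS[of "xs a c (Inl i) \<otimes>[?A] u" z ?n] by (simp add: tens_mult[OF X_alg X_alg] alg_simps(1)[OF X_alg])
    qed
    have q: "?q \<otimes>[?W] y \<in> span ?W (?R ?n)"
    proof (rule span_lin[OF WV WV lin_mult_left[OF W c(2) lin_id] S _ y])
      fix s assume "s \<in> ?R (length w)"
      then obtain u v h where s: "s = ?t u (P.mon c m (v, h))" "u \<in> carrier ?A" "v \<in> lists I" "h \<in> carrier G" "length v < length w" by auto
      then show "s \<in> carrier ?W \<and> ?q \<otimes>[?W] s \<in> span ?W (?R ?n)"
        using i RS[of "xs a c (Inr (gd i)) \<otimes>[?A] u" "(i # v, h)" ?n] by (simp add: tens_mult[OF X_alg X_alg] P.mon_simps)
    qed
    let ?r = "?t (xs a c (Inl i) \<otimes>[?A] xs a c (Inr ?k)) (P.mon c m (w, g))"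
    have r: "?r \<in> span ?W (?R ?n)" by (rule RS) (use i k z in auto)
    have rc: "?r \<in> carrier ?W" "?p \<otimes>[?W] y \<in> carrier ?W" "?q \<otimes>[?W] y \<in> carrier ?W" using r p q D(1) by blast+
    have "Dx c a m (P.mon a m (i # w, g)) = (?p \<oplus>[?W] ?q) \<otimes>[?W] (?t (xs a c (Inr ?k)) (P.mon c m (w, g)) \<oplus>[?W] y)"
      unfolding e[symmetric] using i z by (simp add: P.mon_simps ahom_mult[OF Dx_hom] Dx_gen dcop_def)
    also have "... = ?t (xs a c (Inr (\<gamma> (i # w, g)))) (P.mon c m (i # w, g)) \<oplus>[?W] (?r \<oplus>[?W] (?p \<otimes>[?W] y \<oplus>[?W] ?q \<otimes>[?W] y))"
      using c yc i k mc rc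
      by (simp add: alg_simps(6,7)[OF W] tens_mult[OF X_alg X_alg] alg_simps(1)[OF X_alg] xg_mult[OF BBd] P.mon_simps vs_ac[OF WV])
    finally show ?case using D(3)[OF r D(3)[OF p q]] by auto
  qed
  then show ?thesis using z by (cases z) auto
qed

lemma functional_low:
  assumes f: "f \<in> C.dual c m" and y: "y \<in> span (Xc a c >< Xc c m) {tens K (Xc a c) (Xc c m) u v | u v. u \<in> carrier (Xc a c) \<and> v \<in> S}"
    and S: "S \<subseteq> carrier (Xc c m)" and 0: "\<And>v. v \<in> S ==> f v = \<zero>"
  shows "tens_lift K (Xc a c) (%h1 h2. f h2 \<odot>[Xc a c] h1) y = \<zero>[Xc a c]"
proof -
  note t = tens_lift_tens[OF X_vs X_vs X_vs C.rt_bil[OF f]]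
  have "tens_lift K (Xc a c) (%h1 h2. f h2 \<odot>[Xc a c] h1) y \<in> {\<zero>[Xc a c]}"
    by (rule span_lin[OF vs_tensor[OF X_vs X_vs] X_vs tens_lift_lin[OF X_vs X_vs X_vs C.rt_bil[OF f]] submod_null[OF X_vs] _ y])
      (use S 0 in \<open>auto simp: t vs_simps[OF X_vs] subset_iff\<close>)
  then show ?thesis by simp
qed

lemma vec_low:
  assumes "u \<in> span (Xc l m) (low l m n)"
  shows "P.vec l m u \<in> fin_funs K {z \<in> WG. length (fst z) < n}"
proof -
  have "submodule (fin_funs K {z \<in> WG. length (fst z) < n}) K (fmod WG)"
    by (rule submodI[OF vs_fmod]) (use ff_mono[of _ "{z \<in> WG. length (fst z) < n}" WG] in auto)
  then show ?thesis by (rule span_lin[OF X_vs vs_fmod P.vec_lin _ _ assms]) (auto simp: P.vec_mon)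
qed

text \<open>The leading term of \<open>comult_mon\<close> contributes the word itself, with
  coefficient \<phi>(\<gamma>(z)) = 1. Translation by \<phi> is thus unitriangular with respect to
  length.\<close>

lemma lt_mon:
  assumes \<phi>: "\<phi> \<in> C.dual a c" and \<phi>1: "\<And>g. g \<in> carrier G ==> \<phi> (xs a c (Inr g)) = \<one>" and z: "z \<in> WG"
  obtains y where "y \<in> span (Xc c m) (low c m (length (fst z)))" "C.lt a c m \<phi> (P.mon a m z) = P.mon c m z \<oplus>[Xc c m] y"
proof -
  let ?F = "tens_lift K (Xc c m) (%h1 h2. \<phi> h1 \<odot>[Xc c m] h2)" and ?n = "length (fst z)"
  note L = tens_lift_lin[OF X_vs X_vs X_vs C.lt_bil[OF \<phi>, of m]] and t = tens_lift_tens[OF X_vs X_vs X_vs C.lt_bil[OF \<phi>]]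
  obtain y where y: "y \<in> span (Xc a c >< Xc c m) {tens K (Xc a c) (Xc c m) u v | u v. u \<in> carrier (Xc a c) \<and> v \<in> low c m ?n}"
    and e: "Dx c a m (P.mon a m z) = tens K (Xc a c) (Xc c m) (xs a c (Inr (\<gamma> z))) (P.mon c m z) \<oplus>[Xc a c >< Xc c m] y"
    using comult_mon[OF z] by blast
  have lc: "low c m ?n \<subseteq> carrier (Xc c m)" by auto
  note S = span_submod[OF X_vs lc]
  have sub: "{tens K (Xc a c) (Xc c m) u v | u v. u \<in> carrier (Xc a c) \<and> v \<in> low c m ?n} \<subseteq> carrier (Xc a c >< Xc c m)" by auto
  have yc: "y \<in> carrier (Xc a c >< Xc c m)" using submodD(1)[OF vs_tensor[OF X_vs X_vs] span_submod[OF vs_tensor[OF X_vs X_vs] sub]] y by blast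
  have "?F y \<in> span (Xc c m) (low c m ?n)"
  proof (rule span_lin[OF vs_tensor[OF X_vs X_vs] X_vs L S _ y])
    fix s assume "s \<in> {tens K (Xc a c) (Xc c m) u v | u v. u \<in> carrier (Xc a c) \<and> v \<in> low c m ?n}"
    then obtain u v where s: "s = tens K (Xc a c) (Xc c m) u v" "u \<in> carrier (Xc a c)" "v \<in> low c m ?n" by blast
    have "v \<in> span (Xc c m) (low c m ?n)" by (rule subsetD[OF span_incl s(3)])
    then show "s \<in> carrier (Xc a c >< Xc c m) \<and> ?F s \<in> span (Xc c m) (low c m ?n)"
      using s lc submodD(4)[OF X_vs S C.dual_closed[OF \<phi> s(2)]] by (auto simp: t)
  qed
  moreover have "C.lt a c m \<phi> (P.mon a m z) = P.mon c m z \<oplus>[Xc c m] ?F y"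
    unfolding C.lt_def C.sw_def e using z yc \<gamma>_closed[OF z] by (simp add: lin_add[OF L] t \<phi>1 vs_simps[OF X_vs])
  ultimately show ?thesis by (rule that)
qed

text \<open>Evaluated at words, the condition on \<psi> is a unitriangular linear system for the
  values of \<psi> at words, with the counits of the words on the right-hand side.\<close>

lemma convolution_inverse:
  assumes \<phi>: "\<phi> \<in> C.dual a c" and \<phi>1: "\<And>g. g \<in> carrier G ==> \<phi> (xs a c (Inr g)) = \<one>"
  obtains \<psi> where "C.conv_inv a c \<phi> \<psi>" "\<And>g. g \<in> carrier G ==> \<psi> (xs c a (Inr g)) = \<one>"
proof -
  let ?k = "base_algebra K"
  have "\<exists>y. y \<in> span (Xc c a) (low c a (length (fst z))) \<and> C.lt a c a \<phi> (P.mon a a z) = P.mon c a z \<oplus>[Xc c a] y" if "z \<in> WG" for z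
    by (rule lt_mon[OF \<phi> \<phi>1 that, where m = a]) blast+
  then have "\<exists>r. \<forall>z\<in>WG. r z \<in> span (Xc c a) (low c a (length (fst z))) \<and> C.lt a c a \<phi> (P.mon a a z) = P.mon c a z \<oplus>[Xc c a] r z"
    by (intro bchoice) blast
  then obtain r where r: "\<And>z. z \<in> WG ==> r z \<in> span (Xc c a) (low c a (length (fst z)))"
    and lt: "\<And>z. z \<in> WG ==> C.lt a c a \<phi> (P.mon a a z) = P.mon c a z \<oplus>[Xc c a] r z" by blast
  have rc: "r z \<in> carrier (Xc c a)" if "z \<in> WG" for z
  proof -
    have lc: "low c a (length (fst z)) \<subseteq> carrier (Xc c a)" by auto
    show ?thesis using submodD(1)[OF X_vs span_submod[OF X_vs lc]] r[OF that] by blast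
  qed
  obtain f where f: "\<And>z. z \<in> WG ==> f z \<in> carrier K"
    and fr: "\<And>z. z \<in> WG ==> f z \<oplus> lincomb K ?k f (P.vec c a (r z)) = Ec a (P.mon a a z)"
    by (rule triangular[where S = WG and len = "%z. length (fst z)" and r = "%z. P.vec c a (r z)" and e = "%z. Ec a (P.mon a a z)"])
      (use vec_low[OF r] C.E_closed in auto)
  define \<psi> where "\<psi> u = lincomb K ?k f (P.vec c a u)" for u
  have \<psi>: "\<psi> \<in> C.dual c a"
    unfolding \<psi>_def by (rule lin_comp[OF lincomb_lin_fmod[OF vs_base] P.vec_lin]) (use f in auto)
  have \<psi>m: "\<psi> (P.mon c a z) = f z" if "z \<in> WG" for z
    using that f by (simp add: \<psi>_def P.vec_mon lincomb_point[OF vs_base])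
  have inv: "\<psi> (C.lt a c a \<phi> u) = Ec a u" if u: "u \<in> carrier (Xc a a)" for u
  proof -
    note L = lin_comp[OF \<psi> C.lt_lin[OF \<phi>, of a]]
    have v: "P.vec a a u \<in> fin_funs K WG" using lin_closed[OF P.vec_lin u] by simp
    have "\<psi> (C.lt a c a \<phi> (lincomb K (Xc a a) (P.mon a a) (P.vec a a u))) = lincomb K ?k (%z. \<psi> (C.lt a c a \<phi> (P.mon a a z))) (P.vec a a u)"
      by (rule lin_lincomb[OF L X_vs vs_base v]) auto
    also have "... = lincomb K ?k (%z. Ec a (P.mon a a z)) (P.vec a a u)"
      by (rule lincomb_cong[OF vs_base v])
        (use lt fr \<psi>m rc lin_add[OF \<psi>] \<psi>_def lin_closed[OF L] P.mon_closed in auto)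
    also have "... = Ec a (lincomb K (Xc a a) (P.mon a a) (P.vec a a u))"
      by (rule lin_lincomb[OF ahom_lin[OF Ec_hom] X_vs vs_base v, symmetric]) auto
    finally show ?thesis by (simp only: P.lc_vec[OF u])
  qed
  then have i: "C.conv_inv a c \<phi> \<psi>" using \<phi> \<psi> by (simp add: C.conv_inv_def)
  \<comment> \<open>Translation by \<phi> sends g to g, so \<psi> takes the value \<epsilon>(g) = 1
    there. Therefore \<psi> satisfies the hypothesis of this lemma and has an inverse in its
    turn.\<close>
  have "\<psi> (xs c a (Inr g)) = \<one>" if g: "g \<in> carrier G" for g
  proof -
    have "C.lt a c a \<phi> (xs a a (Inr g)) = xs c a (Inr g)"
      using g \<phi>1 by (simp add: C.lt_def C.sw_def Dx_gen dcop_def tens_lift_tens[OF X_vs X_vs X_vs C.lt_bil[OF \<phi>]] vs_simps[OF X_vs])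
    then show ?thesis using inv[of "xs a a (Inr g)"] g by (simp add: Ec_gen dcou_def)
  qed
  with i show ?thesis by (rule that)
qed

lemma conv_inv_exists:
  obtains \<phi> \<psi> where "C.conv_inv p q \<phi> \<psi>" "C.conv_inv q p \<psi> \<phi>" "\<phi> \<one>[Xc p q] = \<one>" "\<psi> \<one>[Xc q p] = \<one>"
proof -
  \<comment> \<open>The functional with value 1 at every word; in particular it is 1 at the group
    elements, as \<open>convolution_inverse\<close> requires.\<close>
  define \<phi> where "\<phi> u = lincomb K (base_algebra K) (%z. \<one>) (P.vec p q u)" for u
  have \<phi>: "\<phi> \<in> C.dual p q"
    unfolding \<phi>_def by (rule lin_comp[OF lincomb_lin_fmod[OF vs_base] P.vec_lin]) auto
  have \<phi>1: "\<phi> (xs p q (Inr g)) = \<one>" if g: "g \<in> carrier G" for g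
    using P.vec_mon[of "([], g)" p q] g by (simp add: P.mon_simps \<phi>_def lincomb_point[OF vs_base])
  obtain \<psi> where \<psi>: "C.conv_inv p q \<phi> \<psi>" "\<And>g. g \<in> carrier G ==> \<psi> (xs q p (Inr g)) = \<one>"
    using convolution_inverse[OF \<phi> \<phi>1] by blast
  have \<psi>d: "\<psi> \<in> C.dual q p" using \<psi> by (simp add: C.conv_inv_def)
  \<comment> \<open>A one-sided inverse of \<psi> as well, so that \<open>conv_inv_sym\<close> makes
    \<phi> and \<psi> inverse on both sides.\<close>
  obtain \<chi> where \<chi>: "C.conv_inv q p \<psi> \<chi>" using convolution_inverse[OF \<psi>d \<psi>(2)] by blast
  show ?thesis
    by (rule that[OF \<psi>(1) C.conv_inv_sym[OF \<psi>(1) \<chi>]]) (use \<phi>1[of "\<one>[G]"] \<psi>(2)[of "\<one>[G]"] in \<open>simp_all add: xs_one\<close>)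
qed

theorem cocycle_deformation_H: "cocycle_deformation K (Hq q) (Hq p)"
  by (metis conv_inv_exists C.cocycle_deformation HA_eq)

theorem bigalois_X:
  assumes "\<one> \<noteq> \<zero>" shows "bigalois_extension K (Hq p) (Hq q) (Xc p q) (Dx p p q) (Dx q p q)"
proof -
  obtain \<phi> \<psi> where \<phi>: "C.conv_inv p q \<phi> \<psi>" "\<phi> \<one>[Xc p q] = \<one>" by (rule conv_inv_exists)
  then show ?thesis using C.bigalois[of \<phi> p q] assms by (simp add: C.conv_inv_def HA_eq)
qed

text \<open>\<open>f\<close> kills the second factors of all terms in \<open>comult_mon\<close>
  except the leading one, whose first factor is a group element.\<close>

lemma rt_mon:
  assumes f: "f \<in> C.dual c m" and z: "z \<in> WG" and 0: "\<And>y. y \<in> WG ==> length (fst y) < length (fst z) ==> f (P.mon c m y) = \<zero>"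
  shows "C.rt a c m f (P.mon a m z) = f (P.mon c m z) \<odot>[Xc a c] xs a c (Inr (\<gamma> z))"
proof -
  note L = tens_lift_lin[OF X_vs X_vs X_vs C.rt_bil[OF f, of a]] and t = tens_lift_tens[OF X_vs X_vs X_vs C.rt_bil[OF f]]
  obtain y where y: "y \<in> span (Xc a c >< Xc c m) {tens K (Xc a c) (Xc c m) u v | u v. u \<in> carrier (Xc a c) \<and> v \<in> low c m (length (fst z))}"
    and e: "Dx c a m (P.mon a m z) = tens K (Xc a c) (Xc c m) (xs a c (Inr (\<gamma> z))) (P.mon c m z) \<oplus>[Xc a c >< Xc c m] y"
    using comult_mon[OF z] by blast
  have lc: "low c m (length (fst z)) \<subseteq> carrier (Xc c m)" by auto
  have sub: "{tens K (Xc a c) (Xc c m) u v | u v. u \<in> carrier (Xc a c) \<and> v \<in> low c m (length (fst z))} \<subseteq> carrier (Xc a c >< Xc c m)" by auto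
  have yc: "y \<in> carrier (Xc a c >< Xc c m)" using submodD(1)[OF vs_tensor[OF X_vs X_vs] span_submod[OF vs_tensor[OF X_vs X_vs] sub]] y by blast
  have "tens_lift K (Xc a c) (%h1 h2. f h2 \<odot>[Xc a c] h1) y = \<zero>[Xc a c]"
    by (rule functional_low[OF f y lc]) (use 0 in auto)
  then show ?thesis
    unfolding C.rt_def C.sw_def e using z yc \<gamma>_closed[OF z] C.dual_closed[OF f, of "P.mon c m z"]
    by (simp add: lin_add[OF L] t vs_simps[OF X_vs])
qed

theorem pointed:
  assumes F: "field K"
  shows "pointed_hopf_algebra K (Hq a)"
proof -
  let ?X = "Xc a a"
  have "\<exists>d\<in>carrier ?X. d \<noteq> \<zero>[?X] \<and> D = {c \<odot>[?X] d | c. c \<in> carrier K}" if D: "simple_subcoalgebra K (C.HA a) D" for D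
  proof -
    \<comment> \<open>A functional that reads off a coefficient of maximal length maps \<^term>\<open>D\<close> to the multiples of a group element.\<close>
    interpret F: field K by (rule F)
    have sD: "submodule D K (C.HA a)" and DD: "Dx a a a ` D \<subseteq> span (?X >< ?X) {tens K ?X ?X c d | c d. c \<in> D \<and> d \<in> D}"
      and ne: "D \<noteq> {\<zero>[?X]}" and simple: "\<And>C. subcoalgebra K (C.HA a) C ==> C \<subseteq> D ==> C = {\<zero>[?X]} \<or> C = D"
      using D by (auto simp: simple_subcoalgebra_def subcoalgebra_def)
    note Dm = submodD[OF C.HA_vs sD, simplified]
    have S: "submodule D K ?X" by (rule submodI[OF X_vs]) (use Dm in auto)
    obtain d where d: "d \<in> D" "d \<noteq> \<zero>[?X]" using ne Dm(2) by blast
    have dc: "d \<in> carrier ?X" using d Dm(1) by blast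
    let ?p = "P.vec a a d"
    have p: "?p \<in> fin_funs K WG" using lin_closed[OF P.vec_lin dc] by simp
    let ?Z = "{z. ?p z \<noteq> \<zero>}"
    have fin: "finite ?Z" "?Z \<subseteq> WG" using p by (auto simp: fin_funs_def)
    have "?Z \<noteq> {}"
    proof
      assume "?Z = {}"
      then have "?p = (%_. \<zero>)" by auto
      then have "d = \<zero>[?X]" using P.lc_vec[OF dc] lincomb_zero[OF X_vs] by metis
      then show False using d by simp
    qed
    \<comment> \<open>A word of maximal length in the support of d. Because of maximality, the
      coordinate at this word vanishes on every word shorter than some word in the support, which is
      what \<open>rt_mon\<close> asks for.\<close>
    then have "Max ((%z. length (fst z)) ` ?Z) \<in> (%z. length (fst z)) ` ?Z" using fin by (intro Max_in) auto
    then obtain z0 where z0': "z0 \<in> ?Z" "Max ((%z. length (fst z)) ` ?Z) = length (fst z0)" by (rule imageE) simp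
    have z0: "z0 \<in> ?Z" "\<And>z. z \<in> ?Z ==> length (fst z) \<le> length (fst z0)"
      unfolding z0'(2)[symmetric] by (rule z0'(1), rule Max_ge[OF finite_imageI[OF fin(1)] imageI])
    have z0W: "z0 \<in> WG" using z0 fin by blast
    define f where "f u = P.vec a a u z0" for u
    have ev: "(%p. p z0) \<in> lin (fmod WG) (base_algebra K)" by (rule linI) (auto simp: ff_val)
    have f: "f \<in> C.dual a a" unfolding f_def by (rule lin_comp[OF ev P.vec_lin])
    have fm: "f (P.mon a a z) = point K z z0" if "z \<in> WG" for z using that by (simp add: f_def P.vec_mon)
    let ?u = "xs a a (Inr (\<gamma> z0))"
    have uc: "?u \<in> carrier ?X" using \<gamma>_closed[OF z0W] by simp
    have "C.rt a a a f d = ?p z0 \<odot>[?X] ?u"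
    proof -
      note L = C.rt_lin[OF f, of a]
      have "C.rt a a a f d = C.rt a a a f (lincomb K ?X (P.mon a a) ?p)" using P.lc_vec[OF dc] by simp
      also have "... = lincomb K ?X (%z. C.rt a a a f (P.mon a a z)) ?p"
        by (rule lin_lincomb[OF L X_vs X_vs p]) auto
      also have "... = lincomb K ?X (%z. point K z z0 \<odot>[?X] ?u) ?p"
      proof (rule lincomb_cong[OF X_vs])
        show "?p \<in> fin_funs K ?Z" using p by (auto simp: fin_funs_def)
        fix z assume z: "z \<in> ?Z"
        then have zW: "z \<in> WG" using fin by blast
        have "C.rt a a a f (P.mon a a z) = f (P.mon a a z) \<odot>[?X] xs a a (Inr (\<gamma> z))"
          by (rule rt_mon[OF f zW]) (use z0(2)[OF z] fm in \<open>auto simp: point_def\<close>)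
        then show "C.rt a a a f (P.mon a a z) = point K z z0 \<odot>[?X] ?u"
          using uc \<gamma>_closed[OF zW] by (simp add: fm[OF zW]) (auto simp: point_def vs_simps[OF X_vs])
        show "C.rt a a a f (P.mon a a z) \<in> carrier ?X" by (rule C.rt_closed[OF f]) (use zW in auto)
      qed
      also have "... = ?p z0 \<odot>[?X] ?u"
        by (rule lin_ext_fmod[OF lincomb_lin_fmod[OF X_vs] lin_smult_vec[OF X_vs uc ev] X_vs _ p])
          (use uc in \<open>auto simp: lincomb_point[OF X_vs]\<close>)
      finally show ?thesis .
    qed
    \<comment> \<open>A subcoalgebra is stable under translation by functionals.\<close>
    moreover have "C.rt a a a f d \<in> D"
    proof -
      have "Dx a a a d \<in> span (?X >< ?X) {tens K ?X ?X c d | c d. c \<in> D \<and> d \<in> D}" using DD d by blast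
      then show ?thesis unfolding C.rt_def C.sw_def
        by (rule span_lin[OF vs_tensor[OF X_vs X_vs] X_vs tens_lift_lin[OF X_vs X_vs X_vs C.rt_bil[OF f]] S, rotated])
          (use Dm(1,4) C.dual_closed[OF f] in \<open>auto simp: tens_lift_tens[OF X_vs X_vs X_vs C.rt_bil[OF f]] subset_iff\<close>)
    qed
    ultimately have pD: "?p z0 \<odot>[?X] ?u \<in> D" by simp
    have pU: "?p z0 \<in> Units K" using F.field_Units z0 ff_val[OF p] by auto
    have "inv (?p z0) \<odot>[?X] (?p z0 \<odot>[?X] ?u) = ?u"
      using pU uc by (simp add: vs_distr(3)[OF X_vs, symmetric] Units_l_inv vs_simps(4)[OF X_vs] Units_closed)
    then have uD: "?u \<in> D" using Dm(4)[OF Units_inv_closed[OF pU] pD] by simp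
    \<comment> \<open>The line through a group element is a nonzero subcoalgebra, so by simplicity
      it is all of \<open>D\<close>.\<close>
    let ?C = "{c \<odot>[?X] ?u | c. c \<in> carrier K}"
    have u0: "?u \<noteq> \<zero>[?X]"
    proof
      assume "?u = \<zero>[?X]"
      then have "P.vec a a (P.mon a a ([], \<gamma> z0)) = \<zero>[fmod WG]" using lin_zero[OF P.vec_lin X_vs vs_fmod] by (simp add: P.mon_simps)
      then have "point K ([] :: 'i list, \<gamma> z0) = (%_. \<zero>)" using \<gamma>_closed[OF z0W] by (simp add: P.vec_mon)
      from fun_cong[OF this, of "([], \<gamma> z0)"] have "point K ([] :: 'i list, \<gamma> z0) ([], \<gamma> z0) = \<zero>" .
      then show False by (simp add: point_def)
    qed
    have Cc: "submodule ?C K (C.HA a)"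
    proof (rule submodI[OF C.HA_vs])
      show "\<zero>[C.HA a] \<in> ?C" using vs_simps(3)[OF X_vs uc] zero_closed by fastforce
      show "v \<oplus>[C.HA a] w \<in> ?C" if "v \<in> ?C" "w \<in> ?C" for v w
        using that vs_distr(1)[OF X_vs _ _ uc, symmetric] by fastforce
      show "c \<odot>[C.HA a] v \<in> ?C" if "c \<in> carrier K" "v \<in> ?C" for c v
        using that vs_distr(3)[OF X_vs _ _ uc, symmetric] by fastforce
    qed (use uc in auto)
    have "Dx a a a ` ?C \<subseteq> span (?X >< ?X) {tens K ?X ?X c d | c d. c \<in> ?C \<and> d \<in> ?C}"
    proof clarify
      fix c assume c: "c \<in> carrier K"
      have "Dx a a a (c \<odot>[?X] ?u) = tens K ?X ?X (c \<odot>[?X] ?u) (\<one> \<odot>[?X] ?u)"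
        using c uc \<gamma>_closed[OF z0W]
        by (simp add: lin_smult[OF ahom_lin[OF Dx_hom]] Dx_gen dcop_def tens_simps[OF X_vs X_vs] vs_simps[OF X_vs])
      moreover have "... \<in> span (?X >< ?X) {tens K ?X ?X c d | c d. c \<in> ?C \<and> d \<in> ?C}"
        by (rule subsetD[OF span_incl]) (use c in blast)
      ultimately show "Dx a a a (c \<odot>[?X] ?u) \<in> span (?X >< ?X) {tens K ?X ?X c d | c d. c \<in> ?C \<and> d \<in> ?C}" by simp
    qed
    with Cc have sub: "subcoalgebra K (C.HA a) ?C" by (simp add: subcoalgebra_def)
    have CD: "?C \<subseteq> D" using Dm(4) uD by auto
    have C0: "?C \<noteq> {\<zero>[?X]}"
    proof
      assume e: "?C = {\<zero>[?X]}"
      have "\<one> \<odot>[?X] ?u \<in> ?C" by blast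
      then have "?u \<in> {\<zero>[?X]}" unfolding e vs_simps(4)[OF X_vs uc] .
      then show False using u0 by simp
    qed
    have "D = ?C" by (rule disjE[OF simple[OF sub CD]], rule notE[OF C0], assumption, erule sym)
    then show ?thesis by (intro bexI[OF _ uc] conjI u0)
  qed
  then show ?thesis unfolding pointed_hopf_algebra_def HA_eq[symmetric] using C.HA_hopf by simp
qed

theorem pointed_quotient: "field K ==> pointed_hopf_quotient K TK (Jc a a)"
  unfolding pointed_hopf_quotient_def using J_hopf_ideal pointed by blast

end

section \<open>From a Hopf ideal to the form of the action\<close>

lemma (in smash_pres) XB_datum_of_kernel:
  assumes B: "B_datum B" and F: "F \<in> ahom T C" and f: "T_datum C f" and e: "\<And>s. s \<in> gens ==> F (tkg_gen K G I s) = f s"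
    and k: "\<And>j. j \<in> JB B ==> F j = \<zero>[C]"
  shows "XB_datum B C f"
proof -
  have C: "alg C" and fc: "\<And>s. s \<in> gens ==> f s \<in> carrier C" using f by (auto simp: T_datum_def)
  note VC = alg_vs[OF C]
  \<comment> \<open>The map factors through the quotient, where the commutation rule holds by
    \<open>XB_rel\<close>; its image is the rule for \<open>f\<close>.\<close>
  have h: "coset_lift F \<in> ahom (XB B) C" by (rule quot_lift_hom[OF alg_T JB_ideal[OF B] C F k])
  have hg: "coset_lift F (xgen B s) = f s" if "s \<in> gens" for s
    using quot_lift_proj[OF vs_T ideal_submod[OF alg_T JB_ideal[OF B]] VC ahom_lin[OF F] k tkg_gen_closed[OF that]] e[OF that] by simp
  have "f (Inr g) \<otimes>[C] f (Inl i) = (vext C (%i. f (Inl i)) (ga g (x i)) \<oplus>[C] lincomb K C (%t. f (Inr t)) (B g i)) \<otimes>[C] f (Inr g)"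
    if g: "g \<in> carrier G" and i: "i \<in> I" for g i
  proof -
    note L = ahom_lin[OF h] and X = vs_XB[OF B]
    have c: "vext (XB B) (xn B) (ga g (x i)) \<in> carrier (XB B)" "lincomb K (XB B) (xg B) (B g i) \<in> carrier (XB B)"
      using g i B_closed[OF B] nuX_closed[OF B] glX_closed[OF B] by auto
    have "coset_lift F (vext (XB B) (xn B) (ga g (x i))) = vext C (%i. coset_lift F (xn B i)) (ga g (x i))"
      by (rule lin_vext[OF L X VC xn_closed[OF B]]) (use g i in auto)
    also have "... = vext C (%i. f (Inl i)) (ga g (x i))" by (rule vext_cong[OF VC]) (use g i hg fc in auto)
    finally have 1: "coset_lift F (vext (XB B) (xn B) (ga g (x i))) = vext C (%i. f (Inl i)) (ga g (x i))" .
    have "coset_lift F (lincomb K (XB B) (xg B) (B g i)) = lincomb K C (%t. coset_lift F (xg B t)) (B g i)"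
      by (rule lin_lincomb[OF L X VC B_closed[OF B g i] xg_closed[OF B]])
    also have "... = lincomb K C (%t. f (Inr t)) (B g i)" by (rule lincomb_cong[OF VC B_closed[OF B g i]]) (use hg fc in auto)
    finally have 2: "coset_lift F (lincomb K (XB B) (xg B) (B g i)) = lincomb K C (%t. f (Inr t)) (B g i)" .
    have "f (Inr g) \<otimes>[C] f (Inl i) = coset_lift F (xg B g \<otimes>[XB B] xn B i)"
      using g i hg by (simp add: ahom_mult[OF h xg_closed[OF B g] xn_closed[OF B i]])
    also have "... = (vext C (%i. f (Inl i)) (ga g (x i)) \<oplus>[C] lincomb K C (%t. f (Inr t)) (B g i)) \<otimes>[C] f (Inr g)"
      unfolding XB_rel[OF B g i]
      using c g hg alg_closed[OF alg_XB[OF B]] X by (simp add: ahom_mult[OF h _ xg_closed[OF B g]] lin_add[OF L c] 1 2)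
    finally show ?thesis .
  qed
  with f show ?thesis by (simp add: XB_datum_def[OF B])
qed

text \<open>If the ideal is a Hopf ideal, then the comultiplication followed by the projections
  kills it, so the images of the generators in the tensor square satisfy the commutation rule. By
  the basis theorem for \<open>B\<close> the group elements are linearly independent in the
  quotient, and coefficients of this equation can be compared.\<close>

lemma (in yd_smash) star_of_hopf_ideal:
  assumes P: "smash_pbw K G I V x ga B" and H: "hopf_ideal K TK (JB B)" and g: "g \<in> carrier G" and i: "i \<in> I"
  shows "B g i = B g i \<one>[G] \<odot>[KG] (\<one>[KG] \<ominus>[KG] point K (g \<otimes>[G] gd i \<otimes>[G] inv\<^bsub>G\<^esub> g))"
proof -
  interpret Q: smash_pbw K G I V x ga B by (rule P)
  let ?X = "XB B" and ?W = "XB B >< XB B" and ?\<pi> = "a_r_coset T (JB B)" and ?t = "tens K (XB B) (XB B)"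
  let ?F = "%h. tens_map K ?X ?X ?\<pi> ?\<pi> (comult TK h)"
  have W: "alg ?W" by simp
  note VW = alg_vs[OF W] and \<pi> = XB_proj[OF Q.Bd] and b = JB_ideal[OF Q.Bd]
  have F: "?F \<in> ahom T ?W" by (rule ahom_comp[OF tens_map_hom(1)[OF alg_T alg_T Q.X_alg Q.X_alg \<pi> \<pi>] DT_hom])
  have xd: "T_datum ?X (xgen B)"
    by (auto simp: T_datum_def xg_mult[OF Q.Bd] xg_one[OF Q.Bd] xgen_closed[OF Q.Bd])
  let ?f = "dcop ?X ?X (xgen B) (xgen B)"
  have Fg: "?F (tgen s) = ?f s" if "s \<in> gens" for s
    unfolding DT_gen[OF that] by (rule dcop_image[OF gens_T_datum gens_T_datum \<pi> \<pi> Q.X_alg Q.X_alg that])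
  have jT: "j \<in> carrier T" if "j \<in> JB B" for j using submodD(1)[OF vs_T ideal_submod[OF alg_T b]] that by blast
  have \<pi>j: "?\<pi> j = \<zero>[?X]" if "j \<in> JB B" for j
    using coset_eq[OF vs_T ideal_submod[OF alg_T b] jT[OF that], of "\<zero>[T]"] quot_zero[OF vs_T ideal_submod[OF alg_T b]] that jT[OF that]
    by (simp add: vs_minus(5)[OF vs_T] vs_simps[OF vs_T])
  have zt: "?t \<zero>[?X] u = \<zero>[?W]" "?t u \<zero>[?X] = \<zero>[?W]" if "u \<in> carrier ?X" for u
    using lin_zero[OF bil2[OF tens_bil[OF Q.X_vs Q.X_vs] that] Q.X_vs VW] lin_zero[OF bil1[OF tens_bil[OF Q.X_vs Q.X_vs] that] Q.X_vs VW] by auto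
  have Fk: "?F j = \<zero>[?W]" if j: "j \<in> JB B" for j
  proof -
    have "comult TK j \<in> span (T >< T) ({tens K T T j h | j h. j \<in> JB B \<and> h \<in> carrier T} \<union> {tens K T T h j | h j. h \<in> carrier T \<and> j \<in> JB B})"
      using H j by (auto simp: hopf_ideal_def)
    then have "?F j \<in> {\<zero>[?W]}"
      by (rule span_lin[OF vs_tensor[OF vs_T vs_T] VW ahom_lin[OF tens_map_hom(1)[OF alg_T alg_T Q.X_alg Q.X_alg \<pi> \<pi>]] submod_null[OF VW], rotated])
        (use jT \<pi>j ahom_closed[OF \<pi>] in \<open>auto simp: tens_map_hom(2)[OF alg_T alg_T Q.X_alg Q.X_alg \<pi> \<pi>] zt\<close>)
    then show ?thesis by simp
  qed
  have D: "XB_datum B ?W ?f" by (rule XB_datum_of_kernel[OF Q.Bd F dcop_datum[OF xd xd] Fg Fk])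
  let ?s = "g \<otimes>[G] gd i \<otimes>[G] inv\<^bsub>G\<^esub> g" and ?v = "ga g (x i)" and ?h = "g \<otimes>[G] gd i"
  have s: "?s \<in> carrier G" and h: "?h \<in> carrier G" and v: "?v \<in> carrier V" using g i by auto
  let ?n = "vext ?X (xn B) ?v" and ?u = "xg B"
  \<comment> \<open>The correction term with g multiplied out, so that g n_i = n g + w.\<close>
  let ?w = "lincomb K ?X (%t. ?u (t \<otimes>[G] g)) (B g i)"
  have n: "?n \<in> carrier ?X" by (rule nuX_closed[OF Q.Bd v])
  have w: "?w \<in> carrier ?X" by (rule lincomb_closed[OF Q.X_vs Q.Bc[OF g i]]) (use g in auto)
  have "?u g \<otimes>[?X] xn B i = ?n \<otimes>[?X] ?u g \<oplus>[?X] lincomb K ?X ?u (B g i) \<otimes>[?X] ?u g"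
    using XB_rel[OF Q.Bd g i] n g glX_closed[OF Q.Bd Q.Bc[OF g i]] by (simp add: alg_simps(6)[OF Q.X_alg])
  also have "lincomb K ?X ?u (B g i) \<otimes>[?X] ?u g = lincomb K ?X (%t. ?u t \<otimes>[?X] ?u g) (B g i)"
    by (rule lincomb_mult_right[OF Q.X_alg _ _ Q.Bc[OF g i]]) (use g in auto)
  also have "... = ?w"
    by (rule lincomb_cong[OF Q.X_vs Q.Bc[OF g i]]) (use g in \<open>auto simp: xg_mult[OF Q.Bd]\<close>)
  finally have gn: "?u g \<otimes>[?X] xn B i = ?n \<otimes>[?X] ?u g \<oplus>[?X] ?w" .
  have nu: "vext ?W (%j. ?f (Inl j)) ?v = ?t ?n \<one>[?X] \<oplus>[?W] ?t (?u ?s) ?n"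
    by (rule dcop_nu[OF xd xd v s]) (use homog g i in auto)
  let ?y = "lincomb K ?W (%t. ?t (?u (t \<otimes>[G] g)) (?u (t \<otimes>[G] g))) (B g i)"
  have y: "?y \<in> carrier ?W" by (rule lincomb_closed[OF VW Q.Bc[OF g i]]) (use g in auto)
  have cl: "?n \<otimes>[?X] ?u g \<in> carrier ?X" "?u g \<in> carrier ?X" "?u ?h \<in> carrier ?X" "xn B i \<in> carrier ?X" "?u (gd i) \<in> carrier ?X"
    using n g h i by auto
  have yl: "lincomb K ?W (%t. ?t (?u t) (?u t)) (B g i) \<in> carrier ?W" by (rule lincomb_closed[OF VW Q.Bc[OF g i]]) auto
  have "lincomb K ?W (%t. ?t (?u t) (?u t)) (B g i) \<otimes>[?W] ?t (?u g) (?u g) = lincomb K ?W (%t. ?t (?u t) (?u t) \<otimes>[?W] ?t (?u g) (?u g)) (B g i)"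
    by (rule lincomb_mult_right[OF W _ _ Q.Bc[OF g i]]) (use g in auto)
  also have "... = ?y"
    by (rule lincomb_cong[OF VW Q.Bc[OF g i]]) (use g in \<open>auto simp: tens_mult[OF Q.X_alg Q.X_alg] xg_mult[OF Q.Bd]\<close>)
  finally have yy: "lincomb K ?W (%t. ?t (?u t) (?u t)) (B g i) \<otimes>[?W] ?t (?u g) (?u g) = ?y" .
  have "?f (Inr g) \<otimes>[?W] ?f (Inl i) = (vext ?W (%j. ?f (Inl j)) ?v \<oplus>[?W] lincomb K ?W (%t. ?f (Inr t)) (B g i)) \<otimes>[?W] ?f (Inr g)"
    using D g i by (simp add: XB_datum_def[OF Q.Bd])
  also have "... = (?t (?n \<otimes>[?X] ?u g) (?u g) \<oplus>[?W] ?t (?u ?h) (?n \<otimes>[?X] ?u g)) \<oplus>[?W] ?y"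
    unfolding nu using cl n s g i y yl
    by (simp add: dcop_def alg_simps(6)[OF W] tens_mult[OF Q.X_alg Q.X_alg] alg_simps(1)[OF Q.X_alg] xg_mult[OF Q.Bd] conj_mult yy)
  also have "?f (Inr g) \<otimes>[?W] ?f (Inl i) = ?t (?u g \<otimes>[?X] xn B i) (?u g) \<oplus>[?W] ?t (?u ?h) (?u g \<otimes>[?X] xn B i)"
    using cl g i by (simp add: dcop_def alg_simps(7)[OF W] tens_mult[OF Q.X_alg Q.X_alg] alg_simps(2)[OF Q.X_alg] xg_mult[OF Q.Bd])
  finally have eq: "?t ?w (?u g) \<oplus>[?W] ?t (?u ?h) ?w = ?y"
  proof -
    assume *: "?t (?u g \<otimes>[?X] xn B i) (?u g) \<oplus>[?W] ?t (?u ?h) (?u g \<otimes>[?X] xn B i)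
      = (?t (?n \<otimes>[?X] ?u g) (?u g) \<oplus>[?W] ?t (?u ?h) (?n \<otimes>[?X] ?u g)) \<oplus>[?W] ?y"
    let ?a = "?t (?n \<otimes>[?X] ?u g) (?u g) \<oplus>[?W] ?t (?u ?h) (?n \<otimes>[?X] ?u g)"
    have c: "?a \<in> carrier ?W" "?t ?w (?u g) \<in> carrier ?W" "?t (?u ?h) ?w \<in> carrier ?W" using cl w by auto
    have "?a \<oplus>[?W] (?t ?w (?u g) \<oplus>[?W] ?t (?u ?h) ?w) = ?t (?u g \<otimes>[?X] xn B i) (?u g) \<oplus>[?W] ?t (?u ?h) (?u g \<otimes>[?X] xn B i)"
      unfolding gn using cl w by (simp add: tens_simps[OF Q.X_vs Q.X_vs] vs_ac[OF VW])
    also have "... = ?a \<oplus>[?W] ?y" by (rule *)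
    finally show ?thesis using vs_cancel[OF VW _ y c(1)] vs_ac(2)[OF VW c(1)] c y VW by simp
  qed
  \<comment> \<open>The words of length one have been cancelled; it remains to compare coefficients of group elements.\<close>
  define \<chi> where "\<chi> p u = Q.vec u ([], p \<otimes>[G] g)" for p u
  have ev: "(%p. p z) \<in> lin (fmod WG) (base_algebra K)" for z by (rule linI) (auto simp: ff_val)
  have evG: "(%c. c p) \<in> lin (fmod (carrier G)) (base_algebra K)" for p by (rule linI) (auto simp: ff_val)
  have \<chi>: "\<chi> p \<in> lin ?X (base_algebra K)" for p unfolding \<chi>_def by (rule lin_comp[OF ev Q.vec_lin])
  \<comment> \<open>The coordinate is taken at p g and not at p, so that it reads off from w the
    coefficient of \<open>B g i\<close> at p.\<close>
  have \<chi>u: "\<chi> p (?u (q \<otimes>[G] g)) = point K q p" if "p \<in> carrier G" "q \<in> carrier G" for p q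
    using Q.vec_mon[of "([], q \<otimes>[G] g)"] that g by (auto simp: \<chi>_def Q.mon_simps point_def)
  have \<chi>w: "\<chi> p ?w = B g i p" if p: "p \<in> carrier G" for p
  proof -
    have "\<chi> p ?w = lincomb K (base_algebra K) (%t. \<chi> p (?u (t \<otimes>[G] g))) (B g i)"
      by (rule lin_lincomb[OF \<chi> Q.X_vs vs_base Q.Bc[OF g i]]) (use g in auto)
    also have "... = lincomb K (base_algebra K) (%t. point K t p) (B g i)"
      by (rule lincomb_cong[OF vs_base Q.Bc[OF g i]]) (use p in \<open>auto simp: \<chi>u\<close>)
    also have "... = B g i p"
      by (rule lin_ext_fmod[OF lincomb_lin_fmod[OF vs_base] evG vs_base _ Q.Bc[OF g i]]) (auto simp: lincomb_point[OF vs_base])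
    finally show ?thesis .
  qed
  \<comment> \<open>The coefficient at p g \<otimes> q g in the equation w \<otimes> g + s g
    \<otimes> w = \<Sum> B(t) (t g \<otimes> t g), where s g = g g_i.\<close>
  have main: "B g i p \<otimes> point K \<one>[G] q \<oplus> point K ?s p \<otimes> B g i q = B g i p \<otimes> point K p q" if p: "p \<in> carrier G" and q: "q \<in> carrier G" for p q
  proof -
    have bl: "(%u w. \<chi> p u \<otimes> \<chi> q w) \<in> bil ?X ?X (base_algebra K)"
      by (intro bilI lin_Kmult_left lin_Kmult_right \<chi>) (use lin_closed[OF \<chi>] in auto)
    note t = tens_lift_tens[OF Q.X_vs Q.X_vs vs_base bl] and L = tens_lift_lin[OF Q.X_vs Q.X_vs vs_base bl]
    let ?L = "tens_lift K (base_algebra K) (%u w. \<chi> p u \<otimes> \<chi> q w)"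
    have "?L ?y = lincomb K (base_algebra K) (%t. ?L (?t (?u (t \<otimes>[G] g)) (?u (t \<otimes>[G] g)))) (B g i)"
      by (rule lin_lincomb[OF L VW vs_base Q.Bc[OF g i]]) (use g in auto)
    also have "... = lincomb K (base_algebra K) (%r. point K r p \<otimes> point K p q) (B g i)"
      by (rule lincomb_cong[OF vs_base Q.Bc[OF g i]]) (use p q g in \<open>auto simp: t \<chi>u point_def\<close>)
    also have "... = B g i p \<otimes> point K p q"
      by (rule lin_ext_fmod[OF lincomb_lin_fmod[OF vs_base] lin_Kmult_right[OF _ evG] vs_base _ Q.Bc[OF g i]])
        (auto simp: lincomb_point[OF vs_base])
    finally have 1: "?L ?y = B g i p \<otimes> point K p q" .
    have "\<chi> q (?u g) = point K \<one>[G] q" "\<chi> p (?u ?h) = point K ?s p"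
      using \<chi>u[OF q, of "\<one>[G]"] \<chi>u[OF p s] g i by (simp_all add: conj_mult)
    then have "?L (?t ?w (?u g) \<oplus>[?W] ?t (?u ?h) ?w) = B g i p \<otimes> point K \<one>[G] q \<oplus> point K ?s p \<otimes> B g i q"
      using cl w p q by (simp add: lin_add[OF L] t \<chi>w)
    then show ?thesis using 1 eq by simp
  qed
  have B1: "B g i \<one>[G] \<in> carrier K" and Bp: "B g i p \<in> carrier K" for p using Q.Bc[OF g i] by auto
  \<comment> \<open>For p \<noteq> 1, taking q = 1 gives B(p) = - B(1) if p = s, and B(p) = 0
    otherwise. If s = 1, then p = q = 1 gives 2 B(1) = B(1), so both sides vanish at 1.\<close>
  have val: "B g i p = B g i \<one>[G] \<otimes> (point K \<one>[G] p \<oplus> \<ominus> point K ?s p)" for p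
  proof (cases "p \<in> carrier G \<and> p \<noteq> \<one>[G]")
    case True
    then have 1: "B g i p \<oplus> point K ?s p \<otimes> B g i \<one>[G] = \<zero>" using main[of p "\<one>[G]"] B1 Bp by (auto simp: point_def)
    then show ?thesis using True B1 Bp[of p] by (auto simp: point_def r_minus minus_equality)
  next
    case False
    show ?thesis
    proof (cases "p = \<one>[G]")
      case True
      show ?thesis
      proof (cases "?s = \<one>[G]")
        assume "?s = \<one>[G]"
        then have "B g i \<one>[G] \<oplus> B g i \<one>[G] = B g i \<one>[G]" using main[of "\<one>[G]" "\<one>[G]"] B1 by (simp add: point_def)
        then show ?thesis using True B1 by (simp add: point_def)
      next
        assume "?s \<noteq> \<one>[G]" then show ?thesis using True B1 by (auto simp: point_def)
      qed
    next
      case pn: False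
      with False have "p \<notin> carrier G" by simp
      then show ?thesis using ff_supp[OF Q.Bc[OF g i], of p] B1 s by (auto simp: point_def)
    qed
  qed
  have "\<one>[KG] \<ominus>[KG] point K ?s = (%p. point K \<one>[G] p \<oplus> \<ominus> point K ?s p)"
    unfolding a_minus_def by (subst ma_a_inv) (use s in simp_all)
  then show ?thesis by (intro ext) (simp only: ma_simps val[symmetric])
qed

subsection \<open>Extensions\<close>

locale graded_action = smash_pres K G I V x "%g. act (point K g)"
  for K :: "('k, 'r) ring_scheme" (structure) and G :: "('g, 'z) monoid_scheme" and I :: "'i set"
    and V :: "('k, 'v, 'm) module_scheme" and x :: "'i => 'v" and act +
  fixes gd :: "'i => 'g"
  assumes act_module: "left_module K (monoid_algebra K G) V act"
    and gd_closed: "i \<in> I ==> gd i \<in> carrier G"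
    and homog: "[|g \<in> carrier G; i \<in> I; coords K V I x (act (point K g) (x i)) j \<noteq> \<zero>|] ==> gd j = g \<otimes>[G] gd i \<otimes>[G] inv\<^bsub>G\<^esub> g"
begin

lemma act_bil: "act \<in> bil KG V V" and act_one: "v \<in> carrier V ==> act (point K \<one>[G]) v = v"
  and act_mult: "[|a \<in> fin_funs K (carrier G); c \<in> fin_funs K (carrier G); v \<in> carrier V|] ==> act (a \<otimes>[KG] c) v = act a (act c v)"
  using act_module by (auto simp: left_module_def)

abbreviation "adj \<equiv> adjoint_action K G"

lemma adj_bil: "adj \<in> bil KG KG KG"
proof (rule bilI)
  have c: "point K g \<otimes>[KG] c \<otimes>[KG] point K (inv\<^bsub>G\<^esub> g) \<in> carrier KG" if "g \<in> carrier G" "c \<in> carrier KG" for g c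
    by (intro alg_closed(1)[OF alg_KG]) (use that in auto)
  show "adj a \<in> lin KG KG" if "a \<in> carrier KG" for a
    unfolding adjoint_action_def Let_def
    by (rule lincomb_fun_lin[OF vs_ma _ _ vs_ma, where S = "carrier G"]) (use that in \<open>auto intro!: lin_mult_left[OF alg_KG] lin_mult_right[OF alg_KG] lin_id simp del: ma_simps(2-)\<close>)
  show "(%a. adj a c) \<in> lin KG KG" if "c \<in> carrier KG" for c
    unfolding adjoint_action_def Let_def by (rule lincomb_lin[OF vs_ma c]) (use that in auto)
qed

lemma adj_point: assumes g: "g \<in> carrier G" and c: "c \<in> fin_funs K (carrier G)" shows "adj (point K g) c = gconj g c"
proof (rule lin_ext[OF bil1[OF adj_bil] gconj_lin[OF g] vs_ma _ c])
  show "point K g \<in> carrier KG" using g by simp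
  fix t assume t: "t \<in> carrier G"
  have e: "point K g \<otimes>[KG] point K t \<otimes>[KG] point K (inv\<^bsub>G\<^esub> g) = point K (g \<otimes>[G] t \<otimes>[G] inv\<^bsub>G\<^esub> g)"
    using g t by (simp add: ma_mult_point)
  have "adj (point K g) (point K t) = point K g \<otimes>[KG] point K t \<otimes>[KG] point K (inv\<^bsub>G\<^esub> g)"
    unfolding adjoint_action_def Let_def by (rule lincomb_point[OF vs_ma]) (use e g t in simp)
  then show "adj (point K g) (point K t) = gconj g (point K t)" using e g t by (simp add: gconj_point)
qed

lemma gconj_mult: "[|g \<in> carrier G; h \<in> carrier G; c \<in> fin_funs K (carrier G)|] ==> gconj (g \<otimes>[G] h) c = gconj g (gconj h c)"
  by (rule lin_ext[OF gconj_lin lin_comp[OF gconj_lin gconj_lin] vs_ma])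
    (auto simp: gconj_point G.inv_mult_group G.m_assoc)

abbreviation "NS \<equiv> extension_space K G V"

lemma NS_simps [simp]:
  "carrier NS = carrier V \<times> fin_funs K (carrier G)" "zero NS = (\<zero>[V], %_. \<zero>)"
  "add NS p q = (fst p \<oplus>[V] fst q, %t. snd p t \<oplus> snd q t)" "smult NS c p = (c \<odot>[V] fst p, %t. c \<otimes> snd p t)"
  by (cases p; cases q; simp add: extension_space_def direct_sum_def RDirProd_def DirProd_def ring.defs module.defs monoid.defs split: prod.splits)+

lemma NS_vs: "vs NS"
  by (rule moduleI') (auto simp: vs_simps[OF V] vs_distr[OF V] vs_ac[OF V] a_ac l_distr r_distr m_assoc)

lemma fst_lin: "fst \<in> lin NS V" and snd_lin: "snd \<in> lin NS KG"
  by (auto intro!: linI)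

lemma pair_lin: "[|f \<in> lin W V; h \<in> lin W KG|] ==> (%w. (f w, h w)) \<in> lin W NS"
  by (rule linI) (auto simp: lin_add[of f] lin_add[of h] lin_smult[of f] lin_smult[of h] lin_closed[of f] lin_closed[of h W KG, simplified])

end

locale extension_family = graded_action K G I V x act gd
  for K :: "('k, 'r) ring_scheme" (structure) and G :: "('g, 'z) monoid_scheme" and I :: "'i set"
    and V :: "('k, 'v, 'm) module_scheme" and x :: "'i => 'v" and act and gd :: "'i => 'g" +
  fixes b :: "'g => ('g => 'k) => 'v => 'k"
  assumes b_bil: "t \<in> carrier G ==> b t \<in> bilinear_maps K (monoid_algebra K G) V (base_algebra K)"
    and b_fin: "[|g \<in> carrier G; i \<in> I|] ==> finite {t \<in> carrier G. b t (point K g) (x i) \<noteq> \<zero>}"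
begin

definition Bf :: "('g => 'k) => 'v => 'g => 'k"
  where "Bf a v = (%t. if t \<in> carrier G then b t a v else \<zero>)"

lemma Bf_gen: "[|g \<in> carrier G; i \<in> I|] ==> Bf (point K g) (x i) \<in> fin_funs K (carrier G)"
proof (rule ffI)
  assume g: "g \<in> carrier G" and i: "i \<in> I"
  show "Bf (point K g) (x i) t \<in> carrier K" for t using bil_closed[OF b_bil, of t "point K g" "x i"] g i by (simp add: Bf_def)
  have "{t. Bf (point K g) (x i) t \<noteq> \<zero>} = {t \<in> carrier G. b t (point K g) (x i) \<noteq> \<zero>}" by (auto simp: Bf_def)
  then show "finite {t. Bf (point K g) (x i) t \<noteq> \<zero>}" using b_fin[OF g i] by simp
  show "Bf (point K g) (x i) t \<noteq> \<zero> ==> t \<in> carrier G" for t by (auto simp: Bf_def split: if_splits)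
qed

text \<open>Finite support is given only for a group element and a basis vector. \<open>?C\<close>
  is the bilinear extension of these values and takes values in KG; it agrees with \<open>Bf\<close>
  in each coefficient because each b_t is bilinear.\<close>

lemma Bf_bil: "Bf \<in> bil KG V KG"
proof -
  let ?C = "%a v. lincomb K KG (%g. vext KG (%i. Bf (point K g) (x i)) v) a"
  have v: "vext KG (%i. Bf (point K g) (x i)) \<in> lin V KG" if "g \<in> carrier G" for g
    by (rule vext_lin[OF vs_ma]) (use Bf_gen that in auto)
  have C: "?C \<in> bil KG V KG"
  proof (rule bilI)
    show "?C a \<in> lin V KG" if "a \<in> carrier KG" for a
      by (rule lincomb_fun_lin[OF vs_ma _ _ V]) (use that v in auto)
    show "(%a. ?C a w) \<in> lin KG KG" if "w \<in> carrier V" for w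
      by (rule lincomb_lin[OF vs_ma]) (rule lin_closed[OF v that])
  qed
  have ev: "(%c. c t) \<in> lin KG (base_algebra K)" for t by (rule linI) (auto simp: ff_val)
  have e: "?C a w = Bf a w" if a: "a \<in> carrier KG" and w: "w \<in> carrier V" for a w
  proof
    fix t
    show "?C a w t = Bf a w t"
    proof (cases "t \<in> carrier G")
      case True
      have "?C a w t = b t a w"
      proof (rule lin_ext[OF lin_comp[OF ev bil2[OF C w]] bil2[OF b_bil[OF True] w] vs_base])
        show "a \<in> fin_funs K (carrier G)" using a by simp
        fix g assume g: "g \<in> carrier G"
        then have pg: "point K g \<in> carrier KG" by simp
        show "?C (point K g) w t = b t (point K g) w"
        proof (rule lin_ext_V[OF vs_base lin_comp[OF ev bil1[OF C pg]] bil1[OF b_bil[OF True] pg] _ w])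
          fix i assume i: "i \<in> I"
          have vx: "vext KG (%i. Bf (point K g) (x i)) (x i) = Bf (point K g) (x i)" by (rule vext_x[OF vs_ma i]) (use Bf_gen g i in auto)
          have "?C (point K g) (x i) = vext KG (%i. Bf (point K g) (x i)) (x i)"
            by (rule lincomb_point[OF vs_ma]) (use Bf_gen g i vx in auto)
          then show "?C (point K g) (x i) t = b t (point K g) (x i)" using vx True by (simp add: Bf_def)
        qed
      qed
      then show ?thesis using True by (simp add: Bf_def)
    next
      case False
      then show ?thesis using ff_supp[of "?C a w" "carrier G" t] bil_closed[OF C a w] by (auto simp: Bf_def)
    qed
  qed
  show ?thesis by (rule bil_cong[OF _ vs_ma V C]) (use e in simp)
qed

abbreviation "N \<equiv> extension_action K G act b"

lemma N_app: "N a z = (act a (fst z), adj a (snd z) \<oplus>[KG] Bf a (fst z))"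
  by (cases z) (simp add: extension_action_def Bf_def)

lemma N_x: assumes "g \<in> carrier G" "i \<in> I" shows "N (point K g) (x i, \<zero>[KG]) = (act (point K g) (x i), Bf (point K g) (x i))"
proof -
  have "adj (point K g) \<zero>[KG] = \<zero>[KG]" using lin_zero[OF bil1[OF adj_bil] vs_ma vs_ma, of "point K g"] assms by simp
  moreover have "\<zero>[KG] \<oplus>[KG] Bf (point K g) (x i) = Bf (point K g) (x i)"
    by (rule vs_simps(1)[OF vs_ma]) (use Bf_gen[OF assms] in simp)
  ultimately show ?thesis by (simp only: N_app fst_conv snd_conv)
qed

text \<open>Associativity of the action at g, h and x_i, read in the component KG.\<close>

definition "cocycle \<longleftrightarrow> (\<forall>g\<in>carrier G. \<forall>h\<in>carrier G. \<forall>i\<in>I.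
  Bf (point K (g \<otimes>[G] h)) (x i) = Bf (point K g) (act (point K h) (x i)) \<oplus>[KG] gconj g (Bf (point K h) (x i)))"

lemma vext_Bf: "[|g \<in> carrier G; v \<in> carrier V|] ==> vext KG (%i. Bf (point K g) (x i)) v = Bf (point K g) v"
  by (rule vext_unique[OF vs_ma bil1[OF Bf_bil]]) auto

lemma Bf_datum: "B_datum (%g i. Bf (point K g) (x i))"
  by (simp add: B_datum_def Bf_gen)

lemma pbw: "cocycle ==> smash_pbw K G I V x (%g. act (point K g)) (%g i. Bf (point K g) (x i))"
  by unfold_locales (auto simp: Bf_datum vext_Bf cocycle_def)

lemma Bf_swap:
  assumes "g \<in> carrier G" "h \<in> carrier G" "i \<in> I"
  shows "Bf (point K g) (act (point K h) (x i)) \<oplus>[KG] gconj g (Bf (point K h) (x i))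
    = adj (point K g) (Bf (point K h) (x i)) \<oplus>[KG] Bf (point K g) (act (point K h) (x i))"
  unfolding adj_point[OF assms(1) Bf_gen[OF assms(2,3)]]
proof (rule vs_ac(2)[OF vs_ma])
  have "point K g \<in> carrier KG" using assms by simp
  then show "Bf (point K g) (act (point K h) (x i)) \<in> carrier KG" by (rule bil_closed[OF Bf_bil]) (use assms in auto)
qed (use gconj_closed[OF assms(1) Bf_gen[OF assms(2,3)]] in simp)

lemma cocycle_of_extension: assumes "is_extension K G V act N" shows cocycle
  unfolding cocycle_def
proof (intro ballI)
  fix g h i assume g: "g \<in> carrier G" and h: "h \<in> carrier G" and i: "i \<in> I"
  have pc: "point K g \<in> carrier KG" "point K h \<in> carrier KG" using g h by auto
  have "left_module K KG NS N" using assms by (simp add: is_extension_def short_exact_def)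
  then have m: "N (point K g \<otimes>[KG] point K h) (x i, \<zero>[KG]) = N (point K g) (N (point K h) (x i, \<zero>[KG]))"
    using pc i by (simp add: left_module_def)
  have "(act (point K (g \<otimes>[G] h)) (x i), Bf (point K (g \<otimes>[G] h)) (x i)) = N (point K g) (act (point K h) (x i), Bf (point K h) (x i))"
    using m unfolding ma_mult_point[OF g h] N_x[OF h i] N_x[OF G.m_closed[OF g h] i] .
  then have "Bf (point K (g \<otimes>[G] h)) (x i) = adj (point K g) (Bf (point K h) (x i)) \<oplus>[KG] Bf (point K g) (act (point K h) (x i))"
    by (simp only: N_app fst_conv snd_conv prod.inject)
  then show "Bf (point K (g \<otimes>[G] h)) (x i) = Bf (point K g) (act (point K h) (x i)) \<oplus>[KG] gconj g (Bf (point K h) (x i))"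
    unfolding Bf_swap[OF g h i] .
qed

text \<open>The cocycle identity speaks of group elements and basis vectors only. Each module axiom
  is linear in every argument, so it is extended from these one argument at a time.\<close>

lemma extension_of_cocycle: assumes coc: cocycle shows "is_extension K G V act N"
proof -
  note al = alg_KG and A = adj_bil and B = Bf_bil
  interpret P: smash_pbw K G I V x "%g. act (point K g)" "%g i. Bf (point K g) (x i)" by (rule pbw[OF coc])
  have adj1: "adj (point K \<one>[G]) u = u" if "u \<in> carrier KG" for u using that by (simp add: adj_point gconj_one)
  have B1: "Bf (point K \<one>[G]) v = (%_. \<zero>)" if v: "v \<in> carrier V" for v
    by (rule lin_ext_V[OF vs_ma bil1[OF B] lin_null[of KG, simplified] _ v]) (use P.B_one in auto)
  have adjm: "adj (p \<otimes>[KG] q) u = adj p (adj q u)" if p: "p \<in> carrier KG" and q: "q \<in> carrier KG" and u: "u \<in> carrier KG" for p q u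
  proof -
    note qu = bil_closed[OF A q u]
    show ?thesis
    proof (rule lin_ext[OF lin_comp[OF bil2[OF A u] lin_mult_right[OF al q lin_id]] bil2[OF A qu] vs_ma _ p[simplified]])
      fix g assume g: "g \<in> carrier G"
      then have pg: "point K g \<in> carrier KG" by simp
      show "adj (point K g \<otimes>[KG] q) u = adj (point K g) (adj q u)"
      proof (rule lin_ext[OF lin_comp[OF bil2[OF A u] lin_mult_left[OF al pg lin_id]] lin_comp[OF bil1[OF A pg] bil2[OF A u]] vs_ma _ q[simplified]])
        fix h assume h: "h \<in> carrier G"
        show "adj (point K g \<otimes>[KG] point K h) u = adj (point K g) (adj (point K h) u)"
          unfolding ma_mult_point[OF g h] using g h u by (simp add: adj_point gconj_mult gconj_closed)
      qed
    qed
  qed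
  have Bm: "Bf (p \<otimes>[KG] q) v = adj p (Bf q v) \<oplus>[KG] Bf p (act q v)" if p: "p \<in> carrier KG" and q: "q \<in> carrier KG" and v: "v \<in> carrier V" for p q v
  proof -
    have c: "act q v \<in> carrier V" "Bf q v \<in> carrier KG" using bil_closed[OF act_bil q v] bil_closed[OF B q v] by auto
    show ?thesis
    proof (rule lin_ext[OF lin_comp[OF bil2[OF B v] lin_mult_right[OF al q lin_id]] lin_plus[OF vs_ma bil2[OF A c(2)] bil2[OF B c(1)]] vs_ma _ p[simplified]])
      fix g assume g: "g \<in> carrier G"
      then have pg: "point K g \<in> carrier KG" by simp
      show "Bf (point K g \<otimes>[KG] q) v = adj (point K g) (Bf q v) \<oplus>[KG] Bf (point K g) (act q v)"
      proof (rule lin_ext[OF lin_comp[OF bil2[OF B v] lin_mult_left[OF al pg lin_id]]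
            lin_plus[OF vs_ma lin_comp[OF bil1[OF A pg] bil2[OF B v]] lin_comp[OF bil1[OF B pg] bil2[OF act_bil v]]] vs_ma _ q[simplified]])
        fix h assume h: "h \<in> carrier G"
        then have ph: "point K h \<in> carrier KG" and gh: "point K g \<otimes>[KG] point K h \<in> carrier KG" using g by (auto simp: ma_mult_point)
        show "Bf (point K g \<otimes>[KG] point K h) v = adj (point K g) (Bf (point K h) v) \<oplus>[KG] Bf (point K g) (act (point K h) v)"
        proof (rule lin_ext_V[OF vs_ma bil1[OF B gh] lin_plus[OF vs_ma lin_comp[OF bil1[OF A pg] bil1[OF B ph]] lin_comp[OF bil1[OF B pg] bil1[OF act_bil ph]]] _ v])
          fix i assume i: "i \<in> I"
          have "Bf (point K (g \<otimes>[G] h)) (x i) = Bf (point K g) (act (point K h) (x i)) \<oplus>[KG] gconj g (Bf (point K h) (x i))"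
            using coc g h i unfolding cocycle_def by blast
          then show "Bf (point K g \<otimes>[KG] point K h) (x i) = adj (point K g) (Bf (point K h) (x i)) \<oplus>[KG] Bf (point K g) (act (point K h) (x i))"
            unfolding ma_mult_point[OF g h] Bf_swap[OF g h i] .
        qed
      qed
    qed
  qed
  have "N \<in> bil KG NS NS"
    unfolding N_app
    by (intro bilI pair_lin lin_plus vs_ma lin_comp[OF bil1[OF act_bil] fst_lin] lin_comp[OF bil1[OF A] snd_lin] lin_comp[OF bil1[OF B] fst_lin]
        bil2[OF act_bil] bil2[OF A] bil2[OF B]) auto
  moreover have "N (point K \<one>[G]) z = z" if z: "z \<in> carrier NS" for z
    using z by (cases z) (auto simp: N_app act_one B1 adj1)
  moreover have "N (p \<otimes>[KG] q) z = N p (N q z)" if p: "p \<in> carrier KG" and q: "q \<in> carrier KG" and z: "z \<in> carrier NS" for p q z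
  proof -
    have c: "fst z \<in> carrier V" "snd z \<in> carrier KG" using z by auto
    note cl = bil_closed[OF A q c(2)] bil_closed[OF B q c(1)] bil_closed[OF act_bil q c(1)]
    have "adj (p \<otimes>[KG] q) (snd z) \<oplus>[KG] Bf (p \<otimes>[KG] q) (fst z)
      = adj p (adj q (snd z) \<oplus>[KG] Bf q (fst z)) \<oplus>[KG] Bf p (act q (fst z))"
      unfolding adjm[OF p q c(2)] Bm[OF p q c(1)] lin_add[OF bil1[OF A p] cl(1,2)]
      by (rule vs_ac(1)[OF vs_ma, symmetric]) (rule bil_closed[OF A p cl(1)] bil_closed[OF A p cl(2)] bil_closed[OF B p cl(3)])+
    then show ?thesis unfolding N_app fst_conv snd_conv using act_mult[OF p[simplified] q[simplified] c(1)] by simp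
  qed
  ultimately have "left_module K KG NS N" by (simp add: left_module_def NS_vs)
  moreover have "left_module K KG KG adj" using adj1 adjm A by (simp add: left_module_def)
  moreover have "(%c. (\<zero>[V], c)) \<in> left_module_homs K KG KG adj NS N"
  proof -
    have "N a (\<zero>[V], c) = (\<zero>[V], adj a c)" if a: "a \<in> carrier KG" and c: "c \<in> carrier KG" for a c
      unfolding N_app fst_conv snd_conv lin_zero[OF bil1[OF act_bil a] V V] lin_zero[OF bil1[OF B a] V vs_ma]
      using vs_simps(2)[OF vs_ma bil_closed[OF A a c]] by simp
    then show ?thesis unfolding left_module_homs_def using pair_lin[OF lin_null[OF V] lin_id] by simp
  qed
  moreover have "fst \<in> left_module_homs K KG NS N V act"
    unfolding left_module_homs_def using fst_lin by (simp add: N_app)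
  moreover have "(%c. (\<zero>[V], c)) ` carrier KG = {v \<in> carrier NS. fst v = \<zero>[V]}" by (auto simp: image_iff)
  moreover have "fst ` carrier NS = carrier V"
  proof -
    have "(%_. \<zero>) \<in> fin_funs K (carrier G)" by (rule ff_zero)
    then have "fin_funs K (carrier G) \<noteq> {}" by (metis empty_iff)
    then show ?thesis unfolding NS_simps(1) fst_image_times by (rule if_not_P)
  qed
  ultimately show ?thesis using act_module unfolding is_extension_def short_exact_def by (auto simp: inj_on_def)
qed

end

section \<open>Yetter-Drinfeld modules over the group algebra in coordinates\<close>

context smash_pres
begin

abbreviation "GB \<equiv> group_bialg K G"

lemma GB_simps [simp]:
  "carrier GB = carrier KG" "mult GB = mult KG" "one GB = one KG" "zero GB = zero KG" "add GB = add KG" "smult GB = smult KG"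
  "comult GB = lincomb K (KG >< KG) (%g. tens K KG KG (point K g) (point K g))" "counit GB = lincomb K (base_algebra K) (%g. \<one>)"
  by (simp_all add: group_bialg_def Let_def module.defs bialg.defs del: ma_simps)

lemma same_GB: "same GB KG"
  by (simp add: same_def del: ma_simps)

lemma GB_same [simp]:
  "GB >< W = KG >< W" "W >< GB = W >< KG" "tens K GB W = tens K KG W" "tens K W GB = tens K W KG"
  "lin GB W = lin KG W" "lin W GB = lin W KG" "tens_lift K GB = tens_lift K KG" "a_minus GB = a_minus KG"
proof -
  show "tens_lift K GB = tens_lift K KG" by (rule vsame_tens_lift) (simp add: vsame_def del: ma_simps)
  show "a_minus GB = a_minus KG" by (intro ext) (simp add: a_minus_def same_a_inv[OF same_GB] del: ma_simps)
qed (rule same_tensor[OF same_GB same_refl] same_tensor[OF same_refl same_GB] same_lin[OF same_GB])+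

lemma GB_bil: "bil GB V W = bil KG V W"
  by (simp add: bilinear_maps_def del: ma_simps)

lemma comult_GB_lin: "comult GB \<in> lin KG (KG >< KG)" and comult_GB: "g \<in> carrier G ==> comult GB (point K g) = tens K KG KG (point K g) (point K g)"
  unfolding GB_simps by (rule lincomb_lin; simp) (rule lincomb_point; simp)

text \<open>The Yetter-Drinfeld condition speaks of some antipode, so its values have to be
  computed: the antipode axiom at g reads S(g) g = 1, and g is invertible.\<close>

lemma antipode_GB:
  assumes S: "is_antipode K GB S" and g: "g \<in> carrier G"
  shows "S (point K g) = point K (inv\<^bsub>G\<^esub> g)"
proof -
  have L: "S \<in> lin KG KG" using S by (simp add: is_antipode_def del: ma_simps)
  have pg: "point K g \<in> carrier KG" "point K (inv\<^bsub>G\<^esub> g) \<in> carrier KG" using g by auto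
  have b: "(%h1 h2. S h1 \<otimes>[KG] h2) \<in> bil KG KG KG" by (intro bilI lin_mult_left lin_mult_right alg_KG lin_id L lin_closed[OF L])
  have "tens_lift K GB (%h1 h2. S h1 \<otimes>[GB] h2) (comult GB (point K g)) = counit GB (point K g) \<odot>[GB] \<one>[GB]"
    using S pg(1) unfolding is_antipode_def by (simp only: GB_simps(1) ball_simps)
  then have "S (point K g) \<otimes>[KG] point K g = \<one>[KG]"
    unfolding comult_GB[OF g] GB_same(7) GB_simps(2,3,6,8)
    using vs_simps(4)[OF vs_ma alg_closed(2)[OF alg_KG]]
    by (simp add: tens_lift_tens[OF vs_ma vs_ma vs_ma b pg(1) pg(1)] lincomb_point[OF vs_base] del: ma_simps)
  then have "(S (point K g) \<otimes>[KG] point K g) \<otimes>[KG] point K (inv\<^bsub>G\<^esub> g) = \<one>[KG] \<otimes>[KG] point K (inv\<^bsub>G\<^esub> g)" by simp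
  then have "S (point K g) \<otimes>[KG] (point K g \<otimes>[KG] point K (inv\<^bsub>G\<^esub> g)) = point K (inv\<^bsub>G\<^esub> g)"
    using alg_simps(5)[OF alg_KG lin_closed[OF L pg(1)] pg] alg_simps(1)[OF alg_KG pg(2)] by simp
  moreover have "point K g \<otimes>[KG] point K (inv\<^bsub>G\<^esub> g) = \<one>[KG]" using ma_mult_point[of g G "inv\<^bsub>G\<^esub> g"] g by simp
  ultimately show ?thesis using alg_simps(2)[OF alg_KG lin_closed[OF L pg(1)]] by metis
qed

text \<open>The iterated comultiplication of g is g \<otimes> g \<otimes> g, so the three sums
  reduce to a single term, in which h_(1) u S(h_(3)) = g t g\<inverse>.\<close>

lemma yetter_drinfeld_point:
  assumes yd: "yetter_drinfeld K GB V act \<delta>" and d: "\<delta> v = tens K KG V (point K t) v"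
    and g: "g \<in> carrier G" and t: "t \<in> carrier G" and v: "v \<in> carrier V"
  shows "\<delta> (act (point K g) v) = tens K KG V (point K (g \<otimes>[G] t \<otimes>[G] inv\<^bsub>G\<^esub> g)) (act (point K g) v)"
proof -
  let ?U = "KG >< V"
  have U: "vs ?U" using V by simp
  note VK = vs_ma[where M = G]
  obtain S where S: "is_antipode K GB S" and
    e: "\<And>h v. h \<in> carrier KG ==> v \<in> carrier V ==> \<delta> (act h v) =
        tens_lift K ?U (%h1 h'. tens_lift K ?U (%h2 h3.
          tens_lift K ?U (%u w. tens K KG V (h1 \<otimes>[KG] u \<otimes>[KG] S h3) (act h2 w)) (\<delta> v))
        (comult GB h')) (comult GB h)"
    using yd unfolding yetter_drinfeld_def by (auto simp del: ma_simps GB_simps(7,8))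
  have Sl: "S \<in> lin KG KG" using S by (simp add: is_antipode_def del: ma_simps)
  have act: "act \<in> bil KG V V" using yd by (simp add: yetter_drinfeld_def left_module_def GB_bil del: ma_simps)
  note ac = bil_closed[OF act] and Sc = lin_closed[OF Sl] and mc = alg_closed(1)[OF alg_KG]
  have pg: "point K g \<in> carrier KG" and pt: "point K t \<in> carrier KG" using g t by auto
  have b3: "(%u w. tens K KG V (h1 \<otimes>[KG] u \<otimes>[KG] S h3) (act h2 w)) \<in> bil KG V ?U"
    if "h1 \<in> carrier KG" "h2 \<in> carrier KG" "h3 \<in> carrier KG" for h1 h2 h3
    by (intro bilI lin_tens_left lin_tens_right lin_mult_left lin_mult_right alg_KG VK V lin_id bil1[OF act] that ac Sc mc)
  let ?\<beta> = "%h1 h2 h3. tens K KG V (h1 \<otimes>[KG] point K t \<otimes>[KG] S h3) (act h2 v)"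
  have i3: "tens_lift K ?U (%u w. tens K KG V (h1 \<otimes>[KG] u \<otimes>[KG] S h3) (act h2 w)) (\<delta> v) = ?\<beta> h1 h2 h3"
    if "h1 \<in> carrier KG" "h2 \<in> carrier KG" "h3 \<in> carrier KG" for h1 h2 h3
    unfolding d by (rule tens_lift_tens[OF VK V U b3[OF that] pt v])
  have b2: "?\<beta> h1 \<in> bil KG KG ?U" if "h1 \<in> carrier KG" for h1
    by (intro bilI lin_tens_left lin_tens_right lin_mult_left alg_KG VK V Sl bil2[OF act] that ac Sc mc pt v)
  have b2': "(%h1. ?\<beta> h1 h2 h3) \<in> lin KG ?U" if "h2 \<in> carrier KG" "h3 \<in> carrier KG" for h2 h3
    by (intro lin_tens_right lin_mult_right alg_KG VK V lin_id that ac Sc mc pt v)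
  have cm: "comult GB h \<in> carrier (KG >< KG)" if "h \<in> carrier KG" for h by (rule lin_closed[OF comult_GB_lin that])
  have i2: "tens_lift K ?U (%h2 h3. tens_lift K ?U (%u w. tens K KG V (h1 \<otimes>[KG] u \<otimes>[KG] S h3) (act h2 w)) (\<delta> v)) (comult GB h')
    = tens_lift K ?U (?\<beta> h1) (comult GB h')" if "h1 \<in> carrier KG" "h' \<in> carrier KG" for h1 h'
    by (rule tens_lift_cong[OF i3[OF that(1)] VK VK U b2[OF that(1)] cm[OF that(2)]])
  have b1: "(%h1 h'. tens_lift K ?U (?\<beta> h1) (comult GB h')) \<in> bil KG KG ?U"
    by (intro bilI lin_comp[OF tens_lift_lin[OF VK VK U b2] comult_GB_lin] lin_tens_lift_param[OF VK VK VK U cm b2 b2'])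
  have "\<delta> (act (point K g) v) = tens_lift K ?U (%h1 h'. tens_lift K ?U (?\<beta> h1) (comult GB h')) (comult GB (point K g))"
    unfolding e[OF pg v] by (rule tens_lift_cong[OF i2 VK VK U b1 cm[OF pg]])
  also have "... = ?\<beta> (point K g) (point K g) (point K g)"
    unfolding comult_GB[OF g] tens_lift_tens[OF VK VK U b1 pg pg] by (rule tens_lift_tens[OF VK VK U b2[OF pg] pg pg])
  finally show ?thesis using g t by (simp add: antipode_GB[OF S g] ma_mult_point)
qed

text \<open>The functional u \<otimes> w \<mapsto> u(g_j) w_j after the coaction is the j-th
  coordinate, as one sees on the basis. The coaction of g \<cdot>_V x_i is concentrated in degree g
  g_i g\<inverse>, so its j-th coordinate vanishes if g_j is a different element.\<close>

lemma yetter_drinfeld_homog: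
  assumes yd: "yetter_drinfeld K GB V act \<delta>" and d: "\<And>i. i \<in> I ==> \<delta> (x i) = tens K KG V (point K (gd i)) (x i)"
    and gd: "\<And>i. i \<in> I ==> gd i \<in> carrier G"
    and g: "g \<in> carrier G" and i: "i \<in> I" and j: "cd (act (point K g) (x i)) j \<noteq> \<zero>"
  shows "gd j = g \<otimes>[G] gd i \<otimes>[G] inv\<^bsub>G\<^esub> g"
proof (rule ccontr)
  let ?s = "g \<otimes>[G] gd i \<otimes>[G] inv\<^bsub>G\<^esub> g" and ?v = "act (point K g) (x i)"
  assume ne: "gd j \<noteq> ?s"
  have act: "act \<in> bil KG V V" using yd by (simp add: yetter_drinfeld_def left_module_def GB_bil del: ma_simps)
  have \<delta>: "\<delta> \<in> lin V (KG >< V)" using yd by (simp add: yetter_drinfeld_def left_comodule_def del: ma_simps)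
  have pg: "point K g \<in> carrier KG" using g by simp
  have v: "?v \<in> carrier V" by (rule bil_closed[OF act pg x_closed[OF i]])
  have l1: "(%u. u (gd j)) \<in> lin KG (base_algebra K)" by (rule linI) (auto simp: ff_val)
  have l2: "(%w. cd w j) \<in> lin V (base_algebra K)"
  proof -
    have "(%c. c j) \<in> lin (fmod I) (base_algebra K)" by (rule linI) (auto simp: ff_val)
    from lin_comp[OF this cd_lin] show ?thesis .
  qed
  have b: "(%u w. u (gd j) \<otimes> cd w j) \<in> bil KG V (base_algebra K)"
    by (intro bilI lin_Kmult_left lin_Kmult_right l1 l2) (use lin_closed[OF l1] lin_closed[OF l2] in auto)
  note t = tens_lift_tens[OF vs_ma V vs_base b] and L = tens_lift_lin[OF vs_ma V vs_base b]
  have "tens_lift K (base_algebra K) (%u w. u (gd j) \<otimes> cd w j) (\<delta> ?v) = cd ?v j"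
  proof (rule lin_ext_V[OF vs_base lin_comp[OF L \<delta>] l2 _ v])
    fix k assume k: "k \<in> I"
    have "point K (gd k) (gd j) \<otimes> cd (x k) j = cd (x k) j" using k by (auto simp: cd_x point_def)
    then show "tens_lift K (base_algebra K) (%u w. u (gd j) \<otimes> cd w j) (\<delta> (x k)) = cd (x k) j"
      using k gd by (simp add: d t)
  qed
  moreover have p0: "point K ?s (gd j) = \<zero>" and cv: "cd ?v j \<in> carrier K" using ne ff_val[OF cd_closed[OF v]] by (auto simp: point_def)
  have "tens_lift K (base_algebra K) (%u w. u (gd j) \<otimes> cd w j) (\<delta> ?v) = \<zero>"
    unfolding yetter_drinfeld_point[OF yd d[OF i] g gd[OF i] x_closed[OF i]]
    using v g i gd p0 cv by (simp add: t)
  ultimately show False using j by simp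
qed

end

section \<open>The scalar cocycle identity and the three conditions\<close>

context extension_family
begin

lemma gconj_at_one: "[|g \<in> carrier G; c \<in> fin_funs K (carrier G)|] ==> gconj g c \<one>[G] = c \<one>[G]"
proof -
  assume g: "g \<in> carrier G" and c: "c \<in> fin_funs K (carrier G)"
  have ev: "(%c. c \<one>[G]) \<in> lin KG (base_algebra K)" by (rule linI) (auto simp: ff_val)
  show ?thesis
  proof (rule lin_ext[OF lin_comp[OF ev gconj_lin[OF g]] ev vs_base _ c])
    fix t assume t: "t \<in> carrier G"
    have "\<one>[G] = g \<otimes>[G] t \<otimes>[G] inv\<^bsub>G\<^esub> g \<longleftrightarrow> \<one>[G] = t" using g t G.inv_solve_right' G.r_cancel_one' by (metis G.inv_closed G.inv_equality G.l_cancel_one G.l_inv G.m_closed G.one_closed G.r_inv)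
    then show "gconj g (point K t) \<one>[G] = point K t \<one>[G]" unfolding gconj_point[OF g t] by (simp add: point_def)
  qed
qed

definition "b_cocycle \<longleftrightarrow> (\<forall>g\<in>carrier G. \<forall>h\<in>carrier G. \<forall>i\<in>I.
  b \<one>[G] (point K (g \<otimes>[G] h)) (x i) = b \<one>[G] (point K g) (act (point K h) (x i)) \<oplus> b \<one>[G] (point K h) (x i))"

text \<open>This is the coefficient at \<^term>\<open>\<one>[G]\<close>, which conjugation does not move.\<close>

lemma b_cocycle: "cocycle ==> b_cocycle"
  unfolding b_cocycle_def
proof (intro ballI)
  fix g h i assume c: cocycle and g: "g \<in> carrier G" and h: "h \<in> carrier G" and i: "i \<in> I"
  have e: "Bf (point K (g \<otimes>[G] h)) (x i) = Bf (point K g) (act (point K h) (x i)) \<oplus>[KG] gconj g (Bf (point K h) (x i))"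
    using c g h i unfolding cocycle_def by blast
  from fun_cong[OF e, of "\<one>[G]"] show "b \<one>[G] (point K (g \<otimes>[G] h)) (x i) = b \<one>[G] (point K g) (act (point K h) (x i)) \<oplus> b \<one>[G] (point K h) (x i)"
    by (simp add: gconj_at_one[OF g Bf_gen[OF h i]]) (simp add: Bf_def)
qed

lemma yd_smash_b: "b_cocycle ==> yd_smash K G I V x (%g. act (point K g)) gd (%g. b \<one>[G] (point K g))"
proof (unfold_locales)
  show "b \<one>[G] (point K g) \<in> lin V (base_algebra K)" if "g \<in> carrier G" for g by (rule bil1[OF b_bil]) (use that in auto)
qed (use gd_closed homog in \<open>auto simp: b_cocycle_def\<close>)

lemma smash_ideal_N: "smash_ideal K G V I x N = JB (%g i. Bf (point K g) (x i))"
  by (rule smash_ideal_eq) (rule N_x)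

lemma one_minus_point: "s \<in> carrier G ==> \<one>[KG] \<ominus>[KG] point K s = (%p. point K \<one>[G] p \<oplus> \<ominus> point K s p)"
  unfolding a_minus_def by (subst ma_a_inv) simp_all

abbreviation "bone \<equiv> (%g. b \<one>[G] (point K g))"

definition "star \<longleftrightarrow> (\<forall>g\<in>carrier G. \<forall>i\<in>I.
  Bf (point K g) (x i) = bone g (x i) \<odot>[KG] (\<one>[KG] \<ominus>[KG] point K (g \<otimes>[G] gd i \<otimes>[G] inv\<^bsub>G\<^esub> g)))"

text \<open>For a correction of the shape \<open>BB l m\<close> the scalar identity already gives
  the identity in KG. This is applied to M with (l, m) = (1, 1) and to M' with (1, 0).\<close>

lemma cocycle_of_BB:
  assumes bc: "yd_smash K G I V x (%g. act (point K g)) gd \<beta>"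
    and e: "\<And>g i. [|g \<in> carrier G; i \<in> I|] ==> Bf (point K g) (x i) = yd_smash.BB K G x gd \<beta> l m g i"
  shows cocycle
proof -
  interpret Y: yd_smash K G I V x "%g. act (point K g)" gd \<beta> by (rule bc)
  show ?thesis unfolding cocycle_def
  proof (intro ballI)
    fix g h i assume g: "g \<in> carrier G" and h: "h \<in> carrier G" and i: "i \<in> I"
    have v: "act (point K h) (x i) \<in> carrier V" using h i by simp
    have "vext KG (Y.BB l m g) (act (point K h) (x i)) = vext KG (%i. Bf (point K g) (x i)) (act (point K h) (x i))"
      by (rule vext_cong[OF vs_ma e[symmetric] _ v]) (use g Y.BB_closed in auto)
    then show "Bf (point K (g \<otimes>[G] h)) (x i) = Bf (point K g) (act (point K h) (x i)) \<oplus>[KG] gconj g (Bf (point K h) (x i))"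
      using Y.BB_cocycle[OF g h i, of l m] unfolding vext_Bf[OF g v] e[OF G.m_closed[OF g h] i] e[OF h i] by simp
  qed
qed

lemma star_BB:
  assumes "yd_smash K G I V x (%g. act (point K g)) gd bone" and s: star and g: "g \<in> carrier G" and i: "i \<in> I"
  shows "Bf (point K g) (x i) = yd_smash.BB K G x gd bone True True g i"
proof -
  interpret Y: yd_smash K G I V x "%g. act (point K g)" gd bone by (rule assms(1))
  let ?s = "g \<otimes>[G] gd i \<otimes>[G] inv\<^bsub>G\<^esub> g"
  have sc: "?s \<in> carrier G" using g i by simp
  then have "kk \<odot>[KG] point K \<one>[G] \<oplus>[KG] (\<ominus> kk) \<odot>[KG] point K ?s = \<one>[KG] \<ominus>[KG] point K ?s" if "kk = \<one>" for kk
    unfolding one_minus_point[OF sc] that by (auto simp: point_def l_minus)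
  then show ?thesis using s g i unfolding star_def Y.BB_def by (simp add: Y.kk_def del: ma_simps)
qed

lemma star_of_hopf:
  assumes c: cocycle and H: "hopf_ideal K (tkg K G I gd) (smash_ideal K G V I x N)"
  shows star
proof -
  interpret Y: yd_smash K G I V x "%g. act (point K g)" gd bone by (rule yd_smash_b[OF b_cocycle[OF c]])
  show ?thesis unfolding star_def
    using Y.star_of_hopf_ideal[OF pbw[OF c] H[unfolded smash_ideal_N]] by (simp add: Bf_def)
qed

lemma smash_ideal_BB:
  assumes "\<And>g i. [|g \<in> carrier G; i \<in> I|] ==> Bf (point K g) (x i) = B g i"
  shows "smash_ideal K G V I x N = JB B"
  by (rule smash_ideal_eq) (simp only: N_x assms)

lemma pointed_of_star:
  assumes "field K" and bc: b_cocycle and s: star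
  shows "pointed_hopf_quotient K (tkg K G I gd) (smash_ideal K G V I x N)"
proof -
  interpret Y: yd_smash K G I V x "%g. act (point K g)" gd bone by (rule yd_smash_b[OF bc])
  have "smash_ideal K G V I x N = JB (Y.BB True True)"
    by (rule smash_ideal_BB[OF star_BB[OF Y.yd_smash_axioms s]])
  then show ?thesis using Y.pointed_quotient[OF assms(1)] by simp
qed

lemma extension_iff_cocycle: "is_extension K G V act N \<longleftrightarrow> cocycle"
  using cocycle_of_extension extension_of_cocycle by blast

text \<open>For an action of the form in (a) the scalar cocycle identity and the one in KG imply
  each other, and the latter is equivalent to being an extension. In (c) the form of the action is
  recovered from the Hopf ideal.\<close>

lemma equivalences:
  assumes "field K"
  shows "(is_extension K G V act N \<and> star) \<longleftrightarrow> star \<and> b_cocycle"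
    and "star \<and> b_cocycle \<longleftrightarrow> is_extension K G V act N \<and> pointed_hopf_quotient K (tkg K G I gd) (smash_ideal K G V I x N)"
proof -
  have 1: cocycle if "star" "b_cocycle" by (rule cocycle_of_BB[OF yd_smash_b[OF that(2)] star_BB[OF yd_smash_b[OF that(2)] that(1)]])
  then show "(is_extension K G V act N \<and> star) \<longleftrightarrow> star \<and> b_cocycle"
    using extension_iff_cocycle b_cocycle by blast
  show "star \<and> b_cocycle \<longleftrightarrow> is_extension K G V act N \<and> pointed_hopf_quotient K (tkg K G I gd) (smash_ideal K G V I x N)"
    using extension_iff_cocycle b_cocycle 1 star_of_hopf pointed_of_star[OF assms] by (auto simp: pointed_hopf_quotient_def)
qed

end

section \<open>From the given Yetter-Drinfeld module to the objects X(l, m)\<close>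

lemma yetter_drinfeld_family:
  assumes K: "field K" and G: "group G" and yd: "yetter_drinfeld K (group_bialg K G) V act \<delta>" and x: "vs_basis K V I x"
    and gd: "\<And>i. i \<in> I ==> gd i \<in> carrier G" and d: "\<And>i. i \<in> I ==> \<delta> (x i) = tens K (group_bialg K G) V (point K (gd i)) (x i)"
    and b: "\<And>t. t \<in> carrier G ==> b t \<in> bilinear_maps K (group_bialg K G) V (base_algebra K)"
    and f: "\<And>g i. [|g \<in> carrier G; i \<in> I|] ==> finite {t \<in> carrier G. b t (point K g) (x i) \<noteq> \<zero>[K]}"
  shows "extension_family K G I V x act gd b"
proof -
  interpret K: field K by (rule K)
  interpret G: group G by (rule G)
  interpret tkg_pres K G I by unfold_locales
  have KG: "carrier (group_bialg K G) = carrier KG" "mult (group_bialg K G) = mult KG" "one (group_bialg K G) = one KG"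
    "add (group_bialg K G) = add KG" "smult (group_bialg K G) = smult KG"
    by (simp_all add: group_bialg_def Let_def module.defs bialg.defs del: ma_simps)
  have V: "module K V" and act: "act \<in> bil KG V V" and one: "\<And>v. v \<in> carrier V ==> act \<one>[KG] v = v"
    and mul: "\<And>a c v. [|a \<in> carrier KG; c \<in> carrier KG; v \<in> carrier V|] ==> act (a \<otimes>[KG] c) v = act a (act c v)"
    using yd by (auto simp: yetter_drinfeld_def left_module_def bilinear_maps_def linear_maps_def KG simp del: ma_simps)
  have pg: "point K g \<in> carrier KG" if "g \<in> carrier G" for g using that by simp
  interpret smash_pres K G I V x "%g. act (point K g)"
  proof (intro smash_pres.intro smash_pres_axioms.intro tkg_pres_axioms V x)
    show "act (point K g) \<in> lin V V" if "g \<in> carrier G" for g by (rule bil1[OF act pg[OF that]])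
    show "act (point K \<one>[G]) v = v" if "v \<in> carrier V" for v using one[OF that] by simp
    show "act (point K (g \<otimes>[G] h)) v = act (point K g) (act (point K h) v)"
      if "g \<in> carrier G" "h \<in> carrier G" "v \<in> carrier V" for g h v
      using mul[OF pg[OF that(1)] pg[OF that(2)] that(3)] by (simp add: ma_mult_point that)
  qed
  have lm: "left_module K KG V act" using V act one mul by (simp add: left_module_def)
  show ?thesis
  proof (intro extension_family.intro graded_action.intro graded_action_axioms.intro extension_family_axioms.intro)
    show "smash_pres K G I V x (%g. act (point K g))" by (rule smash_pres_axioms)
    show "gd j = g \<otimes>[G] gd i \<otimes>[G] inv\<^bsub>G\<^esub> g" if "g \<in> carrier G" "i \<in> I" "coords K V I x (act (point K g) (x i)) j \<noteq> \<zero>[K]" for g i j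
      by (rule yetter_drinfeld_homog[OF yd _ gd that]) (use d in \<open>auto simp del: ma_simps\<close>)
    show "b t \<in> bil KG V (base_algebra K)" if "t \<in> carrier G" for t using b[OF that] by (simp add: GB_bil del: ma_simps)
  qed (use lm gd f in auto)
qed

theorem corollary2p7:
  fixes K :: "'k ring" and G :: "'g monoid" and V :: "('k, 'v) module"
    and act :: "('g \<Rightarrow> 'k) \<Rightarrow> 'v \<Rightarrow> 'v" and \<delta> :: "'v \<Rightarrow> ('k, 'g \<Rightarrow> 'k, 'v) tensor"
    and I :: "'i set" and x :: "'i \<Rightarrow> 'v" and gd :: "'i \<Rightarrow> 'g"
    and b :: "'g \<Rightarrow> ('g \<Rightarrow> 'k) \<Rightarrow> 'v \<Rightarrow> 'k"
  defines "KG \<equiv> group_bialg K G"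
    and "e \<equiv> point K"
  assumes "field K" and "group G"
    and "yetter_drinfeld K KG V act \<delta>"
    and "vs_basis K V I x"
    and "\<And>i. i \<in> I \<Longrightarrow> gd i \<in> carrier G"
    and "\<And>i. i \<in> I \<Longrightarrow> \<delta> (x i) = tens K KG V (e (gd i)) (x i)"
    and "\<And>t. t \<in> carrier G \<Longrightarrow> b t \<in> bilinear_maps K KG V (base_algebra K)"
    and "\<And>g i. \<lbrakk>g \<in> carrier G; i \<in> I\<rbrakk> \<Longrightarrow> finite {t \<in> carrier G. b t (e g) (x i) \<noteq> \<zero>\<^bsub>K\<^esub>}"
    and M_def: "M = extension_action K G act b"
    and star_def: "star \<longleftrightarrow> (\<forall>g\<in>carrier G. \<forall>i\<in>I. M (e g) (x i, \<zero>\<^bsub>KG\<^esub>) =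
        (act (e g) (x i),
         b \<one>\<^bsub>G\<^esub> (e g) (x i) \<odot>\<^bsub>KG\<^esub> (\<one>\<^bsub>KG\<^esub> \<ominus>\<^bsub>KG\<^esub> e (g \<otimes>\<^bsub>G\<^esub> gd i \<otimes>\<^bsub>G\<^esub> inv\<^bsub>G\<^esub> g))))"
    and M'_def: "M' = extension_action K G act (\<lambda>t. if t = \<one>\<^bsub>G\<^esub> then b \<one>\<^bsub>G\<^esub> else (\<lambda>_ _. \<zero>\<^bsub>K\<^esub>))"
    and M''_def: "M'' = extension_action K G act (\<lambda>_ _ _. \<zero>\<^bsub>K\<^esub>)"
    and L_def: "L = smash_hopf K G V I x gd M"
    and E_def: "E = smash_algebra K G V I x M'"
    and A_def: "A = smash_hopf K G V I x gd M''"
    and genL_def: "genL = smash_gen K G V I x M"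
    and genE_def: "genE = smash_gen K G V I x M'"
    and genA_def: "genA = smash_gen K G V I x M''"
  defines "cond_a \<equiv> is_extension K G V act M \<and> star"
    and "cond_b \<equiv> star \<and> (\<forall>g\<in>carrier G. \<forall>h\<in>carrier G. \<forall>i\<in>I.
        b \<one>\<^bsub>G\<^esub> (e (g \<otimes>\<^bsub>G\<^esub> h)) (x i) = b \<one>\<^bsub>G\<^esub> (e g) (act (e h) (x i)) \<oplus>\<^bsub>K\<^esub> b \<one>\<^bsub>G\<^esub> (e h) (x i))"
    and "cond_c \<equiv> is_extension K G V act M \<and>
        pointed_hopf_quotient K (tkg K G I gd) (smash_ideal K G V I x M)"
  shows "(cond_a \<longleftrightarrow> cond_b) \<and> (cond_b \<longleftrightarrow> cond_c) \<and>
    (cond_a \<longrightarrow>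
      is_extension K G V act M' \<and>
      (\<exists>\<rho>l \<rho>r.
        (\<forall>g\<in>carrier G.
          \<rho>l (genE (Inr g)) = tens K L E (genL (Inr g)) (genE (Inr g)) \<and>
          \<rho>r (genE (Inr g)) = tens K E A (genE (Inr g)) (genA (Inr g))) \<and>
        (\<forall>i\<in>I.
          \<rho>l (genE (Inl i)) =
            tens K L E (genL (Inl i)) \<one>\<^bsub>E\<^esub> \<oplus>\<^bsub>tensor K L E\<^esub> tens K L E (genL (Inr (gd i))) (genE (Inl i)) \<and>
          \<rho>r (genE (Inl i)) =
            tens K E A (genE (Inl i)) \<one>\<^bsub>A\<^esub> \<oplus>\<^bsub>tensor K E A\<^esub> tens K E A (genE (Inr (gd i))) (genA (Inl i))) \<and>
        bigalois_extension K L A E \<rho>l \<rho>r) \<and>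
      cocycle_deformation K A L)"
proof -
  interpret X: extension_family K G I V x act gd b
    by (rule yetter_drinfeld_family) (use assms in \<open>auto simp: KG_def e_def\<close>)
  \<comment> \<open>M' and M'' belong to families of the same kind, with b_t replaced by 0 for t
    \<noteq> 1 and for all t.\<close>
  interpret X': extension_family K G I V x act gd "%t. if t = \<one>[G] then b \<one>[G] else (%_ _. \<zero>[K])"
    by (intro extension_family.intro X.graded_action_axioms extension_family_axioms.intro)
      (use X.b_bil in \<open>auto simp: bilinear_maps_def linear_maps_def\<close>)
  interpret X'': extension_family K G I V x act gd "%_ _ _. \<zero>[K]"
    by (intro extension_family.intro X.graded_action_axioms extension_family_axioms.intro)
      (auto simp: bilinear_maps_def linear_maps_def)
  have star: "star \<longleftrightarrow> X.star"
    unfolding star_def X.star_def M_def KG_def e_def X.GB_simps X.GB_same by (simp add: X.N_x del: X.ma_simps)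
  have a: "cond_a \<longleftrightarrow> is_extension K G V act X.N \<and> X.star" unfolding cond_a_def star M_def ..
  have b: "cond_b \<longleftrightarrow> X.star \<and> X.b_cocycle" unfolding cond_b_def star X.b_cocycle_def e_def ..
  have c: "cond_c \<longleftrightarrow> is_extension K G V act X.N \<and> pointed_hopf_quotient K (tkg K G I gd) (smash_ideal K G V I x X.N)"
    unfolding cond_c_def M_def ..
  note eq = X.equivalences[OF \<open>field K\<close>]
  have fin: "is_extension K G V act M' \<and>
      (\<exists>\<rho>l \<rho>r.
        (\<forall>g\<in>carrier G.
          \<rho>l (genE (Inr g)) = tens K L E (genL (Inr g)) (genE (Inr g)) \<and>
          \<rho>r (genE (Inr g)) = tens K E A (genE (Inr g)) (genA (Inr g))) \<and>
        (\<forall>i\<in>I.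
          \<rho>l (genE (Inl i)) =
            tens K L E (genL (Inl i)) \<one>[E] \<oplus>[tensor K L E] tens K L E (genL (Inr (gd i))) (genE (Inl i)) \<and>
          \<rho>r (genE (Inl i)) =
            tens K E A (genE (Inl i)) \<one>[A] \<oplus>[tensor K E A] tens K E A (genE (Inr (gd i))) (genA (Inl i))) \<and>
        bigalois_extension K L A E \<rho>l \<rho>r) \<and>
      cocycle_deformation K A L" if s: X.star and bc: X.b_cocycle
  proof -
    interpret Y: yd_smash K G I V x "%g. act (point K g)" gd X.bone by (rule X.yd_smash_b[OF bc])
    have M: "smash_ideal K G V I x M = X.JB (Y.BB True True)"
      unfolding M_def by (rule X.smash_ideal_BB[OF X.star_BB[OF Y.yd_smash_axioms s]])
    have cl: "b \<one>[G] (point K g) (x i) \<in> carrier K" "g \<otimes>[G] gd i \<otimes>[G] inv\<^bsub>G\<^esub> g \<in> carrier G" if "g \<in> carrier G" "i \<in> I" for g i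
      using that Y.b_closed[of g "x i"] by auto
    \<comment> \<open>The second scalar is 0, which removes g g_i g\<inverse> from the correction;
      for M'' the first scalar is 0 as well.\<close>
    have B': "X'.Bf (point K g) (x i) = Y.BB True False g i" if "g \<in> carrier G" "i \<in> I" for g i
      unfolding X'.Bf_def Y.BB_def Y.kk_def using cl[OF that] by (auto simp: fun_eq_iff point_def)
    have B'': "X''.Bf (point K g) (x i) = Y.BB False False g i" if "g \<in> carrier G" "i \<in> I" for g i
      unfolding X''.Bf_def Y.BB_def Y.kk_def using cl[OF that] by (auto simp: fun_eq_iff point_def)
    have M': "smash_ideal K G V I x M' = X.JB (Y.BB True False)"
      unfolding M'_def by (rule X'.smash_ideal_BB[OF B'])
    have M'': "smash_ideal K G V I x M'' = X.JB (Y.BB False False)"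
      unfolding M''_def by (rule X''.smash_ideal_BB[OF B''])
    have L: "L = Y.C.HA True" and A: "A = Y.C.HA False" and E: "E = Y.Xc True False"
      unfolding L_def A_def E_def smash_hopf_def smash_algebra_def M M' M'' Y.HA_eq by simp_all
    have gL: "genL = Y.xs True True" and gE: "genE = Y.xs True False" and gA: "genA = Y.xs False False"
      unfolding genL_def genE_def genA_def by (simp_all add: fun_eq_iff smash_gen_def M M' M'')
    have ext: "is_extension K G V act M'"
      unfolding M'_def by (rule X'.extension_of_cocycle[OF X'.cocycle_of_BB[OF Y.yd_smash_axioms B']])
    have bg: "bigalois_extension K L A E (Y.Dx True True False) (Y.Dx False True False)"
      unfolding L A E Y.HA_eq by (rule Y.bigalois_X) (rule domain.one_not_zero[OF field.axioms(1)[OF \<open>field K\<close>]])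
    have cd: "cocycle_deformation K A L" unfolding L A Y.HA_eq by (rule Y.cocycle_deformation_H)
    have gen: "Y.Dx True True False (genE s) = Y.dX True True False s" "Y.Dx False True False (genE s) = Y.dX True False False s"
      if "s \<in> X.gens" for s
      unfolding gE by (rule Y.Dx_gen[OF that])+
    have g1: "Y.Dx True True False (genE (Inr g)) = tens K L E (genL (Inr g)) (genE (Inr g)) \<and>
        Y.Dx False True False (genE (Inr g)) = tens K E A (genE (Inr g)) (genA (Inr g))" if "g \<in> carrier G" for g
      using gen[of "Inr g"] that unfolding L A E gL gE gA Y.C.HA_same by (simp add: Y.dcop_def)
    have g2: "Y.Dx True True False (genE (Inl i)) =
          tens K L E (genL (Inl i)) \<one>[E] \<oplus>[tensor K L E] tens K L E (genL (Inr (gd i))) (genE (Inl i)) \<and>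
        Y.Dx False True False (genE (Inl i)) =
          tens K E A (genE (Inl i)) \<one>[A] \<oplus>[tensor K E A] tens K E A (genE (Inr (gd i))) (genA (Inl i))" if "i \<in> I" for i
      using gen[of "Inl i"] that unfolding L A E gL gE gA Y.C.HA_same Y.C.HA_simps by (simp add: Y.dcop_def)
    \<comment> \<open>The two coactions are the comultiplications of X(1, 0) through the objects 1
      and 0.\<close>
    show ?thesis
      by (rule conjI[OF ext conjI[OF _ cd]], rule exI[of _ "Y.Dx True True False"], rule exI[of _ "Y.Dx False True False"],
          intro conjI[OF _ conjI[OF _ bg]] ballI, erule g1, erule g2)
  qed
  show ?thesis unfolding a b c using eq fin by blast
qed

end
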